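(* Let $(X_i)_{i\in\mathbb N}$ be an $\mathbb R^d$-valued causal function of an i.i.d. sequence. Assume: (i) the distribution function $F$ of $X_0$ is $\theta$-Hölder for some $\theta\in(0,1]$; (ii) there are $r\in[1,\infty)$, $s\in(1,\infty]$ with $\frac1r+\frac1s=1$, an integer $p>rd$ and $\alpha\in(0,1]$ such that $\frac\theta\alpha>\frac{rp}{p-rd}$ and $\sum_{i=1}^\infty i^{2p-2}(\delta_{i,s})^\alpha<\infty$. Then there is a centered Gaussian process $(W(t))_{t\in[-\infty,\infty]^d}$ with almost surely continuous sample paths such that $U_n\to W$ in distribution in $\mathbb D([-\infty,\infty]^d)$.
   Context: Causal function: $(\xi_j)_{j\in\mathbb Z}$ is an i.i.d. process with values in a Banach space $\mathcal X$, $G:\mathcal X^{\mathbb N}\to\mathbb R^d$ is measurable, and $X_i=G(\xi_i,\xi_{i-1},\dots)$. Let $(\xi'_j)$ be an independent copy of $(\xi_j)$ and $\dot X_i=G(\xi_i,\dots,\xi_1,\xi'_0,\xi'_{-1},\dots)$; $\delta_{i,s}=\big({\rm E}\|X_i-\dot X_i\|^s_{\mathbb R^d}\big)^{1/s}$. $F$ $\theta$-Hölder means $|F(s)-F(t)|\le c\|s-t\|^\theta$ for some $c<\infty$. Inequalities between vectors are componentwise, $F(t)=P(X_0\le t)$; $U_n(t)=\frac1{\sqrt n}\sum_{i=1}^n(\mathbf 1\{X_i\le t\}-F(t))$, $t\in[-\infty,\infty]^d$, a random element of $\mathbb D([-\infty,\infty]^d)$ (multidimensional càdlàg functions with the multidimensional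 Skorokhod metric). *)

theory Defs
  imports "HOL-Probability.Probability"
begin

definition ext_le :: "real^'d \<Rightarrow> ereal^'d \<Rightarrow> bool" where
  "ext_le x t \<longleftrightarrow> (\<forall>k. ereal (x $ k) \<le> t $ k)"

text \<open>An order-homeomorphism of [-inf,inf] onto [-1,1], used to measure time distortions.\<close>
definition ext_to_unit :: "ereal \<Rightarrow> real" where
  "ext_to_unit x = (case x of ereal r \<Rightarrow> r / (1 + \<bar>r\<bar>) | PInfty \<Rightarrow> 1 | MInfty \<Rightarrow> -1)"

definition time_changes :: "('d \<Rightarrow> ereal \<Rightarrow> ereal) set" where
  "time_changes = {l. \<forall>k. strict_mono (l k) \<and> continuous_on UNIV (l k) \<and> surj (l k)}"

definition apply_tc :: "('d \<Rightarrow> ereal \<Rightarrow> ereal) \<Rightarrow> ereal^'d \<Rightarrow> ereal^'d" where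
  "apply_tc l t = (\<chi> k. l k (t $ k))"

text \<open>Multidimensional Skorokhod (Bickel--Wichura / Neuhaus) distance.\<close>
definition skorokhod_dist :: "(ereal^'d::finite \<Rightarrow> real) \<Rightarrow> (ereal^'d \<Rightarrow> real) \<Rightarrow> real" where
  "skorokhod_dist x y = Inf {e. 0 \<le> e \<and> (\<exists>l\<in>time_changes.
      (\<forall>t k. \<bar>ext_to_unit (l k (t $ k)) - ext_to_unit (t $ k)\<bar> \<le> e) \<and>
      (\<forall>t. \<bar>x t - y (apply_tc l t)\<bar> \<le> e))}"

definition cadlag_multi :: "(ereal^'d::finite \<Rightarrow> real) \<Rightarrow> bool" where
  "cadlag_multi x \<longleftrightarrow> (\<forall>t.
      (x \<longlongrightarrow> x t) (at t within {s. t \<le> s}) \<and>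
      (\<forall>S::'d set. \<exists>L. (x \<longlongrightarrow> L)
         (at t within {s. (\<forall>k\<in>S. s $ k < t $ k) \<and> (\<forall>k. k \<notin> S \<longrightarrow> t $ k \<le> s $ k)})))"

definition D_space :: "(ereal^'d::finite \<Rightarrow> real) set" where
  "D_space = {x. cadlag_multi x}"

definition D_open :: "(ereal^'d::finite \<Rightarrow> real) set \<Rightarrow> bool" where
  "D_open U \<longleftrightarrow> U \<subseteq> D_space \<and>
     (\<forall>x\<in>U. \<exists>e>0. \<forall>y\<in>D_space. skorokhod_dist x y < e \<longrightarrow> y \<in> U)"

definition D_borel :: "(ereal^'d::finite \<Rightarrow> real) measure" where
  "D_borel = sigma D_space {U. D_open U}"

definition D_bcont :: "((ereal^'d::finite \<Rightarrow> real) \<Rightarrow> real) \<Rightarrow> bool" where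
  "D_bcont f \<longleftrightarrow> (\<exists>B. \<forall>x\<in>D_space. \<bar>f x\<bar> \<le> B) \<and>
     (\<forall>x\<in>D_space. \<forall>e>0. \<exists>d>0. \<forall>y\<in>D_space. skorokhod_dist x y < d \<longrightarrow> \<bar>f y - f x\<bar> < e)"

definition conv_distr_D ::
  "'a measure \<Rightarrow> (nat \<Rightarrow> 'a \<Rightarrow> (ereal^'d::finite \<Rightarrow> real)) \<Rightarrow> 'b measure \<Rightarrow> ('b \<Rightarrow> (ereal^'d \<Rightarrow> real)) \<Rightarrow> bool" where
  "conv_distr_D M U N W \<longleftrightarrow>
     (\<forall>n. U n \<in> M \<rightarrow>\<^sub>M D_borel) \<and> W \<in> N \<rightarrow>\<^sub>M D_borel \<and>
     (\<forall>f. D_bcont f \<longrightarrow> (\<lambda>n. \<integral>\<omega>. f (U n \<omega>) \<partial>M) \<longlonglongrightarrow> (\<integral>\<omega>. f (W \<omega>) \<partial>N))"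

text \<open>Centered Gaussian process: every finite linear combination is a centered
  (possibly degenerate) normal random variable, expressed via its characteristic function.\<close>
definition centered_gaussian_process :: "'b measure \<Rightarrow> ('b \<Rightarrow> 'i \<Rightarrow> real) \<Rightarrow> bool" where
  "centered_gaussian_process N W \<longleftrightarrow> prob_space N \<and>
     (\<forall>(T::'i set) (a::'i \<Rightarrow> real). finite T \<longrightarrow>
        (\<lambda>\<omega>. \<Sum>t\<in>T. a t * W \<omega> t) \<in> borel_measurable N \<and>
        (\<exists>v\<ge>0. \<forall>u. char (distr N borel (\<lambda>\<omega>. \<Sum>t\<in>T. a t * W \<omega> t)) u
                    = complex_of_real (exp (- (v * u\<^sup>2) / 2))))"

definition Lp_norm_ext :: "'a measure \<Rightarrow> ereal \<Rightarrow> ('a \<Rightarrow> real) \<Rightarrow> ereal" where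
  "Lp_norm_ext M s f =
     (if s = \<infinity> then esssup M (\<lambda>\<omega>. ereal \<bar>f \<omega>\<bar>)
      else (let m = (\<integral>\<^sup>+\<omega>. ennreal (\<bar>f \<omega>\<bar> powr real_of_ereal s) \<partial>M)
            in if m = \<infinity> then \<infinity> else ereal (enn2real m powr (1 / real_of_ereal s))))"

definition causal_X :: "((nat \<Rightarrow> 'x) \<Rightarrow> 'y) \<Rightarrow> (int \<Rightarrow> 'a \<Rightarrow> 'x) \<Rightarrow> nat \<Rightarrow> 'a \<Rightarrow> 'y" where
  "causal_X G \<xi> i \<omega> = G (\<lambda>j. \<xi> (int i - int j) \<omega>)"

definition coupled_X :: "((nat \<Rightarrow> 'x) \<Rightarrow> 'y) \<Rightarrow> (int \<Rightarrow> 'a \<Rightarrow> 'x) \<Rightarrow> (int \<Rightarrow> 'a \<Rightarrow> 'x) \<Rightarrow> nat \<Rightarrow> 'a \<Rightarrow> 'y" where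
  "coupled_X G \<xi> \<xi>' i \<omega> =
     G (\<lambda>j. if 1 \<le> int i - int j then \<xi> (int i - int j) \<omega> else \<xi>' (int i - int j) \<omega>)"

definition emp_proc :: "'a measure \<Rightarrow> (nat \<Rightarrow> 'a \<Rightarrow> real^'d) \<Rightarrow> nat \<Rightarrow> 'a \<Rightarrow> ereal^'d \<Rightarrow> real" where
  "emp_proc M X n \<omega> t = (1 / sqrt (real n)) *
     (\<Sum>i = 1..n. (if ext_le (X i \<omega>) t then 1 else 0) - measure M {\<omega>' \<in> space M. ext_le (X 0 \<omega>') t})"

end

theory Submission
  imports Defs "HOL-Real_Asymp.Real_Asymp"
begin

section \<open>Empirical processes of causal functions\<close>

text \<open>
  Replacing the innovations up to time \<open>a\<close> by independent copies makes the past of \<open>X\<close> independent of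
  the coupled future, so an expectation of a product of Hoelder functions of \<open>X\<close> factorises at the
  largest gap between its time indices up to an error of order \<open>L \<pi> powr (1 / r)\<close> times the
  \<open>\<alpha>\<close>-th power of the dependence coefficient; here \<open>L\<close> is the Hoelder constant and \<open>\<pi>\<close> the \<open>L\<^sup>1\<close> norm.
  This gives moment bounds of order \<open>2 p\<close> and a central limit theorem by blocking. The indicators
  of \<open>x \<le> t\<close> are approximated by Hoelder functions \<open>\<psi> k a\<close> on a dyadic grid of level \<open>k\<close> in the
  marginal quantile scale; neighbouring functions have \<open>L \<approx> 2 powr (k \<alpha> / \<theta>)\<close> and \<open>\<pi> \<approx> 2 powr (- k)\<close>,
  so chaining over the \<open>2 powr (k d)\<close> grid points converges exactly when \<open>d / p < 1 / r - \<alpha> / \<theta>\<close>.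
  The same chaining argument, applied to a Gaussian field with the limiting covariances, constructs
  the continuous limit \<open>W\<close>, and weak convergence follows from convergence on each grid.
\<close>

subsection \<open>Correlations and moments under coupling\<close>

text \<open>The moment bound of order 2 p holds only while n L \<pi> powr (1 / r) is at least 1.
  Chaining of the empirical process therefore stops at a level K with n \<le> 2 ^ K \<le> 2 n.
  Beyond it monotonicity takes over: the indicator is bracketed by two grid functions whose means
  differ by O(2 powr (- K)), which leaves a bias of O(1 / sqrt n) after normalisation. The Gaussian
  field has no such cutoff, because there all moments follow from the variance. The weight i ^ (2 p
  - 2) comes from counting: once one index and the gap d after it are fixed, each of the remaining 2
  p - 2 indices has O(d) choices. A second obstacle is measurability. Path space carries the full
  Borel sigma-algebra of the Skorokhod distance, and a path need not depend continuously on the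
  sample where coordinates tie, so samples are sorted by their pattern of ties. Suprema over t are
  never integrated; explicit integrable majorants, built from sums of 2 p-th powers over a grid,
  replace them.\<close>

text \<open>The diameter of \<open>T\<close> is the sum of its consecutive gaps, hence at most
  \<open>card T\<close> times the largest one. This control of the diameter by the gap later limits
  the number of index tuples with a prescribed gap. In the induction only the gap below the new
  maximum has to be compared with the old largest gap.\<close>

lemma finite_set_largest_gap:
  fixes T :: "nat set"
  assumes "finite T" "card T \<ge> 2"
  shows "\<exists>a\<in>T. \<exists>b\<in>T. a < b \<and> (\<forall>x\<in>T. x \<le> a \<or> b \<le> x) \<and> (\<forall>x\<in>T. \<forall>y\<in>T. x \<le> y + card T * (b - a))"
  using assms
proof (induction T rule: finite_linorder_max_induct)
  case empty
  then show ?case by simp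
next
  case (insert v T)
  have vT: "v \<notin> T" using insert.hyps by auto
  then have cT: "card (insert v T) = Suc (card T)" using insert.hyps by simp
  show ?case
  proof (cases "card T \<ge> 2")
    case False
    then have "card T = 1" using insert.prems cT by simp
    then obtain w where T: "T = {w}" by (auto simp: card_1_singleton_iff)
    have "w < v" using insert.hyps T by auto
    then show ?thesis unfolding cT using T by (intro bexI[of _ w] bexI[of _ v]) auto
  next
    case True
    then obtain a b where ab: "a \<in> T" "b \<in> T" "a < b" "\<And>x. x\<in>T \<Longrightarrow> x \<le> a \<or> b \<le> x"
      "\<And>x y. x\<in>T \<Longrightarrow> y\<in>T \<Longrightarrow> x \<le> y + card T * (b - a)" using insert.IH by blast
    define w where "w = Max T"
    have wT: "w \<in> T" using True insert.hyps(1) ab(1) unfolding w_def by (intro Max_in) auto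
    have wmax: "x \<le> w" if "x \<in> T" for x using that insert.hyps(1) unfolding w_def by simp
    have wv: "w < v" using insert.hyps wT by auto
    show ?thesis
    proof (cases "v - w \<le> b - a")
      case True
      have "x \<le> y + card (insert v T) * (b - a)" if "x\<in>insert v T" "y \<in> insert v T" for x y
      proof -
        have 1: "x \<le> max x w + 0" by simp
        have xw: "x \<le> w + (b - a)" using that(1) wmax[of x] wv True by auto
        show ?thesis
        proof (cases "y = v")
          case True
          then show ?thesis using that(1) wmax[of x] wv by auto
        next
          case False
          then have "y \<in> T" using that by simp
          then have "w \<le> y + card T * (b - a)" using ab(5) wT by blast
          then show ?thesis using xw unfolding cT by simp
        qed
      qed
      moreover have "\<forall>x\<in>insert v T. x \<le> a \<or> b \<le> x" using ab(2,4) wv wmax[of b] by auto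
      ultimately have "a < b \<and> (\<forall>x\<in>insert v T. x \<le> a \<or> b \<le> x) \<and>
          (\<forall>x\<in>insert v T. \<forall>y\<in>insert v T. x \<le> y + card (insert v T) * (b - a))"
        using ab(3) by metis
      then show ?thesis by (intro bexI[where x=a] bexI[where x=b] insertI2[OF ab(1)] insertI2[OF ab(2)])
    next
      case False
      have "x \<le> y + card (insert v T) * (v - w)" if "x\<in>insert v T" "y \<in> insert v T" for x y
      proof -
        have xw: "x \<le> w + (v - w)" using that(1) wmax[of x] wv by auto
        show ?thesis
        proof (cases "y = v")
          case True
          then show ?thesis using that(1) wmax[of x] wv by auto
        next
          case F: False
          then have "y \<in> T" using that by simp
          then have "w \<le> y + card T * (b - a)" using ab(5) wT by blast
          also have "\<dots> \<le> y + card T * (v - w)" using False by (simp add: mult_le_mono)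
          finally show ?thesis using xw unfolding cT by simp
        qed
      qed
      moreover have "\<forall>x\<in>insert v T. x \<le> w \<or> v \<le> x" using wmax by auto
      ultimately have "w < v \<and> (\<forall>x\<in>insert v T. x \<le> w \<or> v \<le> x) \<and>
          (\<forall>x\<in>insert v T. \<forall>y\<in>insert v T. x \<le> y + card (insert v T) * (v - w))"
        using wv by metis
      then show ?thesis by (intro bexI[where x=w] bexI[where x=v] insertI1 insertI2[OF wT])
    qed
  qed
qed

text \<open>Fubini for sums over index tuples. The conditions on \<open>restrict\<close> express
  that \<open>f\<close> reads only the coordinates in \<open>S\<close> and \<open>g\<close> only
  those in \<open>R\<close>.\<close>

lemma sum_PiE_Un:
  fixes f g :: "('i \<Rightarrow> 'b) \<Rightarrow> real"
  assumes "finite S" "finite R" "S \<inter> R = {}" "finite N"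
    and f: "\<And>t. f (restrict t S) = f t" and g: "\<And>t. g (restrict t R) = g t"
  shows "(\<Sum>t\<in>PiE (S \<union> R) (\<lambda>_. N). f t * g t) = (\<Sum>t\<in>PiE S (\<lambda>_. N). f t) * (\<Sum>t\<in>PiE R (\<lambda>_. N). g t)"
proof -
  have "(\<Sum>t\<in>PiE (S \<union> R) (\<lambda>_. N). f t * g t) = (\<Sum>(x,y)\<in>PiE S (\<lambda>_. N) \<times> PiE R (\<lambda>_. N). f x * g y)"
  proof (rule sum.reindex_bij_witness[of _ "\<lambda>(x,y) i. if i \<in> S then x i else y i" "\<lambda>t. (restrict t S, restrict t R)"])
    fix t assume "t \<in> PiE (S \<union> R) (\<lambda>_. N)"
    then show "(case (restrict t S, restrict t R) of (x, y) \<Rightarrow> \<lambda>i. if i \<in> S then x i else y i) = t"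
      by (auto simp: fun_eq_iff PiE_def extensional_def)
  next
    fix t assume "t \<in> PiE (S \<union> R) (\<lambda>_. N)"
    then show "(restrict t S, restrict t R) \<in> PiE S (\<lambda>_. N) \<times> PiE R (\<lambda>_. N)" by auto
  next
    fix t assume "t \<in> PiE (S \<union> R) (\<lambda>_. N)"
    then show "(case (restrict t S, restrict t R) of (x, y) \<Rightarrow> f x * g y) = f t * g t" by (simp add: f g)
  next
    fix b assume b: "b \<in> PiE S (\<lambda>_. N) \<times> PiE R (\<lambda>_. N)"
    show "(restrict (case b of (x, y) \<Rightarrow> \<lambda>i. if i \<in> S then x i else y i) S,
           restrict (case b of (x, y) \<Rightarrow> \<lambda>i. if i \<in> S then x i else y i) R) = b"
      using b assms(3) by (cases b) (auto simp: fun_eq_iff PiE_def extensional_def)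
    show "(case b of (x, y) \<Rightarrow> \<lambda>i. if i \<in> S then x i else y i) \<in> PiE (S \<union> R) (\<lambda>_. N)"
      using b by (cases b) (auto simp: PiE_def extensional_def)
  qed
  also have "\<dots> = (\<Sum>t\<in>PiE S (\<lambda>_. N). f t) * (\<Sum>t\<in>PiE R (\<lambda>_. N). g t)"
    by (simp add: sum_product sum.cartesian_product)
  finally show ?thesis .
qed

text \<open>\<open>X' a\<close> is the process after resampling all innovations up to time \<open>a\<close>; \<open>\<delta>\<close> already contains the power \<open>\<alpha>\<close>.\<close>
locale weakly_dependent = prob_space M for M :: "'a measure" +
  fixes X :: "nat \<Rightarrow> 'a \<Rightarrow> 'e :: {real_normed_vector, second_countable_topology}"
    and X' :: "nat \<Rightarrow> nat \<Rightarrow> 'a \<Rightarrow> 'e" and \<delta> :: "nat \<Rightarrow> real" and r \<alpha> :: real and P :: nat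
  assumes X_meas [measurable]: "\<And>i. X i \<in> borel_measurable M"
    and X'_meas [measurable]: "\<And>a i. X' a i \<in> borel_measurable M"
    and decouple: "\<And>(A::nat set) B t a (f :: nat \<Rightarrow> 'e \<Rightarrow> complex) K. finite A \<Longrightarrow> finite B \<Longrightarrow>
       (\<And>j. j \<in> A \<Longrightarrow> t j \<le> a) \<Longrightarrow> (\<And>i. i \<in> B \<Longrightarrow> a < t i) \<Longrightarrow>
       (\<And>i. f i \<in> borel_measurable borel) \<Longrightarrow> (\<And>i x. norm (f i x) \<le> K) \<Longrightarrow>
       expectation (\<lambda>\<omega>. (\<Prod>j\<in>A. f j (X (t j) \<omega>)) * (\<Prod>i\<in>B. f i (X' a (t i) \<omega>)))
       = expectation (\<lambda>\<omega>. \<Prod>j\<in>A. f j (X (t j) \<omega>)) * expectation (\<lambda>\<omega>. \<Prod>i\<in>B. f i (X (t i) \<omega>))"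
    and stationary: "\<And>(A::nat set) t a (f :: nat \<Rightarrow> 'e \<Rightarrow> complex) K. finite A \<Longrightarrow>
       (\<And>i. f i \<in> borel_measurable borel) \<Longrightarrow> (\<And>i x. norm (f i x) \<le> K) \<Longrightarrow>
       expectation (\<lambda>\<omega>. \<Prod>i\<in>A. f i (X (t i + a) \<omega>)) = expectation (\<lambda>\<omega>. \<Prod>i\<in>A. f i (X (t i) \<omega>))"
    and coupling_integrable: "\<And>a i. a < i \<Longrightarrow> integrable M (\<lambda>\<omega>. norm (X i \<omega> - X' a i \<omega>) powr \<alpha>)"
    and coupling: "\<And>a i Z. a < i \<Longrightarrow> Z \<in> borel_measurable M \<Longrightarrow> (\<And>\<omega>. \<bar>Z \<omega>\<bar> \<le> 1) \<Longrightarrow>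
       expectation (\<lambda>\<omega>. \<bar>Z \<omega>\<bar> * norm (X i \<omega> - X' a i \<omega>) powr \<alpha>)
         \<le> expectation (\<lambda>\<omega>. \<bar>Z \<omega>\<bar>) powr (1 / r) * \<delta> (i - a)"
    and \<delta>_nonneg: "\<And>i. 0 \<le> \<delta> i"
    and \<delta>_summable: "summable (\<lambda>i. real i ^ (P - 2) * \<delta> i)"
    and r_ge1: "1 \<le> r" and \<alpha>_pos: "0 < \<alpha>" and P_ge: "4 \<le> P"
begin

section \<open>Decoupling inequalities for products of Hoelder functions\<close>

lemma holder_measurable:
  fixes f :: "'e \<Rightarrow> 'b::real_normed_vector"
  assumes "\<And>x y :: 'e. norm (f x - f y) \<le> L * norm (x - y) powr \<alpha>"
  shows "continuous_on UNIV f" "f \<in> borel_measurable borel"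
proof -
  show c: "continuous_on UNIV f"
    unfolding continuous_on_eq_continuous_at[OF open_UNIV] isCont_def
  proof
    fix x :: 'e
    have "((\<lambda>y. L * norm (y - x) powr \<alpha>) \<longlongrightarrow> L * norm (x - x) powr \<alpha>) (at x)"
      using \<alpha>_pos by (intro tendsto_intros) auto
    then have "((\<lambda>y. L * norm (y - x) powr \<alpha>) \<longlongrightarrow> 0) (at x)" by simp
    then have "((\<lambda>y. f y - f x) \<longlongrightarrow> 0) (at x)"
      by (rule Lim_null_comparison[rotated]) (use assms in auto)
    then show "(f \<longlongrightarrow> f x) (at x)" using LIM_zero_cancel by blast
  qed
  show "f \<in> borel_measurable borel" using c by (rule borel_measurable_continuous_onI)
qed

text \<open>On the future block \<open>B\<close> the process is replaced by its resampled copy, for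
  which the expectation factorises exactly. The error telescopes into one Hoelder increment per
  index of \<open>B\<close>. Keeping the past product as the weight \<open>Z\<close> in
  \<open>coupling\<close>, instead of bounding it by 1, is what produces the factor
  \<open>\<pi> powr (1 / r)\<close>.\<close>

lemma decouple_bound:
  fixes f :: "nat \<Rightarrow> 'e \<Rightarrow> complex"
  assumes fin: "finite A" "finite B" and L0: "0 \<le> L"
    and A: "\<And>j. j \<in> A \<Longrightarrow> t j \<le> a" and B: "\<And>i. i \<in> B \<Longrightarrow> a < t i"
    and hol: "\<And>i x y. norm (f i x - f i y) \<le> L * norm (x - y) powr \<alpha>" and bd: "\<And>i x. norm (f i x) \<le> 1"
    and \<pi>: "expectation (\<lambda>\<omega>. norm (\<Prod>j\<in>A. f j (X (t j) \<omega>))) \<le> \<pi>"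
  shows "norm (expectation (\<lambda>\<omega>. (\<Prod>j\<in>A. f j (X (t j) \<omega>)) * (\<Prod>i\<in>B. f i (X (t i) \<omega>)))
       - expectation (\<lambda>\<omega>. \<Prod>j\<in>A. f j (X (t j) \<omega>)) * expectation (\<lambda>\<omega>. \<Prod>i\<in>B. f i (X (t i) \<omega>)))
       \<le> (\<Sum>i\<in>B. L * \<pi> powr (1 / r) * \<delta> (t i - a))"
proof -
  have [measurable]: "f i \<in> borel_measurable borel" for i by (rule holder_measurable[OF hol])
  define Z where "Z = (\<lambda>\<omega>. \<Prod>j\<in>A. f j (X (t j) \<omega>))"
  define G where "G = (\<lambda>\<omega>. \<Prod>i\<in>B. f i (X (t i) \<omega>))"
  define G' where "G' = (\<lambda>\<omega>. \<Prod>i\<in>B. f i (X' a (t i) \<omega>))"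
  have [measurable]: "Z \<in> borel_measurable M" "G \<in> borel_measurable M" "G' \<in> borel_measurable M"
    unfolding Z_def G_def G'_def by measurable
  have bdp: "norm (\<Prod>i\<in>C. f i (y i)) \<le> 1" for C y
    unfolding prod_norm[symmetric] by (rule prod_le_1) (auto simp: bd)
  have Z1: "norm (Z \<omega>) \<le> 1" and G1: "norm (G \<omega>) \<le> 1" and G'1: "norm (G' \<omega>) \<le> 1" for \<omega>
    unfolding Z_def G_def G'_def by (auto intro: bdp)
  have ZG1: "norm (Z \<omega> * G \<omega>) \<le> 1" and ZG'1: "norm (Z \<omega> * G' \<omega>) \<le> 1" for \<omega>
    using Z1[of \<omega>] G1[of \<omega>] G'1[of \<omega>] by (auto simp: norm_mult intro: mult_le_one)
  have int: "integrable M (\<lambda>\<omega>. Z \<omega> * G \<omega>)" "integrable M (\<lambda>\<omega>. Z \<omega> * G' \<omega>)"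
    by (rule integrable_const_bound[where B=1]; use ZG1 ZG'1 in auto)+
  have e: "expectation Z * expectation G = expectation (\<lambda>\<omega>. Z \<omega> * G' \<omega>)"
    unfolding Z_def G_def G'_def by (rule decouple[symmetric, OF fin A B _ bd]) auto
  have intd: "integrable M (\<lambda>\<omega>. \<bar>norm (Z \<omega>)\<bar> * norm (X (t i) \<omega> - X' a (t i) \<omega>) powr \<alpha>)" if "i \<in> B" for i
    by (rule Bochner_Integration.integrable_bound[OF coupling_integrable[OF B[OF that]]])
      (auto simp: abs_mult intro!: mult_left_le_one_le Z1)
  have "norm (expectation (\<lambda>\<omega>. Z \<omega> * G \<omega>) - expectation Z * expectation G)
     = norm (expectation (\<lambda>\<omega>. Z \<omega> * (G \<omega> - G' \<omega>)))"
    unfolding e using int by (simp add: right_diff_distrib)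
  also have "\<dots> \<le> expectation (\<lambda>\<omega>. norm (Z \<omega> * (G \<omega> - G' \<omega>)))"
    by (rule integral_norm_bound)
  also have "\<dots> \<le> expectation (\<lambda>\<omega>. \<Sum>i\<in>B. L * (\<bar>norm (Z \<omega>)\<bar> * norm (X (t i) \<omega> - X' a (t i) \<omega>) powr \<alpha>))"
  proof (rule integral_mono)
    show "integrable M (\<lambda>\<omega>. norm (Z \<omega> * (G \<omega> - G' \<omega>)))"
      using Bochner_Integration.integrable_diff[OF int] by (intro integrable_norm) (simp add: right_diff_distrib)
    show "integrable M (\<lambda>\<omega>. \<Sum>i\<in>B. L * (\<bar>norm (Z \<omega>)\<bar> * norm (X (t i) \<omega> - X' a (t i) \<omega>) powr \<alpha>))"
      using intd by auto
    fix \<omega>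
    have "norm (G \<omega> - G' \<omega>) \<le> (\<Sum>i\<in>B. norm (f i (X (t i) \<omega>) - f i (X' a (t i) \<omega>)))"
      unfolding G_def G'_def by (rule norm_prod_diff) (auto simp: bd)
    also have "\<dots> \<le> (\<Sum>i\<in>B. L * norm (X (t i) \<omega> - X' a (t i) \<omega>) powr \<alpha>)"
      by (intro sum_mono hol)
    finally have "norm (Z \<omega>) * norm (G \<omega> - G' \<omega>) \<le> norm (Z \<omega>) * (\<Sum>i\<in>B. L * norm (X (t i) \<omega> - X' a (t i) \<omega>) powr \<alpha>)"
      by (rule mult_left_mono) simp
    then show "norm (Z \<omega> * (G \<omega> - G' \<omega>)) \<le> (\<Sum>i\<in>B. L * (\<bar>norm (Z \<omega>)\<bar> * norm (X (t i) \<omega> - X' a (t i) \<omega>) powr \<alpha>))"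
      unfolding norm_mult by (simp add: sum_distrib_left mult.left_commute)
  qed
  also have "\<dots> = (\<Sum>i\<in>B. L * expectation (\<lambda>\<omega>. \<bar>norm (Z \<omega>)\<bar> * norm (X (t i) \<omega> - X' a (t i) \<omega>) powr \<alpha>))"
    using intd by (subst Bochner_Integration.integral_sum) auto
  also have "\<dots> \<le> (\<Sum>i\<in>B. L * (\<pi> powr (1 / r) * \<delta> (t i - a)))"
  proof (intro sum_mono mult_left_mono L0)
    fix i assume "i \<in> B"
    have "expectation (\<lambda>\<omega>. \<bar>norm (Z \<omega>)\<bar> * norm (X (t i) \<omega> - X' a (t i) \<omega>) powr \<alpha>)
       \<le> expectation (\<lambda>\<omega>. \<bar>norm (Z \<omega>)\<bar>) powr (1 / r) * \<delta> (t i - a)"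
      by (rule coupling[OF B[OF \<open>i \<in> B\<close>]]) (auto simp: Z1)
    also have "\<dots> \<le> \<pi> powr (1 / r) * \<delta> (t i - a)"
      using \<pi> r_ge1 unfolding Z_def by (intro mult_right_mono powr_mono2 \<delta>_nonneg) auto
    finally show "expectation (\<lambda>\<omega>. \<bar>norm (Z \<omega>)\<bar> * norm (X (t i) \<omega> - X' a (t i) \<omega>) powr \<alpha>)
       \<le> \<pi> powr (1 / r) * \<delta> (t i - a)" .
  qed
  finally show ?thesis unfolding Z_def G_def by (simp add: mult_ac)
qed

lemma decouple_bound_real:
  fixes h :: "'e \<Rightarrow> real" and t :: "nat \<Rightarrow> nat"
  assumes fin: "finite A" "finite B" "jj \<in> A" and L0: "0 \<le> L"
    and A: "\<And>j. j \<in> A \<Longrightarrow> t j \<le> a" and B: "\<And>i. i \<in> B \<Longrightarrow> a < t i"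
    and hol: "\<And>x y. \<bar>h x - h y\<bar> \<le> L * norm (x - y) powr \<alpha>" and bd: "\<And>x. \<bar>h x\<bar> \<le> 1"
    and \<pi>: "\<And>i. expectation (\<lambda>\<omega>. \<bar>h (X i \<omega>)\<bar>) \<le> \<pi>"
  shows "\<bar>expectation (\<lambda>\<omega>. (\<Prod>j\<in>A. h (X (t j) \<omega>)) * (\<Prod>i\<in>B. h (X (t i) \<omega>)))\<bar>
       \<le> \<bar>expectation (\<lambda>\<omega>. \<Prod>j\<in>A. h (X (t j) \<omega>))\<bar> * \<bar>expectation (\<lambda>\<omega>. \<Prod>i\<in>B. h (X (t i) \<omega>))\<bar>
        + (\<Sum>i\<in>B. L * \<pi> powr (1 / r) * \<delta> (t i - a))"
proof -
  define f :: "nat \<Rightarrow> 'e \<Rightarrow> complex" where "f = (\<lambda>i x. of_real (h x))"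
  have [measurable]: "h \<in> borel_measurable borel" by (rule holder_measurable[of h L]) (simp add: hol)
  have pf: "(\<Prod>j\<in>C. f j (y j)) = of_real (\<Prod>j\<in>C. h (y j))" for C and y :: "nat \<Rightarrow> 'e" by (simp add: f_def)
  have bdp: "\<bar>\<Prod>j\<in>C. h (y j)\<bar> \<le> 1" for C y unfolding abs_prod by (rule prod_le_1) (auto simp: bd)
  have "norm (expectation (\<lambda>\<omega>. (\<Prod>j\<in>A. f j (X (t j) \<omega>)) * (\<Prod>i\<in>B. f i (X (t i) \<omega>)))
       - expectation (\<lambda>\<omega>. \<Prod>j\<in>A. f j (X (t j) \<omega>)) * expectation (\<lambda>\<omega>. \<Prod>i\<in>B. f i (X (t i) \<omega>)))
       \<le> (\<Sum>i\<in>B. L * \<pi> powr (1 / r) * \<delta> (t i - a))"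
  proof (rule decouple_bound[OF fin(1,2) L0 A B])
    show "norm (f i x - f i y) \<le> L * norm (x - y) powr \<alpha>" for i x y
      using hol[of x y] unfolding f_def of_real_diff[symmetric] norm_of_real .
    show "norm (f i x) \<le> 1" for i x by (simp add: f_def bd)
    have "expectation (\<lambda>\<omega>. norm (\<Prod>j\<in>A. f j (X (t j) \<omega>))) \<le> expectation (\<lambda>\<omega>. \<bar>h (X (t jj) \<omega>)\<bar>)"
    proof (rule integral_mono)
      show "integrable M (\<lambda>\<omega>. norm (\<Prod>j\<in>A. f j (X (t j) \<omega>)))"
        unfolding pf norm_of_real by (rule integrable_const_bound[where B=1], rule AE_I2, simp only: real_norm_def abs_idempotent bdp, measurable)
      show "integrable M (\<lambda>\<omega>. \<bar>h (X (t jj) \<omega>)\<bar>)"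
        by (rule integrable_const_bound[where B=1]) (use bd in auto)
      fix \<omega>
      have "norm (\<Prod>j\<in>A. f j (X (t j) \<omega>)) = \<bar>h (X (t jj) \<omega>)\<bar> * \<bar>\<Prod>j\<in>A-{jj}. h (X (t j) \<omega>)\<bar>"
        unfolding pf norm_of_real using fin by (subst prod.remove[of _ jj]) (auto simp: abs_mult)
      also have "\<dots> \<le> \<bar>h (X (t jj) \<omega>)\<bar>" using bdp by (intro mult_left_le) auto
      finally show "norm (\<Prod>j\<in>A. f j (X (t j) \<omega>)) \<le> \<bar>h (X (t jj) \<omega>)\<bar>" .
    qed
    then show "expectation (\<lambda>\<omega>. norm (\<Prod>j\<in>A. f j (X (t j) \<omega>))) \<le> \<pi>" using \<pi> by (rule order_trans)
  qed
  then have "\<bar>expectation (\<lambda>\<omega>. (\<Prod>j\<in>A. h (X (t j) \<omega>)) * (\<Prod>i\<in>B. h (X (t i) \<omega>)))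
       - expectation (\<lambda>\<omega>. \<Prod>j\<in>A. h (X (t j) \<omega>)) * expectation (\<lambda>\<omega>. \<Prod>i\<in>B. h (X (t i) \<omega>))\<bar>
       \<le> (\<Sum>i\<in>B. L * \<pi> powr (1 / r) * \<delta> (t i - a))"
    unfolding pf of_real_mult[symmetric] integral_complex_of_real of_real_diff[symmetric] norm_of_real .
  then show ?thesis unfolding abs_mult[symmetric] by linarith
qed

lemma stationary_real:
  fixes f :: "nat \<Rightarrow> 'e \<Rightarrow> real"
  assumes "finite A" "\<And>i. f i \<in> borel_measurable borel" "\<And>i x. \<bar>f i x\<bar> \<le> K"
  shows "expectation (\<lambda>\<omega>. \<Prod>i\<in>A. f i (X (t i + a) \<omega>)) = expectation (\<lambda>\<omega>. \<Prod>i\<in>A. f i (X (t i) \<omega>))"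
proof -
  have "expectation (\<lambda>\<omega>. \<Prod>i\<in>A. complex_of_real (f i (X (t i + a) \<omega>))) = expectation (\<lambda>\<omega>. \<Prod>i\<in>A. complex_of_real (f i (X (t i) \<omega>)))"
    by (rule stationary[of A "\<lambda>i x. complex_of_real (f i x)" K]) (use assms in auto)
  then show ?thesis unfolding of_real_prod[symmetric] integral_complex_of_real of_real_eq_iff .
qed

section \<open>Moment bounds through sums of joint correlations over index tuples\<close>

definition corr_sum :: "('e \<Rightarrow> real) \<Rightarrow> nat \<Rightarrow> nat set \<Rightarrow> real" where
  "corr_sum h n I = (\<Sum>t\<in>PiE I (\<lambda>_. {1..n}). \<bar>expectation (\<lambda>\<omega>. \<Prod>i\<in>I. h (X (t i) \<omega>))\<bar>)"

lemma corr_sum_nonneg: "0 \<le> corr_sum h n I"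
  unfolding corr_sum_def by (rule sum_nonneg) auto

text \<open>The set \<open>S\<close> of positions before the largest gap depends on the tuple
  \<open>t\<close>. To have a bound of the same shape for every \<open>t\<close>, the right-hand
  side sums over all proper splits and all pairs \<open>(a, q)\<close>; all terms are nonnegative,
  so the actual split is among them. The condition kept in the second sum, that all indices lie
  within \<open>card I\<close> gaps of \<open>t a\<close>, is what makes the tuples countable
  afterwards.\<close>

lemma corr_split:
  fixes I :: "nat set" and t :: "nat \<Rightarrow> nat" and h :: "'e \<Rightarrow> real"
  assumes fin: "finite I" and card: "2 \<le> card I" and L0: "0 \<le> L" and t: "\<not> (\<exists>c. \<forall>i\<in>I. t i = c)"
    and hol: "\<And>x y. \<bar>h x - h y\<bar> \<le> L * norm (x - y) powr \<alpha>" and bd: "\<And>x. \<bar>h x\<bar> \<le> 1"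
    and \<pi>: "\<And>i. expectation (\<lambda>\<omega>. \<bar>h (X i \<omega>)\<bar>) \<le> \<pi>"
  shows "\<bar>expectation (\<lambda>\<omega>. \<Prod>i\<in>I. h (X (t i) \<omega>))\<bar> \<le>
     (\<Sum>S\<in>Pow I - {{}, I}. \<bar>expectation (\<lambda>\<omega>. \<Prod>i\<in>S. h (X (t i) \<omega>))\<bar> * \<bar>expectation (\<lambda>\<omega>. \<Prod>i\<in>I-S. h (X (t i) \<omega>))\<bar>)
     + (\<Sum>(a,q)\<in>I\<times>I. if t a < t q \<and> (\<forall>i\<in>I. t i \<le> t a + card I * (t q - t a) \<and> t a \<le> t i + card I * (t q - t a))
          then L * \<pi> powr (1 / r) * \<delta> (t q - t a) else 0)"
  (is "_ \<le> (\<Sum>S\<in>_. ?f S) + (\<Sum>(a,q)\<in>I\<times>I. ?g a q)")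
proof -
  obtain i0 where i0: "i0 \<in> I" using card by fastforce
  with t obtain i1 where i1: "i1 \<in> I" "t i1 \<noteq> t i0" by blast
  have "card {t i0, t i1} \<le> card (t ` I)" using fin i0 i1 by (intro card_mono) auto
  then have "card (t ` I) \<ge> 2" using i1 by simp
  then obtain u v where uv: "u \<in> t ` I" "v \<in> t ` I" "u < v" "\<forall>x\<in>t ` I. x \<le> u \<or> v \<le> x"
      "\<forall>x\<in>t ` I. \<forall>y\<in>t ` I. x \<le> y + card (t ` I) * (v - u)"
    using finite_set_largest_gap[of "t ` I"] fin by blast
  define S where "S = {i\<in>I. t i \<le> u}"
  obtain a where a: "a \<in> I" "t a = u" using uv by blast
  obtain b where b: "b \<in> I" "t b = v" using uv by blast
  have "b \<notin> S" "a \<in> S" using a b uv(3) by (auto simp: S_def)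
  then have S: "S \<in> Pow I - {{}, I}" "a \<in> S" using b by (auto simp: S_def)
  have "\<bar>expectation (\<lambda>\<omega>. \<Prod>i\<in>I. h (X (t i) \<omega>))\<bar> = \<bar>expectation (\<lambda>\<omega>. (\<Prod>i\<in>S. h (X (t i) \<omega>)) * (\<Prod>i\<in>I-S. h (X (t i) \<omega>)))\<bar>"
    using S(1) fin by (simp add: prod.subset_diff[of S I] mult.commute)
  also have "\<dots> \<le> ?f S + (\<Sum>q\<in>I-S. L * \<pi> powr (1 / r) * \<delta> (t q - u))"
  proof (rule decouple_bound_real[where a=u and t=t and h=h and jj=a and A=S and B="I-S" and L=L and \<pi>=\<pi>])
    show "finite S" "finite (I - S)" using fin S by (auto intro: finite_subset)
  qed (use S(2) L0 hol bd \<pi> in \<open>auto simp: S_def\<close>)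
  \<comment> \<open>Every later index is at least the largest gap away from \<open>u\<close>, so the
    diameter bound survives with \<open>t q - t a\<close> in place of \<open>v - u\<close>.\<close>
  also have "(\<Sum>q\<in>I-S. L * \<pi> powr (1 / r) * \<delta> (t q - u)) \<le> (\<Sum>q\<in>I-S. ?g a q)"
  proof (rule sum_mono)
    fix q assume q: "q \<in> I - S"
    then have q': "v \<le> t q" using uv(4) by (auto simp: S_def)
    have ci: "card (t ` I) * (v - u) \<le> card I * (t q - u)"
      using q' card_image_le[OF fin, of t] by (intro mult_le_mono) auto
    have "t i \<le> t a + card I * (t q - t a) \<and> t a \<le> t i + card I * (t q - t a)" if "i \<in> I" for i
      using uv(5)[rule_format, of "t i" "t a"] uv(5)[rule_format, of "t a" "t i"] ci that a by auto
    then show "L * \<pi> powr (1 / r) * \<delta> (t q - u) \<le> ?g a q" using q' a uv(3) by auto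
  qed
  also have "\<dots> = (\<Sum>(a,q)\<in>{a}\<times>(I-S). ?g a q)" by (simp add: sum.cartesian_product[symmetric])
  also have "\<dots> \<le> (\<Sum>(a,q)\<in>I\<times>I. ?g a q)"
  proof (rule sum_mono2)
    show "0 \<le> (case x of (a, q) \<Rightarrow> ?g a q)" for x using L0 \<delta>_nonneg by (cases x) simp
  qed (use fin a in auto)
  also have "?f S \<le> (\<Sum>S\<in>Pow I - {{}, I}. ?f S)"
    using fin S by (intro member_le_sum) auto
  finally show ?thesis by simp
qed

text \<open>The normalisation \<open>1 \<le> L\<close>, \<open>\<pi> \<le> 1\<close> gives \<pi>
  \<le> L \<pi> powr (1 / r), so that the single quantity L \<pi> powr (1 / r) bounds both the
  tuples with all indices equal and the coupling errors.\<close>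

definition admissible :: "('e \<Rightarrow> real) \<Rightarrow> real \<Rightarrow> real \<Rightarrow> bool" where
  "admissible h L \<pi> \<longleftrightarrow> (\<forall>x y. \<bar>h x - h y\<bar> \<le> L * norm (x - y) powr \<alpha>) \<and> (\<forall>x. \<bar>h x\<bar> \<le> 1) \<and>
     (\<forall>i. expectation (\<lambda>\<omega>. \<bar>h (X i \<omega>)\<bar>) \<le> \<pi>) \<and> (\<forall>i. expectation (\<lambda>\<omega>. h (X i \<omega>)) = 0) \<and> 1 \<le> L \<and> \<pi> \<le> 1"

lemma admissible_measurable: "admissible h L \<pi> \<Longrightarrow> h \<in> borel_measurable borel"
  by (rule holder_measurable[of h L]) (auto simp: admissible_def)

lemma admissible_\<pi>: assumes "admissible h L \<pi>" shows "0 \<le> \<pi>" "\<pi> \<le> \<pi> powr (1 / r)"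
proof -
  have "0 \<le> expectation (\<lambda>\<omega>. \<bar>h (X 0 \<omega>)\<bar>)" by simp
  then show "0 \<le> \<pi>" using assms unfolding admissible_def by (meson order_trans)
  then show "\<pi> \<le> \<pi> powr (1 / r)"
    using assms powr_mono'[of "1/r" 1 \<pi>] r_ge1 by (cases "\<pi> = 0") (auto simp: admissible_def)
qed

lemma \<delta>_sum_le:
  assumes "m \<le> P"
  shows "(\<Sum>d\<in>{1..n}. real d ^ (m - 2) * \<delta> d) \<le> (\<Sum>d. real d ^ (P - 2) * \<delta> d)"
proof -
  have "(\<Sum>d\<in>{1..n}. real d ^ (m - 2) * \<delta> d) \<le> (\<Sum>d\<in>{1..n}. real d ^ (P - 2) * \<delta> d)"
    using assms by (intro sum_mono mult_right_mono \<delta>_nonneg power_increasing) auto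
  also have "\<dots> \<le> (\<Sum>d. real d ^ (P - 2) * \<delta> d)"
    using \<delta>_nonneg by (intro sum_le_suminf \<delta>_summable) auto
  finally show ?thesis .
qed

text \<open>For a given position \<open>u = t a\<close> and gap \<open>d = t q - t a\<close>, the
  other \<open>m - 2\<close> indices lie in a window of length \<open>2 * m * d + 1\<close> around
  \<open>u\<close>. Summing over \<open>u\<close> gives the factor \<open>n\<close>; summing over
  \<open>d\<close> gives the series that the hypothesis on the dependence coefficients makes
  finite.\<close>

lemma gap_count:
  fixes I :: "nat set" and n :: nat
  defines "m \<equiv> card I"
  assumes fin: "finite I" and m: "m \<le> P" and aq: "a \<in> I" "q \<in> I" and \<kappa>: "0 \<le> \<kappa>"
  shows "(\<Sum>t\<in>PiE I (\<lambda>_. {1..n}). if t a < t q \<and> (\<forall>i\<in>I. t i \<le> t a + m * (t q - t a) \<and> t a \<le> t i + m * (t q - t a))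
          then \<kappa> * \<delta> (t q - t a) else 0) \<le> real n * (\<kappa> * (2 * real m + 1) ^ (m - 2) * (\<Sum>d. real d ^ (P - 2) * \<delta> d))"
  (is "(\<Sum>t\<in>?E. if ?c t then ?w t else 0) \<le> _")
proof (cases "a = q")
  case True
  have "0 \<le> (\<Sum>d. real d ^ (P - 2) * \<delta> d)" using \<delta>_nonneg by (intro suminf_nonneg \<delta>_summable) auto
  then show ?thesis using True \<kappa> by simp
next
  case aq': False
  have finE: "finite ?E" using fin by (auto intro: finite_PiE)
  have m2: "2 \<le> m" using aq aq' card_mono[of I "{a,q}"] fin unfolding m_def by simp
  have "(\<Sum>t\<in>?E. if ?c t then ?w t else 0) = (\<Sum>t\<in>{t\<in>?E. ?c t}. ?w t)"
    by (rule sum.inter_filter[symmetric, OF finE])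
  also have "\<dots> = (\<Sum>y\<in>{1..n}\<times>{1..n}. \<Sum>t\<in>{t\<in>{t\<in>?E. ?c t}. (t a, t q - t a) = y}. ?w t)"
  proof (rule sum.group[symmetric])
    show "finite {t\<in>?E. ?c t}" by (rule finite_subset[OF Collect_restrict finE])
    show "(\<lambda>t. (t a, t q - t a)) ` {t\<in>?E. ?c t} \<subseteq> {1..n} \<times> {1..n}"
    proof (rule image_subsetI)
      fix t assume "t \<in> {t\<in>?E. ?c t}"
      then have t: "t \<in> ?E" "t a < t q" by blast+
      have "t a \<in> {1..n}" "t q \<in> {1..n}" by (rule PiE_mem[OF t(1) aq(1)], rule PiE_mem[OF t(1) aq(2)])
      then show "(t a, t q - t a) \<in> {1..n} \<times> {1..n}" using t(2) by auto
    qed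
  qed simp
  also have "\<dots> = (\<Sum>u\<in>{1..n}. \<Sum>d\<in>{1..n}. \<Sum>t\<in>{t\<in>{t\<in>?E. ?c t}. (t a, t q - t a) = (u,d)}. ?w t)"
    unfolding sum.cartesian_product split_def prod.collapse ..
  also have "\<dots> \<le> (\<Sum>u\<in>{1..n}. \<Sum>d\<in>{1..n}. (2 * real m + 1) ^ (m - 2) * real d ^ (m - 2) * (\<kappa> * \<delta> d))"
  proof (intro sum_mono)
    fix u d assume u: "u \<in> {1..n}" and d: "d \<in> {1..n}"
    define B where "B i = (if i = a then {u} else if i = q then {u + d} else {u - m * d..u + m * d})" for i
    have finB: "finite (B i)" for i by (simp add: B_def)
    have sub: "{t\<in>{t\<in>?E. ?c t}. (t a, t q - t a) = (u,d)} \<subseteq> PiE I B"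
    proof
      fix t assume "t \<in> {t\<in>{t\<in>?E. ?c t}. (t a, t q - t a) = (u,d)}"
      then have tE: "t \<in> ?E" and c: "?c t" and ud: "t a = u" "t q - t a = d" by blast+
      show "t \<in> PiE I B"
      proof (rule PiE_I)
        fix i assume "i \<in> I"
        then have "t i \<le> t a + m * (t q - t a) \<and> t a \<le> t i + m * (t q - t a)" using c by blast
        then have "t i \<le> u + m * d" "u \<le> t i + m * d" unfolding ud(2) unfolding ud(1) by blast+
        moreover have "t q = u + d" using c ud by linarith
        ultimately show "t i \<in> B i" using ud(1) by (simp add: B_def le_diff_conv)
      next
        fix i assume "i \<notin> I"
        then show "t i = undefined" using tE by (rule PiE_arb[rotated])
      qed
    qed
    have "card (PiE I B) = (\<Prod>i\<in>I. card (B i))" using fin by (rule card_PiE)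
    also have "\<dots> = card (B a) * (card (B q) * (\<Prod>i\<in>I-{a}-{q}. card (B i)))"
      using fin aq aq' by (simp add: prod.remove[of I a] prod.remove[of "I-{a}" q])
    also have "\<dots> = (\<Prod>i\<in>I-{a}-{q}. card (B i))" using aq' by (simp add: B_def)
    also have "\<dots> \<le> (\<Prod>i\<in>I-{a}-{q}. 2 * m * d + 1)"
      by (rule prod_mono) (auto simp: B_def)
    also have "\<dots> = (2 * m * d + 1) ^ (m - 2)"
      using fin aq aq' by (simp add: m_def card_Diff_singleton_if numeral_2_eq_2)
    \<comment> \<open>Here \<open>d \<ge> 1\<close> absorbs the summand 1.\<close>
    also have "\<dots> \<le> ((2 * m + 1) * d) ^ (m - 2)" using d by (intro power_mono) auto
    finally have "card (PiE I B) \<le> ((2 * m + 1) * d) ^ (m - 2)" .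
    moreover have "card {t\<in>{t\<in>?E. ?c t}. (t a, t q - t a) = (u,d)} \<le> card (PiE I B)"
      by (rule card_mono[OF finite_PiE[OF fin finB] sub])
    ultimately have "card {t\<in>{t\<in>?E. ?c t}. (t a, t q - t a) = (u,d)} \<le> ((2 * m + 1) * d) ^ (m - 2)" by linarith
    then have c: "real (card {t\<in>{t\<in>?E. ?c t}. (t a, t q - t a) = (u,d)}) \<le> (2 * real m + 1) ^ (m - 2) * real d ^ (m - 2)"
      unfolding of_nat_le_iff[symmetric, where 'a=real] of_nat_power of_nat_mult power_mult_distrib of_nat_add of_nat_numeral of_nat_1 .
    have "(\<Sum>t\<in>{t\<in>{t\<in>?E. ?c t}. (t a, t q - t a) = (u,d)}. ?w t) = (\<Sum>t\<in>{t\<in>{t\<in>?E. ?c t}. (t a, t q - t a) = (u,d)}. \<kappa> * \<delta> d)"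
      by (rule sum.cong) auto
    also have "\<dots> \<le> (2 * real m + 1) ^ (m - 2) * real d ^ (m - 2) * (\<kappa> * \<delta> d)"
      unfolding sum_constant using \<kappa> \<delta>_nonneg by (intro mult_right_mono c) auto
    finally show "(\<Sum>t\<in>{t\<in>{t\<in>?E. ?c t}. (t a, t q - t a) = (u,d)}. ?w t) \<le> (2 * real m + 1) ^ (m - 2) * real d ^ (m - 2) * (\<kappa> * \<delta> d)" .
  qed
  also have "\<dots> = real n * (\<kappa> * (2 * real m + 1) ^ (m - 2) * (\<Sum>d\<in>{1..n}. real d ^ (m - 2) * \<delta> d))"
    by (simp add: sum_distrib_left mult_ac)
  also have "\<dots> \<le> real n * (\<kappa> * (2 * real m + 1) ^ (m - 2) * (\<Sum>d. real d ^ (P - 2) * \<delta> d))"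
    using \<kappa> by (intro mult_left_mono \<delta>_sum_le m) auto
  finally show ?thesis .
qed

text \<open>A constant tuple has no gap to split at; there are at most \<open>n\<close> of them,
  each contributing at most \<pi>. For all other tuples \<open>corr_split\<close> applies: the
  product terms factor into smaller correlation sums and the gap terms are counted by
  \<open>gap_count\<close>.\<close>

lemma corr_sum_recursion:
  fixes I :: "nat set" and n :: nat
  defines "m \<equiv> card I"
  assumes fin: "finite I" and m: "2 \<le> m" "m \<le> P" and h: "admissible h L \<pi>"
  shows "corr_sum h n I \<le> (\<Sum>S\<in>Pow I - {{}, I}. corr_sum h n S * corr_sum h n (I - S))
    + (1 + real m ^ 2 * (2 * real m + 1) ^ (m - 2) * (\<Sum>d. real d ^ (P - 2) * \<delta> d)) * (real n * (L * \<pi> powr (1 / r)))"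
proof -
  note h' = h[unfolded admissible_def]
  have [measurable]: "h \<in> borel_measurable borel" using h by (rule admissible_measurable)
  define \<kappa> where "\<kappa> = L * \<pi> powr (1 / r)"
  define D where "D = (\<Sum>d. real d ^ (P - 2) * \<delta> d)"
  define E where "E = PiE I (\<lambda>_. {1..n})"
  define cst where "cst = {t\<in>E. \<exists>c. \<forall>i\<in>I. t i = c}"
  define g where "g t a q = (if t a < t q \<and> (\<forall>i\<in>I. t i \<le> t a + m * (t q - t a) \<and> t a \<le> t i + m * (t q - t a))
          then \<kappa> * \<delta> (t q - t a) else 0)" for t :: "nat \<Rightarrow> nat" and a q
  define e where "e S t = \<bar>expectation (\<lambda>\<omega>. \<Prod>i\<in>S. h (X (t i) \<omega>))\<bar>" for S and t :: "nat \<Rightarrow> nat"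
  have \<kappa>0: "0 \<le> \<kappa>" using h' by (simp add: \<kappa>_def)
  have \<pi>\<kappa>: "\<pi> \<le> \<kappa>" using admissible_\<pi>[OF h] h' mult_right_mono[of 1 L "\<pi> powr (1/r)"] by (simp add: \<kappa>_def)
  have g0: "0 \<le> g t a q" for t a q using \<kappa>0 \<delta>_nonneg by (simp add: g_def)
  have finE: "finite E" unfolding E_def using fin by (auto intro: finite_PiE)
  obtain i0 where i0: "i0 \<in> I" using m unfolding m_def by fastforce
  have bdp: "\<bar>\<Prod>j\<in>C. h (y j)\<bar> \<le> 1" for C and y :: "nat \<Rightarrow> 'e" unfolding abs_prod by (rule prod_le_1) (use h' in auto)
  have e_le: "e I t \<le> \<pi>" for t
  proof -
    have "e I t \<le> expectation (\<lambda>\<omega>. \<bar>\<Prod>i\<in>I. h (X (t i) \<omega>)\<bar>)" unfolding e_def by (rule integral_abs_bound)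
    also have "\<dots> \<le> expectation (\<lambda>\<omega>. \<bar>h (X (t i0) \<omega>)\<bar>)"
    proof (rule integral_mono)
      show "integrable M (\<lambda>\<omega>. \<bar>\<Prod>i\<in>I. h (X (t i) \<omega>)\<bar>)"
        by (rule integrable_const_bound[where B=1], rule AE_I2, simp only: real_norm_def abs_idempotent bdp, measurable)
      show "integrable M (\<lambda>\<omega>. \<bar>h (X (t i0) \<omega>)\<bar>)"
        by (rule integrable_const_bound[where B=1]) (use h' in auto)
      fix \<omega>
      have "\<bar>\<Prod>i\<in>I. h (X (t i) \<omega>)\<bar> = \<bar>h (X (t i0) \<omega>)\<bar> * \<bar>\<Prod>j\<in>I-{i0}. h (X (t j) \<omega>)\<bar>"
        using fin i0 by (subst prod.remove[of _ i0]) (auto simp: abs_mult)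
      also have "\<dots> \<le> \<bar>h (X (t i0) \<omega>)\<bar>" using bdp by (intro mult_left_le) auto
      finally show "\<bar>\<Prod>i\<in>I. h (X (t i) \<omega>)\<bar> \<le> \<bar>h (X (t i0) \<omega>)\<bar>" .
    qed
    also have "\<dots> \<le> \<pi>" using h' by blast
    finally show ?thesis .
  qed
  have e0: "0 \<le> e S t" for S t by (simp add: e_def)
  have pt: "e I t \<le> (if t \<in> cst then \<pi> else 0) + (\<Sum>S\<in>Pow I - {{}, I}. e S t * e (I - S) t) + (\<Sum>(a,q)\<in>I\<times>I. g t a q)" if "t \<in> E" for t
  proof (cases "t \<in> cst")
    case True
    have "0 \<le> (\<Sum>S\<in>Pow I - {{}, I}. e S t * e (I - S) t)" "0 \<le> (\<Sum>(a,q)\<in>I\<times>I. g t a q)"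
      using e0 g0 by (auto intro!: sum_nonneg)
    then show ?thesis using e_le[of t] True by simp
  next
    case False
    then have "\<not> (\<exists>c. \<forall>i\<in>I. t i = c)" using that by (auto simp: cst_def)
    then have "e I t \<le> (\<Sum>S\<in>Pow I - {{}, I}. e S t * e (I - S) t) + (\<Sum>(a,q)\<in>I\<times>I. g t a q)"
      unfolding e_def g_def m_def \<kappa>_def using h' m
      by (intro corr_split[OF fin]) (auto simp: m_def)
    then show ?thesis using False by simp
  qed
  have card_cst: "card cst \<le> n"
  proof -
    have "cst \<subseteq> (\<lambda>c. \<lambda>i\<in>I. c) ` {1..n}"
    proof
      fix t assume t: "t \<in> cst"
      then obtain c where c: "\<forall>i\<in>I. t i = c" by (auto simp: cst_def)
      have "t = (\<lambda>i\<in>I. c)" using t c by (auto simp: cst_def E_def PiE_def extensional_def fun_eq_iff)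
      moreover have "c \<in> {1..n}" using t c i0 unfolding cst_def E_def by force
      ultimately show "t \<in> (\<lambda>c. \<lambda>i\<in>I. c) ` {1..n}" by blast
    qed
    then have "card cst \<le> card ((\<lambda>c. \<lambda>i\<in>I. c) ` {1..n})" by (intro card_mono) auto
    also have "\<dots> \<le> n" using card_image_le[of "{1..n}" "\<lambda>c. \<lambda>i\<in>I. c"] by simp
    finally show ?thesis .
  qed
  have eS: "e S t = e S (restrict t S)" for S t unfolding e_def by (intro arg_cong[where f=abs] Bochner_Integration.integral_cong prod.cong) auto
  have "corr_sum h n I = (\<Sum>t\<in>E. e I t)" by (simp add: corr_sum_def E_def e_def)
  also have "\<dots> \<le> (\<Sum>t\<in>E. (if t \<in> cst then \<pi> else 0) + (\<Sum>S\<in>Pow I - {{}, I}. e S t * e (I - S) t) + (\<Sum>(a,q)\<in>I\<times>I. g t a q))"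
    by (rule sum_mono[OF pt])
  also have "\<dots> = (\<Sum>t\<in>E. if t \<in> cst then \<pi> else 0) + (\<Sum>S\<in>Pow I - {{}, I}. \<Sum>t\<in>E. e S t * e (I - S) t)
      + (\<Sum>(a,q)\<in>I\<times>I. \<Sum>t\<in>E. g t a q)"
    unfolding sum.distrib by (simp add: sum.swap[of _ _ E] split_def)
  also have "(\<Sum>t\<in>E. if t \<in> cst then \<pi> else 0) = real (card cst) * \<pi>"
    using finE by (subst sum.inter_filter[symmetric]) (auto simp: cst_def)
  also have "\<dots> \<le> real n * \<kappa>" using card_cst \<pi>\<kappa> admissible_\<pi>[OF h] by (intro mult_mono) auto
  also have "(\<Sum>S\<in>Pow I - {{}, I}. \<Sum>t\<in>E. e S t * e (I - S) t) = (\<Sum>S\<in>Pow I - {{}, I}. corr_sum h n S * corr_sum h n (I - S))"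
  proof (rule sum.cong[OF refl])
    fix S assume S: "S \<in> Pow I - {{}, I}"
    then have I: "S \<union> (I - S) = I" by auto
    have "(\<Sum>t\<in>PiE (S \<union> (I - S)) (\<lambda>_. {1..n}). e S t * e (I - S) t) = (\<Sum>t\<in>PiE S (\<lambda>_. {1..n}). e S t) * (\<Sum>t\<in>PiE (I - S) (\<lambda>_. {1..n}). e (I - S) t)"
      using S fin by (intro sum_PiE_Un) (auto simp: eS[symmetric] intro: finite_subset)
    then show "(\<Sum>t\<in>E. e S t * e (I - S) t) = corr_sum h n S * corr_sum h n (I - S)"
      unfolding I E_def corr_sum_def e_def .
  qed
  also have "(\<Sum>(a,q)\<in>I\<times>I. \<Sum>t\<in>E. g t a q) \<le> (\<Sum>(a,q)\<in>I\<times>I. real n * (\<kappa> * (2 * real m + 1) ^ (m - 2) * D))"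
    unfolding split_def
  proof (rule sum_mono)
    fix x assume "x \<in> I \<times> I"
    then have "fst x \<in> I" "snd x \<in> I" by auto
    then show "(\<Sum>t\<in>E. g t (fst x) (snd x)) \<le> real n * (\<kappa> * (2 * real m + 1) ^ (m - 2) * D)"
      unfolding g_def m_def D_def E_def using m \<kappa>0 by (intro gap_count fin) (auto simp: m_def)
  qed
  also have "\<dots> = real m ^ 2 * (real n * (\<kappa> * (2 * real m + 1) ^ (m - 2) * D))"
    using fin by (simp add: m_def card_cartesian_product power2_eq_square split_def)
  finally show ?thesis unfolding D_def[symmetric] \<kappa>_def[symmetric] by (simp add: algebra_simps)
qed

lemma corr_sum_singleton: "admissible h L \<pi> \<Longrightarrow> corr_sum h n {i} = 0"
  unfolding corr_sum_def admissible_def by simp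

lemma corr_sum_empty: "corr_sum h n {} = 1"
  unfolding corr_sum_def by (simp add: prob_space)

text \<open>Splitting a pair leaves singletons, whose correlation sums vanish by centering. The
  recursion therefore closes at once and gives a bound linear in \<open>n\<close> at every scale,
  also where n L \<pi> powr (1 / r) is below 1.\<close>

lemma corr_sum_2:
  "\<exists>C\<ge>0. \<forall>I n h L \<pi>. card I = 2 \<longrightarrow> admissible h L \<pi> \<longrightarrow> corr_sum h n I \<le> C * (real n * (L * \<pi> powr (1 / r)))"
proof (intro exI conjI allI impI)
  let ?C = "1 + real 2 ^ 2 * (2 * real 2 + 1) ^ (2 - 2) * (\<Sum>d. real d ^ (P - 2) * \<delta> d)"
  have "0 \<le> (\<Sum>d. real d ^ (P - 2) * \<delta> d)" using \<delta>_nonneg by (intro suminf_nonneg \<delta>_summable) auto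
  then show "0 \<le> ?C" by simp
  fix I :: "nat set" and n h L \<pi> assume c: "card I = 2" and h: "admissible h L \<pi>"
  have fin: "finite I" using c card.infinite by fastforce
  have "corr_sum h n S = 0" if "S \<in> Pow I - {{}, I}" for S
  proof -
    have "card S < 2" "card S \<noteq> 0" using that c fin psubset_card_mono[OF fin, of S] by (auto dest: finite_subset)
    then have "card S = 1" by linarith
    then show ?thesis using corr_sum_singleton[OF h] by (auto simp: card_1_singleton_iff)
  qed
  then have "(\<Sum>S\<in>Pow I - {{}, I}. corr_sum h n S * corr_sum h n (I - S)) = 0" by simp
  then show "corr_sum h n I \<le> ?C * (real n * (L * \<pi> powr (1 / r)))"
    using corr_sum_recursion[OF fin _ _ h, of n] P_ge unfolding c by simp
qed

text \<open>The exponent \<open>m div 2\<close> arises because singletons contribute nothing, so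
  each surviving factor costs at least two indices. The induction closes since halving with rounding
  down is superadditive; all lower powers are absorbed because the base is at least 1.\<close>

lemma corr_bound:
  "m \<le> P \<Longrightarrow> \<exists>C\<ge>0. \<forall>I n h L \<pi>. finite I \<longrightarrow> card I = m \<longrightarrow> admissible h L \<pi> \<longrightarrow> 1 \<le> real n * (L * \<pi> powr (1 / r)) \<longrightarrow>
     corr_sum h n I \<le> C * (real n * (L * \<pi> powr (1 / r))) ^ (m div 2)"
proof (induction m rule: less_induct)
  case (less m)
  show ?case
  proof (cases "m < 2")
    case True
    show ?thesis
    proof (intro exI[of _ 1] conjI allI impI)
      fix I :: "nat set" and n h L \<pi> assume *: "finite I" "card I = m" "admissible h L \<pi>" "1 \<le> real n * (L * \<pi> powr (1 / r))"
      show "corr_sum h n I \<le> 1 * (real n * (L * \<pi> powr (1 / r))) ^ (m div 2)"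
      proof (cases "m = 0")
        case True
        then show ?thesis using * by (simp add: corr_sum_empty)
      next
        case False
        then have "card I = 1" using * \<open>m < 2\<close> by simp
        then show ?thesis using corr_sum_singleton[OF *(3), of n] \<open>m < 2\<close> by (auto simp: card_1_singleton_iff)
      qed
    qed simp
  next
    case m2: False
    have "\<forall>j\<in>{..<m}. \<exists>C\<ge>0. \<forall>I n h L \<pi>. finite I \<longrightarrow> card I = j \<longrightarrow> admissible h L \<pi> \<longrightarrow> 1 \<le> real n * (L * \<pi> powr (1 / r)) \<longrightarrow>
     corr_sum h n I \<le> C * (real n * (L * \<pi> powr (1 / r))) ^ (j div 2)"
      using less by auto
    then obtain C where C: "\<And>j. j < m \<Longrightarrow> 0 \<le> C j"
      "\<And>j I n h L \<pi>. j < m \<Longrightarrow> finite I \<Longrightarrow> card I = j \<Longrightarrow> admissible h L \<pi> \<Longrightarrow> 1 \<le> real n * (L * \<pi> powr (1 / r)) \<Longrightarrow>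
     corr_sum h n I \<le> C j * (real n * (L * \<pi> powr (1 / r))) ^ (j div 2)"
      by (subst (asm) bchoice_iff) (metis lessThan_iff)
    define K where "K = (\<Sum>j<m. C j)"
    have K0: "0 \<le> K" using C(1) by (auto simp: K_def intro: sum_nonneg)
    have CK: "C j \<le> K" if "j < m" for j unfolding K_def using that C(1) by (intro member_le_sum) auto
    define c where "c = 1 + real m ^ 2 * (2 * real m + 1) ^ (m - 2) * (\<Sum>d. real d ^ (P - 2) * \<delta> d)"
    have "0 \<le> (\<Sum>d. real d ^ (P - 2) * \<delta> d)" using \<delta>_nonneg by (intro suminf_nonneg \<delta>_summable) auto
    then have c0: "0 \<le> c" by (simp add: c_def)
    show ?thesis
    proof (intro exI[of _ "2 ^ m * (K * K) + c"] conjI allI impI)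
      show "0 \<le> 2 ^ m * (K * K) + c" using K0 c0 by simp
      fix I :: "nat set" and n h L \<pi> assume *: "finite I" "card I = m" "admissible h L \<pi>" "1 \<le> real n * (L * \<pi> powr (1 / r))"
      define z where "z = real n * (L * \<pi> powr (1 / r))"
      have z1: "1 \<le> z" using * by (simp add: z_def)
      have "corr_sum h n S * corr_sum h n (I - S) \<le> K * K * z ^ (m div 2)" if "S \<in> Pow I - {{}, I}" for S
      proof -
        have S0: "S \<subset> I" "I - S \<subset> I" using that by auto
        have S: "finite S" "card S < m" "card (I - S) < m" "card S + card (I - S) = m"
          using S0 *(1,2) psubset_card_mono[OF *(1) S0(1)] psubset_card_mono[OF *(1) S0(2)] finite_subset[of S I]
            card_Diff_subset[of S I] by auto
        have "corr_sum h n S * corr_sum h n (I - S) \<le> (K * z ^ (card S div 2)) * (K * z ^ (card (I - S) div 2))"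
        proof (intro mult_mono corr_sum_nonneg)
          show "corr_sum h n S \<le> K * z ^ (card S div 2)"
            using order_trans[OF C(2)[OF S(2,1) refl *(3,4), folded z_def] mult_right_mono[OF CK[OF S(2)], of "z ^ (card S div 2)"]] z1
            by simp
          show "corr_sum h n (I - S) \<le> K * z ^ (card (I - S) div 2)"
            using order_trans[OF C(2)[OF S(3) _ refl *(3,4), folded z_def] mult_right_mono[OF CK[OF S(3)], of "z ^ (card (I - S) div 2)"]] z1 *(1)
            by simp
        qed (use K0 z1 in auto)
        also have "\<dots> = K * K * z ^ (card S div 2 + card (I - S) div 2)" by (simp add: power_add)
        also have "\<dots> \<le> K * K * z ^ (m div 2)"
          using S(4) K0 z1 by (intro mult_left_mono power_increasing) auto
        finally show ?thesis .
      qed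
      then have "(\<Sum>S\<in>Pow I - {{}, I}. corr_sum h n S * corr_sum h n (I - S)) \<le> (\<Sum>S\<in>Pow I - {{}, I}. K * K * z ^ (m div 2))"
        by (rule sum_mono)
      also have "\<dots> \<le> (\<Sum>S\<in>Pow I. K * K * z ^ (m div 2))"
        using *(1) K0 z1 by (intro sum_mono2) auto
      also have "\<dots> = 2 ^ m * (K * K) * z ^ (m div 2)" using *(1,2) by (simp add: card_Pow)
      finally have 1: "(\<Sum>S\<in>Pow I - {{}, I}. corr_sum h n S * corr_sum h n (I - S)) \<le> 2 ^ m * (K * K) * z ^ (m div 2)" .
      \<comment> \<open>The linear term of the recursion is dominated because
        \<open>m \<ge> 2\<close> makes the exponent at least 1.\<close>
      have 2: "c * z \<le> c * z ^ (m div 2)"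
        using c0 z1 m2 power_increasing[of 1 "m div 2" z] by (intro mult_left_mono) auto
      have "corr_sum h n I \<le> (\<Sum>S\<in>Pow I - {{}, I}. corr_sum h n S * corr_sum h n (I - S)) + c * z"
        using corr_sum_recursion[OF *(1) _ _ *(3), of n] m2 less.prems unfolding *(2) c_def z_def by simp
      then show "corr_sum h n I \<le> (2 ^ m * (K * K) + c) * (real n * (L * \<pi> powr (1 / r))) ^ (m div 2)"
        using 1 2 unfolding z_def[symmetric] by (simp add: algebra_simps)
    qed
  qed
qed

lemma moment_le_corr_sum:
  assumes h: "admissible h L \<pi>"
  shows "expectation (\<lambda>\<omega>. (\<Sum>i\<in>{1..n}. h (X i \<omega>)) ^ m) \<le> corr_sum h n {..<m}"
proof -
  have [measurable]: "h \<in> borel_measurable borel" using h by (rule admissible_measurable)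
  have bdp: "\<bar>\<Prod>j\<in>C. h (y j)\<bar> \<le> 1" for C and y :: "nat \<Rightarrow> 'e" unfolding abs_prod by (rule prod_le_1) (use h in \<open>auto simp: admissible_def\<close>)
  have "(\<Sum>i\<in>{1..n}. h (X i \<omega>)) ^ m = (\<Sum>t\<in>PiE {..<m} (\<lambda>_. {1..n}). \<Prod>j<m. h (X (t j) \<omega>))" for \<omega>
    using prod_sum_PiE[of "{..<m}" "\<lambda>_. {1..n}" "\<lambda>_ i. h (X i \<omega>)"] by simp
  then have "expectation (\<lambda>\<omega>. (\<Sum>i\<in>{1..n}. h (X i \<omega>)) ^ m) = (\<Sum>t\<in>PiE {..<m} (\<lambda>_. {1..n}). expectation (\<lambda>\<omega>. \<Prod>j<m. h (X (t j) \<omega>)))"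
    by (simp only:) (rule Bochner_Integration.integral_sum, rule integrable_const_bound[where B=1], rule AE_I2, simp only: real_norm_def bdp, measurable)
  also have "\<dots> \<le> corr_sum h n {..<m}" unfolding corr_sum_def by (intro sum_mono abs_ge_self)
  finally show ?thesis .
qed

lemma moment_bound_2:
  "\<exists>C\<ge>0. \<forall>n h L \<pi>. admissible h L \<pi> \<longrightarrow> expectation (\<lambda>\<omega>. (\<Sum>i\<in>{1..n}. h (X i \<omega>)) ^ 2) \<le> C * (real n * (L * \<pi> powr (1 / r)))"
  using corr_sum_2 moment_le_corr_sum[where m=2] by (meson card_lessThan order_trans)

lemma moment_bound:
  assumes "2 * m \<le> P"
  shows "\<exists>C\<ge>0. \<forall>n h L \<pi>. admissible h L \<pi> \<longrightarrow> 1 \<le> real n * (L * \<pi> powr (1 / r)) \<longrightarrow>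
     expectation (\<lambda>\<omega>. (\<Sum>i\<in>{1..n}. h (X i \<omega>)) ^ (2 * m)) \<le> C * (real n * (L * \<pi> powr (1 / r))) ^ m"
proof -
  obtain C where "C \<ge> 0" and C: "\<And>I n h L \<pi>. finite I \<Longrightarrow> card I = 2 * m \<Longrightarrow> admissible h L \<pi> \<Longrightarrow> 1 \<le> real n * (L * \<pi> powr (1 / r)) \<Longrightarrow>
     corr_sum h n I \<le> C * (real n * (L * \<pi> powr (1 / r))) ^ m" using corr_bound[OF assms] by auto
  show ?thesis
  proof (intro exI[of _ C] conjI allI impI)
    fix n h L \<pi> assume h: "admissible h L \<pi>" "1 \<le> real n * (L * \<pi> powr (1 / r))"
    show "expectation (\<lambda>\<omega>. (\<Sum>i\<in>{1..n}. h (X i \<omega>)) ^ (2 * m)) \<le> C * (real n * (L * \<pi> powr (1 / r))) ^ m"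
      by (rule order_trans[OF moment_le_corr_sum[OF h(1)] C[OF _ _ h]]) auto
  qed fact
qed

end

subsection \<open>A central limit theorem by blocking\<close>

lemma cesaro_mean:
  fixes a :: "nat \<Rightarrow> real"
  assumes "a \<longlonglongrightarrow> c"
  shows "(\<lambda>n. (\<Sum>m<n. a m) / real n) \<longlonglongrightarrow> c"
proof (rule LIMSEQ_I)
  fix e :: real assume e: "0 < e"
  have "0 < e / 2" using e by simp
  from LIMSEQ_D[OF assms this] obtain N where N: "\<And>n. n \<ge> N \<Longrightarrow> \<bar>a n - c\<bar> < e / 2"
    unfolding real_norm_def by blast
  define K where "K = (\<Sum>m<N. \<bar>a m - c\<bar>)"
  obtain N2 where N2: "2 * K / e < real N2" using reals_Archimedean2 by blast
  show "\<exists>no. \<forall>n\<ge>no. norm ((\<Sum>m<n. a m) / real n - c) < e"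
  proof (intro exI allI impI)
    fix n assume n: "Suc (max N N2) \<le> n"
    have n0: "0 < real n" "N \<le> n" using n by auto
    have "\<bar>(\<Sum>m<n. a m) / real n - c\<bar> = \<bar>(\<Sum>m<n. a m - c) / real n\<bar>"
      using n0 unfolding sum_subtractf diff_divide_distrib by simp
    also have "\<dots> \<le> (\<Sum>m<n. \<bar>a m - c\<bar>) / real n"
      unfolding abs_divide abs_of_nat by (intro divide_right_mono sum_abs of_nat_0_le_iff)
    finally have 1: "\<bar>(\<Sum>m<n. a m) / real n - c\<bar> \<le> (\<Sum>m<n. \<bar>a m - c\<bar>) / real n" .
    have S: "{..<n} = {..<N} \<union> {N..<n}" using n0 by auto
    have 2: "(\<Sum>m<n. \<bar>a m - c\<bar>) = K + (\<Sum>m\<in>{N..<n}. \<bar>a m - c\<bar>)"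
      unfolding K_def S by (rule sum.union_disjoint) auto
    have "(\<Sum>m\<in>{N..<n}. \<bar>a m - c\<bar>) \<le> (\<Sum>m\<in>{N..<n}. e / 2)"
      by (rule sum_mono, rule less_imp_le, rule N) simp
    also have "\<dots> = real (n - N) * (e / 2)" by simp
    also have "\<dots> \<le> real n * (e / 2)" using e by (intro mult_right_mono) auto
    finally have 3: "(\<Sum>m\<in>{N..<n}. \<bar>a m - c\<bar>) \<le> real n * (e / 2)" .
    have "2 * K / e < real n" using N2 n by linarith
    then have "2 * K < real n * e" using e by (simp only: pos_divide_less_eq)
    then have 4: "K < real n * (e / 2)" by linarith
    have "(\<Sum>m<n. \<bar>a m - c\<bar>) < real n * e" using 2 3 4 by linarith
    then have "(\<Sum>m<n. \<bar>a m - c\<bar>) / real n < e" using n0 by (simp only: pos_divide_less_eq mult.commute)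
    then show "norm ((\<Sum>m<n. a m) / real n - c) < e" using 1 by simp
  qed
qed

lemma exp_minus_approx: "0 \<le> x \<Longrightarrow> \<bar>exp (- x) - (1 - x)\<bar> \<le> (x::real)\<^sup>2"
proof -
  assume x: "0 \<le> x"
  have 1: "1 - x \<le> exp (- x)" using exp_ge_add_one_self[of "-x"] by simp
  have "exp (- x) \<le> 1 / (1 + x)" using exp_ge_add_one_self[of x] x by (simp add: exp_minus field_simps)
  also have "\<dots> \<le> 1 - x + x\<^sup>2"
  proof -
    have "0 \<le> x ^ 3" using x by simp
    then have "1 \<le> (1 - x + x\<^sup>2) * (1 + x)" by (simp add: algebra_simps power2_eq_square power3_eq_cube)
    then show ?thesis using x by (simp add: pos_divide_le_eq)
  qed
  finally show ?thesis using 1 by simp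
qed

context weakly_dependent
begin

section \<open>Long-run variance and the blocking argument\<close>

lemma bounded_integrable:
  fixes f :: "'a \<Rightarrow> 'b::{banach, second_countable_topology}"
  shows "f \<in> borel_measurable M \<Longrightarrow> (\<And>\<omega>. norm (f \<omega>) \<le> B) \<Longrightarrow> integrable M f"
  by (rule integrable_const_bound[where B=B]) auto

definition psum :: "('e \<Rightarrow> real) \<Rightarrow> nat \<Rightarrow> 'a \<Rightarrow> real" where
  "psum h n \<omega> = (\<Sum>i\<in>{1..n}. h (X i \<omega>))"

lemma psum_bound: "(\<And>x. \<bar>h x\<bar> \<le> 1) \<Longrightarrow> \<bar>psum h n \<omega>\<bar> \<le> real n"
  using order_trans[OF sum_abs sum_bounded_above[of "{1..n}" "\<lambda>i. \<bar>h (X i \<omega>)\<bar>" 1]] by (simp add: psum_def)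

lemma psum_measurable:
  assumes [measurable]: "h \<in> borel_measurable borel"
  shows "psum h n \<in> borel_measurable M"
  unfolding psum_def[abs_def] by measurable

lemma psum_power_bound: "(\<And>x. \<bar>h x\<bar> \<le> 1) \<Longrightarrow> \<bar>psum h n \<omega> ^ m\<bar> \<le> real n ^ m"
  using power_mono[OF psum_bound, of h n \<omega> m] by (simp add: power_abs)

lemma psum_power_integrable:
  "h \<in> borel_measurable borel \<Longrightarrow> (\<And>x. \<bar>h x\<bar> \<le> 1) \<Longrightarrow> integrable M (\<lambda>\<omega>. psum h n \<omega> ^ m)"
  by (rule bounded_integrable[where B="real n ^ m"]) (use psum_power_bound psum_measurable in auto)

text \<open>The cost of coupling a whole future block is bounded independently of its length:
  distinct indices have distinct distances from \<open>a\<close>.\<close>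

lemma \<delta>_sum_le': "finite B \<Longrightarrow> (\<And>i. i \<in> B \<Longrightarrow> a < i) \<Longrightarrow> (\<Sum>i\<in>B. \<delta> (i - a)) \<le> (\<Sum>d. real d ^ (P - 2) * \<delta> d)"
proof -
  assume B: "finite B" "\<And>i. i \<in> B \<Longrightarrow> a < i"
  have "(\<Sum>i\<in>B. \<delta> (i - a)) = (\<Sum>d\<in>(\<lambda>i. i - a) ` B. \<delta> d)"
    using B(2) by (subst sum.reindex) (auto simp: inj_on_def dest!: eq_diff_iff[THEN iffD1, rotated 2] intro: less_imp_le)
  also have "\<dots> \<le> (\<Sum>d\<in>{1..Max (insert 0 B)}. \<delta> d)"
  proof (intro sum_mono2)
    show "(\<lambda>i. i - a) ` B \<subseteq> {1..Max (insert 0 B)}"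
    proof (rule image_subsetI)
      fix i assume i: "i \<in> B"
      then have "i \<le> Max (insert 0 B)" using B by (intro Max_ge) auto
      then show "i - a \<in> {1..Max (insert 0 B)}" using B(2)[OF i] by auto
    qed
  qed (auto simp: \<delta>_nonneg)
  also have "\<dots> \<le> (\<Sum>d. real d ^ (P - 2) * \<delta> d)" using \<delta>_sum_le[of 2] P_ge by simp
  finally show ?thesis .
qed

text \<open>The increments of the variance in \<open>n\<close> are the partial sums of the
  covariances \<gamma>, with all lags but 0 counted twice. These partial sums converge because
  \<gamma> decays at least as fast as \<delta>, and the normalised variance is their Cesaro
  mean.\<close>

lemma variance_limit:
  assumes h: "admissible h L \<pi>"
  shows "\<exists>v\<ge>0. (\<lambda>n. expectation (\<lambda>\<omega>. psum h n \<omega> ^ 2) / real n) \<longlonglongrightarrow> v"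
proof -
  note h' = h[unfolded admissible_def]
  have [measurable]: "h \<in> borel_measurable borel" using h by (rule admissible_measurable)
  have hb: "\<And>x. \<bar>h x\<bar> \<le> 1" using h' by blast
  define \<gamma> where "\<gamma> k = expectation (\<lambda>\<omega>. h (X 0 \<omega>) * h (X k \<omega>))" for k
  have st: "expectation (\<lambda>\<omega>. h (X i \<omega>) * h (X (i + k) \<omega>)) = \<gamma> k" for i k
    using stationary_real[of "{0,1::nat}" "\<lambda>_. h" 1 "\<lambda>j. if j = 0 then 0 else k" i] hb
    by (simp add: \<gamma>_def add.commute)
  have \<gamma>_le: "\<bar>\<gamma> k\<bar> \<le> L * \<delta> k" if "0 < k" for k
  proof -
    have "\<bar>expectation (\<lambda>\<omega>. (\<Prod>j\<in>{0::nat}. h (X (if j = 0 then 0 else k) \<omega>)) * (\<Prod>i\<in>{1::nat}. h (X (if i = 0 then 0 else k) \<omega>)))\<bar>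
       \<le> \<bar>expectation (\<lambda>\<omega>. \<Prod>j\<in>{0::nat}. h (X (if j = 0 then 0 else k) \<omega>))\<bar> * \<bar>expectation (\<lambda>\<omega>. \<Prod>i\<in>{1::nat}. h (X (if i = 0 then 0 else k) \<omega>))\<bar>
        + (\<Sum>i\<in>{1::nat}. L * \<pi> powr (1 / r) * \<delta> ((if i = 0 then 0 else k) - 0))"
      by (rule decouple_bound_real[where a=0 and jj=0 and h=h and t="\<lambda>j. if j = 0 then 0 else k"]) (use that h' in auto)
    then have "\<bar>\<gamma> k\<bar> \<le> L * \<pi> powr (1 / r) * \<delta> k" using h' by (simp add: \<gamma>_def)
    also have "\<dots> \<le> L * 1 * \<delta> k"
    proof (intro mult_right_mono mult_left_mono \<delta>_nonneg)
      show "\<pi> powr (1 / r) \<le> 1" using admissible_\<pi>(1)[OF h] h' r_ge1 powr_mono2[of "1/r" \<pi> 1] by auto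
    qed (use h' in auto)
    finally show ?thesis by simp
  qed
  have sg: "summable (\<lambda>k. \<gamma> (Suc k))"
  proof (rule summable_comparison_test)
    show "summable (\<lambda>k. L * (real (Suc k) ^ (P - 2) * \<delta> (Suc k)))"
      using \<delta>_summable by (intro summable_mult) (subst (asm) summable_Suc_iff[symmetric], simp)
    have "\<bar>\<gamma> (Suc k)\<bar> \<le> L * (real (Suc k) ^ (P - 2) * \<delta> (Suc k))" for k
    proof -
      have "1 * \<delta> (Suc k) \<le> real (Suc k) ^ (P - 2) * \<delta> (Suc k)"
        by (intro mult_right_mono \<delta>_nonneg one_le_power) simp
      then have "L * \<delta> (Suc k) \<le> L * (real (Suc k) ^ (P - 2) * \<delta> (Suc k))" using h' by (intro mult_left_mono) auto
      then show ?thesis using \<gamma>_le[of "Suc k"] by linarith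
    qed
    then show "\<exists>N. \<forall>n\<ge>N. norm (\<gamma> (Suc n)) \<le> L * (real (Suc n) ^ (P - 2) * \<delta> (Suc n))" by auto
  qed
  define a where "a m = \<gamma> 0 + 2 * (\<Sum>k<m. \<gamma> (Suc k))" for m
  have alim: "a \<longlonglongrightarrow> \<gamma> 0 + 2 * (\<Sum>k. \<gamma> (Suc k))"
    unfolding a_def using summable_LIMSEQ[OF sg] by (intro tendsto_intros)
  have inth: "integrable M (\<lambda>\<omega>. h (X i \<omega>) * h (X j \<omega>))" for i j
    by (rule bounded_integrable[where B=1]) (use hb in \<open>auto simp: abs_mult intro: mult_le_one\<close>)
  have g: "expectation (\<lambda>\<omega>. psum h n \<omega> ^ 2) = (\<Sum>m<n. a m)" for n
  proof (induction n)
    case 0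
    then show ?case by (simp add: psum_def)
  next
    case (Suc n)
    have "expectation (\<lambda>\<omega>. psum h (Suc n) \<omega> ^ 2) = expectation (\<lambda>\<omega>. psum h n \<omega> ^ 2 + (2 * (\<Sum>i\<in>{1..n}. h (X i \<omega>) * h (X (Suc n) \<omega>)) + h (X (Suc n) \<omega>) * h (X (Suc n) \<omega>)))"
      by (intro Bochner_Integration.integral_cong refl) (simp add: psum_def power2_eq_square algebra_simps sum_distrib_left sum_distrib_right)
    also have "\<dots> = (\<Sum>m<n. a m) + (2 * (\<Sum>i\<in>{1..n}. expectation (\<lambda>\<omega>. h (X i \<omega>) * h (X (Suc n) \<omega>))) + \<gamma> 0)"
      using psum_power_integrable[OF _ hb] inth st[of "Suc n" 0] Suc
      by (simp add: Bochner_Integration.integral_sum)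
    also have "(\<Sum>i\<in>{1..n}. expectation (\<lambda>\<omega>. h (X i \<omega>) * h (X (Suc n) \<omega>))) = (\<Sum>k<n. \<gamma> (Suc k))"
    proof (rule sum.reindex_bij_witness[of _ "\<lambda>k. n - k" "\<lambda>i. n - i"])
      fix i assume "i \<in> {1..n}"
      then have "Suc n = i + Suc (n - i)" by auto
      then show "\<gamma> (Suc (n - i)) = expectation (\<lambda>\<omega>. h (X i \<omega>) * h (X (Suc n) \<omega>))" using st[of i "Suc (n - i)"] by metis
    qed auto
    finally show ?case by (simp add: a_def)
  qed
  have lim: "(\<lambda>n. expectation (\<lambda>\<omega>. psum h n \<omega> ^ 2) / real n) \<longlonglongrightarrow> \<gamma> 0 + 2 * (\<Sum>k. \<gamma> (Suc k))"
    unfolding g by (rule cesaro_mean[OF alim])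
  moreover have "0 \<le> \<gamma> 0 + 2 * (\<Sum>k. \<gamma> (Suc k))"
    by (rule LIMSEQ_le_const[OF lim]) auto
  ultimately show ?thesis by blast
qed

lemma iexp_lipschitz: "norm (iexp (v * x) - iexp (v * y)) \<le> \<bar>v\<bar> * \<bar>x - y\<bar>"
proof -
  have "norm (iexp (v * x) - iexp (v * y)) = norm (iexp (v * y)) * norm (iexp (v * x - v * y) - 1)"
    unfolding norm_mult[symmetric] by (simp add: algebra_simps exp_diff)
  also have "\<dots> \<le> \<bar>v * x - v * y\<bar>"
    using iexp_approx1[of "v * x - v * y" 0] by simp
  also have "\<dots> = \<bar>v\<bar> * \<bar>x - y\<bar>" unfolding right_diff_distrib[symmetric] abs_mult ..
  finally show ?thesis .
qed

text \<open>The blocks are adjacent. Cutting at a block boundary costs one sum of \<delta>, which is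
  bounded uniformly in the block length \<open>l\<close>, so for \<open>v\<close> of order 1 / sqrt
  n the total error is of order j / sqrt n.\<close>

lemma block_decoupling:
  assumes h: "admissible h L \<pi>"
  shows "norm (expectation (\<lambda>\<omega>. iexp (v * psum h (j * l) \<omega>)) - expectation (\<lambda>\<omega>. iexp (v * psum h l \<omega>)) ^ j)
     \<le> real j * (\<bar>v\<bar> * L * (\<Sum>d. real d ^ (P - 2) * \<delta> d))"
proof (induction j)
  case 0
  then show ?case by (simp add: psum_def prob_space)
next
  case (Suc j)
  note h' = h[unfolded admissible_def]
  have [measurable]: "h \<in> borel_measurable borel" using h by (rule admissible_measurable)
  let ?D = "\<Sum>d. real d ^ (P - 2) * \<delta> d"
  define f where "f = (\<lambda>(i::nat) x. iexp (v * h x))"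
  have f1: "norm (f i x) = 1" for i x by (simp add: f_def)
  have hol: "norm (f i x - f i y) \<le> (\<bar>v\<bar> * L) * norm (x - y) powr \<alpha>" for i x y
  proof -
    have "norm (f i x - f i y) \<le> \<bar>v\<bar> * \<bar>h x - h y\<bar>" unfolding f_def by (rule iexp_lipschitz)
    also have "\<dots> \<le> \<bar>v\<bar> * (L * norm (x - y) powr \<alpha>)" using h' by (intro mult_left_mono) auto
    finally show ?thesis by simp
  qed
  have prod: "(\<Prod>i\<in>C. f i (y i)) = iexp (v * (\<Sum>i\<in>C. h (y i)))" if "finite C" for C y
    unfolding f_def using that by (simp add: exp_sum[symmetric] sum_distrib_left)
  let ?A = "{1..j * l}" and ?B = "{j * l + 1..Suc j * l}"
  have AB: "{1..Suc j * l} = ?A \<union> ?B" "?A \<inter> ?B = {}" by auto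
  have pA: "(\<Prod>i\<in>?A. f i (X i \<omega>)) = iexp (v * psum h (j * l) \<omega>)" for \<omega> by (simp add: prod psum_def)
  have pAB: "(\<Prod>i\<in>?A. f i (X i \<omega>)) * (\<Prod>i\<in>?B. f i (X i \<omega>)) = iexp (v * psum h (Suc j * l) \<omega>)" for \<omega>
  proof -
    have "(\<Prod>i\<in>?A. f i (X i \<omega>)) * (\<Prod>i\<in>?B. f i (X i \<omega>)) = (\<Prod>i\<in>{1..Suc j * l}. f i (X i \<omega>))"
      unfolding AB(1) by (rule prod.union_disjoint[symmetric, OF _ _ AB(2)]) simp_all
    also have "\<dots> = iexp (v * psum h (Suc j * l) \<omega>)" unfolding psum_def by (rule prod) simp
    finally show ?thesis .
  qed
  have "expectation (\<lambda>\<omega>. \<Prod>i\<in>?B. f i (X i \<omega>)) = expectation (\<lambda>\<omega>. \<Prod>i\<in>{1..l}. f i (X (i + j * l) \<omega>))"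
  proof (intro Bochner_Integration.integral_cong refl)
    fix \<omega>
    have "?B = (\<lambda>i. i + j * l) ` {1..l}" by (simp add: add.commute)
    then have "(\<Prod>i\<in>?B. f i (X i \<omega>)) = (\<Prod>i\<in>(\<lambda>i. i + j * l) ` {1..l}. f i (X i \<omega>))" by simp
    also have "\<dots> = (\<Prod>i\<in>{1..l}. f i (X (i + j * l) \<omega>))"
      by (subst prod.reindex) (auto simp: f_def)
    finally show "(\<Prod>i\<in>?B. f i (X i \<omega>)) = (\<Prod>i\<in>{1..l}. f i (X (i + j * l) \<omega>))" .
  qed
  also have "\<dots> = expectation (\<lambda>\<omega>. \<Prod>i\<in>{1..l}. f i (X i \<omega>))"
    by (rule stationary[of "{1..l}" f 1 "\<lambda>i. i"]) (auto simp: f1 f_def)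
  finally have pB: "expectation (\<lambda>\<omega>. \<Prod>i\<in>?B. f i (X i \<omega>)) = expectation (\<lambda>\<omega>. iexp (v * psum h l \<omega>))"
    by (simp add: prod psum_def)
  let ?E = "\<lambda>n. expectation (\<lambda>\<omega>. iexp (v * psum h n \<omega>))"
  have E1: "norm (?E n) \<le> 1" for n
  proof -
    have "norm (?E n) \<le> expectation (\<lambda>\<omega>. norm (iexp (v * psum h n \<omega>)))" by (rule integral_norm_bound)
    also have "\<dots> = 1" by (simp add: prob_space)
    finally show ?thesis .
  qed
  have "norm (expectation (\<lambda>\<omega>. (\<Prod>i\<in>?A. f i (X i \<omega>)) * (\<Prod>i\<in>?B. f i (X i \<omega>)))
      - expectation (\<lambda>\<omega>. \<Prod>i\<in>?A. f i (X i \<omega>)) * expectation (\<lambda>\<omega>. \<Prod>i\<in>?B. f i (X i \<omega>)))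
      \<le> (\<Sum>i\<in>?B. (\<bar>v\<bar> * L) * 1 powr (1 / r) * \<delta> (i - j * l))"
    by (rule decouple_bound[where t="\<lambda>i. i", OF _ _ _ _ _ hol]) (use h' in \<open>auto simp: f1 prod_norm[symmetric] prob_space\<close>)
  then have 1: "norm (?E (Suc j * l) - ?E (j * l) * ?E l) \<le> (\<Sum>i\<in>?B. (\<bar>v\<bar> * L) * \<delta> (i - j * l))"
    unfolding pAB unfolding pA pB by simp
  have "(\<Sum>i\<in>?B. (\<bar>v\<bar> * L) * \<delta> (i - j * l)) = (\<bar>v\<bar> * L) * (\<Sum>i\<in>?B. \<delta> (i - j * l))" by (simp add: sum_distrib_left)
  also have "\<dots> \<le> (\<bar>v\<bar> * L) * ?D" using h' by (intro mult_left_mono \<delta>_sum_le') auto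
  finally have 2: "(\<Sum>i\<in>?B. (\<bar>v\<bar> * L) * \<delta> (i - j * l)) \<le> (\<bar>v\<bar> * L) * ?D" .
  have "norm (?E (j * l) * ?E l - ?E l ^ j * ?E l) \<le> norm (?E (j * l) - ?E l ^ j)"
    unfolding left_diff_distrib[symmetric] norm_mult by (intro mult_left_le E1) auto
  then have "norm (?E (Suc j * l) - ?E l ^ Suc j) \<le> (\<bar>v\<bar> * L) * ?D + norm (?E (j * l) - ?E l ^ j)"
    using 1 2 norm_triangle_ineq[of "?E (Suc j * l) - ?E (j * l) * ?E l" "?E (j * l) * ?E l - ?E l ^ j * ?E l"]
    by (simp add: mult.commute)
  also have "\<dots> \<le> (\<bar>v\<bar> * L) * ?D + real j * (\<bar>v\<bar> * L * ?D)" using Suc.IH by simp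
  finally show ?case by (simp only: of_nat_Suc distrib_right mult_1 add.commute)
qed

text \<open>Third-order expansion of the characteristic function of one block, compared with the
  Gaussian one of the same variance. The variable \<bar>v\<bar> sqrt l is the scale on which the
  second and fourth moments of a block of length \<open>l\<close> live.\<close>

lemma char_block_approx:
  assumes h: "admissible h L \<pi>"
  obtains C where "0 \<le> C"
    "\<And>l v. 1 \<le> l \<Longrightarrow> norm (expectation (\<lambda>\<omega>. iexp (v * psum h l \<omega>)) - exp (- complex_of_real (v\<^sup>2 * expectation (\<lambda>\<omega>. psum h l \<omega> ^ 2) / 2)))
       \<le> C * ((\<bar>v\<bar> * sqrt l) ^ 3 + (\<bar>v\<bar> * sqrt l) ^ 4)"
proof -
  note h' = h[unfolded admissible_def]
  have [measurable]: "h \<in> borel_measurable borel" using h by (rule admissible_measurable)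
  note [measurable] = psum_measurable[OF this]
  have hb: "\<And>x. \<bar>h x\<bar> \<le> 1" using h' by blast
  \<comment> \<open>With \<pi> weakened to 1, the threshold of the moment bound holds for every
    \<open>n \<ge> 1\<close>.\<close>
  have h1: "admissible h L 1"
    using h' unfolding admissible_def by (auto intro: order_trans)
  obtain C2 where C2: "0 \<le> C2" "\<And>n. expectation (\<lambda>\<omega>. psum h n \<omega> ^ 2) \<le> C2 * (real n * L)"
    using moment_bound_2 h1 unfolding psum_def by fastforce
  obtain C4 where C4: "0 \<le> C4" "\<And>n. 1 \<le> n \<Longrightarrow> expectation (\<lambda>\<omega>. psum h n \<omega> ^ 4) \<le> C4 * (real n * L)\<^sup>2"
  proof -
    obtain C where C: "C\<ge>0" "\<And>n h L \<pi>. admissible h L \<pi> \<Longrightarrow> 1 \<le> real n * (L * \<pi> powr (1 / r)) \<Longrightarrow>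
     expectation (\<lambda>\<omega>. (\<Sum>i\<in>{1..n}. h (X i \<omega>)) ^ (2 * 2)) \<le> C * (real n * (L * \<pi> powr (1 / r))) ^ 2"
      using moment_bound[of 2] P_ge by auto
    have "expectation (\<lambda>\<omega>. psum h n \<omega> ^ 4) \<le> C * (real n * L)\<^sup>2" if "1 \<le> n" for n
    proof -
      have "1 * 1 \<le> real n * L" using that h' by (intro mult_mono) auto
      then show ?thesis using C(2)[OF h1, of n] by (simp add: psum_def)
    qed
    with C(1) show ?thesis by (rule that)
  qed
  define C where "C = C2 * L + C4 * L\<^sup>2 + (C2 * L)\<^sup>2"
  have L0: "0 \<le> L" using h' by simp
  have C0: "0 \<le> C" using C2(1) C4(1) L0 by (simp add: C_def)
  have "norm (expectation (\<lambda>\<omega>. iexp (v * psum h l \<omega>)) - exp (- complex_of_real (v\<^sup>2 * expectation (\<lambda>\<omega>. psum h l \<omega> ^ 2) / 2)))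
       \<le> C * ((\<bar>v\<bar> * sqrt l) ^ 3 + (\<bar>v\<bar> * sqrt l) ^ 4)" if l: "1 \<le> l" for l v
  proof -
    define g where "g = expectation (\<lambda>\<omega>. psum h l \<omega> ^ 2)"
    have g0: "0 \<le> g" by (simp add: g_def)
    have gl: "g \<le> C2 * L * real l" using C2(2)[of l] by (simp add: g_def mult_ac)
    define s where "s = sqrt (real l)"
    have s: "0 < s" "s ^ 2 = real l" using l by (auto simp: s_def)
    have int: "integrable M (\<lambda>\<omega>. psum h l \<omega> ^ m)" for m by (rule psum_power_integrable) (use hb in auto)
    have E0: "expectation (psum h l) = 0"
      unfolding psum_def[abs_def] using h' by (subst Bochner_Integration.integral_sum) (auto intro!: bounded_integrable[where B=1])
    have "norm (char (distr M borel (psum h l)) v - (1 - v\<^sup>2 * g / 2)) \<le> v\<^sup>2 / 6 * expectation (\<lambda>\<omega>. min (6 * psum h l \<omega> ^ 2) (\<bar>v\<bar> * \<bar>psum h l \<omega>\<bar> ^ 3))"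
      by (rule char_approx3') (use int[of 1] int[of 2] E0 in \<open>auto simp: g_def\<close>)
    also have "char (distr M borel (psum h l)) v = expectation (\<lambda>\<omega>. iexp (v * psum h l \<omega>))"
      by (simp add: char_def integral_distr)
    also have "expectation (\<lambda>\<omega>. min (6 * psum h l \<omega> ^ 2) (\<bar>v\<bar> * \<bar>psum h l \<omega>\<bar> ^ 3))
        \<le> expectation (\<lambda>\<omega>. \<bar>v\<bar> * (s * psum h l \<omega> ^ 2 + psum h l \<omega> ^ 4 / s))"
    proof (rule integral_mono)
      show "integrable M (\<lambda>\<omega>. min (6 * psum h l \<omega> ^ 2) (\<bar>v\<bar> * \<bar>psum h l \<omega>\<bar> ^ 3))"
        by (rule Bochner_Integration.integrable_bound[of _ "\<lambda>\<omega>. 6 * psum h l \<omega> ^ 2"]) (use int in auto)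
      show "integrable M (\<lambda>\<omega>. \<bar>v\<bar> * (s * psum h l \<omega> ^ 2 + psum h l \<omega> ^ 4 / s))" using int by auto
      fix \<omega>
      \<comment> \<open>The third absolute moment is interpolated between the second and the fourth;
        the weight \<open>s = sqrt l\<close> balances their orders l and l ^ 2.\<close>
      have "\<bar>x\<bar> ^ 3 \<le> s * x ^ 2 + x ^ 4 / s" for x :: real
      proof -
        have "0 \<le> \<bar>x\<bar> ^ 2 * (s - \<bar>x\<bar>)\<^sup>2 + s * \<bar>x\<bar> ^ 3" using s by simp
        then have "\<bar>x\<bar> ^ 3 * s \<le> s * s * \<bar>x\<bar> ^ 2 + \<bar>x\<bar> ^ 4" by (simp add: power2_eq_square power3_eq_cube power4_eq_xxxx algebra_simps)
        then show ?thesis using s by (simp add: field_simps power2_eq_square)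
      qed
      then have "\<bar>v\<bar> * \<bar>psum h l \<omega>\<bar> ^ 3 \<le> \<bar>v\<bar> * (s * psum h l \<omega> ^ 2 + psum h l \<omega> ^ 4 / s)" by (intro mult_left_mono) auto
      then show "min (6 * psum h l \<omega> ^ 2) (\<bar>v\<bar> * \<bar>psum h l \<omega>\<bar> ^ 3) \<le> \<bar>v\<bar> * (s * psum h l \<omega> ^ 2 + psum h l \<omega> ^ 4 / s)" by linarith
    qed
    also have "\<dots> = \<bar>v\<bar> * (s * g + expectation (\<lambda>\<omega>. psum h l \<omega> ^ 4) / s)" using int by (simp add: g_def)
    also have "\<dots> \<le> \<bar>v\<bar> * (s * (C2 * L * s ^ 2) + C4 * (s ^ 2 * L)\<^sup>2 / s)"
      using gl C4(2)[OF l] s by (intro mult_left_mono add_mono divide_right_mono) (auto simp: s(2))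
    also have "\<dots> = \<bar>v\<bar> * s ^ 3 * (C2 * L + C4 * L\<^sup>2)" using s(1) by (simp add: field_simps power2_eq_square power3_eq_cube)
    finally have 1: "norm (expectation (\<lambda>\<omega>. iexp (v * psum h l \<omega>)) - (1 - v\<^sup>2 * g / 2)) \<le> v\<^sup>2 / 6 * (\<bar>v\<bar> * s ^ 3 * (C2 * L + C4 * L\<^sup>2))"
      by (simp add: mult_left_mono)
    have "v\<^sup>2 / 6 * (\<bar>v\<bar> * s ^ 3 * (C2 * L + C4 * L\<^sup>2)) = (\<bar>v\<bar> * s) ^ 3 * ((C2 * L + C4 * L\<^sup>2) / 6)"
      by (simp add: power_mult_distrib power3_eq_cube power2_eq_square abs_mult[symmetric])
    also have "\<dots> \<le> (\<bar>v\<bar> * s) ^ 3 * C"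
      using s C2 C4 L0 by (intro mult_left_mono) (auto simp: C_def field_simps)
    finally have 2: "v\<^sup>2 / 6 * (\<bar>v\<bar> * s ^ 3 * (C2 * L + C4 * L\<^sup>2)) \<le> (\<bar>v\<bar> * s) ^ 3 * C" .
    define x where "x = v\<^sup>2 * g / 2"
    have x0: "0 \<le> x" using g0 by (simp add: x_def)
    have "x \<le> v\<^sup>2 * (C2 * L * s ^ 2)" using mult_nonneg_nonneg[OF zero_le_power2[of v] g0] mult_left_mono[OF gl zero_le_power2[of v]] unfolding x_def s(2) by linarith
    then have "x\<^sup>2 \<le> (v\<^sup>2 * (C2 * L * s ^ 2))\<^sup>2" using x0 by (rule power_mono)
    also have "\<dots> = (\<bar>v\<bar> * s) ^ 4 * (C2 * L)\<^sup>2" by (simp add: power_mult_distrib flip: power_mult)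
    also have "\<dots> \<le> (\<bar>v\<bar> * s) ^ 4 * C" using C2 C4 L0 by (intro mult_left_mono) (auto simp: C_def)
    finally have 3: "x\<^sup>2 \<le> (\<bar>v\<bar> * s) ^ 4 * C" .
    have "norm (complex_of_real (1 - x) - exp (- complex_of_real x)) = \<bar>exp (- x) - (1 - x)\<bar>"
      unfolding of_real_minus[symmetric] exp_of_real of_real_diff[symmetric] norm_of_real by (rule abs_minus_commute)
    also have "\<dots> \<le> x\<^sup>2" by (rule exp_minus_approx[OF x0])
    finally have 4: "norm (complex_of_real (1 - x) - exp (- complex_of_real x)) \<le> x\<^sup>2" .
    have "norm (expectation (\<lambda>\<omega>. iexp (v * psum h l \<omega>)) - exp (- complex_of_real x)) \<le> (\<bar>v\<bar> * s) ^ 3 * C + (\<bar>v\<bar> * s) ^ 4 * C"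
      using norm_triangle_ineq[of "expectation (\<lambda>\<omega>. iexp (v * psum h l \<omega>)) - complex_of_real (1 - x)" "complex_of_real (1 - x) - exp (- complex_of_real x)"]
        1 2 3 4 by (simp add: x_def)
    then show ?thesis by (simp add: x_def g_def s_def algebra_simps)
  qed
  with C0 show ?thesis by (rule that)
qed

theorem clt:
  assumes h: "admissible h L \<pi>" and v: "(\<lambda>n. expectation (\<lambda>\<omega>. psum h n \<omega> ^ 2) / real n) \<longlonglongrightarrow> v"
  shows "(\<lambda>n. expectation (\<lambda>\<omega>. iexp (u * (psum h n \<omega> / sqrt (real n))))) \<longlonglongrightarrow> complex_of_real (exp (- (v * u\<^sup>2) / 2))"
proof -
  note h' = h[unfolded admissible_def]
  have [measurable]: "h \<in> borel_measurable borel" using h by (rule admissible_measurable)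
  note [measurable] = psum_measurable[OF this]
  have hb: "\<And>x. \<bar>h x\<bar> \<le> 1" using h' by blast
  obtain C where C: "0 \<le> C"
    "\<And>l v. 1 \<le> l \<Longrightarrow> norm (expectation (\<lambda>\<omega>. iexp (v * psum h l \<omega>)) - exp (- complex_of_real (v\<^sup>2 * expectation (\<lambda>\<omega>. psum h l \<omega> ^ 2) / 2)))
       \<le> C * ((\<bar>v\<bar> * sqrt l) ^ 3 + (\<bar>v\<bar> * sqrt l) ^ 4)"
    using char_block_approx[OF h] by blast
  define D where "D = (\<Sum>d. real d ^ (P - 2) * \<delta> d)"
  \<comment> \<open>There are about n powr (1/4) blocks. Any number of blocks that tends to infinity
    and is o(sqrt n) serves: the decoupling error and the leftover of at most \<open>q n\<close>
    summands are of order q / sqrt n, and the expansion errors of the blocks add up to order 1 /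
    sqrt q.\<close>
  define q where "q n = nat \<lfloor>sqrt (sqrt (real n))\<rfloor>" for n
  define l where "l n = n div q n" for n
  define E where "E w n = expectation (\<lambda>\<omega>. iexp (w * psum h n \<omega>))" for w n
  define g where "g n = expectation (\<lambda>\<omega>. psum h n \<omega> ^ 2)" for n
  define w where "w n = u / sqrt (real n)" for n
  have q1: "1 \<le> q n" if "1 \<le> n" for n using that by (simp add: q_def le_nat_floor)
  have qle: "real (q n) \<le> sqrt (sqrt (real n))" for n by (simp add: q_def)
  have qge: "sqrt (sqrt (real n)) - 1 \<le> real (q n)" for n unfolding q_def by linarith
  have q4: "real (q n) ^ 4 \<le> real n" for n
  proof -
    have "real (q n) ^ 4 \<le> sqrt (sqrt (real n)) ^ 4" using qle by (intro power_mono) auto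
    also have "\<dots> = (sqrt (sqrt (real n)) ^ 2) ^ 2" unfolding power_mult[symmetric] by simp
    also have "\<dots> = real n" by simp
    finally show ?thesis .
  qed
  have qn: "q n \<le> n" for n
  proof (cases "q n = 0")
    case False
    have "real (q n) * 1 \<le> real (q n) * real (q n) ^ 3" using False by (intro mult_left_mono one_le_power) auto
    also have "\<dots> = real (q n) ^ 4" by (simp add: eval_nat_numeral)
    finally show ?thesis using q4[of n] by linarith
  qed simp
  have l1: "1 \<le> l n" if "1 \<le> n" for n using q1[OF that] qn[of n] by (simp add: l_def div_greater_zero_iff Suc_leI)
  have qtop: "filterlim (\<lambda>n. real (q n)) at_top sequentially"
    by (rule filterlim_at_top_mono[where f="\<lambda>n. sqrt (sqrt (real n)) - 1"]) (real_asymp, use qge in auto)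
  have ql: "q n * l n \<le> n" and ql2: "n - q n * l n \<le> q n" for n
  proof -
    have "n = q n * l n + n mod q n" by (simp add: l_def)
    moreover have "n mod q n \<le> q n" if "1 \<le> n" using q1[OF that] by (simp add: less_imp_le)
    ultimately show "q n * l n \<le> n" "n - q n * l n \<le> q n" by (cases "n = 0"; auto)+
  qed
  have qs: "(\<lambda>n. real (q n) / sqrt (real n)) \<longlonglongrightarrow> 0"
  proof (rule tendsto_sandwich[OF _ _ tendsto_const])
    show "\<forall>\<^sub>F n in sequentially. real (q n) / sqrt (real n) \<le> sqrt (sqrt (real n)) / sqrt (real n)"
      by (intro always_eventually allI divide_right_mono qle) simp
    show "(\<lambda>n. sqrt (sqrt (real n)) / sqrt (real n)) \<longlonglongrightarrow> 0" by real_asymp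
  qed auto
  have qlim: "(\<lambda>n. 1 / real (q n)) \<longlonglongrightarrow> 0"
    using tendsto_divide_0[OF tendsto_const filterlim_at_top_imp_at_infinity[OF qtop]] .
  have lq: "real (l n) \<le> real n / real (q n)" if "1 \<le> n" for n
  proof -
    have "real (q n) * real (l n) \<le> real n" unfolding of_nat_mult[symmetric] of_nat_le_iff by (rule ql)
    then show ?thesis using q1[OF that] by (simp add: field_simps)
  qed
  have ltop: "filterlim l at_top sequentially"
    unfolding filterlim_sequentially_iff_filterlim_real
  proof (rule filterlim_at_top_mono[where f="\<lambda>n. real n / sqrt (sqrt (real n)) - 1"])
    show "\<forall>\<^sub>F n in sequentially. real n / sqrt (sqrt (real n)) - 1 \<le> real (l n)"
      using eventually_ge_at_top[of 1]
    proof eventually_elim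
      case (elim n)
      have "real n / sqrt (sqrt (real n)) \<le> real n / real (q n)" using qle[of n] q1[OF elim] elim by (intro divide_left_mono mult_pos_pos) auto
      also have "\<dots> \<le> real (l n) + 1"
      proof -
        have "n \<le> q n * l n + q n" using ql2[of n] by linarith
        then have "real n \<le> real (q n * l n + q n)" by (simp only: of_nat_le_iff)
        then show ?thesis using q1[OF elim] by (simp add: field_simps)
      qed
      finally show ?case by simp
    qed
  qed real_asymp
  have qln: "(\<lambda>n. real (q n * l n) / real n) \<longlonglongrightarrow> 1"
  proof (rule tendsto_sandwich[OF _ _ _ tendsto_const])
    show "\<forall>\<^sub>F n in sequentially. 1 - real (q n) / sqrt (real n) \<le> real (q n * l n) / real n"
      using eventually_ge_at_top[of 1]
    proof eventually_elim
      case (elim n)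
      have "real n - real (q n) \<le> real (q n * l n)" using ql2[of n] by linarith
      then have "(real n - real (q n)) / real n \<le> real (q n * l n) / real n" by (intro divide_right_mono) auto
      moreover have "real (q n) / real n \<le> real (q n) / sqrt (real n)"
        using elim by (intro divide_left_mono real_le_lsqrt mult_pos_pos) (auto simp: power2_eq_square)
      ultimately show ?case using elim by (simp add: diff_divide_distrib)
    qed
    show "\<forall>\<^sub>F n in sequentially. real (q n * l n) / real n \<le> 1"
    proof (rule always_eventually, rule allI)
      fix n show "real (q n * l n) / real n \<le> 1" using ql[of n] by (cases "n = 0") (simp_all add: divide_le_eq_1 del: of_nat_mult)
    qed
    show "(\<lambda>n. 1 - real (q n) / sqrt (real n)) \<longlonglongrightarrow> 1" using tendsto_diff[OF tendsto_const qs, of 1] by simp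
  qed
  have main: "\<forall>\<^sub>F n in sequentially. norm (E (w n) n - exp (- complex_of_real (real (q n) * ((w n)\<^sup>2 * g (l n) / 2))))
     \<le> \<bar>u\<bar> * (real (q n) / sqrt (real n)) + \<bar>u\<bar> * L * D * (real (q n) / sqrt (real n)) + C * (\<bar>u\<bar> ^ 3 * sqrt (1 / real (q n)) + \<bar>u\<bar> ^ 4 * (1 / real (q n)))"
    using eventually_ge_at_top[of 1]
  proof eventually_elim
    case (elim n)
    define x where "x = (w n)\<^sup>2 * g (l n) / 2"
    have x0: "0 \<le> x" by (simp add: x_def g_def)
    have psub: "\<bar>psum h n \<omega> - psum h (q n * l n) \<omega>\<bar> \<le> real (q n)" for \<omega>
    proof -
      have e: "psum h n \<omega> - psum h (q n * l n) \<omega> = (\<Sum>i\<in>{1..n} - {1..q n * l n}. h (X i \<omega>))"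
        unfolding psum_def using ql[of n] by (subst sum_diff) auto
      have S: "{1..n} - {1..q n * l n} = {Suc (q n * l n)..n}" by auto
      have "\<bar>\<Sum>i\<in>{1..n} - {1..q n * l n}. h (X i \<omega>)\<bar> \<le> (\<Sum>i\<in>{1..n} - {1..q n * l n}. 1)"
        by (rule order_trans[OF sum_abs sum_mono]) (use hb in auto)
      also have "\<dots> = real (n - q n * l n)" unfolding S by simp
      finally show ?thesis unfolding e using ql2[of n] by linarith
    qed
    have "norm (E (w n) n - E (w n) (q n * l n)) = norm (expectation (\<lambda>\<omega>. iexp (w n * psum h n \<omega>) - iexp (w n * psum h (q n * l n) \<omega>)))"
      unfolding E_def by (subst Bochner_Integration.integral_diff) (auto intro!: bounded_integrable[where B=1])
    also have "\<dots> \<le> expectation (\<lambda>\<omega>. norm (iexp (w n * psum h n \<omega>) - iexp (w n * psum h (q n * l n) \<omega>)))"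
      by (rule integral_norm_bound)
    also have "\<dots> \<le> \<bar>w n\<bar> * real (q n)"
    proof (rule integral_le_const)
      show "AE \<omega> in M. norm (iexp (w n * psum h n \<omega>) - iexp (w n * psum h (q n * l n) \<omega>)) \<le> \<bar>w n\<bar> * real (q n)"
        by (rule AE_I2) (rule order_trans[OF iexp_lipschitz mult_left_mono[OF psub]], simp)
      show "integrable M (\<lambda>\<omega>. norm (iexp (w n * psum h n \<omega>) - iexp (w n * psum h (q n * l n) \<omega>)))"
        by (intro integrable_norm Bochner_Integration.integrable_diff bounded_integrable[where B=1]) auto
    qed
    also have "\<dots> = \<bar>u\<bar> * (real (q n) / sqrt (real n))" by (simp add: w_def)
    finally have 1: "norm (E (w n) n - E (w n) (q n * l n)) \<le> \<bar>u\<bar> * (real (q n) / sqrt (real n))" .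
    have 2: "norm (E (w n) (q n * l n) - E (w n) (l n) ^ q n) \<le> \<bar>u\<bar> * L * D * (real (q n) / sqrt (real n))"
      using block_decoupling[OF h, of "w n" "q n" "l n"] unfolding E_def D_def by (simp add: w_def mult_ac)
    have wl: "\<bar>w n\<bar> * sqrt (real (l n)) \<le> \<bar>u\<bar> * sqrt (1 / real (q n))"
    proof -
      have "\<bar>w n\<bar> * sqrt (real (l n)) \<le> \<bar>w n\<bar> * sqrt (real n / real (q n))"
        using lq[OF elim] by (intro mult_left_mono real_sqrt_le_mono) auto
      also have "\<dots> = \<bar>u\<bar> * sqrt (1 / real (q n))" using elim by (simp add: w_def real_sqrt_divide)
      finally show ?thesis .
    qed
    define z where "z = sqrt (1 / real (q n))"
    have z: "0 \<le> z" "real (q n) * z ^ 2 = 1" using q1[OF elim] by (auto simp: z_def)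
    have "norm (E (w n) (l n) ^ q n - exp (- complex_of_real x) ^ q n) \<le> real (q n) * norm (E (w n) (l n) - exp (- complex_of_real x))"
    proof (rule norm_power_diff)
      have "norm (E (w n) (l n)) \<le> expectation (\<lambda>\<omega>. norm (iexp (w n * psum h (l n) \<omega>)))" unfolding E_def by (rule integral_norm_bound)
      then show "norm (E (w n) (l n)) \<le> 1" by (simp add: prob_space)
      show "norm (exp (- complex_of_real x)) \<le> 1" using x0 by simp
    qed
    also have "\<dots> \<le> real (q n) * (C * ((\<bar>w n\<bar> * sqrt (l n)) ^ 3 + (\<bar>w n\<bar> * sqrt (l n)) ^ 4))"
      using C(2)[OF l1[OF elim], of "w n"] unfolding E_def x_def g_def by (intro mult_left_mono) auto
    also have "\<dots> \<le> real (q n) * (C * ((\<bar>u\<bar> * z) ^ 3 + (\<bar>u\<bar> * z) ^ 4))"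
      using wl C(1) unfolding z_def by (intro mult_left_mono add_mono power_mono) auto
    also have "\<dots> = C * (\<bar>u\<bar> ^ 3 * (z * (real (q n) * z ^ 2)) + \<bar>u\<bar> ^ 4 * (z ^ 2 * (real (q n) * z ^ 2)))"
      by (simp add: algebra_simps power2_eq_square power3_eq_cube power4_eq_xxxx)
    also have "\<dots> = C * (\<bar>u\<bar> ^ 3 * z + \<bar>u\<bar> ^ 4 * z ^ 2)" unfolding z by simp
    also have "z ^ 2 = 1 / real (q n)" by (simp add: z_def)
    finally have 3: "norm (E (w n) (l n) ^ q n - exp (- complex_of_real x) ^ q n) \<le> C * (\<bar>u\<bar> ^ 3 * z + \<bar>u\<bar> ^ 4 * (1 / real (q n)))" .
    have 4: "exp (- complex_of_real x) ^ q n = exp (- complex_of_real (real (q n) * x))"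
      by (simp add: exp_of_nat_mult[symmetric])
    have tri: "norm (a - d) \<le> norm (a - b) + norm (b - c) + norm (c - d)" for a b c d :: complex
      using norm_triangle_ineq[of "a - b" "b - d"] norm_triangle_ineq[of "b - c" "c - d"] by simp
    have "norm (E (w n) n - exp (- complex_of_real x) ^ q n)
       \<le> norm (E (w n) n - E (w n) (q n * l n)) + norm (E (w n) (q n * l n) - E (w n) (l n) ^ q n) + norm (E (w n) (l n) ^ q n - exp (- complex_of_real x) ^ q n)"
      by (rule tri)
    then show ?case using 1 2 3 unfolding x_def[symmetric] 4 z_def by linarith
  qed
  have "(\<lambda>n. E (w n) n - exp (- complex_of_real (real (q n) * ((w n)\<^sup>2 * g (l n) / 2)))) \<longlonglongrightarrow> 0"
  proof (rule Lim_null_comparison[OF main])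
    have "(\<lambda>n. \<bar>u\<bar> * (real (q n) / sqrt (real n)) + \<bar>u\<bar> * L * D * (real (q n) / sqrt (real n)) + C * (\<bar>u\<bar> ^ 3 * sqrt (1 / real (q n)) + \<bar>u\<bar> ^ 4 * (1 / real (q n))))
      \<longlonglongrightarrow> \<bar>u\<bar> * 0 + \<bar>u\<bar> * L * D * 0 + C * (\<bar>u\<bar> ^ 3 * sqrt 0 + \<bar>u\<bar> ^ 4 * 0)"
      by (intro tendsto_intros qs qlim)
    then show "(\<lambda>n. \<bar>u\<bar> * (real (q n) / sqrt (real n)) + \<bar>u\<bar> * L * D * (real (q n) / sqrt (real n)) + C * (\<bar>u\<bar> ^ 3 * sqrt (1 / real (q n)) + \<bar>u\<bar> ^ 4 * (1 / real (q n)))) \<longlonglongrightarrow> 0"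
      by simp
  qed
  moreover have "(\<lambda>n. exp (- complex_of_real (real (q n) * ((w n)\<^sup>2 * g (l n) / 2)))) \<longlonglongrightarrow> exp (- complex_of_real (u\<^sup>2 * (1 * v) / 2))"
  proof -
    have gl: "(\<lambda>n. g (l n) / real (l n)) \<longlonglongrightarrow> v"
      using v ltop unfolding g_def by (rule filterlim_compose)
    have "(\<lambda>n. u\<^sup>2 * ((real (q n * l n) / real n) * (g (l n) / real (l n))) / 2) \<longlonglongrightarrow> u\<^sup>2 * (1 * v) / 2"
      by (intro tendsto_intros qln gl) auto
    moreover have "\<forall>\<^sub>F n in sequentially. u\<^sup>2 * ((real (q n * l n) / real n) * (g (l n) / real (l n))) / 2 = real (q n) * ((w n)\<^sup>2 * g (l n) / 2)"
      using eventually_ge_at_top[of 1]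
    proof eventually_elim
      case (elim n)
      have "real (l n) \<noteq> 0" "real n \<noteq> 0" using l1[OF elim] elim by auto
      then show ?case by (simp add: w_def power_divide field_simps)
    qed
    ultimately have "(\<lambda>n. real (q n) * ((w n)\<^sup>2 * g (l n) / 2)) \<longlonglongrightarrow> u\<^sup>2 * (1 * v) / 2"
      by (rule Lim_transform_eventually)
    then show ?thesis by (intro tendsto_intros)
  qed
  ultimately have "(\<lambda>n. (E (w n) n - exp (- complex_of_real (real (q n) * ((w n)\<^sup>2 * g (l n) / 2)))) + exp (- complex_of_real (real (q n) * ((w n)\<^sup>2 * g (l n) / 2)))) \<longlonglongrightarrow> 0 + exp (- complex_of_real (u\<^sup>2 * (1 * v) / 2))"
    by (rule tendsto_add)
  then have "(\<lambda>n. E (w n) n) \<longlonglongrightarrow> exp (- complex_of_real (u\<^sup>2 * (1 * v) / 2))"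
    by (simp only: diff_add_cancel add_0)
  moreover have "exp (- complex_of_real (u\<^sup>2 * (1 * v) / 2)) = complex_of_real (exp (- (v * u\<^sup>2) / 2))"
    unfolding of_real_minus[symmetric] exp_of_real by (simp add: mult.commute)
  moreover have "E (w n) n = expectation (\<lambda>\<omega>. iexp (u * (psum h n \<omega> / sqrt (real n))))" for n
    by (simp add: E_def w_def)
  ultimately show ?thesis by simp
qed

end

subsection \<open>Convergence of Lipschitz functionals from characteristic functions\<close>

lemma abs_diff_sin_le: "\<bar>t - sin t\<bar> \<le> (t::real)\<^sup>2"
proof -
  have "\<bar>sin t - (\<Sum>m<2. sin_coeff m * t ^ m)\<bar> \<le> inverse (fact 2) * \<bar>t\<bar> ^ 2" by (rule Maclaurin_sin_bound)
  then have "\<bar>sin t - t\<bar> \<le> t\<^sup>2 / 2" by (simp add: sin_coeff_def numeral_2_eq_2)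
  also have "\<dots> \<le> t\<^sup>2" by simp
  finally show ?thesis by (simp add: abs_minus_commute)
qed

lemma scaled_sin_error:
  assumes "0 < (m::real)"
  shows "\<bar>x - m * sin (x / m)\<bar> \<le> x\<^sup>2 / m"
proof -
  have "x - m * sin (x / m) = m * (x / m - sin (x / m))" using assms by (simp add: right_diff_distrib)
  then have "\<bar>x - m * sin (x / m)\<bar> = m * \<bar>x / m - sin (x / m)\<bar>" using assms by (simp only: abs_mult abs_of_pos)
  also have "\<dots> \<le> m * (x / m)\<^sup>2" using assms by (intro mult_left_mono abs_diff_sin_le) auto
  also have "\<dots> = x\<^sup>2 / m" using assms by (simp add: power2_eq_square)
  finally show ?thesis .
qed

text \<open>Polynomials in the coordinates from \<open>A\<close>. The inductive form allows
  properties of test functions to be propagated along sums and products.\<close>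

inductive_set coord_poly :: "'i set \<Rightarrow> (('i \<Rightarrow> real) \<Rightarrow> real) set" for A where
  const: "(\<lambda>_. c) \<in> coord_poly A"
| coord: "i \<in> A \<Longrightarrow> (\<lambda>x. x i) \<in> coord_poly A"
| add: "f \<in> coord_poly A \<Longrightarrow> g \<in> coord_poly A \<Longrightarrow> (\<lambda>x. f x + g x) \<in> coord_poly A"
| mult: "f \<in> coord_poly A \<Longrightarrow> g \<in> coord_poly A \<Longrightarrow> (\<lambda>x. f x * g x) \<in> coord_poly A"

text \<open>Coordinates outside \<open>A\<close> are pinned to 0, so that the coordinates in
  \<open>A\<close> alone separate the points, as Stone-Weierstrass requires.\<close>

lemma compact_cube:
  "compact {s :: 'i \<Rightarrow> real. \<forall>i. if i \<in> A then s i \<in> {-1..1} else s i = 0}"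
proof -
  have "compactin (product_topology (\<lambda>_. euclidean) UNIV) (PiE UNIV (\<lambda>i::'i. if i \<in> A then {-1..1::real} else {0}))"
    unfolding compactin_PiE by auto
  moreover have "(PiE UNIV (\<lambda>i::'i. if i \<in> A then {-1..1::real} else {0})) = {s. \<forall>i. if i \<in> A then s i \<in> {-1..1} else s i = 0}"
    by (auto simp: PiE_def Pi_def split: if_splits)
  ultimately show ?thesis by (simp add: euclidean_product_topology)
qed

lemma coord_poly_dense:
  fixes F :: "('i::countable \<Rightarrow> real) \<Rightarrow> real"
  assumes "continuous_on {s. \<forall>i. if i \<in> A then s i \<in> {-1..1} else s i = 0} F" "0 < e"
  shows "\<exists>g\<in>coord_poly A. \<forall>s. (\<forall>i. if i \<in> A then s i \<in> {-1..1} else s i = 0) \<longrightarrow> \<bar>F s - g s\<bar> < e"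
proof -
  let ?S = "{s :: 'i \<Rightarrow> real. \<forall>i. if i \<in> A then s i \<in> {-1..1} else s i = 0}"
  interpret function_ring_on "coord_poly A" ?S
  proof
    show "compact ?S" by (rule compact_cube)
    show "continuous_on ?S f" if "f \<in> coord_poly A" for f
      using that
    proof induction
      case (coord i)
      show ?case by (rule continuous_on_subset[OF continuous_on_product_coordinates]) simp
    next
      case (add f g)
      show ?case by (rule continuous_on_add[OF add.IH])
    next
      case (mult f g)
      show ?case by (rule continuous_on_mult[OF mult.IH])
    qed (rule continuous_on_const)
    show "\<exists>f\<in>coord_poly A. f x \<noteq> f y" if "x \<in> ?S" "y \<in> ?S" "x \<noteq> y" for x y
    proof -
      obtain i where i: "x i \<noteq> y i" using \<open>x \<noteq> y\<close> by blast
      then have "i \<in> A" using that by (auto split: if_splits) (metis)+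
      then show ?thesis using i by (intro bexI[OF _ coord_poly.coord]) auto
    qed
  qed (auto intro: coord_poly.intros)
  show ?thesis using Stone_Weierstrass_basic[OF assms] by auto
qed

lemma multivariate_levy:
  fixes Y :: "nat \<Rightarrow> 'a \<Rightarrow> 'i::countable \<Rightarrow> real" and Z :: "'b \<Rightarrow> 'i \<Rightarrow> real" and \<Phi> :: "('i \<Rightarrow> real) \<Rightarrow> real"
  assumes M: "prob_space M" and N: "prob_space N" and A: "finite A"
    and Ym [measurable]: "\<And>n i. i \<in> A \<Longrightarrow> (\<lambda>\<omega>. Y n \<omega> i) \<in> borel_measurable M"
    and Zm [measurable]: "\<And>i. i \<in> A \<Longrightarrow> (\<lambda>\<omega>. Z \<omega> i) \<in> borel_measurable N"
    and Y2: "\<And>n i. i \<in> A \<Longrightarrow> integrable M (\<lambda>\<omega>. (Y n \<omega> i)\<^sup>2)" "\<And>n i. i \<in> A \<Longrightarrow> (\<integral>\<omega>. (Y n \<omega> i)\<^sup>2 \<partial>M) \<le> B"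
    and Z2: "\<And>i. i \<in> A \<Longrightarrow> integrable N (\<lambda>\<omega>. (Z \<omega> i)\<^sup>2)" "\<And>i. i \<in> A \<Longrightarrow> (\<integral>\<omega>. (Z \<omega> i)\<^sup>2 \<partial>N) \<le> B"
    and char: "\<And>c. (\<lambda>n. \<integral>\<omega>. iexp (\<Sum>i\<in>A. c i * Y n \<omega> i) \<partial>M) \<longlonglongrightarrow> (\<integral>\<omega>. iexp (\<Sum>i\<in>A. c i * Z \<omega> i) \<partial>N)"
    and lip: "\<And>x y. \<bar>\<Phi> x - \<Phi> y\<bar> \<le> L * (\<Sum>i\<in>A. \<bar>x i - y i\<bar>)" and bd: "\<And>x. \<bar>\<Phi> x\<bar> \<le> K"
  shows "(\<lambda>\<omega>. \<Phi> (Y n \<omega>)) \<in> borel_measurable M" "(\<lambda>\<omega>. \<Phi> (Z \<omega>)) \<in> borel_measurable N"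
    "(\<lambda>n. \<integral>\<omega>. \<Phi> (Y n \<omega>) \<partial>M) \<longlonglongrightarrow> (\<integral>\<omega>. \<Phi> (Z \<omega>) \<partial>N)"
proof -
  interpret M: prob_space M by (rule M)
  interpret N: prob_space N by (rule N)
  define L' where "L' = \<bar>L\<bar>"
  have lip: "\<bar>\<Phi> x - \<Phi> y\<bar> \<le> L' * (\<Sum>i\<in>A. \<bar>x i - y i\<bar>)" for x y
    unfolding L'_def by (rule order_trans[OF lip mult_right_mono]) (auto intro: sum_nonneg)
  have L0: "0 \<le> L'" by (simp add: L'_def)
  have cont: "continuous_on UNIV (\<lambda>s. \<Phi> (\<lambda>i. m * s i))" for m :: real
    unfolding continuous_on_eq_continuous_at[OF open_UNIV] isCont_def
  proof
    fix s :: "'i \<Rightarrow> real"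
    have c: "((\<lambda>x. x i) \<longlongrightarrow> s i) (at s)" for i
    proof -
      have "continuous_on UNIV (\<lambda>x :: 'i \<Rightarrow> real. x i)" by (rule continuous_on_product_coordinates)
      then show ?thesis unfolding continuous_on_eq_continuous_at[OF open_UNIV] isCont_def by blast
    qed
    have "((\<lambda>x. L' * (\<Sum>i\<in>A. \<bar>m * x i - m * s i\<bar>)) \<longlongrightarrow> L' * (\<Sum>i\<in>A. \<bar>m * s i - m * s i\<bar>)) (at s)"
      by (intro tendsto_intros c)
    then have "((\<lambda>x. L' * (\<Sum>i\<in>A. \<bar>m * x i - m * s i\<bar>)) \<longlongrightarrow> 0) (at s)" by simp
    then have "((\<lambda>x. \<Phi> (\<lambda>i. m * x i) - \<Phi> (\<lambda>i. m * s i)) \<longlongrightarrow> 0) (at s)"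
      by (rule Lim_null_comparison[rotated]) (use lip in auto)
    then show "((\<lambda>x. \<Phi> (\<lambda>i. m * x i)) \<longlongrightarrow> \<Phi> (\<lambda>i. m * s i)) (at s)" by (rule LIM_zero_cancel)
  qed
  \<comment> \<open>The Lipschitz bound sees only coordinates in \<open>A\<close>, so \<Phi> cannot
    depend on the others.\<close>
  have rest: "\<Phi> x = \<Phi> (\<lambda>i. if i \<in> A then x i else 0)" for x
    using lip[of x "\<lambda>i. if i \<in> A then x i else 0"] by simp
  have \<Phi>m: "\<Phi> \<in> borel_measurable borel"
    using borel_measurable_continuous_onI[OF cont[of 1]] by simp
  have meas: "(\<lambda>\<omega>. \<Phi> (V \<omega>)) \<in> borel_measurable Q" if V: "\<And>i. i \<in> A \<Longrightarrow> (\<lambda>\<omega>. V \<omega> i) \<in> borel_measurable Q" for V and Q :: "'c measure"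
  proof -
    have "(\<lambda>\<omega>. (\<lambda>i. if i \<in> A then V \<omega> i else 0)) \<in> borel_measurable Q"
    proof (rule measurable_coordinatewise_then_product)
      show "(\<lambda>\<omega>. if i \<in> A then V \<omega> i else 0) \<in> borel_measurable Q" for i
        by (cases "i \<in> A") (simp_all add: V)
    qed
    from measurable_compose[OF this \<Phi>m] show ?thesis unfolding rest[symmetric] .
  qed
  show mY: "(\<lambda>\<omega>. \<Phi> (Y n \<omega>)) \<in> borel_measurable M" for n by (rule meas) simp
  show mZ: "(\<lambda>\<omega>. \<Phi> (Z \<omega>)) \<in> borel_measurable N" by (rule meas) simp
  \<comment> \<open>Convergence is required against every cosine with arbitrary frequency and phase.
    This strengthening makes the class stable under multiplication by a sine, which only shifts
    frequency and phase.\<close>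
  define good where "good g \<longleftrightarrow> (\<exists>B. \<forall>x. \<bar>g x\<bar> \<le> B) \<and> (\<forall>n. (\<lambda>\<omega>. g (Y n \<omega>)) \<in> borel_measurable M) \<and> (\<lambda>\<omega>. g (Z \<omega>)) \<in> borel_measurable N \<and>
     (\<forall>c \<theta>. (\<lambda>n. \<integral>\<omega>. g (Y n \<omega>) * cos ((\<Sum>i\<in>A. c i * Y n \<omega> i) + \<theta>) \<partial>M) \<longlonglongrightarrow> (\<integral>\<omega>. g (Z \<omega>) * cos ((\<Sum>i\<in>A. c i * Z \<omega> i) + \<theta>) \<partial>N))" for g :: "('i \<Rightarrow> real) \<Rightarrow> real"
  have intY: "integrable M (\<lambda>\<omega>. g (Y n \<omega>) * cos ((\<Sum>i\<in>A. c i * Y n \<omega> i) + \<theta>))" if gg: "good g" for g n c \<theta>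
  proof -
    obtain B where B: "\<And>x. \<bar>g x\<bar> \<le> B" using gg unfolding good_def by blast
    have [measurable]: "(\<lambda>\<omega>. g (Y n \<omega>)) \<in> borel_measurable M" using gg unfolding good_def by blast+
    show ?thesis
    proof (rule M.integrable_const_bound[where B=B], rule AE_I2)
      fix \<omega> show "norm (g (Y n \<omega>) * cos ((\<Sum>i\<in>A. c i * Y n \<omega> i) + \<theta>)) \<le> B"
        using mult_mono[OF B[of "Y n \<omega>"] abs_cos_le_one] B[of "Y n \<omega>"] by (simp add: abs_mult)
    qed measurable
  qed
  have intZ: "integrable N (\<lambda>\<omega>. g (Z \<omega>) * cos ((\<Sum>i\<in>A. c i * Z \<omega> i) + \<theta>))" if gg: "good g" for g c \<theta>
  proof -
    obtain B where B: "\<And>x. \<bar>g x\<bar> \<le> B" using gg unfolding good_def by blast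
    have [measurable]: "(\<lambda>\<omega>. g (Z \<omega>)) \<in> borel_measurable N" using gg unfolding good_def by blast+
    show ?thesis
    proof (rule N.integrable_const_bound[where B=B], rule AE_I2)
      fix \<omega> show "norm (g (Z \<omega>) * cos ((\<Sum>i\<in>A. c i * Z \<omega> i) + \<theta>)) \<le> B"
        using mult_mono[OF B[of "Z \<omega>"] abs_cos_le_one] B[of "Z \<omega>"] by (simp add: abs_mult)
    qed measurable
  qed
  have cosRe: "cos (a + \<theta>) = Re (iexp \<theta> * iexp a)" for a \<theta> :: real
    by (simp add: exp_add[symmetric] distrib_left[symmetric] add.commute[of \<theta>] Re_exp)
  have good1: "good (\<lambda>_. 1)"
    unfolding good_def
  proof (intro conjI allI)
    fix c \<theta>
    have iY: "integrable M (\<lambda>\<omega>. iexp \<theta> * iexp (\<Sum>i\<in>A. c i * Y n \<omega> i))" for n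
      by (rule M.integrable_const_bound[where B=1]) (auto simp: norm_mult)
    have iZ: "integrable N (\<lambda>\<omega>. iexp \<theta> * iexp (\<Sum>i\<in>A. c i * Z \<omega> i))"
      by (rule N.integrable_const_bound[where B=1]) (auto simp: norm_mult)
    have "(\<lambda>n. Re (iexp \<theta> * (\<integral>\<omega>. iexp (\<Sum>i\<in>A. c i * Y n \<omega> i) \<partial>M))) \<longlonglongrightarrow> Re (iexp \<theta> * (\<integral>\<omega>. iexp (\<Sum>i\<in>A. c i * Z \<omega> i) \<partial>N))"
      by (intro tendsto_Re tendsto_mult tendsto_const char)
    then show "(\<lambda>n. \<integral>\<omega>. 1 * cos ((\<Sum>i\<in>A. c i * Y n \<omega> i) + \<theta>) \<partial>M) \<longlonglongrightarrow> (\<integral>\<omega>. 1 * cos ((\<Sum>i\<in>A. c i * Z \<omega> i) + \<theta>) \<partial>N)"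
      unfolding mult_1 cosRe integral_Re[OF iY] integral_Re[OF iZ] integral_mult_right_zero .
  qed auto
  have good_cmul: "good (\<lambda>x. g x * k)" if gg: "good g" for g and k :: real
    unfolding good_def
  proof (intro conjI allI)
    obtain B where B: "\<And>x. \<bar>g x\<bar> \<le> B" using gg unfolding good_def by blast
    show "\<exists>B. \<forall>x. \<bar>g x * k\<bar> \<le> B"
      by (rule exI[of _ "B * \<bar>k\<bar>"]) (auto simp: abs_mult intro: mult_right_mono B)
    fix c \<theta>
    have "(\<lambda>n. k * (\<integral>\<omega>. g (Y n \<omega>) * cos ((\<Sum>i\<in>A. c i * Y n \<omega> i) + \<theta>) \<partial>M)) \<longlonglongrightarrow> k * (\<integral>\<omega>. g (Z \<omega>) * cos ((\<Sum>i\<in>A. c i * Z \<omega> i) + \<theta>) \<partial>N)"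
      using gg unfolding good_def by (intro tendsto_intros) auto
    then show "(\<lambda>n. \<integral>\<omega>. g (Y n \<omega>) * k * cos ((\<Sum>i\<in>A. c i * Y n \<omega> i) + \<theta>) \<partial>M) \<longlonglongrightarrow> (\<integral>\<omega>. g (Z \<omega>) * k * cos ((\<Sum>i\<in>A. c i * Z \<omega> i) + \<theta>) \<partial>N)"
      unfolding integral_mult_right_zero[symmetric] by (simp only: mult_ac)
  qed (use gg in \<open>auto simp: good_def intro!: borel_measurable_times borel_measurable_const\<close>)
  have good_add: "good (\<lambda>x. f x + g x)" if f: "good f" and g: "good g" for f g
    unfolding good_def
  proof (intro conjI allI)
    obtain B where B: "\<And>x. \<bar>f x\<bar> \<le> B" using f unfolding good_def by blast
    obtain B' where B': "\<And>x. \<bar>g x\<bar> \<le> B'" using g unfolding good_def by blast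
    show "\<exists>B. \<forall>x. \<bar>f x + g x\<bar> \<le> B"
      by (rule exI[of _ "B + B'"]) (use B B' in \<open>auto intro: order_trans[OF abs_triangle_ineq add_mono]\<close>)
    fix c \<theta>
    have "(\<lambda>n. (\<integral>\<omega>. f (Y n \<omega>) * cos ((\<Sum>i\<in>A. c i * Y n \<omega> i) + \<theta>) \<partial>M) + (\<integral>\<omega>. g (Y n \<omega>) * cos ((\<Sum>i\<in>A. c i * Y n \<omega> i) + \<theta>) \<partial>M))
       \<longlonglongrightarrow> (\<integral>\<omega>. f (Z \<omega>) * cos ((\<Sum>i\<in>A. c i * Z \<omega> i) + \<theta>) \<partial>N) + (\<integral>\<omega>. g (Z \<omega>) * cos ((\<Sum>i\<in>A. c i * Z \<omega> i) + \<theta>) \<partial>N)"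
      using f g unfolding good_def by (intro tendsto_intros) auto
    then show "(\<lambda>n. \<integral>\<omega>. (f (Y n \<omega>) + g (Y n \<omega>)) * cos ((\<Sum>i\<in>A. c i * Y n \<omega> i) + \<theta>) \<partial>M) \<longlonglongrightarrow> (\<integral>\<omega>. (f (Z \<omega>) + g (Z \<omega>)) * cos ((\<Sum>i\<in>A. c i * Z \<omega> i) + \<theta>) \<partial>N)"
      unfolding distrib_right Bochner_Integration.integral_add[OF intY[OF f] intY[OF g]] Bochner_Integration.integral_add[OF intZ[OF f] intZ[OF g]] .
  qed (use f g in \<open>auto simp: good_def intro!: borel_measurable_add\<close>)
  have good_sin: "good (\<lambda>x. g x * sin (x i / m))" if g: "good g" and i: "i \<in> A" for g i and m :: real
    unfolding good_def
  proof (intro conjI allI)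
    obtain B where B: "\<And>x. \<bar>g x\<bar> \<le> B" using g unfolding good_def by blast
    have "\<bar>g x * sin (x i / m)\<bar> \<le> B" for x
      using mult_mono[OF B[of x] abs_sin_le_one[of "x i / m"]] B[of x] by (simp add: abs_mult)
    then show "\<exists>B. \<forall>x. \<bar>g x * sin (x i / m)\<bar> \<le> B" by blast
    have [measurable]: "(\<lambda>\<omega>. g (Y n \<omega>)) \<in> borel_measurable M" "(\<lambda>\<omega>. g (Z \<omega>)) \<in> borel_measurable N" for n
      using g unfolding good_def by blast+
    show "(\<lambda>\<omega>. g (Y n \<omega>) * sin (Y n \<omega> i / m)) \<in> borel_measurable M" for n using i by measurable
    show "(\<lambda>\<omega>. g (Z \<omega>) * sin (Z \<omega> i / m)) \<in> borel_measurable N" using i by measurable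
    fix c \<theta>
    define c1 where "c1 = c(i := c i + 1 / m)"
    define c2 where "c2 = c(i := c i - 1 / m)"
    have s1: "(\<Sum>j\<in>A. c1 j * x j) = (\<Sum>j\<in>A. c j * x j) + x i / m" for x
      using A i by (simp add: c1_def sum.remove[of A i] algebra_simps)
    have s2: "(\<Sum>j\<in>A. c2 j * x j) = (\<Sum>j\<in>A. c j * x j) - x i / m" for x
      using A i by (simp add: c2_def sum.remove[of A i] algebra_simps)
    \<comment> \<open>Product-to-sum formula, with each sine written as a cosine shifted by pi /
      2.\<close>
    have eq: "g x * sin (x i / m) * cos ((\<Sum>j\<in>A. c j * x j) + \<theta>) =
      (g x * cos ((\<Sum>j\<in>A. c1 j * x j) + (\<theta> - pi / 2))) / 2 - (g x * cos ((\<Sum>j\<in>A. c2 j * x j) + (\<theta> - pi / 2))) / 2" for x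
    proof -
      define t where "t = (\<Sum>j\<in>A. c j * x j) + \<theta>"
      have 1: "cos ((\<Sum>j\<in>A. c1 j * x j) + (\<theta> - pi / 2)) = sin (t + x i / m)"
      proof -
        have e: "(\<Sum>j\<in>A. c1 j * x j) + (\<theta> - pi / 2) = (t + x i / m) - pi / 2" unfolding s1 t_def by simp
        show ?thesis unfolding e cos_diff by simp
      qed
      have 2: "cos ((\<Sum>j\<in>A. c2 j * x j) + (\<theta> - pi / 2)) = sin (t - x i / m)"
      proof -
        have e: "(\<Sum>j\<in>A. c2 j * x j) + (\<theta> - pi / 2) = (t - x i / m) - pi / 2" unfolding s2 t_def by simp
        show ?thesis unfolding e cos_diff by simp
      qed
      show ?thesis unfolding 1 2 t_def[symmetric] by (simp add: sin_add sin_diff algebra_simps add_divide_distrib diff_divide_distrib)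
    qed
    have "(\<lambda>n. (\<integral>\<omega>. g (Y n \<omega>) * cos ((\<Sum>i\<in>A. c1 i * Y n \<omega> i) + (\<theta> - pi / 2)) \<partial>M) / 2 - (\<integral>\<omega>. g (Y n \<omega>) * cos ((\<Sum>i\<in>A. c2 i * Y n \<omega> i) + (\<theta> - pi / 2)) \<partial>M) / 2)
       \<longlonglongrightarrow> (\<integral>\<omega>. g (Z \<omega>) * cos ((\<Sum>i\<in>A. c1 i * Z \<omega> i) + (\<theta> - pi / 2)) \<partial>N) / 2 - (\<integral>\<omega>. g (Z \<omega>) * cos ((\<Sum>i\<in>A. c2 i * Z \<omega> i) + (\<theta> - pi / 2)) \<partial>N) / 2"
      using g unfolding good_def by (intro tendsto_intros) auto
    then show "(\<lambda>n. \<integral>\<omega>. g (Y n \<omega>) * sin (Y n \<omega> i / m) * cos ((\<Sum>j\<in>A. c j * Y n \<omega> j) + \<theta>) \<partial>M) \<longlonglongrightarrow> (\<integral>\<omega>. g (Z \<omega>) * sin (Z \<omega> i / m) * cos ((\<Sum>j\<in>A. c j * Z \<omega> j) + \<theta>) \<partial>N)"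
      unfolding eq using intY[OF g] intZ[OF g] by simp
  qed
  define T where "T m x = (\<lambda>i. if i \<in> A then sin (x i / m) else 0)" for m :: real and x :: "'i \<Rightarrow> real"
  have good_poly: "good (\<lambda>x. g x * h (T m x))" if "h \<in> coord_poly A" "good g" for g h m
    using that
  proof (induction arbitrary: g)
    case (const c)
    then show ?case using good_cmul by blast
  next
    case (coord i)
    then show ?case using good_sin[of g i m] by (simp add: T_def)
  next
    case (add f h)
    then show ?case using good_add[of "\<lambda>x. g x * f (T m x)" "\<lambda>x. g x * h (T m x)"] by (simp add: distrib_left)
  next
    case (mult f h)
    then show ?case using mult.IH(2)[OF mult.IH(1)[OF mult.prems]] by (simp add: mult.assoc)
  qed
  have intbY: "integrable M (\<lambda>\<omega>. \<Phi> (Y n \<omega>))" for n by (rule M.integrable_const_bound[where B=K]) (use bd mY in auto)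
  have intbZ: "integrable N (\<lambda>\<omega>. \<Phi> (Z \<omega>))" by (rule N.integrable_const_bound[where B=K]) (use bd mZ in auto)
  have approx: "\<bar>(\<integral>\<omega>. \<Phi> (V \<omega>) \<partial>Q) - (\<integral>\<omega>. h (T m (V \<omega>)) \<partial>Q)\<bar> \<le> L' * (real (card A) * B / m) + e"
    if Q: "prob_space Q" and V: "\<And>i. i \<in> A \<Longrightarrow> integrable Q (\<lambda>\<omega>. (V \<omega> i)\<^sup>2)" "\<And>i. i \<in> A \<Longrightarrow> (\<integral>\<omega>. (V \<omega> i)\<^sup>2 \<partial>Q) \<le> B"
      and i1: "integrable Q (\<lambda>\<omega>. \<Phi> (V \<omega>))" and i2: "integrable Q (\<lambda>\<omega>. h (T m (V \<omega>)))" and m: "0 < m"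
      and h: "\<And>x. \<bar>\<Phi> (\<lambda>i. m * T m x i) - h (T m x)\<bar> \<le> e" for V and Q :: "'c measure" and h m e
  proof -
    interpret Q: prob_space Q by (rule Q)
    have pt: "\<bar>\<Phi> (V \<omega>) - h (T m (V \<omega>))\<bar> \<le> L' * (\<Sum>i\<in>A. (V \<omega> i)\<^sup>2 / m) + e" for \<omega>
    proof -
      have "\<bar>\<Phi> (V \<omega>) - \<Phi> (\<lambda>i. m * T m (V \<omega>) i)\<bar> \<le> L' * (\<Sum>i\<in>A. \<bar>V \<omega> i - m * T m (V \<omega>) i\<bar>)" by (rule lip)
      also have "\<dots> \<le> L' * (\<Sum>i\<in>A. (V \<omega> i)\<^sup>2 / m)"
        using L0 by (intro mult_left_mono sum_mono) (auto simp: T_def intro: scaled_sin_error[OF m])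
      finally show ?thesis using h[of "V \<omega>"] by linarith
    qed
    have "\<bar>(\<integral>\<omega>. \<Phi> (V \<omega>) \<partial>Q) - (\<integral>\<omega>. h (T m (V \<omega>)) \<partial>Q)\<bar> = \<bar>\<integral>\<omega>. \<Phi> (V \<omega>) - h (T m (V \<omega>)) \<partial>Q\<bar>" using i1 i2 by simp
    also have "\<dots> \<le> (\<integral>\<omega>. \<bar>\<Phi> (V \<omega>) - h (T m (V \<omega>))\<bar> \<partial>Q)" by (rule integral_abs_bound)
    also have "\<dots> \<le> (\<integral>\<omega>. L' * (\<Sum>i\<in>A. (V \<omega> i)\<^sup>2 / m) + e \<partial>Q)"
      by (rule integral_mono) (use i1 i2 V(1) pt in auto)
    also have "\<dots> = L' * (\<Sum>i\<in>A. (\<integral>\<omega>. (V \<omega> i)\<^sup>2 \<partial>Q) / m) + e" using V(1) by (simp add: Q.prob_space)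
    also have "\<dots> \<le> L' * (\<Sum>i\<in>A. B / m) + e" using V(2) m L0 by (intro add_right_mono mult_left_mono sum_mono divide_right_mono) auto
    finally show ?thesis by simp
  qed
  have B0: "0 \<le> B" if ne: "A \<noteq> {}"
  proof -
    obtain i where i: "i \<in> A" using ne by blast
    have "0 \<le> (\<integral>\<omega>. (Z \<omega> i)\<^sup>2 \<partial>N)" by simp
    also have "\<dots> \<le> B" using Z2(2) i by blast
    finally show ?thesis .
  qed
  show "(\<lambda>n. \<integral>\<omega>. \<Phi> (Y n \<omega>) \<partial>M) \<longlonglongrightarrow> (\<integral>\<omega>. \<Phi> (Z \<omega>) \<partial>N)"
  proof (rule LIMSEQ_I)
    fix e :: real assume e: "0 < e"
    \<comment> \<open>Chosen so that the distortion error is at most e / 8; the summand 1 keeps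
      \<open>m\<close> positive when the constant in front vanishes.\<close>
    define m where "m = 8 * (L' * (real (card A) * B) + 1) / e"
    have cb: "0 \<le> L' * (real (card A) * B)" using B0 L0 by (cases "A = {}") auto
    then have m: "0 < m" using e by (simp add: m_def)
    have me: "L' * (real (card A) * B / m) \<le> e / 8"
      using e m cb by (simp add: m_def field_simps)
    obtain h where h: "h \<in> coord_poly A" "\<forall>s. (\<forall>i. if i \<in> A then s i \<in> {-1..1} else s i = 0) \<longrightarrow> \<bar>\<Phi> (\<lambda>i. m * s i) - h s\<bar> < e / 8"
      using coord_poly_dense[OF continuous_on_subset[OF cont[of m] subset_UNIV], where A=A and e="e/8"] e by auto
    have h': "\<bar>\<Phi> (\<lambda>i. m * T m x i) - h (T m x)\<bar> \<le> e / 8" for x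
    proof (rule less_imp_le, rule h(2)[rule_format])
      fix i show "if i \<in> A then T m x i \<in> {-1..1} else T m x i = 0" by (simp add: T_def)
    qed
    have gd: "good (\<lambda>x. h (T m x))" using good_poly[OF h(1) good1, of m] by simp
    have cv: "(\<lambda>n. \<integral>\<omega>. h (T m (Y n \<omega>)) * cos ((\<Sum>i\<in>A. (0::real) * Y n \<omega> i) + 0) \<partial>M) \<longlonglongrightarrow> (\<integral>\<omega>. h (T m (Z \<omega>)) * cos ((\<Sum>i\<in>A. (0::real) * Z \<omega> i) + 0) \<partial>N)"
      using gd unfolding good_def by (elim conjE) (drule spec[of _ "\<lambda>_. 0"], drule spec[of _ 0], assumption)
    then have cv: "(\<lambda>n. \<integral>\<omega>. h (T m (Y n \<omega>)) \<partial>M) \<longlonglongrightarrow> (\<integral>\<omega>. h (T m (Z \<omega>)) \<partial>N)" by simp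
    have iY: "integrable M (\<lambda>\<omega>. h (T m (Y n \<omega>)))" for n using intY[OF gd, of n "\<lambda>_. 0" 0] by simp
    have iZ: "integrable N (\<lambda>\<omega>. h (T m (Z \<omega>)))" using intZ[OF gd, of "\<lambda>_. 0" 0] by simp
    have "0 < e / 8" using e by simp
    from LIMSEQ_D[OF cv this] obtain no where no: "\<And>n. n \<ge> no \<Longrightarrow> \<bar>(\<integral>\<omega>. h (T m (Y n \<omega>)) \<partial>M) - (\<integral>\<omega>. h (T m (Z \<omega>)) \<partial>N)\<bar> < e / 8"
      unfolding real_norm_def by blast
    show "\<exists>no. \<forall>n\<ge>no. norm ((\<integral>\<omega>. \<Phi> (Y n \<omega>) \<partial>M) - (\<integral>\<omega>. \<Phi> (Z \<omega>) \<partial>N)) < e"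
    proof (intro exI allI impI)
      fix n assume n: "no \<le> n"
      have 1: "\<bar>(\<integral>\<omega>. \<Phi> (Y n \<omega>) \<partial>M) - (\<integral>\<omega>. h (T m (Y n \<omega>)) \<partial>M)\<bar> \<le> e / 8 + e / 8"
        by (rule order_trans[OF approx[OF M Y2 intbY iY m h'] add_right_mono[OF me]])
      have 2: "\<bar>(\<integral>\<omega>. \<Phi> (Z \<omega>) \<partial>N) - (\<integral>\<omega>. h (T m (Z \<omega>)) \<partial>N)\<bar> \<le> e / 8 + e / 8"
        by (rule order_trans[OF approx[OF N Z2 intbZ iZ m h'] add_right_mono[OF me]])
      show "norm ((\<integral>\<omega>. \<Phi> (Y n \<omega>) \<partial>M) - (\<integral>\<omega>. \<Phi> (Z \<omega>) \<partial>N)) < e"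
        using 1 2 no[OF n] e unfolding real_norm_def by linarith
    qed
  qed
qed

subsection \<open>Gaussian fields with a given covariance\<close>

definition psd :: "(nat \<Rightarrow> nat \<Rightarrow> real) \<Rightarrow> bool" where
  "psd S \<longleftrightarrow> (\<forall>i j. S i j = S j i) \<and> (\<forall>I c. finite I \<longrightarrow> 0 \<le> (\<Sum>i\<in>I. \<Sum>j\<in>I. c i * c j * S i j))"

text \<open>The quadratic form at the vector c + t e_k, expanded in \<open>t\<close>. As
  \<open>k\<close> may or may not belong to \<open>I\<close>, both vectors are padded by 0 on
  \<open>insert k I\<close>.\<close>

lemma psd_shift:
  assumes S: "psd S" and I: "finite I"
  shows "0 \<le> (\<Sum>i\<in>I. \<Sum>j\<in>I. c i * c j * S i j) + 2 * t * (\<Sum>i\<in>I. c i * S i k) + t\<^sup>2 * S k k"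
proof -
  define J where "J = insert k I"
  define a where "a i = (if i \<in> I then c i else 0)" for i
  define b where "b i = (if i = k then t else 0)" for i
  have J: "finite J" "k \<in> J" "I \<subseteq> J" using I by (auto simp: J_def)
  have sym: "S i j = S j i" for i j using S unfolding psd_def by blast
  have restr: "(\<Sum>i\<in>J. a i * f i) = (\<Sum>i\<in>I. c i * f i)" for f
  proof -
    have "(\<Sum>i\<in>J. a i * f i) = (\<Sum>i\<in>I. a i * f i)"
      by (rule sum.mono_neutral_right[OF J(1) J(3)]) (simp add: a_def)
    also have "\<dots> = (\<Sum>i\<in>I. c i * f i)" by (rule sum.cong) (simp_all add: a_def)
    finally show ?thesis .
  qed
  have pick: "(\<Sum>i\<in>J. b i * f i) = t * f k" for f
  proof -
    have "(\<Sum>i\<in>J. b i * f i) = (\<Sum>i\<in>J. if i = k then t * f i else 0)" by (rule sum.cong) (simp_all add: b_def)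
    also have "\<dots> = t * f k" using J by (simp add: sum.delta)
    finally show ?thesis .
  qed
  have "0 \<le> (\<Sum>i\<in>J. \<Sum>j\<in>J. (a i + b i) * (a j + b j) * S i j)" by (rule S[unfolded psd_def, THEN conjunct2, rule_format, OF J(1)])
  also have "\<dots> = (\<Sum>i\<in>J. a i * (\<Sum>j\<in>J. a j * S i j)) + (\<Sum>i\<in>J. a i * (\<Sum>j\<in>J. b j * S i j))
      + (\<Sum>i\<in>J. b i * (\<Sum>j\<in>J. a j * S i j)) + (\<Sum>i\<in>J. b i * (\<Sum>j\<in>J. b j * S i j))"
    by (simp add: sum.distrib sum_distrib_left algebra_simps)
  also have "\<dots> = (\<Sum>i\<in>I. c i * (\<Sum>j\<in>I. c j * S i j)) + (\<Sum>i\<in>I. c i * (t * S i k)) + t * (\<Sum>j\<in>I. c j * S k j) + t * (t * S k k)"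
    unfolding restr pick ..
  also have "(\<Sum>i\<in>I. c i * (t * S i k)) = t * (\<Sum>i\<in>I. c i * S i k)"
    by (simp add: sum_distrib_left mult.left_commute)
  also have "(\<Sum>j\<in>I. c j * S k j) = (\<Sum>i\<in>I. c i * S i k)"
  proof (rule sum.cong[OF refl])
    show "c j * S k j = c j * S j k" for j by (simp only: sym[of k j])
  qed
  also have "(\<Sum>i\<in>I. c i * (\<Sum>j\<in>I. c j * S i j)) = (\<Sum>i\<in>I. \<Sum>j\<in>I. c i * c j * S i j)"
    by (simp only: sum_distrib_left mult.assoc)
  finally have "0 \<le> (\<Sum>i\<in>I. \<Sum>j\<in>I. c i * c j * S i j) + t * (\<Sum>i\<in>I. c i * S i k) + t * (\<Sum>i\<in>I. c i * S i k) + t * (t * S k k)" .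
  moreover have "x + t * y + t * y + t * (t * z) = x + 2 * t * y + t\<^sup>2 * z" for x y z :: real
    by (simp add: power2_eq_square)
  ultimately show ?thesis by (simp only:)
qed

lemma psd_diag: assumes "psd S" shows "0 \<le> S k k"
  using psd_shift[OF assms, of "{}" "\<lambda>_. 0" 1 k] by simp

lemma psd_zero: assumes S: "psd S" and k: "S k k = 0" shows "S i k = 0"
proof (rule ccontr)
  assume n: "S i k \<noteq> 0"
  \<comment> \<open>With a vanishing diagonal entry the form is affine in \<open>t\<close>; this
    \<open>t\<close> would make its value -1.\<close>
  define t where "t = - (S i i + 1) / (2 * S i k)"
  have "0 \<le> S i i + 2 * t * S i k + t\<^sup>2 * S k k"
    using psd_shift[OF S, of "{i}" "\<lambda>_. 1" t k] by simp
  moreover have "2 * t * S i k = - (S i i + 1)" using n by (simp add: t_def)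
  ultimately show False using k by simp
qed

lemma psd_zero': "psd S \<Longrightarrow> S k k = 0 \<Longrightarrow> S k i = 0"
  using psd_zero[of S k i] by (simp add: psd_def)

text \<open>Schur complements; if the pivot vanishes then so does its row, and \<open>x / 0 = 0\<close> leaves the kernel unchanged.\<close>
fun schur :: "(nat \<Rightarrow> nat \<Rightarrow> real) \<Rightarrow> nat \<Rightarrow> nat \<Rightarrow> nat \<Rightarrow> real" where
  "schur K 0 = K"
| "schur K (Suc k) = (\<lambda>i j. schur K k i j - schur K k i k * schur K k j k / schur K k k k)"

text \<open>Completing the square: the form of the complement at \<open>c\<close> is the old form at
  c + t e_k for the optimal shift t = - w / S k k. A zero pivot gives t = 0.\<close>

lemma schur_psd: "psd K \<Longrightarrow> psd (schur K k)"
proof (induction k)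
  case (Suc k)
  let ?S = "schur K k"
  have S: "psd ?S" using Suc by simp
  have nonneg: "0 \<le> (\<Sum>i\<in>I. \<Sum>j\<in>I. c i * c j * (?S i j - ?S i k * ?S j k / ?S k k))" if I: "finite I" for I c
  proof -
    define w where "w = (\<Sum>i\<in>I. c i * ?S i k)"
    define t where "t = - w / ?S k k"
    have "(\<Sum>i\<in>I. \<Sum>j\<in>I. c i * c j * (?S i k * ?S j k / ?S k k)) = w * w / ?S k k"
      unfolding w_def sum_product sum_divide_distrib by (intro sum.cong refl) simp
    then have "(\<Sum>i\<in>I. \<Sum>j\<in>I. c i * c j * (?S i j - ?S i k * ?S j k / ?S k k)) = (\<Sum>i\<in>I. \<Sum>j\<in>I. c i * c j * ?S i j) - w * w / ?S k k"
      by (simp add: right_diff_distrib sum_subtractf)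
    also have "\<dots> = (\<Sum>i\<in>I. \<Sum>j\<in>I. c i * c j * ?S i j) + 2 * t * w + t\<^sup>2 * ?S k k"
    proof (cases "?S k k = 0")
      case True
      then show ?thesis by (simp add: t_def)
    next
      case False
      then have "t * ?S k k = - w" by (simp add: t_def)
      then have "t\<^sup>2 * ?S k k = - (t * w)" by (simp add: power2_eq_square mult.assoc)
      moreover have "t * w = - (w * w / ?S k k)" by (simp add: t_def)
      ultimately show ?thesis by linarith
    qed
    also have "\<dots> \<ge> 0" unfolding w_def by (rule psd_shift[OF S I])
    finally show ?thesis .
  qed
  have sym: "schur K (Suc k) i j = schur K (Suc k) j i" for i j
  proof -
    have "?S i j = ?S j i" using S unfolding psd_def by blast
    then show ?thesis by (simp only: schur.simps mult.commute)
  qed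
  show ?case unfolding psd_def
  proof (intro conjI allI impI sym)
    fix I :: "nat set" and c :: "nat \<Rightarrow> real" assume "finite I"
    from nonneg[OF this, of c] show "0 \<le> (\<Sum>i\<in>I. \<Sum>j\<in>I. c i * c j * schur K (Suc k) i j)" by (simp only: schur.simps)
  qed
qed simp

lemma schur_vanish:
  assumes "psd K"
  shows "i < k \<Longrightarrow> schur K k i j = 0 \<and> schur K k j i = 0"
proof (induction k arbitrary: i j)
  case (Suc k)
  let ?S = "schur K k"
  have S: "psd ?S" by (rule schur_psd[OF assms])
  then have sym: "?S i j = ?S j i" for i j by (simp add: psd_def)
  show ?case
  proof (cases "i = k")
    case True
    show ?thesis
    proof (cases "?S k k = 0")
      case z: True
      show ?thesis by (simp add: True z psd_zero[OF S z] psd_zero'[OF S z])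
    next
      case nz: False
      then show ?thesis by (simp add: True sym[of k j])
    qed
  next
    case False
    then have "i < k" using Suc.prems by simp
    then show ?thesis using Suc.IH[of i] by simp
  qed
qed simp

text \<open>The k-th column of the Cholesky factor, read off just before the k-th elimination. A
  zero pivot yields a zero column.\<close>

definition chol :: "(nat \<Rightarrow> nat \<Rightarrow> real) \<Rightarrow> nat \<Rightarrow> nat \<Rightarrow> real" where
  "chol K i k = schur K k i k / sqrt (schur K k k k)"

text \<open>The products of Cholesky columns telescope along the Schur complements, and the
  remainder in row \<open>i\<close> is zero once that row has been eliminated.\<close>

lemma chol_decomp:
  assumes K: "psd K" and m: "i < m"
  shows "(\<Sum>k<m. chol K i k * chol K j k) = K i j"
proof -
  have "(\<Sum>k<n. chol K i k * chol K j k) = K i j - schur K n i j" for n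
  proof (induction n)
    case (Suc n)
    have "chol K i n * chol K j n = schur K n i n * schur K n j n / schur K n n n"
      unfolding chol_def times_divide_times_eq real_sqrt_mult_self abs_of_nonneg[OF psd_diag[OF schur_psd[OF K]]] ..
    then show ?case using Suc by (simp only: sum.lessThan_Suc schur.simps)
  qed simp
  then show ?thesis using conjunct1[OF schur_vanish[OF K m, of j]] by simp
qed

lemma chol_upper: "psd K \<Longrightarrow> i < k \<Longrightarrow> chol K i k = 0"
  using schur_vanish[of K i k k] by (simp add: chol_def)

lemma char_scaled_std_normal:
  assumes N: "prob_space N" and z: "z \<in> borel_measurable N" "distr N borel z = std_normal_distribution"
  shows "char (distr N borel (\<lambda>\<omega>. d * z \<omega>)) u = exp (- complex_of_real ((d * u)\<^sup>2 / 2))"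
proof -
  have "char (distr N borel (\<lambda>\<omega>. d * z \<omega>)) u = char (distr N borel z) (u * d)"
    unfolding char_def using z(1) by (simp add: integral_distr mult_ac)
  then show ?thesis unfolding z(2) char_std_normal_distribution
    by (simp add: exp_of_real[symmetric] mult.commute del: exp_of_real)
qed

text \<open>A countable Gaussian family with prescribed covariance, obtained by applying the
  Cholesky factor to independent normals. Since the factor is lower triangular, every
  \<open>Z i\<close> is a finite sum and no convergence has to be discussed.\<close>

lemma (in prob_space) gaussian_array:
  fixes z :: "nat \<Rightarrow> 'a \<Rightarrow> real"
  assumes ind: "indep_vars (\<lambda>_. borel) z UNIV" and z: "\<And>k. distr M borel (z k) = std_normal_distribution"
    and K: "psd K"
  defines "Z \<equiv> \<lambda>i \<omega>. \<Sum>k\<le>i. chol K i k * z k \<omega>"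
  shows "Z i \<in> borel_measurable M"
    and "finite I \<Longrightarrow> char (distr M borel (\<lambda>\<omega>. \<Sum>i\<in>I. c i * Z i \<omega>)) u = complex_of_real (exp (- ((\<Sum>i\<in>I. \<Sum>j\<in>I. c i * c j * K i j) * u\<^sup>2) / 2))"
proof -
  have zm [measurable]: "z k \<in> borel_measurable M" for k using ind by (auto simp: indep_vars_def)
  show "Z i \<in> borel_measurable M" unfolding Z_def by measurable
  assume I: "finite I"
  define m where "m = Suc (Max (insert 0 I))"
  have im: "i < m" if "i \<in> I" for i using that I by (simp add: m_def less_Suc_eq_le)
  define d where "d k = (\<Sum>i\<in>I. c i * chol K i k)" for k
  have Zm: "Z i \<omega> = (\<Sum>k<m. chol K i k * z k \<omega>)" if "i \<in> I" for i \<omega>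
    unfolding Z_def by (rule sum.mono_neutral_left) (use im[OF that] chol_upper[OF K] in auto)
  have "(\<Sum>i\<in>I. c i * Z i \<omega>) = (\<Sum>k<m. d k * z k \<omega>)" for \<omega>
  proof -
    have "(\<Sum>i\<in>I. c i * Z i \<omega>) = (\<Sum>i\<in>I. \<Sum>k<m. c i * chol K i k * z k \<omega>)"
      by (rule sum.cong) (auto simp: Zm sum_distrib_left mult.assoc)
    also have "\<dots> = (\<Sum>k<m. d k * z k \<omega>)" unfolding d_def sum_distrib_right by (rule sum.swap)
    finally show ?thesis .
  qed
  then have "char (distr M borel (\<lambda>\<omega>. \<Sum>i\<in>I. c i * Z i \<omega>)) u = char (distr M borel (\<lambda>\<omega>. \<Sum>k<m. d k * z k \<omega>)) u" by simp
  also have "\<dots> = (\<Prod>k<m. char (distr M borel (\<lambda>\<omega>. d k * z k \<omega>)) u)"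
    by (rule char_distr_sum, rule indep_vars_compose2[where X=z], rule indep_vars_subset[OF ind]) auto
  also have "\<dots> = (\<Prod>k<m. exp (- complex_of_real ((d k * u)\<^sup>2 / 2)))"
    by (intro prod.cong refl char_scaled_std_normal z zm) unfold_locales
  also have "\<dots> = exp (\<Sum>k<m. - complex_of_real ((d k * u)\<^sup>2 / 2))" by (rule exp_sum[symmetric]) simp
  also have "(\<Sum>k<m. - complex_of_real ((d k * u)\<^sup>2 / 2)) = complex_of_real (- ((\<Sum>k<m. (d k)\<^sup>2) * u\<^sup>2) / 2)"
    by (simp add: sum_negf power_mult_distrib sum_distrib_right sum_divide_distrib)
  also have "(\<Sum>k<m. (d k)\<^sup>2) = (\<Sum>k<m. \<Sum>i\<in>I. \<Sum>j\<in>I. c i * c j * (chol K i k * chol K j k))"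
    unfolding d_def power2_eq_square sum_product by (intro sum.cong refl) (simp add: mult_ac)
  also have "\<dots> = (\<Sum>i\<in>I. \<Sum>k<m. \<Sum>j\<in>I. c i * c j * (chol K i k * chol K j k))" by (rule sum.swap)
  also have "\<dots> = (\<Sum>i\<in>I. \<Sum>j\<in>I. \<Sum>k<m. c i * c j * (chol K i k * chol K j k))" by (intro sum.cong refl sum.swap)
  also have "\<dots> = (\<Sum>i\<in>I. \<Sum>j\<in>I. c i * c j * K i j)"
    by (intro sum.cong refl) (simp add: sum_distrib_left[symmetric] chol_decomp[OF K im])
  finally show "char (distr M borel (\<lambda>\<omega>. \<Sum>i\<in>I. c i * Z i \<omega>)) u = complex_of_real (exp (- ((\<Sum>i\<in>I. \<Sum>j\<in>I. c i * c j * K i j) * u\<^sup>2) / 2))"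
    by (simp only: exp_of_real)
qed

text \<open>By uniqueness of characteristic functions \<open>Y\<close> has the law of sqrt v times a
  standard normal, including the degenerate case v = 0; the constant is the standard normal moment
  of order 2 p.\<close>

lemma (in prob_space) gaussian_moment:
  assumes Y [measurable]: "Y \<in> borel_measurable M" and v: "0 \<le> v"
    and ch: "\<And>u. char (distr M borel Y) u = complex_of_real (exp (- (v * u\<^sup>2) / 2))"
  shows "integrable M (\<lambda>\<omega>. Y \<omega> ^ (2 * p))" "expectation (\<lambda>\<omega>. Y \<omega> ^ (2 * p)) = v ^ p * (fact (2 * p) / (2 ^ p * fact p))"
proof -
  have std: "prob_space std_normal_distribution" using real_dist_normal_dist by (simp add: real_distribution_def)
  interpret S: prob_space std_normal_distribution by (rule std)
  have e: "distr M borel Y = distr std_normal_distribution borel (\<lambda>x. sqrt v * x)"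
  proof (rule Levy_uniqueness)
    show "real_distribution (distr M borel Y)" by (rule real_distribution_distr) simp
    show "real_distribution (distr std_normal_distribution borel (\<lambda>x. sqrt v * x))" by (rule S.real_distribution_distr) simp
    have "char (distr std_normal_distribution borel (\<lambda>x. sqrt v * (\<lambda>x. x) x)) u = exp (- complex_of_real ((sqrt v * u)\<^sup>2 / 2))" for u
      by (rule char_scaled_std_normal[OF std]) (auto simp: distr_id2)
    then have c: "char (distr std_normal_distribution borel (\<lambda>x. sqrt v * x)) u = exp (- complex_of_real ((sqrt v * u)\<^sup>2 / 2))" for u by simp
    show "char (distr M borel Y) = char (distr std_normal_distribution borel (\<lambda>x. sqrt v * x))"
      using v by (intro ext) (simp only: c ch exp_of_real[symmetric] power_mult_distrib real_sqrt_pow2 of_real_minus of_real_divide minus_divide_left)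
  qed
  have "has_bochner_integral lborel (\<lambda>x. std_normal_density x * x ^ (2 * p)) (fact (2 * p) / (2^p * fact p))" by (rule std_normal_moment_even)
  then have i: "integrable lborel (\<lambda>x. std_normal_density x * x ^ (2 * p))" "(\<integral>x. std_normal_density x * x ^ (2 * p) \<partial>lborel) = fact (2 * p) / (2^p * fact p)"
    by (auto simp: has_bochner_integral_iff)
  have j: "integrable std_normal_distribution (\<lambda>x. x ^ (2 * p))" "(\<integral>x. x ^ (2 * p) \<partial>std_normal_distribution) = fact (2 * p) / (2^p * fact p)"
    using i by (auto simp: integrable_density integral_density)
  have "integrable (distr M borel Y) (\<lambda>x. x ^ (2 * p))"
    unfolding e using j by (subst integrable_distr_eq) (auto simp: power_mult_distrib)
  then show "integrable M (\<lambda>\<omega>. Y \<omega> ^ (2 * p))" by (simp add: integrable_distr_eq)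
  have "expectation (\<lambda>\<omega>. Y \<omega> ^ (2 * p)) = (\<integral>x. x ^ (2 * p) \<partial>(distr M borel Y))" by (simp add: integral_distr)
  also have "\<dots> = (\<integral>x. (sqrt v * x) ^ (2 * p) \<partial>std_normal_distribution)" unfolding e by (subst integral_distr) auto
  also have "\<dots> = (sqrt v) ^ (2 * p) * (fact (2 * p) / (2^p * fact p))" using j(2) by (simp add: power_mult_distrib)
  also have "(sqrt v) ^ (2 * p) = v ^ p" using v by (simp add: power_mult)
  finally show "expectation (\<lambda>\<omega>. Y \<omega> ^ (2 * p)) = v ^ p * (fact (2 * p) / (2 ^ p * fact p))" .
qed

text \<open>The theorem prescribes the type of the sample space of the limit. The normals are
  therefore independent coordinates on a product over a given index type, and an injection
  \<open>em\<close> selects countably many of them.\<close>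

lemma iid_std_normal_exists:
  fixes em :: "nat \<Rightarrow> 'k"
  assumes em: "inj em"
  defines "N \<equiv> PiM (UNIV :: 'k set) (\<lambda>_. std_normal_distribution)"
  shows "prob_space N" "prob_space.indep_vars N (\<lambda>_. borel) (\<lambda>k \<omega>. \<omega> (em k)) UNIV"
    "distr N borel (\<lambda>\<omega>. \<omega> (em k)) = std_normal_distribution"
proof -
  have std: "prob_space std_normal_distribution" using real_dist_normal_dist by (simp add: real_distribution_def)
  show N: "prob_space N" unfolding N_def by (rule prob_space_PiM) (rule std)
  interpret N: prob_space N by (rule N)
  have s: "sets std_normal_distribution = sets borel" by simp
  have d: "distr N borel (\<lambda>\<omega>. \<omega> (em k)) = std_normal_distribution" for k
    using distr_PiM_component[of UNIV "\<lambda>_. std_normal_distribution" "em k"] std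
    unfolding N_def by (subst distr_cong[OF refl _ refl, of borel std_normal_distribution]) auto
  show "distr N borel (\<lambda>\<omega>. \<omega> (em k)) = std_normal_distribution" by (rule d)
  have "distr N (\<Pi>\<^sub>M i\<in>UNIV. std_normal_distribution) (\<lambda>\<omega>. \<lambda>n\<in>UNIV. \<omega> (em n)) = (\<Pi>\<^sub>M i\<in>UNIV. std_normal_distribution)"
    unfolding N_def by (rule distr_PiM_reindex) (use std em in auto)
  moreover have "sets (\<Pi>\<^sub>M i\<in>(UNIV::nat set). std_normal_distribution) = sets (\<Pi>\<^sub>M i\<in>(UNIV::nat set). (borel::real measure))"
    by (rule sets_PiM_cong) auto
  ultimately have "distr N (\<Pi>\<^sub>M i\<in>UNIV. borel) (\<lambda>\<omega>. \<lambda>n\<in>UNIV. \<omega> (em n)) = (\<Pi>\<^sub>M i\<in>UNIV. std_normal_distribution)"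
    by (metis (no_types, lifting) distr_cong)
  moreover have rv: "(\<lambda>\<omega>. \<omega> (em k)) \<in> borel_measurable N" for k
    using measurable_component_singleton[of "em k" UNIV "\<lambda>_. std_normal_distribution"] unfolding N_def by simp
  ultimately show "N.indep_vars (\<lambda>_. borel) (\<lambda>k \<omega>. \<omega> (em k)) UNIV"
    by (subst N.indep_vars_iff_distr_eq_PiM') (simp_all only: d rv not_False_eq_True empty_not_UNIV UNIV_not_empty)
qed

subsection \<open>Empirical paths in the Skorokhod space\<close>

text \<open>The quadrant belonging to \<open>S = {}\<close> is the closed upper orthant, so one
  family of quadrant limits covers right-continuity as well.\<close>

lemma cadlag_multiI:
  fixes f :: "ereal^'d::finite \<Rightarrow> real"
  assumes "\<And>t S. (f \<longlongrightarrow> L t S) (at t within {s. (\<forall>k\<in>S. s $ k < t $ k) \<and> (\<forall>k. k \<notin> S \<longrightarrow> t $ k \<le> s $ k)})"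
    and "\<And>t. L t {} = f t"
  shows "cadlag_multi f"
  unfolding cadlag_multi_def
proof (intro allI conjI)
  fix t
  show "\<exists>L. (f \<longlongrightarrow> L) (at t within {s. (\<forall>k\<in>S. s $ k < t $ k) \<and> (\<forall>k. k \<notin> S \<longrightarrow> t $ k \<le> s $ k)})" for S
    using assms(1) by blast
  show "(f \<longlongrightarrow> f t) (at t within {s. t \<le> s})"
    using assms(1)[of t "{}"] unfolding assms(2) by (simp add: less_eq_vec_def)
qed

lemma cadlag_continuous:
  fixes f :: "ereal^'d::finite \<Rightarrow> real"
  assumes "continuous_on UNIV f"
  shows "cadlag_multi f"
proof (rule cadlag_multiI[where L="\<lambda>t S. f t"])
  fix t :: "ereal^'d" and S
  have "(f \<longlongrightarrow> f t) (at t)" using assms by (simp add: continuous_on_def)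
  then show "(f \<longlongrightarrow> f t) (at t within {s. (\<forall>k\<in>S. s $ k < t $ k) \<and> (\<forall>k. k \<notin> S \<longrightarrow> t $ k \<le> s $ k)})"
    by (rule tendsto_within_subset) simp
qed simp

lemma cadlag_add:
  assumes "cadlag_multi f" "cadlag_multi g"
  shows "cadlag_multi (\<lambda>t. f t + g t)"
  unfolding cadlag_multi_def
proof (intro allI conjI)
  fix t
  show "((\<lambda>t. f t + g t) \<longlongrightarrow> f t + g t) (at t within {s. t \<le> s})"
    using assms by (intro tendsto_add) (auto simp: cadlag_multi_def)
  fix S
  obtain L1 L2 where "(f \<longlongrightarrow> L1) (at t within {s. (\<forall>k\<in>S. s $ k < t $ k) \<and> (\<forall>k. k \<notin> S \<longrightarrow> t $ k \<le> s $ k)})"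
    "(g \<longlongrightarrow> L2) (at t within {s. (\<forall>k\<in>S. s $ k < t $ k) \<and> (\<forall>k. k \<notin> S \<longrightarrow> t $ k \<le> s $ k)})"
    using assms unfolding cadlag_multi_def by blast
  then show "\<exists>L. ((\<lambda>t. f t + g t) \<longlongrightarrow> L) (at t within {s. (\<forall>k\<in>S. s $ k < t $ k) \<and> (\<forall>k. k \<notin> S \<longrightarrow> t $ k \<le> s $ k)})"
    using tendsto_add by blast
qed

lemma cadlag_cmult:
  assumes "cadlag_multi f"
  shows "cadlag_multi (\<lambda>t. c * f t)"
  unfolding cadlag_multi_def
proof (intro allI conjI)
  fix t
  show "((\<lambda>t. c * f t) \<longlongrightarrow> c * f t) (at t within {s. t \<le> s})"
    using assms by (intro tendsto_mult tendsto_const) (auto simp: cadlag_multi_def)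
  fix S
  obtain L1 where "(f \<longlongrightarrow> L1) (at t within {s. (\<forall>k\<in>S. s $ k < t $ k) \<and> (\<forall>k. k \<notin> S \<longrightarrow> t $ k \<le> s $ k)})"
    using assms unfolding cadlag_multi_def by blast
  then show "\<exists>L. ((\<lambda>t. c * f t) \<longlongrightarrow> L) (at t within {s. (\<forall>k\<in>S. s $ k < t $ k) \<and> (\<forall>k. k \<notin> S \<longrightarrow> t $ k \<le> s $ k)})"
    using tendsto_mult_left by blast
qed

lemma cadlag_const: "cadlag_multi (\<lambda>_. c)"
  by (rule cadlag_continuous) simp

lemma cadlag_sum: "(\<And>i. i \<in> I \<Longrightarrow> cadlag_multi (f i)) \<Longrightarrow> cadlag_multi (\<lambda>t. \<Sum>i\<in>I. f i t)"
  by (induction I rule: infinite_finite_induct) (auto intro: cadlag_const cadlag_add)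

text \<open>Inside one quadrant every coordinate comparison is eventually constant. Only for a tie
  \<open>x $ k = t $ k\<close> does the value depend on the quadrant: the comparison fails for
  \<open>k\<close> in \<open>S\<close>, where \<open>t\<close> is approached from below, and holds
  otherwise.\<close>

lemma cadlag_indicator:
  fixes x :: "real^'d::finite"
  shows "cadlag_multi (\<lambda>t. if ext_le x t then 1 else 0)"
proof (rule cadlag_multiI[where L="\<lambda>t S. if (\<forall>k. if k \<in> S then ereal (x $ k) < t $ k else ereal (x $ k) \<le> t $ k) then 1 else 0"])
  fix t :: "ereal^'d" and S :: "'d set"
  let ?Q = "{s. (\<forall>k\<in>S. s $ k < t $ k) \<and> (\<forall>k. k \<notin> S \<longrightarrow> t $ k \<le> s $ k)}"
  let ?c = "\<lambda>k. if k \<in> S then ereal (x $ k) < t $ k else ereal (x $ k) \<le> t $ k"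
  have inQ: "\<forall>\<^sub>F s in at t within ?Q. s \<in> ?Q" by (simp add: eventually_at_filter)
  have lim: "((\<lambda>s. s $ k) \<longlongrightarrow> t $ k) (at t within ?Q)" for k by (intro tendsto_vec_nth tendsto_ident_at)
  have "\<forall>\<^sub>F s in at t within ?Q. (ereal (x $ k) \<le> s $ k) = ?c k" for k
  proof -
    consider "ereal (x $ k) < t $ k" | "t $ k < ereal (x $ k)" | "t $ k = ereal (x $ k)" by (meson linorder_cases)
    then show ?thesis
    proof cases
      case 1
      show ?thesis using order_tendstoD(1)[OF lim 1] by eventually_elim (use 1 in auto)
    next
      case 2
      show ?thesis using order_tendstoD(2)[OF lim 2] by eventually_elim (use 2 in auto)
    next
      case 3
      show ?thesis using inQ
      proof eventually_elim
        case (elim s)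
        then show ?case by (cases "k \<in> S") (auto simp: 3[symmetric] not_le)
      qed
    qed
  qed
  then have "\<forall>\<^sub>F s in at t within ?Q. \<forall>k. (ereal (x $ k) \<le> s $ k) = ?c k" by (rule eventually_all_finite)
  then have "\<forall>\<^sub>F s in at t within ?Q. (if (\<forall>k. ?c k) then 1 else 0) = (if ext_le x s then 1 else (0::real))"
  proof eventually_elim
    case (elim s)
    then have "ext_le x s \<longleftrightarrow> (\<forall>k. ?c k)" unfolding ext_le_def by simp
    then show ?case by simp
  qed
  then show "((\<lambda>s. if ext_le x s then 1 else (0::real)) \<longlongrightarrow> (if (\<forall>k. ?c k) then 1 else 0)) (at t within ?Q)"
    by (rule Lim_transform_eventually[OF tendsto_const])
qed (simp add: ext_le_def)

section \<open>Upper bounds for the Skorokhod distance and construction of time changes\<close>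

lemma skorokhod_dist_le:
  assumes "0 \<le> e" "l \<in> time_changes"
    and "\<And>t k. \<bar>ext_to_unit (l k (t $ k)) - ext_to_unit (t $ k)\<bar> \<le> e"
    and "\<And>t. \<bar>x t - y (apply_tc l t)\<bar> \<le> e"
  shows "skorokhod_dist x y \<le> e"
  unfolding skorokhod_dist_def
proof (rule cInf_lower)
  show "e \<in> {e. 0 \<le> e \<and> (\<exists>l\<in>time_changes.
      (\<forall>t k. \<bar>ext_to_unit (l k (t $ k)) - ext_to_unit (t $ k)\<bar> \<le> e) \<and> (\<forall>t. \<bar>x t - y (apply_tc l t)\<bar> \<le> e))}"
    by (intro CollectI conjI bexI[where x=l] allI assms)
qed (rule bdd_belowI[where m=0], simp)

lemma skorokhod_dist_le_sup:
  fixes x y :: "ereal^'d::finite \<Rightarrow> real"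
  assumes "\<And>t. \<bar>x t - y t\<bar> \<le> e"
  shows "skorokhod_dist x y \<le> e"
proof (rule skorokhod_dist_le[where l="\<lambda>k. id"])
  show "0 \<le> e" using assms[of undefined] by linarith
  show "(\<lambda>k. id) \<in> time_changes" by (simp add: time_changes_def strict_mono_def)
  show "\<bar>ext_to_unit (id (t $ k)) - ext_to_unit (t $ k)\<bar> \<le> e" for t :: "ereal^'d" and k
    using \<open>0 \<le> e\<close> by simp
  have "apply_tc (\<lambda>k. id) t = t" for t :: "ereal^'d" by (simp add: apply_tc_def vec_eq_iff)
  then show "\<bar>x t - y (apply_tc (\<lambda>k. id) t)\<bar> \<le> e" for t using assms by simp
qed

lemma strict_mono_surj_continuous:
  fixes l :: "'x::{linorder_topology} \<Rightarrow> 'y::linorder_topology"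
  assumes "strict_mono l" "surj l"
  shows "continuous_on UNIV l"
  unfolding continuous_on_eq_continuous_at[OF open_UNIV] isCont_def
proof
  fix t
  show "(l \<longlongrightarrow> l t) (at t)"
  proof (rule order_tendstoI)
    fix a assume a: "a < l t"
    obtain a' where a': "a = l a'" using assms(2) by (metis surjD)
    then have "a' < t" using a strict_mono_less[OF assms(1)] by simp
    then have "\<forall>\<^sub>F s in at t. a' < s" by (rule order_tendstoD(1)[OF tendsto_ident_at])
    then show "\<forall>\<^sub>F s in at t. a < l s" unfolding a' strict_mono_less[OF assms(1)] .
  next
    fix a assume a: "l t < a"
    obtain a' where a': "a = l a'" using assms(2) by (metis surjD)
    then have "t < a'" using a strict_mono_less[OF assms(1)] by simp
    then have "\<forall>\<^sub>F s in at t. s < a'" by (rule order_tendstoD(2)[OF tendsto_ident_at])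
    then show "\<forall>\<^sub>F s in at t. l s < a" unfolding a' strict_mono_less[OF assms(1)] .
  qed
qed

lemma ext_to_unit_lipschitz: "\<bar>ext_to_unit (ereal a) - ext_to_unit (ereal b)\<bar> \<le> \<bar>a - b\<bar>"
proof -
  define f :: "real \<Rightarrow> real" where "f x = x / (1 + \<bar>x\<bar>)" for x
  have pos: "f x \<le> f y \<and> f y - f x \<le> y - x" if "0 \<le> x" "x \<le> y" for x y
  proof -
    have e: "f y - f x = (y - x) / ((1 + y) * (1 + x))" using that by (simp add: f_def field_simps)
    have "1 * 1 \<le> (1 + y) * (1 + x)" using that by (intro mult_mono) auto
    then have "(y - x) / ((1 + y) * (1 + x)) \<le> (y - x) / 1" using that by (intro divide_left_mono) auto
    moreover have "0 \<le> (y - x) / ((1 + y) * (1 + x))" using that by simp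
    ultimately show ?thesis using e by simp
  qed
  have odd: "f (- x) = - f x" for x by (simp add: f_def)
  have f0: "f 0 = 0" by (simp add: f_def)
  have *: "\<bar>f a - f b\<bar> \<le> b - a" if "a \<le> b" for a b
  proof -
    consider "0 \<le> a" | "b \<le> 0" | "a \<le> 0" "0 \<le> b" by linarith
    then show ?thesis
    proof cases
      case 1 then show ?thesis using pos[of a b] that by linarith
    next
      case 2 then show ?thesis using pos[of "- b" "- a"] odd[of a] odd[of b] that by linarith
    next
      case 3 then show ?thesis using pos[of 0 "- a"] pos[of 0 b] odd[of a] f0 that by linarith
    qed
  qed
  have "ext_to_unit (ereal x) = f x" for x by (simp add: ext_to_unit_def f_def)
  then show ?thesis using *[of a b] *[of b a] by (cases "a \<le> b") auto
qed

fun ereal_lift :: "(real \<Rightarrow> real) \<Rightarrow> ereal \<Rightarrow> ereal" where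
  "ereal_lift h (ereal x) = ereal (h x)"
| "ereal_lift h PInfty = PInfty"
| "ereal_lift h MInfty = MInfty"

lemma ereal_lift_infinity [simp]: "ereal_lift h \<infinity> = \<infinity>" "ereal_lift h (- \<infinity>) = - \<infinity>"
  using ereal_lift.simps(2,3)[of h] unfolding PInfty_eq_infinity MInfty_eq_minfinity by blast+

lemma ereal_lift_strict_mono:
  assumes "strict_mono h"
  shows "strict_mono (ereal_lift h)"
proof (rule strict_monoI)
  fix x y :: ereal assume "x < y"
  then show "ereal_lift h x < ereal_lift h y"
    using strict_mono_less[OF assms] by (cases x; cases y) auto
qed

text \<open>The time change is the identity plus a sum of tent functions of radius \<eta> centred at
  the nodes, with the wanted displacements as heights. Nodes are \<eta>-separated, so each tent
  vanishes at the other nodes; the total slope is at most \<open>m * e / \<eta> \<le> 1 / 2\<close>,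
  so the sum stays strictly increasing. Infinite arguments are fixed.\<close>

lemma time_change_exists:
  fixes P :: "'d::finite \<Rightarrow> real set" and g :: "'d \<Rightarrow> real \<Rightarrow> real"
  assumes P: "\<And>k. finite (P k)" "\<And>k. card (P k) \<le> m" and \<eta>: "0 < \<eta>" "\<And>k p q. p \<in> P k \<Longrightarrow> q \<in> P k \<Longrightarrow> p \<noteq> q \<Longrightarrow> \<eta> \<le> \<bar>p - q\<bar>"
    and g: "\<And>k p. p \<in> P k \<Longrightarrow> \<bar>g k p - p\<bar> \<le> e" and e: "0 \<le> e" "2 * (real m * e) \<le> \<eta>"
  shows "\<exists>l\<in>time_changes. (\<forall>k. \<forall>p\<in>P k. l k (ereal p) = ereal (g k p)) \<and>
    (\<forall>k t. l k t = t \<or> (\<exists>x y. t = ereal x \<and> l k t = ereal y \<and> \<bar>x - y\<bar> \<le> real m * e))"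
proof -
  define \<phi> where "\<phi> k x = (\<Sum>p\<in>P k. (g k p - p) * max 0 (1 - \<bar>x - p\<bar> / \<eta>))" for k x
  have \<phi>_le: "\<bar>\<phi> k x\<bar> \<le> real m * e" for k x
  proof -
    have "\<bar>\<phi> k x\<bar> \<le> (\<Sum>p\<in>P k. \<bar>(g k p - p) * max 0 (1 - \<bar>x - p\<bar> / \<eta>)\<bar>)" unfolding \<phi>_def by (rule sum_abs)
    also have "\<dots> \<le> (\<Sum>p\<in>P k. e * 1)"
    proof (rule sum_mono)
      fix p assume p: "p \<in> P k"
      have "\<bar>max 0 (1 - \<bar>x - p\<bar> / \<eta>)\<bar> \<le> 1" using \<eta>(1) by auto
      then show "\<bar>(g k p - p) * max 0 (1 - \<bar>x - p\<bar> / \<eta>)\<bar> \<le> e * 1" unfolding abs_mult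
        by (rule mult_mono[OF g[OF p] _ e(1) abs_ge_zero])
    qed
    also have "\<dots> = real (card (P k)) * e" by simp
    also have "\<dots> \<le> real m * e" using P(2)[of k] e by (intro mult_right_mono) auto
    finally show ?thesis .
  qed
  have \<phi>_lip: "\<bar>\<phi> k x - \<phi> k y\<bar> \<le> \<bar>x - y\<bar> / 2" for k x y
  proof -
    have "\<bar>\<phi> k x - \<phi> k y\<bar> \<le> (\<Sum>p\<in>P k. \<bar>(g k p - p) * (max 0 (1 - \<bar>x - p\<bar> / \<eta>) - max 0 (1 - \<bar>y - p\<bar> / \<eta>))\<bar>)"
      unfolding \<phi>_def sum_subtractf[symmetric] right_diff_distrib[symmetric] by (rule sum_abs)
    also have "\<dots> \<le> (\<Sum>p\<in>P k. e * (\<bar>x - y\<bar> / \<eta>))"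
    proof (rule sum_mono)
      fix p assume p: "p \<in> P k"
      have "\<bar>max 0 (1 - a) - max 0 (1 - b)\<bar> \<le> \<bar>a - b\<bar>" for a b :: real by linarith
      then have "\<bar>max 0 (1 - \<bar>x - p\<bar> / \<eta>) - max 0 (1 - \<bar>y - p\<bar> / \<eta>)\<bar> \<le> \<bar>\<bar>x - p\<bar> / \<eta> - \<bar>y - p\<bar> / \<eta>\<bar>" .
      also have "\<dots> = \<bar>\<bar>x - p\<bar> - \<bar>y - p\<bar>\<bar> / \<eta>" using \<eta>(1) unfolding diff_divide_distrib[symmetric] abs_divide by simp
      also have "\<dots> \<le> \<bar>x - y\<bar> / \<eta>"
        using \<eta>(1) abs_triangle_ineq3[of "x - p" "y - p"] by (intro divide_right_mono) simp_all
      finally have 1: "\<bar>max 0 (1 - \<bar>x - p\<bar> / \<eta>) - max 0 (1 - \<bar>y - p\<bar> / \<eta>)\<bar> \<le> \<bar>x - y\<bar> / \<eta>" .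
      show "\<bar>(g k p - p) * (max 0 (1 - \<bar>x - p\<bar> / \<eta>) - max 0 (1 - \<bar>y - p\<bar> / \<eta>))\<bar> \<le> e * (\<bar>x - y\<bar> / \<eta>)"
        unfolding abs_mult by (rule mult_mono[OF g[OF p] 1 e(1) abs_ge_zero])
    qed
    also have "\<dots> = real (card (P k)) * e * (\<bar>x - y\<bar> / \<eta>)" by simp
    also have "\<dots> \<le> (\<eta> / 2) * (\<bar>x - y\<bar> / \<eta>)"
    proof (rule mult_right_mono)
      have "real (card (P k)) * e \<le> real m * e" using P(2)[of k] e by (intro mult_right_mono) auto
      then show "real (card (P k)) * e \<le> \<eta> / 2" using e by linarith
    qed (use \<eta> in auto)
    also have "\<dots> = \<bar>x - y\<bar> / 2" using \<eta>(1) by simp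
    finally show ?thesis .
  qed
  have \<phi>_p: "\<phi> k p = g k p - p" if p: "p \<in> P k" for k p
  proof -
    have "\<phi> k p = (\<Sum>q\<in>P k. if q = p then g k p - p else 0)"
      unfolding \<phi>_def
    proof (rule sum.cong[OF refl])
      fix q assume q: "q \<in> P k"
      show "(g k q - q) * max 0 (1 - \<bar>p - q\<bar> / \<eta>) = (if q = p then g k p - p else 0)"
      proof (cases "q = p")
        case False
        then have "\<eta> \<le> \<bar>p - q\<bar>" using \<eta>(2)[OF p q] by simp
        then have "1 \<le> \<bar>p - q\<bar> / \<eta>" using \<eta>(1) by simp
        then show ?thesis using False by simp
      qed simp
    qed
    also have "\<dots> = g k p - p" using p P(1) by simp
    finally show ?thesis .
  qed
  define h where "h k x = x + \<phi> k x" for k x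
  have h_mono: "strict_mono (h k)" for k
  proof (rule strict_monoI)
    fix x y :: real assume "x < y"
    have "\<phi> k x - \<phi> k y \<le> \<bar>x - y\<bar> / 2" by (rule abs_le_D1[OF \<phi>_lip])
    also have "\<dots> < y - x" using \<open>x < y\<close> by simp
    finally show "h k x < h k y" unfolding h_def by simp
  qed
  have \<phi>_cont: "continuous_on UNIV (\<phi> k)" for k unfolding \<phi>_def by (intro continuous_intros) (use \<eta>(1) in auto)
  have h_cont: "continuous_on S (h k)" for S k
    unfolding h_def by (intro continuous_intros continuous_on_subset[OF \<phi>_cont]) auto
  have h_surj: "\<exists>x. h k x = y" for k y
  proof -
    have "\<exists>x\<ge>y - real m * e. x \<le> y + real m * e \<and> h k x = y"
    proof (rule IVT')
      show "h k (y - real m * e) \<le> y" "y \<le> h k (y + real m * e)"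
        using \<phi>_le[of k "y - real m * e"] \<phi>_le[of k "y + real m * e"] unfolding h_def by linarith+
      show "y - real m * e \<le> y + real m * e" using e by simp
    qed (rule h_cont)
    then show ?thesis by blast
  qed
  define l where "l k = ereal_lift (h k)" for k
  have l1: "strict_mono (l k)" for k unfolding l_def by (rule ereal_lift_strict_mono[OF h_mono])
  have l2: "surj (l k)" for k
  proof -
    have "\<exists>x. y = l k x" for y
    proof (cases y)
      case (real r)
      obtain x where "h k x = r" using h_surj by blast
      then show ?thesis using real by (intro exI[of _ "ereal x"]) (simp add: l_def)
    next
      case PInf
      then show ?thesis by (intro exI[of _ PInfty]) (simp add: l_def)
    next
      case MInf
      then show ?thesis by (intro exI[of _ MInfty]) (simp add: l_def)
    qed
    then show ?thesis unfolding surj_def by blast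
  qed
  have "l \<in> time_changes"
    unfolding time_changes_def by (intro CollectI allI conjI l1 l2 strict_mono_surj_continuous)
  moreover have "l k (ereal p) = ereal (g k p)" if "p \<in> P k" for k p using \<phi>_p[OF that] by (simp add: l_def h_def)
  moreover have "l k t = t \<or> (\<exists>x y. t = ereal x \<and> l k t = ereal y \<and> \<bar>x - y\<bar> \<le> real m * e)" for k t
  proof (cases t)
    case (real x)
    then have "l k t = ereal (h k x)" by (simp add: l_def)
    moreover have "\<bar>x - h k x\<bar> \<le> real m * e" using \<phi>_le[of k x] by (simp add: h_def)
    ultimately show ?thesis using real by blast
  qed (simp_all add: l_def)
  ultimately show ?thesis by (intro bexI[of _ l] conjI allI ballI)
qed

section \<open>Empirical paths as functions of the sample points, and their measurability\<close>

definition emp_path :: "real \<Rightarrow> nat \<Rightarrow> (ereal^'d::finite \<Rightarrow> real) \<Rightarrow> (nat \<Rightarrow> real^'d) \<Rightarrow> ereal^'d \<Rightarrow> real" where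
  "emp_path c n G x t = c * (\<Sum>i = 1..n. (if ext_le (x i) t then 1 else 0) - G t)"

lemma emp_path_cadlag:
  assumes "continuous_on UNIV G"
  shows "emp_path c n G x \<in> D_space"
proof -
  have "cadlag_multi (\<lambda>t. c * (\<Sum>i = 1..n. (if ext_le (x i) t then 1 else 0) + (-1) * G t))"
    by (intro cadlag_cmult cadlag_sum cadlag_add cadlag_indicator cadlag_continuous assms)
  moreover have "(\<lambda>t. c * (\<Sum>i = 1..n. (if ext_le (x i) t then 1 else 0) + (-1) * G t)) = emp_path c n G x"
    by (rule ext) (simp only: emp_path_def mult_minus1 add_uminus_conv_diff)
  ultimately show ?thesis by (simp only: D_space_def mem_Collect_eq)
qed

text \<open>Two jumps at a common coordinate that drift apart cannot be matched by one time change,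
  so continuity is claimed only for perturbations that preserve ties. For these a time change
  carries every old coordinate to its new value; the indicators then agree exactly and only the
  continuous centering \<open>G\<close> contributes an error.\<close>

lemma emp_path_continuous_on_pattern:
  fixes G :: "ereal^'d::finite \<Rightarrow> real" and x :: "nat \<Rightarrow> real^'d"
  assumes G: "\<And>e. 0 < e \<Longrightarrow> \<exists>d>0. \<forall>s t. (\<forall>k. s $ k = t $ k \<or> (\<exists>x y. t $ k = ereal x \<and> s $ k = ereal y \<and> \<bar>x - y\<bar> \<le> d)) \<longrightarrow> \<bar>G t - G s\<bar> \<le> e"
    and e: "0 < e"
  shows "\<exists>\<delta>>0. \<forall>x'. (\<forall>i\<in>{1..n}. \<forall>k. \<bar>x' i $ k - x i $ k\<bar> < \<delta>) \<longrightarrow>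
      (\<forall>i\<in>{1..n}. \<forall>j\<in>{1..n}. \<forall>k. x i $ k = x j $ k \<longrightarrow> x' i $ k = x' j $ k) \<longrightarrow>
      skorokhod_dist (emp_path c n G x) (emp_path c n G x') \<le> e"
proof -
  define P where "P k = (\<lambda>i. x i $ k) ` {1..n}" for k
  have Pfin: "finite (P k)" for k by (simp add: P_def)
  have Pcard: "card (P k) \<le> n" for k unfolding P_def using card_image_le[of "{1..n}"] by fastforce
  \<comment> \<open>The element 1 keeps the set nonempty, so its minimum exists even if all nodes
    coincide.\<close>
  define S where "S = insert 1 {\<bar>p - q\<bar> | k p q. p \<in> P k \<and> q \<in> P k \<and> p \<noteq> q}"
  have "{\<bar>p - q\<bar> | k p q. p \<in> P k \<and> q \<in> P k \<and> p \<noteq> q} \<subseteq> (\<Union>k. (\<lambda>(p,q). \<bar>p - q\<bar>) ` (P k \<times> P k))" by auto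
  moreover have "finite (\<Union>k. (\<lambda>(p,q). \<bar>p - q\<bar>) ` (P k \<times> P k))" using Pfin by auto
  ultimately have Sfin: "finite S" unfolding S_def by (intro finite.insertI) (rule finite_subset)
  define \<eta> where "\<eta> = Min S"
  have \<eta>0: "0 < \<eta>" unfolding \<eta>_def using Sfin by (subst Min_gr_iff) (auto simp: S_def)
  have \<eta>: "\<eta> \<le> \<bar>p - q\<bar>" if "p \<in> P k" "q \<in> P k" "p \<noteq> q" for k p q
    unfolding \<eta>_def by (rule Min_le[OF Sfin]) (use that in \<open>auto simp: S_def\<close>)
  define e' where "e' = e / (\<bar>c\<bar> * real n + 1)"
  have e': "0 < e'" using e by (simp add: e'_def divide_pos_pos add_nonneg_pos)
  have ce': "\<bar>c\<bar> * real n * e' \<le> e"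
  proof -
    have "\<bar>c\<bar> * real n * e' \<le> (\<bar>c\<bar> * real n + 1) * e'" using e' by (intro mult_right_mono) auto
    also have "\<dots> = e" unfolding e'_def by (simp add: add_nonneg_eq_0_iff)
    finally show ?thesis .
  qed
  obtain d where d: "0 < d" "\<And>s t. (\<forall>k. s $ k = t $ k \<or> (\<exists>x y. t $ k = ereal x \<and> s $ k = ereal y \<and> \<bar>x - y\<bar> \<le> d)) \<Longrightarrow> \<bar>G t - G s\<bar> \<le> e'"
    using G[OF e'] by blast
  \<comment> \<open>The three bounds serve the slope condition of the time change, the modulus of
    continuity of \<open>G\<close>, and the allowed time distortion. The division accounts for the
    displacement \<open>n * \<delta>\<close> that the time change may produce.\<close>
  define \<delta> where "\<delta> = min (\<eta> / 2) (min d e) / (real n + 1)"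
  have \<delta>0: "0 < \<delta>" using \<eta>0 d(1) e by (simp add: \<delta>_def)
  have n\<delta>: "real n * \<delta> \<le> min (\<eta> / 2) (min d e)"
  proof -
    have "real n * \<delta> \<le> (real n + 1) * \<delta>" using \<delta>0 by (intro mult_right_mono) auto
    also have "\<dots> = min (\<eta> / 2) (min d e)" by (simp add: \<delta>_def)
    finally show ?thesis .
  qed
  show ?thesis
  proof (intro exI[of _ \<delta>] conjI allI impI \<delta>0)
    fix x' assume close: "\<forall>i\<in>{1..n}. \<forall>k. \<bar>x' i $ k - x i $ k\<bar> < \<delta>"
      and pat: "\<forall>i\<in>{1..n}. \<forall>j\<in>{1..n}. \<forall>k. x i $ k = x j $ k \<longrightarrow> x' i $ k = x' j $ k"
    \<comment> \<open>The new value at a node may be read off from any sample point with that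
      coordinate, because ties are preserved.\<close>
    define g where "g k p = x' (SOME i. i \<in> {1..n} \<and> x i $ k = p) $ k" for k p
    have g: "g k (x i $ k) = x' i $ k" if "i \<in> {1..n}" for i k
    proof -
      have "(SOME j. j \<in> {1..n} \<and> x j $ k = x i $ k) \<in> {1..n} \<and> x (SOME j. j \<in> {1..n} \<and> x j $ k = x i $ k) $ k = x i $ k"
        by (rule someI[of _ i]) (use that in auto)
      then show ?thesis using pat that unfolding g_def by blast
    qed
    have gP: "\<bar>g k p - p\<bar> \<le> \<delta>" if pP: "p \<in> P k" for k p
    proof -
      obtain i where i: "i \<in> {1..n}" "p = x i $ k" using pP unfolding P_def by blast
      then have "\<bar>x' i $ k - x i $ k\<bar> < \<delta>" using close by blast
      then show ?thesis unfolding i(2) g[OF i(1)] by simp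
    qed
    obtain l where l: "l \<in> time_changes" "\<And>k p. p \<in> P k \<Longrightarrow> l k (ereal p) = ereal (g k p)"
      "\<And>k t. l k t = t \<or> (\<exists>x y. t = ereal x \<and> l k t = ereal y \<and> \<bar>x - y\<bar> \<le> real n * \<delta>)"
      using time_change_exists[of P n \<eta> g \<delta>] Pfin Pcard \<eta>0 \<eta> gP \<delta>0 n\<delta> by (auto simp: less_imp_le)
    have sm: "strict_mono (l k)" for k using l(1) by (simp add: time_changes_def)
    show "skorokhod_dist (emp_path c n G x) (emp_path c n G x') \<le> e"
    proof (rule skorokhod_dist_le[OF less_imp_le[OF e] l(1)])
      fix t :: "ereal^'d" and k
      show "\<bar>ext_to_unit (l k (t $ k)) - ext_to_unit (t $ k)\<bar> \<le> e"
      proof (cases "l k (t $ k) = t $ k")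
        case True
        then show ?thesis using e by simp
      next
        case False
        then obtain u v where uv: "t $ k = ereal u" "l k (t $ k) = ereal v" "\<bar>u - v\<bar> \<le> real n * \<delta>" using l(3) by blast
        then show ?thesis using ext_to_unit_lipschitz[of v u] n\<delta> by (simp add: abs_minus_commute)
      qed
    next
      fix t :: "ereal^'d"
      have ind: "ext_le (x' i) (apply_tc l t) \<longleftrightarrow> ext_le (x i) t" if "i \<in> {1..n}" for i
      proof -
        have "ereal (x' i $ k) \<le> l k (t $ k) \<longleftrightarrow> ereal (x i $ k) \<le> t $ k" for k
        proof -
          have "l k (ereal (x i $ k)) = ereal (x' i $ k)" using l(2)[of "x i $ k" k] g[OF that] that by (simp add: P_def)
          then show ?thesis using strict_mono_less_eq[OF sm[of k]] by metis
        qed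
        then show ?thesis by (simp add: ext_le_def apply_tc_def)
      qed
      have Gd: "\<bar>G t - G (apply_tc l t)\<bar> \<le> e'"
      proof (rule d(2), intro allI)
        fix k
        show "apply_tc l t $ k = t $ k \<or> (\<exists>x y. t $ k = ereal x \<and> apply_tc l t $ k = ereal y \<and> \<bar>x - y\<bar> \<le> d)"
          using l(3)[where k=k and t="t $ k"] n\<delta> unfolding apply_tc_def by fastforce
      qed
      have "emp_path c n G x t - emp_path c n G x' (apply_tc l t) = c * (\<Sum>i=1..n. G (apply_tc l t) - G t)"
        unfolding emp_path_def right_diff_distrib[symmetric] sum_subtractf[symmetric]
        by (intro arg_cong[where f="(*) c"] sum.cong refl) (simp add: ind)
      also have "\<bar>\<dots>\<bar> = \<bar>c\<bar> * real n * \<bar>G t - G (apply_tc l t)\<bar>"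
        by (simp add: abs_mult abs_minus_commute)
      also have "\<dots> \<le> \<bar>c\<bar> * real n * e'" using Gd by (intro mult_left_mono) auto
      also have "\<dots> \<le> e" by (rule ce')
      finally show "\<bar>emp_path c n G x t - emp_path c n G x' (apply_tc l t)\<bar> \<le> e" .
    qed
  qed
qed

lemma measurable_D_borelI:
  assumes "\<And>\<omega>. \<omega> \<in> space M \<Longrightarrow> f \<omega> \<in> D_space" "\<And>V. D_open V \<Longrightarrow> {\<omega>\<in>space M. f \<omega> \<in> V} \<in> sets M"
  shows "f \<in> M \<rightarrow>\<^sub>M D_borel"
  unfolding D_borel_def
proof (rule measurable_measure_of)
  show "{U. D_open U} \<subseteq> Pow D_space" by (auto simp: D_open_def)
  show "f \<in> space M \<rightarrow> D_space" using assms(1) by auto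
  show "f -` V \<inter> space M \<in> sets M" if V: "V \<in> {U. D_open U}" for V
  proof -
    have eq: "f -` V \<inter> space M = {\<omega>\<in>space M. f \<omega> \<in> V}" by blast
    show ?thesis unfolding eq by (rule assms(2)) (rule CollectD[OF V])
  qed
qed

text \<open>There are finitely many tie patterns, each a measurable event. On one pattern, the
  samples whose path lies in an open \<open>V\<close> form the trace of an open subset of sample
  space, so the preimage is a finite union of measurable sets.\<close>

lemma emp_path_measurable:
  fixes G :: "ereal^'d::finite \<Rightarrow> real" and X :: "nat \<Rightarrow> 'a \<Rightarrow> real^'d"
  assumes X: "\<And>i. X i \<in> borel_measurable M" and Gc: "continuous_on UNIV G"
    and G: "\<And>e. 0 < e \<Longrightarrow> \<exists>d>0. \<forall>s t. (\<forall>k. s $ k = t $ k \<or> (\<exists>x y. t $ k = ereal x \<and> s $ k = ereal y \<and> \<bar>x - y\<bar> \<le> d)) \<longrightarrow> \<bar>G t - G s\<bar> \<le> e"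
  shows "(\<lambda>\<omega>. emp_path c n G (\<lambda>i. X i \<omega>)) \<in> M \<rightarrow>\<^sub>M D_borel"
proof (rule measurable_D_borelI)
  show "emp_path c n G (\<lambda>i. X i \<omega>) \<in> D_space" for \<omega> by (rule emp_path_cadlag[OF Gc])
  fix V :: "(ereal^'d \<Rightarrow> real) set" assume V: "D_open V"
  define pat where "pat x = {(i,j,k). i \<in> {1..n} \<and> j \<in> {1..n} \<and> x i $ k = x j $ k}" for x :: "nat \<Rightarrow> real^'d"
  define All where "All = {1..n} \<times> {1..n} \<times> (UNIV :: 'd set)"
  have patA: "pat x \<in> Pow All" for x by (auto simp: pat_def All_def)
  have "\<exists>\<delta>>0. \<forall>x'. (\<forall>i\<in>{1..n}. \<forall>k. \<bar>x' i $ k - x i $ k\<bar> < \<delta>) \<longrightarrow> pat x' = pat x \<longrightarrow> emp_path c n G x' \<in> V" if x: "emp_path c n G x \<in> V" for x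
  proof -
    obtain e where e: "e > 0" "\<And>y. y \<in> D_space \<Longrightarrow> skorokhod_dist (emp_path c n G x) y < e \<Longrightarrow> y \<in> V"
      using V x unfolding D_open_def by blast
    have "0 < e / 2" using e by simp
    obtain \<delta> where \<delta>: "0 < \<delta>" "\<And>x'. (\<forall>i\<in>{1..n}. \<forall>k. \<bar>x' i $ k - x i $ k\<bar> < \<delta>) \<Longrightarrow>
      (\<forall>i\<in>{1..n}. \<forall>j\<in>{1..n}. \<forall>k. x i $ k = x j $ k \<longrightarrow> x' i $ k = x' j $ k) \<Longrightarrow>
      skorokhod_dist (emp_path c n G x) (emp_path c n G x') \<le> e / 2"
      using emp_path_continuous_on_pattern[OF G \<open>0 < e / 2\<close>, of n x c] by blast
    show ?thesis
    proof (intro exI[of _ \<delta>] conjI allI impI \<delta>(1))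
      fix x' assume c: "\<forall>i\<in>{1..n}. \<forall>k. \<bar>x' i $ k - x i $ k\<bar> < \<delta>" and p: "pat x' = pat x"
      have "\<forall>i\<in>{1..n}. \<forall>j\<in>{1..n}. \<forall>k. x i $ k = x j $ k \<longrightarrow> x' i $ k = x' j $ k"
      proof (intro ballI allI impI)
        fix i j k assume "i \<in> {1..n}" "j \<in> {1..n}" "x i $ k = x j $ k"
        then have "(i,j,k) \<in> pat x'" unfolding p by (simp add: pat_def)
        then show "x' i $ k = x' j $ k" by (simp add: pat_def)
      qed
      from \<delta>(2)[OF c this] show "emp_path c n G x' \<in> V"
        using e(1) by (intro e(2) emp_path_cadlag[OF Gc]) linarith
    qed
  qed
  then obtain \<delta> where \<delta>: "\<And>x. emp_path c n G x \<in> V \<Longrightarrow> 0 < \<delta> x"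
    "\<And>x x'. emp_path c n G x \<in> V \<Longrightarrow> \<forall>i\<in>{1..n}. \<forall>k. \<bar>x' i $ k - x i $ k\<bar> < \<delta> x \<Longrightarrow> pat x' = pat x \<Longrightarrow> emp_path c n G x' \<in> V"
    by metis
  define B where "B x = {y :: nat \<Rightarrow> real^'d. \<forall>i\<in>{1..n}. \<forall>k. \<bar>y i $ k - x i $ k\<bar> < \<delta> x}" for x
  have Bopen: "open (B x)" for x
  proof -
    have "B x = (\<Inter>i\<in>{1..n}. \<Inter>k\<in>UNIV. {y. \<bar>y i $ k - x i $ k\<bar> < \<delta> x})" by (auto simp: B_def)
    moreover have "open {y :: nat \<Rightarrow> real^'d. \<bar>y i $ k - x i $ k\<bar> < \<delta> x}" for i k
    proof (rule open_Collect_less)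
      have "continuous_on UNIV (\<lambda>y :: nat \<Rightarrow> real^'d. y i)" by (rule continuous_on_product_coordinates)
      then show "continuous_on UNIV (\<lambda>y :: nat \<Rightarrow> real^'d. \<bar>y i $ k - x i $ k\<bar>)" by (intro continuous_intros)
    qed simp
    ultimately show ?thesis by (simp add: open_INT)
  qed
  \<comment> \<open>An arbitrary union of open boxes; its openness makes countability
    irrelevant.\<close>
  define Op where "Op E = (\<Union>x\<in>{x. pat x = E \<and> emp_path c n G x \<in> V}. B x)" for E
  have Oopen: "open (Op E)" for E unfolding Op_def using Bopen by auto
  have Xm: "(\<lambda>\<omega> i. X i \<omega>) \<in> borel_measurable M" by (rule measurable_coordinatewise_then_product) (rule X)
  have eq: "{\<omega>\<in>space M. emp_path c n G (\<lambda>i. X i \<omega>) \<in> V} =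
     (\<Union>E\<in>Pow All. {\<omega>\<in>space M. pat (\<lambda>i. X i \<omega>) = E} \<inter> ((\<lambda>\<omega> i. X i \<omega>) -` Op E \<inter> space M))"
  proof (intro set_eqI iffI)
    fix \<omega> assume w: "\<omega> \<in> {\<omega>\<in>space M. emp_path c n G (\<lambda>i. X i \<omega>) \<in> V}"
    let ?x = "\<lambda>i. X i \<omega>"
    have "?x \<in> B ?x" using \<delta>(1)[of ?x] w by (simp add: B_def)
    then have "?x \<in> Op (pat ?x)" using w by (auto simp: Op_def)
    then show "\<omega> \<in> (\<Union>E\<in>Pow All. {\<omega>\<in>space M. pat (\<lambda>i. X i \<omega>) = E} \<inter> ((\<lambda>\<omega> i. X i \<omega>) -` Op E \<inter> space M))"
      using w patA[of ?x] by blast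
  next
    fix \<omega> assume "\<omega> \<in> (\<Union>E\<in>Pow All. {\<omega>\<in>space M. pat (\<lambda>i. X i \<omega>) = E} \<inter> ((\<lambda>\<omega> i. X i \<omega>) -` Op E \<inter> space M))"
    then have w: "\<omega> \<in> space M" "(\<lambda>i. X i \<omega>) \<in> Op (pat (\<lambda>i. X i \<omega>))" by auto
    then obtain x where x: "pat x = pat (\<lambda>i. X i \<omega>)" "emp_path c n G x \<in> V" "(\<lambda>i. X i \<omega>) \<in> B x" by (auto simp: Op_def)
    have "emp_path c n G (\<lambda>i. X i \<omega>) \<in> V"
      by (rule \<delta>(2)[OF x(2)]) (use x in \<open>auto simp: B_def\<close>)
    then show "\<omega> \<in> {\<omega>\<in>space M. emp_path c n G (\<lambda>i. X i \<omega>) \<in> V}" using w by simp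
  qed
  have "{\<omega>\<in>space M. pat (\<lambda>i. X i \<omega>) = E} \<in> sets M" if "E \<in> Pow All" for E
  proof -
    have "{\<omega>\<in>space M. pat (\<lambda>i. X i \<omega>) = E} = {\<omega>\<in>space M. \<forall>q\<in>All. (X (fst q) \<omega> $ snd (snd q) = X (fst (snd q)) \<omega> $ snd (snd q)) = (q \<in> E)}"
    proof (intro Collect_cong conj_cong refl)
      fix \<omega>
      show "(pat (\<lambda>i. X i \<omega>) = E) = (\<forall>q\<in>All. (X (fst q) \<omega> $ snd (snd q) = X (fst (snd q)) \<omega> $ snd (snd q)) = (q \<in> E))"
        using that unfolding pat_def All_def set_eq_iff by fastforce
    qed
    moreover have "finite All" by (simp add: All_def)
    moreover have "{\<omega>\<in>space M. (X i \<omega> $ k = X j \<omega> $ k) = b} \<in> sets M" for i j k b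
    proof -
      have [measurable]: "(\<lambda>\<omega>. X i \<omega> $ k) \<in> borel_measurable M" for i k
        using borel_measurable_continuous_onI[of "\<lambda>x::real^'d. x $ k"] X[of i] by (intro measurable_compose[OF X]) (auto intro: continuous_intros)
      show ?thesis by measurable
    qed
    ultimately show ?thesis by (simp only:) (rule sets.sets_Collect_finite_All, auto)
  qed
  note pm = this
  show "{\<omega>\<in>space M. emp_path c n G (\<lambda>i. X i \<omega>) \<in> V} \<in> sets M"
    unfolding eq
  proof (rule sets.finite_UN)
    show "finite (Pow All)" by (simp add: All_def)
    show "{\<omega>\<in>space M. pat (\<lambda>i. X i \<omega>) = E} \<inter> ((\<lambda>\<omega> i. X i \<omega>) -` Op E \<inter> space M) \<in> sets M" if "E \<in> Pow All" for E
      by (rule sets.Int[OF pm[OF that] measurable_sets[OF Xm borel_open[OF Oopen]]])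
  qed
qed

subsection \<open>Weak convergence from finite grids\<close>

text \<open>The sup distance, truncated at 1 so that it is finite for arbitrary functions and
  bounded by a constant.\<close>

definition trunc_dist :: "('t \<Rightarrow> real) \<Rightarrow> ('t \<Rightarrow> real) \<Rightarrow> real" where
  "trunc_dist x y = (SUP t. min 1 \<bar>x t - y t\<bar>)"

lemma trunc_dist_bdd: "bdd_above (range (\<lambda>t. min 1 \<bar>x t - y t :: real\<bar>))"
  by (rule bdd_aboveI2[where M=1]) simp

lemma trunc_dist_upper: "min 1 \<bar>x t - y t\<bar> \<le> trunc_dist x y"
  unfolding trunc_dist_def by (rule cSUP_upper[OF UNIV_I trunc_dist_bdd])

lemma trunc_dist_least: "(\<And>t. min 1 \<bar>x t - y t\<bar> \<le> e) \<Longrightarrow> trunc_dist x y \<le> e"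
  unfolding trunc_dist_def by (rule cSUP_least) auto

lemma trunc_dist_nonneg: "0 \<le> trunc_dist x y"
  using trunc_dist_upper[of x undefined y] by linarith

lemma trunc_dist_le_1: "trunc_dist x y \<le> 1"
  by (rule trunc_dist_least) simp

lemma trunc_dist_le: "(\<And>t. \<bar>x t - y t\<bar> \<le> e) \<Longrightarrow> trunc_dist x y \<le> e"
  by (rule trunc_dist_least) (rule min.coboundedI2)

lemma trunc_dist_self: "trunc_dist x x = 0"
  by (rule antisym[OF trunc_dist_le trunc_dist_nonneg]) simp

lemma trunc_dist_commute: "trunc_dist x y = trunc_dist y x"
  unfolding trunc_dist_def by (subst abs_minus_commute) (rule refl)

lemma trunc_dist_triangle: "trunc_dist x z \<le> trunc_dist x y + trunc_dist y z"
proof (rule trunc_dist_least)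
  fix t
  have "min 1 \<bar>x t - z t\<bar> \<le> min 1 \<bar>x t - y t\<bar> + min 1 \<bar>y t - z t\<bar>" by linarith
  also have "\<dots> \<le> trunc_dist x y + trunc_dist y z" by (intro add_mono trunc_dist_upper)
  finally show "min 1 \<bar>x t - z t\<bar> \<le> trunc_dist x y + trunc_dist y z" .
qed

lemma trunc_dist_ge: "trunc_dist x y < 1 \<Longrightarrow> \<bar>x t - y t\<bar> \<le> trunc_dist x y"
  using trunc_dist_upper[of x t y] by linarith

text \<open>Lipschitz minorants for the sup distance; they reduce Skorokhod-continuous test functions to functionals of grid values.\<close>
definition inf_conv :: "('t \<Rightarrow> real) set \<Rightarrow> (('t \<Rightarrow> real) \<Rightarrow> real) \<Rightarrow> real \<Rightarrow> ('t \<Rightarrow> real) \<Rightarrow> real" where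
  "inf_conv D f m x = (INF y\<in>D. f y + m * trunc_dist x y)"

context
  fixes D :: "('t \<Rightarrow> real) set" and f :: "('t \<Rightarrow> real) \<Rightarrow> real" and B m :: real
  assumes D: "D \<noteq> {}" and f: "\<And>y. y \<in> D \<Longrightarrow> \<bar>f y\<bar> \<le> B" and m: "0 \<le> m"
begin

lemma inf_conv_lower: "y \<in> D \<Longrightarrow> inf_conv D f m x \<le> f y + m * trunc_dist x y"
proof -
  assume y: "y \<in> D"
  have "- B \<le> f y + m * trunc_dist x y" if y: "y \<in> D" for y
    using f[OF y] mult_nonneg_nonneg[OF m trunc_dist_nonneg, of x y] by linarith
  then have "bdd_below ((\<lambda>y. f y + m * trunc_dist x y) ` D)" by (intro bdd_belowI2)
  then show ?thesis unfolding inf_conv_def using y by (rule cINF_lower)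
qed

lemma inf_conv_greatest: "(\<And>y. y \<in> D \<Longrightarrow> c \<le> f y + m * trunc_dist x y) \<Longrightarrow> c \<le> inf_conv D f m x"
  unfolding inf_conv_def using D by (rule cINF_greatest)

lemma inf_conv_lipschitz1: "inf_conv D f m x - m * trunc_dist x x' \<le> inf_conv D f m x'"
proof (rule inf_conv_greatest)
  fix y assume "y \<in> D"
  then have "inf_conv D f m x \<le> f y + m * trunc_dist x y" by (rule inf_conv_lower)
  also have "\<dots> \<le> f y + m * (trunc_dist x x' + trunc_dist x' y)" by (intro add_left_mono mult_left_mono trunc_dist_triangle m)
  finally show "inf_conv D f m x - m * trunc_dist x x' \<le> f y + m * trunc_dist x' y" by (simp add: distrib_left)
qed

lemma inf_conv_lipschitz: "\<bar>inf_conv D f m x - inf_conv D f m x'\<bar> \<le> m * trunc_dist x x'"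
  using inf_conv_lipschitz1[of x x'] inf_conv_lipschitz1[of x' x] trunc_dist_commute[of x x'] by simp

lemma inf_conv_le: "x \<in> D \<Longrightarrow> inf_conv D f m x \<le> f x"
  using inf_conv_lower[of x x] by (simp add: trunc_dist_self)

lemma inf_conv_ge: "- B \<le> inf_conv D f m x"
proof (rule inf_conv_greatest)
  fix y assume "y \<in> D"
  then show "- B \<le> f y + m * trunc_dist x y"
    using f[of y] mult_nonneg_nonneg[OF m trunc_dist_nonneg, of x y] by linarith
qed

lemma inf_conv_bound: "\<bar>inf_conv D f m x\<bar> \<le> B + m"
proof -
  obtain y where y: "y \<in> D" using D by blast
  have "inf_conv D f m x \<le> f y + m * trunc_dist x y" by (rule inf_conv_lower[OF y])
  also have "\<dots> \<le> B + m * 1" using f[OF y] by (intro add_mono mult_left_mono trunc_dist_le_1 m) auto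
  finally show ?thesis using inf_conv_ge[of x] m by linarith
qed

end

lemma zero_in_D: "(\<lambda>_. 0) \<in> D_space"
  by (simp add: D_space_def cadlag_const)

text \<open>A competitor \<open>y\<close> in the infimum is either close to \<open>x\<close> in sup
  distance, hence also in Skorokhod distance, and then f y is near f x; or it pays a penalty that
  exceeds the oscillation 2 B of \<open>f\<close> once \<open>m\<close> is large.\<close>

lemma inf_conv_tendsto:
  fixes f :: "(ereal^'d::finite \<Rightarrow> real) \<Rightarrow> real"
  assumes B: "\<And>y. y \<in> D_space \<Longrightarrow> \<bar>f y\<bar> \<le> B" and x: "x \<in> D_space"
    and c: "\<And>e. 0 < e \<Longrightarrow> \<exists>d>0. \<forall>y\<in>D_space. skorokhod_dist x y < d \<longrightarrow> \<bar>f y - f x\<bar> < e"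
  shows "(\<lambda>m. inf_conv D_space f (real m) x) \<longlonglongrightarrow> f x"
proof (rule LIMSEQ_I)
  have D: "(D_space :: (ereal^'d \<Rightarrow> real) set) \<noteq> {}" using zero_in_D by blast
  fix e :: real assume e: "0 < e"
  then have "0 < e / 2" by simp
  from c[OF this] obtain d where d: "d > 0" "\<And>y. y \<in> D_space \<Longrightarrow> skorokhod_dist x y < d \<Longrightarrow> \<bar>f y - f x\<bar> < e / 2" by blast
  define d' where "d' = min 1 d / 2"
  have d': "0 < d'" "d' < 1" "d' < d" using d(1) by (auto simp: d'_def)
  obtain m0 :: nat where m0: "2 * B / d' < real m0" using reals_Archimedean2 by blast
  show "\<exists>no. \<forall>n\<ge>no. norm (inf_conv D_space f (real n) x - f x) < e"
  proof (intro exI allI impI)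
    fix m assume "m0 \<le> m"
    then have "2 * B / d' < real m" using m0 by linarith
    then have m: "2 * B < real m * d'" using d'(1) by (simp only: pos_divide_less_eq)
    have "f x - e / 2 \<le> inf_conv D_space f (real m) x"
    proof (rule inf_conv_greatest[OF D])
      fix y :: "ereal^'d \<Rightarrow> real" assume y: "y \<in> D_space"
      show "f x - e / 2 \<le> f y + real m * trunc_dist x y"
      proof (cases "trunc_dist x y < d'")
        case True
        have "skorokhod_dist x y \<le> trunc_dist x y"
          by (rule skorokhod_dist_le_sup) (rule trunc_dist_ge, use True d'(2) in linarith)
        then have "\<bar>f y - f x\<bar> < e / 2" using True d'(3) by (intro d(2)[OF y]) linarith
        moreover have "0 \<le> real m * trunc_dist x y" by (simp add: trunc_dist_nonneg)
        ultimately show ?thesis by linarith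
      next
        case False
        then have "real m * d' \<le> real m * trunc_dist x y" by (intro mult_left_mono) auto
        then show ?thesis using m B[OF y] B[OF x] e by linarith
      qed
    qed (use B in auto)
    moreover have "inf_conv D_space f (real m) x \<le> f x"
      by (rule inf_conv_le[OF D B _ x]) auto
    ultimately show "norm (inf_conv D_space f (real m) x - f x) < e" using e unfolding real_norm_def by linarith
  qed
qed

lemma D_bcont_measurable:
  fixes f :: "(ereal^'d::finite \<Rightarrow> real) \<Rightarrow> real"
  assumes "D_bcont f"
  shows "f \<in> borel_measurable D_borel"
proof -
  have sub: "{U :: (ereal^'d \<Rightarrow> real) set. D_open U} \<subseteq> Pow D_space" by (auto simp: D_open_def)
  have sp: "space (D_borel :: (ereal^'d \<Rightarrow> real) measure) = D_space" unfolding D_borel_def by (rule space_measure_of[OF sub])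
  have "{w \<in> space D_borel. a < f w} \<in> sets D_borel" for a
  proof -
    have "D_open {w \<in> D_space. a < f w}"
      unfolding D_open_def
    proof (intro conjI ballI)
      fix x assume x: "x \<in> {w \<in> D_space. a < f w}"
      then have "0 < f x - a" by simp
      then obtain d where d: "d > 0" "\<And>y. y \<in> D_space \<Longrightarrow> skorokhod_dist x y < d \<Longrightarrow> \<bar>f y - f x\<bar> < f x - a"
        using assms x unfolding D_bcont_def by blast
      show "\<exists>e>0. \<forall>y\<in>D_space. skorokhod_dist x y < e \<longrightarrow> y \<in> {w \<in> D_space. a < f w}"
      proof (intro exI[of _ d] conjI ballI impI d(1))
        fix y assume "y \<in> D_space" "skorokhod_dist x y < d"
        with d(2)[OF this] show "y \<in> {w \<in> D_space. a < f w}" by simp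
      qed
    qed simp
    then show ?thesis unfolding sp unfolding D_borel_def sets_measure_of[OF sub] by (intro sigma_sets.Basic) simp
  qed
  then show ?thesis by (simp add: borel_measurable_iff_greater)
qed

lemma D_bcont_uminus: "D_bcont f \<Longrightarrow> D_bcont (\<lambda>x. - f x)"
  unfolding D_bcont_def by (simp add: abs_minus_commute)

text \<open>A criterion for weak convergence by discretisation: paths are close, uniformly in
  \<open>t\<close> and in mean, to step functions of finitely many grid values. The error is stated
  through an integrable majorant \<open>R\<close>, since the supremum over all \<open>t\<close> need
  not be known to be measurable. The pathwise rate on \<open>S\<close> serves a different purpose:
  it makes functionals of \<open>W\<close> limits of functionals of grid values, hence
  measurable.\<close>

locale grid_approximation = M: prob_space M + N: prob_space N
  for M :: "'a measure" and N :: "'b measure" +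
  fixes U :: "nat \<Rightarrow> 'a \<Rightarrow> ereal^'d::finite \<Rightarrow> real" and W :: "'b \<Rightarrow> ereal^'d \<Rightarrow> real"
    and a :: "nat \<Rightarrow> ereal^'d \<Rightarrow> 'i" and A :: "nat \<Rightarrow> 'i set"
    and Y :: "nat \<Rightarrow> nat \<Rightarrow> 'a \<Rightarrow> 'i \<Rightarrow> real" and Z :: "nat \<Rightarrow> 'b \<Rightarrow> 'i \<Rightarrow> real"
    and S :: "'b set" and \<rho> :: "nat \<Rightarrow> real"
  assumes U_meas: "\<And>n. U n \<in> M \<rightarrow>\<^sub>M D_borel"
    and W_cont: "\<And>\<omega>. continuous_on UNIV (W \<omega>)"
    and A_fin: "\<And>k. finite (A k)" and aA: "\<And>k t. a k t \<in> A k"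
    and U_approx: "\<And>k. \<forall>\<^sub>F n in sequentially. \<exists>R. integrable M R \<and> (\<forall>\<omega>\<in>space M. \<forall>t. \<bar>U n \<omega> t - Y k n \<omega> (a k t)\<bar> \<le> R \<omega>) \<and> M.expectation R \<le> \<rho> k"
    and W_approx: "\<And>k. \<exists>R. integrable N R \<and> (AE \<omega> in N. \<forall>t. \<bar>W \<omega> t - Z k \<omega> (a k t)\<bar> \<le> R \<omega>) \<and> N.expectation R \<le> \<rho> k"
    and \<rho>: "\<rho> \<longlonglongrightarrow> 0"
    and S: "S \<in> sets N" and W_off: "\<And>\<omega>. \<omega> \<notin> S \<Longrightarrow> W \<omega> = (\<lambda>_. 0)"
    and W_on: "\<And>\<omega>. \<omega> \<in> S \<Longrightarrow> \<exists>c. c \<longlonglongrightarrow> 0 \<and> (\<forall>k t. \<bar>W \<omega> t - Z k \<omega> (a k t)\<bar> \<le> c k)"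
    and Y_meas: "\<And>k n \<Phi> L K. (\<And>x y. \<bar>\<Phi> x - \<Phi> y\<bar> \<le> L * (\<Sum>i\<in>A k. \<bar>x i - y i\<bar>)) \<Longrightarrow> (\<And>x. \<bar>\<Phi> x\<bar> \<le> K) \<Longrightarrow> (\<lambda>\<omega>. \<Phi> (Y k n \<omega>)) \<in> borel_measurable M"
    and Z_meas: "\<And>k \<Phi> L K. (\<And>x y. \<bar>\<Phi> x - \<Phi> y\<bar> \<le> L * (\<Sum>i\<in>A k. \<bar>x i - y i\<bar>)) \<Longrightarrow> (\<And>x. \<bar>\<Phi> x\<bar> \<le> K) \<Longrightarrow> (\<lambda>\<omega>. \<Phi> (Z k \<omega>)) \<in> borel_measurable N"
    and fidi: "\<And>k \<Phi> L K. (\<And>x y. \<bar>\<Phi> x - \<Phi> y\<bar> \<le> L * (\<Sum>i\<in>A k. \<bar>x i - y i\<bar>)) \<Longrightarrow> (\<And>x. \<bar>\<Phi> x\<bar> \<le> K) \<Longrightarrow>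
       (\<lambda>n. M.expectation (\<lambda>\<omega>. \<Phi> (Y k n \<omega>))) \<longlonglongrightarrow> N.expectation (\<lambda>\<omega>. \<Phi> (Z k \<omega>))"
begin

lemma W_in_D: "W \<omega> \<in> D_space"
  using cadlag_continuous[OF W_cont] by (simp add: D_space_def)

context
  fixes \<Psi> :: "(ereal^'d \<Rightarrow> real) \<Rightarrow> real" and L K :: real
  assumes lip: "\<And>x y. \<bar>\<Psi> x - \<Psi> y\<bar> \<le> L * trunc_dist x y" and L: "0 \<le> L" and bd: "\<And>x. \<bar>\<Psi> x\<bar> \<le> K"
begin

lemma step_lip: "\<bar>\<Psi> (\<lambda>t. x (a k t)) - \<Psi> (\<lambda>t. y (a k t))\<bar> \<le> L * (\<Sum>i\<in>A k. \<bar>x i - y i\<bar>)"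
proof -
  have "trunc_dist (\<lambda>t. x (a k t)) (\<lambda>t. y (a k t)) \<le> (\<Sum>i\<in>A k. \<bar>x i - y i\<bar>)"
    by (rule trunc_dist_le) (rule member_le_sum[of "a k t" "A k" "\<lambda>i. \<bar>x i - y i\<bar>" for t, OF aA _ A_fin], simp)
  then show ?thesis by (rule order_trans[OF lip mult_left_mono[OF _ L]])
qed

lemma step_Z_meas: "(\<lambda>\<omega>. \<Psi> (\<lambda>t. Z k \<omega> (a k t))) \<in> borel_measurable N"
  by (rule Z_meas[of "\<lambda>x. \<Psi> (\<lambda>t. x (a k t))" L k K]) (rule step_lip, rule bd)

text \<open>On \<open>S\<close> the step functions converge to \<open>W\<close> uniformly, so \<Psi>
  of the path is a pointwise limit of measurable functions; off \<open>S\<close> it is a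
  constant.\<close>

lemma lipschitz_W_meas: "(\<lambda>\<omega>. \<Psi> (W \<omega>)) \<in> borel_measurable N"
proof (rule borel_measurable_LIMSEQ_real[where u="\<lambda>k \<omega>. if \<omega> \<in> S then \<Psi> (\<lambda>t. Z k \<omega> (a k t)) else \<Psi> (\<lambda>_. 0)"])
  show "(\<lambda>\<omega>. if \<omega> \<in> S then \<Psi> (\<lambda>t. Z k \<omega> (a k t)) else \<Psi> (\<lambda>_. 0)) \<in> borel_measurable N" for k
  proof (rule measurable_If_set[OF step_Z_meas])
    show "S \<inter> space N \<in> sets N" using S by (rule sets.Int) simp
  qed simp
  fix \<omega>
  show "(\<lambda>k. if \<omega> \<in> S then \<Psi> (\<lambda>t. Z k \<omega> (a k t)) else \<Psi> (\<lambda>_. 0)) \<longlonglongrightarrow> \<Psi> (W \<omega>)"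
  proof (cases "\<omega> \<in> S")
    case True
    obtain c where c: "c \<longlonglongrightarrow> 0" "\<And>k t. \<bar>W \<omega> t - Z k \<omega> (a k t)\<bar> \<le> c k" using W_on[OF True] by blast
    have "\<bar>\<Psi> (\<lambda>t. Z k \<omega> (a k t)) - \<Psi> (W \<omega>)\<bar> \<le> L * c k" for k
    proof -
      have "trunc_dist (W \<omega>) (\<lambda>t. Z k \<omega> (a k t)) \<le> c k" by (rule trunc_dist_le) (rule c(2))
      then have "L * trunc_dist (W \<omega>) (\<lambda>t. Z k \<omega> (a k t)) \<le> L * c k" using L by (rule mult_left_mono)
      then show ?thesis using lip[of "W \<omega>" "\<lambda>t. Z k \<omega> (a k t)"] by (simp add: abs_minus_commute)
    qed
    moreover have "(\<lambda>k. L * c k) \<longlonglongrightarrow> 0" using tendsto_mult_left[OF c(1), of L] by simp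
    ultimately have "(\<lambda>k. \<Psi> (\<lambda>t. Z k \<omega> (a k t)) - \<Psi> (W \<omega>)) \<longlonglongrightarrow> 0"
      using Lim_null_comparison[of "\<lambda>k. \<Psi> (\<lambda>t. Z k \<omega> (a k t)) - \<Psi> (W \<omega>)" "\<lambda>k. L * c k" sequentially]
      unfolding real_norm_def by (meson always_eventually)
    from LIM_zero_cancel[OF this] show ?thesis using True by simp
  qed (simp add: W_off)
qed

lemma step_Z_close: "\<bar>N.expectation (\<lambda>\<omega>. \<Psi> (\<lambda>t. Z k \<omega> (a k t))) - N.expectation (\<lambda>\<omega>. \<Psi> (W \<omega>))\<bar> \<le> L * \<rho> k"
proof -
  obtain R where R: "integrable N R" "AE \<omega> in N. \<forall>t. \<bar>W \<omega> t - Z k \<omega> (a k t)\<bar> \<le> R \<omega>" "N.expectation R \<le> \<rho> k"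
    using W_approx by blast
  have i1: "integrable N (\<lambda>\<omega>. \<Psi> (\<lambda>t. Z k \<omega> (a k t)))" by (rule N.integrable_const_bound[where B=K]) (rule AE_I2, unfold real_norm_def, rule bd, rule step_Z_meas)
  have i2: "integrable N (\<lambda>\<omega>. \<Psi> (W \<omega>))" by (rule N.integrable_const_bound[where B=K]) (rule AE_I2, unfold real_norm_def, rule bd, rule lipschitz_W_meas)
  have "\<bar>N.expectation (\<lambda>\<omega>. \<Psi> (\<lambda>t. Z k \<omega> (a k t))) - N.expectation (\<lambda>\<omega>. \<Psi> (W \<omega>))\<bar> = \<bar>N.expectation (\<lambda>\<omega>. \<Psi> (\<lambda>t. Z k \<omega> (a k t)) - \<Psi> (W \<omega>))\<bar>"
    using i1 i2 by simp
  also have "\<dots> \<le> N.expectation (\<lambda>\<omega>. \<bar>\<Psi> (\<lambda>t. Z k \<omega> (a k t)) - \<Psi> (W \<omega>)\<bar>)" by (rule integral_abs_bound)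
  also have "\<dots> \<le> N.expectation (\<lambda>\<omega>. L * R \<omega>)"
  proof (rule integral_mono_AE)
    show "AE \<omega> in N. \<bar>\<Psi> (\<lambda>t. Z k \<omega> (a k t)) - \<Psi> (W \<omega>)\<bar> \<le> L * R \<omega>"
      using R(2)
    proof eventually_elim
      case (elim \<omega>)
      have "trunc_dist (W \<omega>) (\<lambda>t. Z k \<omega> (a k t)) \<le> R \<omega>" by (rule trunc_dist_le) (use elim in blast)
      then have "L * trunc_dist (W \<omega>) (\<lambda>t. Z k \<omega> (a k t)) \<le> L * R \<omega>" using L by (rule mult_left_mono)
      then show ?case using lip[of "W \<omega>" "\<lambda>t. Z k \<omega> (a k t)"] by (simp add: abs_minus_commute)
    qed
  qed (use i1 i2 R(1) in auto)
  also have "\<dots> = L * N.expectation R" by simp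
  also have "\<dots> \<le> L * \<rho> k" by (rule mult_left_mono[OF R(3) L])
  finally show ?thesis .
qed

end

text \<open>The Skorokhod distance is dominated by the sup distance, so a Skorokhod-open set
  contains a sup ball around each of its points. Hence \<open>W\<close> lies in \<open>V\<close>
  exactly if its sup distance to the complement is positive, and that distance is a Lipschitz
  functional of the path.\<close>

lemma W_meas: "W \<in> N \<rightarrow>\<^sub>M D_borel"
proof (rule measurable_D_borelI)
  show "W \<omega> \<in> D_space" for \<omega> by (rule W_in_D)
  fix V :: "(ereal^'d \<Rightarrow> real) set" assume V: "D_open V"
  show "{\<omega>\<in>space N. W \<omega> \<in> V} \<in> sets N"
  proof (cases "D_space - V = {}")
    case True
    then have "{\<omega>\<in>space N. W \<omega> \<in> V} = space N" using W_in_D by blast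
    then show ?thesis by simp
  next
    case False
    \<comment> \<open>The minorant of the zero function with slope 1 is the truncated sup distance
      to the complement of \<open>V\<close>.\<close>
    define \<Psi> where "\<Psi> x = inf_conv (D_space - V) (\<lambda>_. 0) 1 x" for x
    have "\<bar>\<Psi> x - \<Psi> y\<bar> \<le> 1 * trunc_dist x y" for x y unfolding \<Psi>_def by (rule inf_conv_lipschitz[OF False, where B=0]) auto
    moreover have "\<bar>\<Psi> x\<bar> \<le> 0 + 1" for x unfolding \<Psi>_def by (rule inf_conv_bound[OF False]) auto
    ultimately have m: "(\<lambda>\<omega>. \<Psi> (W \<omega>)) \<in> borel_measurable N" by (intro lipschitz_W_meas[of \<Psi> 1 1]) auto
    have "W \<omega> \<in> V \<longleftrightarrow> 0 < \<Psi> (W \<omega>)" for \<omega>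
    proof
      assume "W \<omega> \<in> V"
      then obtain e where e: "e > 0" "\<And>y. y \<in> D_space \<Longrightarrow> skorokhod_dist (W \<omega>) y < e \<Longrightarrow> y \<in> V" using V unfolding D_open_def by blast
      have "min (1/2) (e / 2) \<le> \<Psi> (W \<omega>)"
        unfolding \<Psi>_def
      proof (rule inf_conv_greatest[OF False, where B=0])
        fix y assume y: "y \<in> D_space - V"
        show "min (1/2) (e / 2) \<le> 0 + 1 * trunc_dist (W \<omega>) y"
        proof (rule ccontr)
          assume "\<not> min (1/2) (e / 2) \<le> 0 + 1 * trunc_dist (W \<omega>) y"
          then have s: "trunc_dist (W \<omega>) y < 1" "trunc_dist (W \<omega>) y < e" using e(1) by auto
          have "skorokhod_dist (W \<omega>) y \<le> trunc_dist (W \<omega>) y" by (rule skorokhod_dist_le_sup) (rule trunc_dist_ge[OF s(1)])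
          then have "y \<in> V" using s(2) y by (intro e(2)) auto
          then show False using y by blast
        qed
      qed auto
      then show "0 < \<Psi> (W \<omega>)" using e(1) by linarith
    next
      assume p: "0 < \<Psi> (W \<omega>)"
      show "W \<omega> \<in> V"
      proof (rule ccontr)
        assume "W \<omega> \<notin> V"
        then have "W \<omega> \<in> D_space - V" using W_in_D by blast
        then have "\<Psi> (W \<omega>) \<le> 0" unfolding \<Psi>_def by (rule inf_conv_le[OF False, where B=0, rotated 2]) auto
        then show False using p by linarith
      qed
    qed
    then have "{\<omega>\<in>space N. W \<omega> \<in> V} = {\<omega>\<in>space N. 0 < \<Psi> (W \<omega>)}" by blast
    also have "\<dots> \<in> sets N" using m by measurable
    finally show ?thesis .
  qed
qed

text \<open>One half of weak convergence. Lipschitz minorants of \<open>f\<close> can be transferred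
  from \<open>U n\<close> to grid values and from there to \<open>W\<close>; monotone approximation
  from below suffices for a lower bound. The other half follows by applying this to the negative of
  \<open>f\<close>.\<close>

lemma D_bcont_liminf:
  assumes f: "D_bcont f" and e: "0 < e"
  shows "\<forall>\<^sub>F n in sequentially. N.expectation (\<lambda>\<omega>. f (W \<omega>)) - e \<le> M.expectation (\<lambda>\<omega>. f (U n \<omega>))"
proof -
  have D: "(D_space :: (ereal^'d \<Rightarrow> real) set) \<noteq> {}" using zero_in_D by blast
  obtain B where B: "\<And>y. y \<in> D_space \<Longrightarrow> \<bar>f y\<bar> \<le> B" using f unfolding D_bcont_def by blast
  have e4: "0 < e / 4" using e by simp
  define g where "g m = inf_conv D_space f (real m)" for m :: nat
  have glip: "\<bar>g m x - g m y\<bar> \<le> real m * trunc_dist x y" for m x y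
    unfolding g_def by (rule inf_conv_lipschitz[OF D B]) auto
  have gbd: "\<bar>g m x\<bar> \<le> B + real m" for m x unfolding g_def by (rule inf_conv_bound[OF D B]) auto
  have gle: "g m x \<le> f x" if "x \<in> D_space" for m x unfolding g_def by (rule inf_conv_le[OF D B _ that]) auto
  have gge: "- B \<le> g m x" for m x unfolding g_def by (rule inf_conv_ge[OF D B]) auto
  have gm: "(\<lambda>\<omega>. g m (W \<omega>)) \<in> borel_measurable N" for m by (rule lipschitz_W_meas[OF glip _ gbd]) simp
  have fW: "(\<lambda>\<omega>. f (W \<omega>)) \<in> borel_measurable N" by (rule measurable_compose[OF W_meas D_bcont_measurable[OF f]])
  have fU: "(\<lambda>\<omega>. f (U n \<omega>)) \<in> borel_measurable M" for n by (rule measurable_compose[OF U_meas D_bcont_measurable[OF f]])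
  have UD: "U n \<omega> \<in> D_space" if "\<omega> \<in> space M" for n \<omega>
  proof -
    have "space (D_borel :: (ereal^'d \<Rightarrow> real) measure) = D_space" unfolding D_borel_def by (rule space_measure_of) (auto simp: D_open_def)
    then show ?thesis using measurable_space[OF U_meas that] by simp
  qed
  have "(\<lambda>m. N.expectation (\<lambda>\<omega>. g m (W \<omega>))) \<longlonglongrightarrow> N.expectation (\<lambda>\<omega>. f (W \<omega>))"
  proof (rule integral_dominated_convergence[where w="\<lambda>_. B"])
    show "AE \<omega> in N. (\<lambda>m. g m (W \<omega>)) \<longlonglongrightarrow> f (W \<omega>)"
      unfolding g_def by (rule AE_I2, rule inf_conv_tendsto[OF B W_in_D], assumption)
        (rule f[unfolded D_bcont_def, THEN conjunct2, rule_format, OF W_in_D])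
    show "AE \<omega> in N. norm (g m (W \<omega>)) \<le> B" for m
    proof (rule AE_I2)
      fix \<omega>
      have "f (W \<omega>) \<le> B" using B[OF W_in_D[of \<omega>]] by linarith
      then show "norm (g m (W \<omega>)) \<le> B" using gle[OF W_in_D[of \<omega>], of m] gge[of m "W \<omega>"] unfolding real_norm_def by linarith
    qed
  qed (use gm fW in auto)
  from LIMSEQ_D[OF this e4] obtain m where m: "\<bar>N.expectation (\<lambda>\<omega>. g m (W \<omega>)) - N.expectation (\<lambda>\<omega>. f (W \<omega>))\<bar> < e / 4"
    unfolding real_norm_def by blast
  \<comment> \<open>The slope \<open>m\<close> must be fixed before the level \<open>k\<close>,
    because it multiplies the discretisation error.\<close>
  have "(\<lambda>k. real m * \<rho> k) \<longlonglongrightarrow> 0" using tendsto_mult_left[OF \<rho>, of "real m"] by simp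
  from LIMSEQ_D[OF this e4] obtain k where k: "\<bar>real m * \<rho> k\<bar> < e / 4" unfolding real_norm_def diff_0_right by blast
  have zk: "\<bar>N.expectation (\<lambda>\<omega>. g m (\<lambda>t. Z k \<omega> (a k t))) - N.expectation (\<lambda>\<omega>. g m (W \<omega>))\<bar> \<le> real m * \<rho> k"
    by (rule step_Z_close[OF glip _ gbd]) simp
  have sl: "\<bar>g m (\<lambda>t. x (a k t)) - g m (\<lambda>t. y (a k t))\<bar> \<le> real m * (\<Sum>i\<in>A k. \<bar>x i - y i\<bar>)" for x y
    by (rule step_lip[OF glip _ gbd]) simp
  have lim: "(\<lambda>n. M.expectation (\<lambda>\<omega>. g m (\<lambda>t. Y k n \<omega> (a k t)))) \<longlonglongrightarrow> N.expectation (\<lambda>\<omega>. g m (\<lambda>t. Z k \<omega> (a k t)))"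
    by (rule fidi[of "\<lambda>x. g m (\<lambda>t. x (a k t))", OF sl gbd])
  have Ym: "(\<lambda>\<omega>. g m (\<lambda>t. Y k n \<omega> (a k t))) \<in> borel_measurable M" for n
    by (rule Y_meas[of "\<lambda>x. g m (\<lambda>t. x (a k t))", OF sl gbd])
  from tendstoD[OF lim e4] U_approx[of k] show ?thesis
  proof eventually_elim
    case (elim n)
    then obtain R where R: "integrable M R" "\<And>\<omega> t. \<omega> \<in> space M \<Longrightarrow> \<bar>U n \<omega> t - Y k n \<omega> (a k t)\<bar> \<le> R \<omega>" "M.expectation R \<le> \<rho> k" by blast
    have i1: "integrable M (\<lambda>\<omega>. g m (\<lambda>t. Y k n \<omega> (a k t)))"
      by (rule M.integrable_const_bound[where B="B + real m"]) (auto simp: gbd Ym)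
    have i2: "integrable M (\<lambda>\<omega>. f (U n \<omega>))"
    proof (rule M.integrable_const_bound[where B=B, OF _ fU])
      show "AE \<omega> in M. norm (f (U n \<omega>)) \<le> B" by (rule AE_I2) (simp add: B UD)
    qed
    have "M.expectation (\<lambda>\<omega>. g m (\<lambda>t. Y k n \<omega> (a k t)) - real m * R \<omega>) \<le> M.expectation (\<lambda>\<omega>. f (U n \<omega>))"
    proof (rule integral_mono)
      fix \<omega> assume w: "\<omega> \<in> space M"
      have "trunc_dist (\<lambda>t. Y k n \<omega> (a k t)) (U n \<omega>) \<le> R \<omega>"
        by (rule trunc_dist_le) (use R(2)[OF w] in \<open>simp add: abs_minus_commute\<close>)
      then have "real m * trunc_dist (\<lambda>t. Y k n \<omega> (a k t)) (U n \<omega>) \<le> real m * R \<omega>" by (rule mult_left_mono) simp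
      then show "g m (\<lambda>t. Y k n \<omega> (a k t)) - real m * R \<omega> \<le> f (U n \<omega>)"
        using glip[of m "\<lambda>t. Y k n \<omega> (a k t)" "U n \<omega>"] gle[OF UD[OF w, of n], of m] by linarith
    qed (use i1 i2 R(1) in auto)
    moreover have "M.expectation (\<lambda>\<omega>. g m (\<lambda>t. Y k n \<omega> (a k t)) - real m * R \<omega>) = M.expectation (\<lambda>\<omega>. g m (\<lambda>t. Y k n \<omega> (a k t))) - real m * M.expectation R"
      using i1 R(1) by simp
    moreover have "real m * M.expectation R \<le> real m * \<rho> k" using R(3) by (rule mult_left_mono) simp
    moreover have "\<bar>M.expectation (\<lambda>\<omega>. g m (\<lambda>t. Y k n \<omega> (a k t))) - N.expectation (\<lambda>\<omega>. g m (\<lambda>t. Z k \<omega> (a k t)))\<bar> < e / 4"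
      using elim(1) by (simp only: dist_real_def)
    ultimately show ?case using zk m k by linarith
  qed
qed

lemma D_bcont_tendsto:
  assumes f: "D_bcont f"
  shows "(\<lambda>n. M.expectation (\<lambda>\<omega>. f (U n \<omega>))) \<longlonglongrightarrow> N.expectation (\<lambda>\<omega>. f (W \<omega>))"
proof (rule tendstoI)
  fix e :: real assume e: "0 < e"
  then have e2: "0 < e / 2" by simp
  show "\<forall>\<^sub>F n in sequentially. dist (M.expectation (\<lambda>\<omega>. f (U n \<omega>))) (N.expectation (\<lambda>\<omega>. f (W \<omega>))) < e"
    using D_bcont_liminf[OF f e2] D_bcont_liminf[OF D_bcont_uminus[OF f] e2]
  proof eventually_elim
    case (elim n)
    then show ?case using e unfolding dist_real_def integral_minus by linarith
  qed
qed

end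

subsection \<open>Smoothed indicators on dyadic grids\<close>

definition clamp01 :: "real \<Rightarrow> real" where "clamp01 z = max 0 (min 1 z)"

lemma clamp01_range: "0 \<le> clamp01 z" "clamp01 z \<le> 1" by (auto simp: clamp01_def)

lemma clamp01_lipschitz: "\<bar>clamp01 x - clamp01 y\<bar> \<le> min 1 \<bar>x - y\<bar>" unfolding clamp01_def by linarith

lemma clamp01_1: "1 \<le> z \<Longrightarrow> clamp01 z = 1" and clamp01_0: "z \<le> 0 \<Longrightarrow> clamp01 z = 0"
  by (simp_all add: clamp01_def)

lemma min_1_le_powr:
  fixes z q :: real
  assumes "0 \<le> z" "0 \<le> q" "q \<le> 1"
  shows "min 1 z \<le> z powr q"
proof (cases "z < 1")
  case True
  then show ?thesis using powr_mono'[of q 1 z] assms by simp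
next
  case False
  then show ?thesis using ge_one_powr_ge_zero[of z q] assms by simp
qed

text \<open>The assumption \<open>exponent\<close> is the theorem's condition on \<theta> /
  \<alpha>, rearranged into the form in which the chaining sum needs it.\<close>

locale empirical_grid = weakly_dependent M X X' \<delta> r \<alpha> "2 * p"
  for M :: "'a measure" and X :: "nat \<Rightarrow> 'a \<Rightarrow> real^'d::finite" and X' \<delta> r \<alpha> p +
  fixes c \<theta> :: real
  assumes \<theta>_pos: "0 < \<theta>"
    and holder: "\<And>x y. \<bar>measure M {\<omega>\<in>space M. X 0 \<omega> \<le> x} - measure M {\<omega>\<in>space M. X 0 \<omega> \<le> y}\<bar> \<le> c * norm (x - y) powr \<theta>"
    and exponent: "real CARD('d) / real p < 1 / r - \<alpha> / \<theta>"
begin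

section \<open>Marginal distribution functions and the quantile scale\<close>

lemma coord_measurable [measurable]: "(\<lambda>\<omega>. X i \<omega> $ j) \<in> borel_measurable M"
  by (rule measurable_compose[OF X_meas]) (intro borel_measurable_continuous_onI continuous_intros)

definition Fm :: "'d \<Rightarrow> real \<Rightarrow> real" where
  "Fm j y = measure M {\<omega>\<in>space M. X 0 \<omega> $ j \<le> y}"

definition C1 :: real where "C1 = max 1 c"

lemma vec_le_sets: "{\<omega>\<in>space M. X 0 \<omega> \<le> x} \<in> sets M"
proof -
  have "{\<omega>\<in>space M. X 0 \<omega> \<le> x} = {\<omega>\<in>space M. \<forall>k\<in>UNIV. X 0 \<omega> $ k \<le> x $ k}" by (simp add: less_eq_vec_def)
  also have "\<dots> \<in> sets M" by measurable
  finally show ?thesis .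
qed

text \<open>Hoelder continuity is assumed for the joint distribution function only. Sending the
  other coordinates to infinity along a common sequence transfers it to the marginals, because two
  such arguments differ in coordinate \<open>j\<close> alone.\<close>

lemma marginal_limit:
  "(\<lambda>n. measure M {\<omega>\<in>space M. X 0 \<omega> \<le> (\<chi> i. if i = j then y else real n)}) \<longlonglongrightarrow> Fm j y"
proof -
  let ?A = "\<lambda>n. {\<omega>\<in>space M. X 0 \<omega> \<le> (\<chi> i. if i = j then y else real n)}"
  have "(\<Union>n. ?A n) = {\<omega>\<in>space M. X 0 \<omega> $ j \<le> y}"
  proof (intro set_eqI iffI)
    fix \<omega> assume "\<omega> \<in> (\<Union>n. ?A n)"
    then obtain n where w: "\<omega> \<in> space M" "X 0 \<omega> \<le> (\<chi> i. if i = j then y else real n)" by blast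
    then have "X 0 \<omega> $ j \<le> y" unfolding less_eq_vec_def by (auto dest: spec[of _ j])
    then show "\<omega> \<in> {\<omega>\<in>space M. X 0 \<omega> $ j \<le> y}" using w(1) by simp
  next
    fix \<omega> assume w: "\<omega> \<in> {\<omega>\<in>space M. X 0 \<omega> $ j \<le> y}"
    obtain n where n: "norm (X 0 \<omega>) \<le> real n" using real_arch_simple by blast
    have "X 0 \<omega> $ i \<le> real n" for i using component_le_norm_cart[of "X 0 \<omega>" i] n by linarith
    then have "\<omega> \<in> ?A n" using w by (simp add: less_eq_vec_def)
    then show "\<omega> \<in> (\<Union>n. ?A n)" by blast
  qed
  moreover have "(\<lambda>n. measure M (?A n)) \<longlonglongrightarrow> measure M (\<Union>n. ?A n)"
  proof (rule finite_Lim_measure_incseq)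
    show "range ?A \<subseteq> events" using vec_le_sets by blast
    show "incseq ?A"
    proof (rule incseq_SucI, rule subsetI)
      fix n \<omega> assume "\<omega> \<in> ?A n"
      then have w: "\<omega> \<in> space M" "X 0 \<omega> $ i \<le> (if i = j then y else real n)" for i
        by (auto simp: less_eq_vec_def dest: spec[of _ i])
      have "X 0 \<omega> $ i \<le> (if i = j then y else real (Suc n))" for i using w(2)[of i] by (simp split: if_splits)
      then show "\<omega> \<in> ?A (Suc n)" using w(1) by (simp add: less_eq_vec_def)
    qed
  qed
  ultimately show ?thesis unfolding Fm_def by simp
qed

lemma Fm_holder: "\<bar>Fm j y - Fm j z\<bar> \<le> C1 * \<bar>y - z\<bar> powr \<theta>"
proof -
  have "(\<lambda>n. \<bar>measure M {\<omega>\<in>space M. X 0 \<omega> \<le> (\<chi> i. if i = j then y else real n)} - measure M {\<omega>\<in>space M. X 0 \<omega> \<le> (\<chi> i. if i = j then z else real n)}\<bar>) \<longlonglongrightarrow> \<bar>Fm j y - Fm j z\<bar>"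
    by (intro tendsto_rabs tendsto_diff marginal_limit)
  moreover have "\<bar>measure M {\<omega>\<in>space M. X 0 \<omega> \<le> (\<chi> i. if i = j then y else real n)} - measure M {\<omega>\<in>space M. X 0 \<omega> \<le> (\<chi> i. if i = j then z else real n)}\<bar> \<le> C1 * \<bar>y - z\<bar> powr \<theta>" for n
  proof -
    have "(\<chi> i. if i = j then y else real n) - (\<chi> i. if i = j then z else real n) = (y - z) *\<^sub>R axis j 1"
      by (simp add: vec_eq_iff axis_def)
    then have "norm ((\<chi> i. if i = j then y else real n) - (\<chi> i. if i = j then z else real n)) = \<bar>y - z\<bar>"
      by (simp only: norm_scaleR norm_axis_1 mult_1_right)
    then show ?thesis using holder[of "\<chi> i. if i = j then y else real n" "\<chi> i. if i = j then z else real n"]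
        mult_right_mono[of c C1 "\<bar>y - z\<bar> powr \<theta>"] by (simp add: C1_def)
  qed
  ultimately show ?thesis by (intro LIMSEQ_le_const2) auto
qed

lemma Fm_cdf: "Fm j = cdf (distr M borel (\<lambda>\<omega>. X 0 \<omega> $ j))"
proof
  fix y
  have "(\<lambda>\<omega>. X 0 \<omega> $ j) -` {..y} \<inter> space M = {\<omega>\<in>space M. X 0 \<omega> $ j \<le> y}" by auto
  then show "Fm j y = cdf (distr M borel (\<lambda>\<omega>. X 0 \<omega> $ j)) y"
    unfolding Fm_def cdf_def by (subst measure_distr) auto
qed

lemma marginal_real_distribution: "real_distribution (distr M borel (\<lambda>\<omega>. X 0 \<omega> $ j))"
  by (rule real_distribution_distr) simp

lemma Fm_mono: "y \<le> z \<Longrightarrow> Fm j y \<le> Fm j z"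
  unfolding Fm_cdf using finite_borel_measure.cdf_nondecreasing[OF real_distribution.finite_borel_measure_M[OF marginal_real_distribution]] .

lemma Fm_range: "0 \<le> Fm j y" "Fm j y \<le> 1"
  unfolding Fm_def by (auto simp: prob_le_1)

lemma Fm_top: "(Fm j \<longlongrightarrow> 1) at_top"
  unfolding Fm_cdf by (rule real_distribution.cdf_lim_at_top_prob[OF marginal_real_distribution])

lemma Fm_bot: "(Fm j \<longlongrightarrow> 0) at_bot"
  unfolding Fm_cdf using finite_borel_measure.cdf_lim_at_bot[OF real_distribution.finite_borel_measure_M[OF marginal_real_distribution]] .

lemma Fm_continuous: "continuous_on S (Fm j)"
  unfolding continuous_on_def
proof
  fix x
  have "((\<lambda>y. C1 * \<bar>y - x\<bar> powr \<theta>) \<longlongrightarrow> C1 * \<bar>x - x\<bar> powr \<theta>) (at x within S)"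
    using \<theta>_pos by (intro tendsto_intros) auto
  then have "((\<lambda>y. C1 * \<bar>y - x\<bar> powr \<theta>) \<longlongrightarrow> 0) (at x within S)" by simp
  then have "((\<lambda>y. Fm j y - Fm j x) \<longlongrightarrow> 0) (at x within S)"
    by (rule Lim_null_comparison[rotated]) (intro always_eventually allI, unfold real_norm_def, rule Fm_holder)
  then show "(Fm j \<longlongrightarrow> Fm j x) (at x within S)" by (rule LIM_zero_cancel)
qed

lemma Fm_borel [measurable]: "Fm j \<in> borel_measurable borel"
  by (rule borel_measurable_continuous_onI[OF Fm_continuous])

lemma Fm_surj:
  assumes "0 < v" "v < 1"
  shows "\<exists>x. Fm j x = v"
proof -
  obtain x1 where x1: "Fm j x1 < v"
    using eventually_happens'[OF trivial_limit_at_bot_linorder order_tendstoD(2)[OF Fm_bot assms(1)]] by blast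
  obtain x2 where x2: "v < Fm j x2"
    using eventually_happens'[OF trivial_limit_at_top_linorder order_tendstoD(1)[OF Fm_top assms(2)]] by blast
  have "x1 \<le> x2"
  proof (rule ccontr)
    assume "\<not> x1 \<le> x2"
    then have "Fm j x2 \<le> Fm j x1" by (intro Fm_mono) simp
    then show False using x1 x2 by linarith
  qed
  then show ?thesis using IVT'[of "Fm j" x1 v x2] x1 x2 Fm_continuous by (auto simp: less_imp_le)
qed

text \<open>Probability integral transform: a continuous distribution function maps its variable to
  a uniform one. The truncation lets \<open>v\<close> be any real, including grid values outside
  [0, 1].\<close>

lemma Fm_prob_less: "prob {\<omega>\<in>space M. Fm j (X 0 \<omega> $ j) < v} \<le> max v 0"
proof -
  consider "v \<le> 0" | "1 \<le> v" | "0 < v" "v < 1" by linarith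
  then show ?thesis
  proof cases
    case 1
    have "\<not> Fm j y < v" for y using Fm_range(1)[of j y] 1 by linarith
    then have e: "{\<omega>\<in>space M. Fm j (X 0 \<omega> $ j) < v} = {}" by blast
    show ?thesis unfolding e by simp
  next
    case 2
    then show ?thesis using prob_le_1[of "{\<omega>\<in>space M. Fm j (X 0 \<omega> $ j) < v}"] by linarith
  next
    case 3
    obtain x where x: "Fm j x = v" using Fm_surj[OF 3] by blast
    have "prob {\<omega>\<in>space M. Fm j (X 0 \<omega> $ j) < v} \<le> prob {\<omega>\<in>space M. X 0 \<omega> $ j \<le> x}"
    proof (rule finite_measure_mono)
      show "{\<omega>\<in>space M. Fm j (X 0 \<omega> $ j) < v} \<subseteq> {\<omega>\<in>space M. X 0 \<omega> $ j \<le> x}"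
      proof (rule Collect_mono, rule impI, elim conjE, intro conjI)
        fix \<omega> assume "Fm j (X 0 \<omega> $ j) < v"
        then show "X 0 \<omega> $ j \<le> x" using Fm_mono[of x "X 0 \<omega> $ j" j] x by linarith
      qed
    qed measurable
    also have "\<dots> = v" using x by (simp add: Fm_def)
    finally show ?thesis by simp
  qed
qed

lemma Fm_prob_le: "min v 1 \<le> prob {\<omega>\<in>space M. Fm j (X 0 \<omega> $ j) \<le> v}"
proof -
  consider "v \<le> 0" | "1 \<le> v" | "0 < v" "v < 1" by linarith
  then show ?thesis
  proof cases
    case 1
    then show ?thesis using measure_nonneg[of M "{\<omega>\<in>space M. Fm j (X 0 \<omega> $ j) \<le> v}"] by linarith
  next
    case 2
    have "Fm j y \<le> v" for y using Fm_range(2)[of j y] 2 by linarith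
    then have "{\<omega>\<in>space M. Fm j (X 0 \<omega> $ j) \<le> v} = space M" by blast
    then show ?thesis using prob_space by simp
  next
    case 3
    obtain x where x: "Fm j x = v" using Fm_surj[OF 3] by blast
    have "v = prob {\<omega>\<in>space M. X 0 \<omega> $ j \<le> x}" using x by (simp add: Fm_def)
    also have "\<dots> \<le> prob {\<omega>\<in>space M. Fm j (X 0 \<omega> $ j) \<le> v}"
    proof (rule finite_measure_mono)
      show "{\<omega>\<in>space M. X 0 \<omega> $ j \<le> x} \<subseteq> {\<omega>\<in>space M. Fm j (X 0 \<omega> $ j) \<le> v}"
      proof (rule Collect_mono, rule impI, elim conjE, intro conjI)
        fix \<omega> assume "X 0 \<omega> $ j \<le> x"
        then show "Fm j (X 0 \<omega> $ j) \<le> v" using Fm_mono x by blast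
      qed
    qed measurable
    finally show ?thesis by simp
  qed
qed

lemma Fm_prob_strip:
  assumes "lo < hi"
  shows "prob {\<omega>\<in>space M. lo < Fm j (X 0 \<omega> $ j) \<and> Fm j (X 0 \<omega> $ j) < hi} \<le> hi - lo"
proof (cases "hi \<le> 0 \<or> 1 \<le> lo")
  case True
  have "\<not> (lo < Fm j y \<and> Fm j y < hi)" for y using Fm_range[of j y] True by linarith
  then have e: "{\<omega>\<in>space M. lo < Fm j (X 0 \<omega> $ j) \<and> Fm j (X 0 \<omega> $ j) < hi} = {}" by blast
  show ?thesis unfolding e using assms by simp
next
  case False
  let ?A = "{\<omega>\<in>space M. lo < Fm j (X 0 \<omega> $ j) \<and> Fm j (X 0 \<omega> $ j) < hi}"
  let ?B = "{\<omega>\<in>space M. Fm j (X 0 \<omega> $ j) \<le> lo}"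
  have "{\<omega>\<in>space M. Fm j (X 0 \<omega> $ j) < hi} = ?A \<union> ?B" using assms by fastforce
  moreover have "prob (?A \<union> ?B) = prob ?A + prob ?B" by (rule finite_measure_Union) auto
  ultimately have "prob ?A = prob {\<omega>\<in>space M. Fm j (X 0 \<omega> $ j) < hi} - prob ?B" by simp
  then show ?thesis using Fm_prob_less[of j hi] Fm_prob_le[of lo j] False by linarith
qed

lemma expectation_ident:
  fixes g :: "real^'d \<Rightarrow> real"
  assumes "g \<in> borel_measurable borel" "\<And>x. \<bar>g x\<bar> \<le> K"
  shows "expectation (\<lambda>\<omega>. g (X i \<omega>)) = expectation (\<lambda>\<omega>. g (X 0 \<omega>))"
  using stationary_real[of "{0::nat}" "\<lambda>_. g" K "\<lambda>_. 0" i] assms by simp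

text \<open>In coordinate \<open>j\<close> the factor is a ramp in the quantile scale: it equals 1
  up to \<open>(a j - 1) / 2 ^ k\<close>, 0 from \<open>a j / 2 ^ k\<close> on, and is linear in
  between.\<close>

definition \<psi> :: "nat \<Rightarrow> ('d \<Rightarrow> int) \<Rightarrow> real^'d \<Rightarrow> real" where
  "\<psi> k a x = (\<Prod>j\<in>UNIV. clamp01 (real_of_int (a j) - 2 ^ k * Fm j (x $ j)))"

lemma \<psi>_range: "0 \<le> \<psi> k a x" "\<psi> k a x \<le> 1"
  unfolding \<psi>_def by (auto intro: prod_nonneg prod_le_1 clamp01_range)

lemma \<psi>_diff: "\<bar>\<psi> k a x - \<psi> l b y\<bar> \<le> (\<Sum>j\<in>UNIV. \<bar>clamp01 (real_of_int (a j) - 2 ^ k * Fm j (x $ j)) - clamp01 (real_of_int (b j) - 2 ^ l * Fm j (y $ j))\<bar>)"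
proof -
  have "norm (\<psi> k a x - \<psi> l b y) \<le> (\<Sum>j\<in>UNIV. norm (clamp01 (real_of_int (a j) - 2 ^ k * Fm j (x $ j)) - clamp01 (real_of_int (b j) - 2 ^ l * Fm j (y $ j))))"
    unfolding \<psi>_def by (rule norm_prod_diff) (auto simp: clamp01_range)
  then show ?thesis by (simp only: real_norm_def)
qed

section \<open>Constants of a chaining level\<close>

definition dd :: real where "dd = real CARD('d)"
definition \<kappa> :: real where "\<kappa> = 1 / r - \<alpha> / \<theta>"
definition Lh :: "nat \<Rightarrow> real" where "Lh k = dd * (2 ^ k * C1) powr (\<alpha> / \<theta>)"
text \<open>The second argument makes \<open>Lk k\<close> dominate the Hoelder constants at both
  level k and level k + 1. The first one secures the lower bound on \<open>Bk\<close>.\<close>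

definition C2 :: real where "C2 = max 2 (dd * (2 * C1) powr (\<alpha> / \<theta>))"
definition Lk :: "nat \<Rightarrow> real" where "Lk k = C2 * 2 powr (real k * (\<alpha> / \<theta>))"
text \<open>An increment at level \<open>k\<close> vanishes unless some of the \<open>dd\<close>
  coordinates falls into a quantile strip of width \<open>7 / 2 ^ k\<close>.\<close>

definition \<pi>k :: "nat \<Rightarrow> real" where "\<pi>k k = min 1 (7 * dd / 2 ^ k)"

lemma dd_ge1: "1 \<le> dd" unfolding dd_def using one_le_card_finite[where 'a='d] by (simp add: Suc_leI)
lemma C1_ge1: "1 \<le> C1" by (simp add: C1_def)
lemma p_pos: "0 < p" using P_ge by simp
lemma ratio_bounds: "0 < \<alpha> / \<theta>" "\<alpha> / \<theta> < 1" "dd / real p < \<kappa>" "\<kappa> \<le> 1" "0 < \<kappa>"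
proof -
  show 1: "0 < \<alpha> / \<theta>" using \<alpha>_pos \<theta>_pos by simp
  show 2: "dd / real p < \<kappa>" using exponent by (simp add: dd_def \<kappa>_def)
  have r: "1 / r \<le> 1" using r_ge1 by simp
  show "0 < \<kappa>" using 2 dd_ge1 p_pos by (smt (verit) divide_pos_pos of_nat_0_less_iff)
  then show "\<alpha> / \<theta> < 1" "\<kappa> \<le> 1" using r 1 unfolding \<kappa>_def by linarith+
qed

text \<open>A ramp increment is bounded both by 1 and by its argument increment; as \<alpha> /
  \<theta> < 1, it is bounded by that increment to the power \<alpha> / \<theta>. This turns the
  \<theta>-Hoelder bound of the marginals into an \<alpha>-Hoelder bound, and the constant grows
  only like 2 powr (k \<alpha> / \<theta>).\<close>

lemma \<psi>_holder: "\<bar>\<psi> k a x - \<psi> k a y\<bar> \<le> Lh k * norm (x - y) powr \<alpha>"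
proof -
  have "\<bar>\<psi> k a x - \<psi> k a y\<bar> \<le> (\<Sum>j\<in>UNIV. \<bar>clamp01 (real_of_int (a j) - 2 ^ k * Fm j (x $ j)) - clamp01 (real_of_int (a j) - 2 ^ k * Fm j (y $ j))\<bar>)"
    by (rule \<psi>_diff)
  also have "\<dots> \<le> (\<Sum>j\<in>(UNIV :: 'd set). (2 ^ k * C1) powr (\<alpha> / \<theta>) * norm (x - y) powr \<alpha>)"
  proof (rule sum_mono)
    fix j :: 'd
    let ?u = "real_of_int (a j) - 2 ^ k * Fm j (x $ j)" and ?v = "real_of_int (a j) - 2 ^ k * Fm j (y $ j)"
    have "\<bar>?u - ?v\<bar> = 2 ^ k * \<bar>Fm j (x $ j) - Fm j (y $ j)\<bar>"
    proof -
      have "?u - ?v = 2 ^ k * (Fm j (y $ j) - Fm j (x $ j))" by (simp add: right_diff_distrib)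
      then show ?thesis by (simp add: abs_mult abs_minus_commute)
    qed
    also have "\<dots> \<le> 2 ^ k * (C1 * \<bar>x $ j - y $ j\<bar> powr \<theta>)" by (intro mult_left_mono Fm_holder) simp
    also have "\<dots> \<le> 2 ^ k * (C1 * norm (x - y) powr \<theta>)"
      using C1_ge1 \<theta>_pos component_le_norm_cart[of "x - y" j] by (intro mult_left_mono powr_mono2) auto
    finally have 1: "\<bar>?u - ?v\<bar> \<le> 2 ^ k * C1 * norm (x - y) powr \<theta>" by simp
    have "\<bar>clamp01 ?u - clamp01 ?v\<bar> \<le> min 1 \<bar>?u - ?v\<bar>" by (rule clamp01_lipschitz)
    also have "\<dots> \<le> \<bar>?u - ?v\<bar> powr (\<alpha> / \<theta>)" using ratio_bounds by (intro min_1_le_powr) auto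
    also have "\<dots> \<le> (2 ^ k * C1 * norm (x - y) powr \<theta>) powr (\<alpha> / \<theta>)" using 1 ratio_bounds by (intro powr_mono2) auto
    also have "\<dots> = (2 ^ k * C1) powr (\<alpha> / \<theta>) * norm (x - y) powr \<alpha>"
      using C1_ge1 \<theta>_pos by (simp add: powr_mult powr_powr)
    finally show "\<bar>clamp01 ?u - clamp01 ?v\<bar> \<le> (2 ^ k * C1) powr (\<alpha> / \<theta>) * norm (x - y) powr \<alpha>" .
  qed
  also have "\<dots> = Lh k * norm (x - y) powr \<alpha>" by (simp add: Lh_def dd_def)
  finally show ?thesis .
qed

lemma \<psi>_measurable [measurable]: "\<psi> k a \<in> borel_measurable borel"
  by (rule holder_measurable[of "\<psi> k a" "Lh k"]) (use \<psi>_holder in simp)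

lemma Lh_Lk: "Lh (Suc k) \<le> Lk k" "Lh k \<le> Lk k"
proof -
  have "Lh (Suc k) = dd * ((2 * C1) powr (\<alpha> / \<theta>) * (2 ^ k) powr (\<alpha> / \<theta>))"
    using C1_ge1 by (simp add: Lh_def powr_mult[symmetric] mult_ac)
  also have "(2 ^ k :: real) powr (\<alpha> / \<theta>) = 2 powr (real k * (\<alpha> / \<theta>))" by (simp add: powr_realpow[symmetric] powr_powr)
  also have "dd * ((2 * C1) powr (\<alpha> / \<theta>) * 2 powr (real k * (\<alpha> / \<theta>))) \<le> Lk k"
    unfolding Lk_def C2_def mult.assoc[symmetric] by (intro mult_right_mono) auto
  finally show 1: "Lh (Suc k) \<le> Lk k" .
  have "Lh k \<le> Lh (Suc k)" unfolding Lh_def using C1_ge1 dd_ge1 ratio_bounds by (intro mult_left_mono powr_mono2) auto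
  then show "Lh k \<le> Lk k" using 1 by linarith
qed

lemma two_powr_ge1: "1 \<le> 2 powr (real k * (\<alpha> / \<theta>))"
proof (rule ge_one_powr_ge_zero)
  show "0 \<le> real k * (\<alpha> / \<theta>)" using ratio_bounds(1) by (intro mult_nonneg_nonneg) auto
qed simp

lemma Lk_ge1: "1 \<le> Lk k"
proof -
  have "1 * 1 \<le> C2 * 2 powr (real k * (\<alpha> / \<theta>))"
    by (intro mult_mono two_powr_ge1) (auto simp: C2_def)
  then show ?thesis by (simp add: Lk_def)
qed

definition Bk :: "nat \<Rightarrow> real" where "Bk k = Lk k * \<pi>k k powr (1 / r)"

lemma Bk_upper: "Bk k \<le> C2 * (7 * dd) * 2 powr (- \<kappa> * real k)"
proof -
  have "\<pi>k k powr (1 / r) \<le> (7 * dd / 2 ^ k) powr (1 / r)" using r_ge1 dd_ge1 by (intro powr_mono2) (auto simp: \<pi>k_def)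
  also have "\<dots> = (7 * dd) powr (1 / r) * 2 powr (- (real k / r))"
  proof -
    have "((2::real) ^ k) powr (1 / r) = 2 powr (real k / r)" by (simp add: powr_realpow[symmetric] powr_powr)
    then show ?thesis using dd_ge1 by (simp add: powr_divide powr_minus_divide)
  qed
  also have "\<dots> \<le> (7 * dd) * 2 powr (- (real k / r))"
  proof (rule mult_right_mono)
    have "(7 * dd) powr (1 / r) \<le> (7 * dd) powr 1" using dd_ge1 r_ge1 by (intro powr_mono) auto
    then show "(7 * dd) powr (1 / r) \<le> 7 * dd" using dd_ge1 by simp
  qed simp
  finally have "Bk k \<le> (C2 * 2 powr (real k * (\<alpha> / \<theta>))) * ((7 * dd) * 2 powr (- (real k / r)))"
    unfolding Bk_def Lk_def by (rule mult_left_mono) (simp add: C2_def)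
  also have "\<dots> = C2 * (7 * dd) * (2 powr (real k * (\<alpha> / \<theta>)) * 2 powr (- (real k / r)))" by (simp only: mult_ac)
  also have "2 powr (real k * (\<alpha> / \<theta>)) * 2 powr (- (real k / r)) = 2 powr (- \<kappa> * real k)"
    unfolding powr_add[symmetric] \<kappa>_def by (simp add: algebra_simps)
  finally show ?thesis .
qed

text \<open>This secures the threshold n L \<pi> powr (1 / r) \<ge> 1 of the moment bound at every
  level with \<open>2 ^ k \<le> 2 * n\<close>, which is as far as the empirical process is
  chained.\<close>

lemma Bk_lower: "2 / 2 ^ k \<le> Bk k"
proof -
  have q: "0 < 1 / (2::real) ^ k" "1 / (2::real) ^ k \<le> 1" by auto
  have "1 / 2 ^ k \<le> \<pi>k k" using dd_ge1 by (simp add: \<pi>k_def divide_right_mono)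
  then have "(1 / 2 ^ k) powr 1 \<le> \<pi>k k powr (1 / r)"
    using q r_ge1 powr_mono'[of "1/r" 1 "1 / 2 ^ k"] powr_mono2[of "1/r" "1 / 2 ^ k" "\<pi>k k"] by (auto intro: order_trans)
  then have 1: "1 / 2 ^ k \<le> \<pi>k k powr (1 / r)" by simp
  have "2 * 1 \<le> C2 * 2 powr (real k * (\<alpha> / \<theta>))"
    by (intro mult_mono two_powr_ge1) (auto simp: C2_def)
  then have "2 * (1 / 2 ^ k) \<le> Lk k * \<pi>k k powr (1 / r)" unfolding Lk_def using 1 by (intro mult_mono) auto
  then show ?thesis by (simp add: Bk_def)
qed

text \<open>Centering can double both the sup norm and the L1 norm; halving the function restores
  both bounds, and it also halves the Hoelder constant.\<close>

lemma admissible_center: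
  fixes g :: "real^'d \<Rightarrow> real"
  assumes g: "\<And>x y. \<bar>g x - g y\<bar> \<le> 2 * L * norm (x - y) powr \<alpha>" "\<And>x. \<bar>g x\<bar> \<le> 1"
    and \<pi>: "expectation (\<lambda>\<omega>. \<bar>g (X 0 \<omega>)\<bar>) \<le> \<pi>" "\<pi> \<le> 1" and L: "1 \<le> L"
  shows "admissible (\<lambda>x. (g x - expectation (\<lambda>\<omega>. g (X 0 \<omega>))) / 2) L \<pi>"
proof -
  have gm: "g \<in> borel_measurable borel" by (rule holder_measurable[of g "2 * L"], unfold real_norm_def, rule g(1))
  have gim: "(\<lambda>\<omega>. g (X i \<omega>)) \<in> borel_measurable M" for i by (rule measurable_compose[OF X_meas gm])
  have gi: "integrable M (\<lambda>\<omega>. g (X i \<omega>))" for i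
    by (rule bounded_integrable[OF gim, where B=1], unfold real_norm_def, rule g(2))
  have gai: "integrable M (\<lambda>\<omega>. \<bar>g (X i \<omega>)\<bar>)" for i by (rule integrable_abs[OF gi])
  have ga: "expectation (\<lambda>\<omega>. \<bar>g (X i \<omega>)\<bar>) = expectation (\<lambda>\<omega>. \<bar>g (X 0 \<omega>)\<bar>)" for i
    by (rule expectation_ident[of "\<lambda>x. \<bar>g x\<bar>" 1]) (simp_all add: gm g(2) borel_measurable_abs)
  define e where "e = expectation (\<lambda>\<omega>. g (X 0 \<omega>))"
  have e: "\<bar>e\<bar> \<le> expectation (\<lambda>\<omega>. \<bar>g (X 0 \<omega>)\<bar>)" unfolding e_def by (rule integral_abs_bound)
  then have e1: "\<bar>e\<bar> \<le> 1" using \<pi> by linarith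
  have ge: "expectation (\<lambda>\<omega>. g (X i \<omega>)) = e" for i unfolding e_def by (rule expectation_ident[OF gm g(2)])
  have lip: "\<bar>(g x - e) / 2 - (g y - e) / 2\<bar> \<le> L * norm (x - y) powr \<alpha>" for x y
  proof -
    have eq: "(g x - e) / 2 - (g y - e) / 2 = (g x - g y) / 2" by (simp add: diff_divide_distrib)
    have "\<bar>g x - g y\<bar> \<le> 2 * (L * norm (x - y) powr \<alpha>)" using g(1)[of x y] by (simp only: mult.assoc)
    then show ?thesis unfolding eq by simp
  qed
  have bd: "\<bar>(g x - e) / 2\<bar> \<le> 1" for x
  proof -
    have "\<bar>g x - e\<bar> \<le> 2" using abs_triangle_ineq4[of "g x" e] g(2)[of x] e1 by linarith
    then show ?thesis by simp
  qed
  have zero: "expectation (\<lambda>\<omega>. (g (X i \<omega>) - e) / 2) = 0" for i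
    using gi[of i] ge[of i] by (simp add: prob_space)
  have L1: "expectation (\<lambda>\<omega>. \<bar>(g (X i \<omega>) - e) / 2\<bar>) \<le> \<pi>" for i
  proof -
    have i1: "integrable M (\<lambda>\<omega>. \<bar>(g (X i \<omega>) - e) / 2\<bar>)" using gi[of i] by (intro integrable_abs) simp
    have i2: "integrable M (\<lambda>\<omega>. (\<bar>g (X i \<omega>)\<bar> + \<bar>e\<bar>) / 2)" using gai[of i] by simp
    have "expectation (\<lambda>\<omega>. \<bar>(g (X i \<omega>) - e) / 2\<bar>) \<le> expectation (\<lambda>\<omega>. (\<bar>g (X i \<omega>)\<bar> + \<bar>e\<bar>) / 2)"
    proof (rule integral_mono[OF i1 i2])
      show "\<bar>(g (X i \<omega>) - e) / 2\<bar> \<le> (\<bar>g (X i \<omega>)\<bar> + \<bar>e\<bar>) / 2" for \<omega>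
        using abs_triangle_ineq4[of "g (X i \<omega>)" e] by simp
    qed
    also have "\<dots> = (expectation (\<lambda>\<omega>. \<bar>g (X i \<omega>)\<bar>) + \<bar>e\<bar>) / 2" using gai[of i] by (simp add: prob_space)
    also have "\<dots> \<le> \<pi>"
    proof -
      have "expectation (\<lambda>\<omega>. \<bar>g (X i \<omega>)\<bar>) + \<bar>e\<bar> \<le> \<pi> + \<pi>"
        unfolding ga[of i] by (rule add_mono[OF \<pi>(1) order_trans[OF e \<pi>(1)]])
      then show ?thesis by simp
    qed
    finally show ?thesis .
  qed
  show ?thesis unfolding admissible_def e_def[symmetric] using lip bd zero L1 L \<pi>(2) by blast
qed

section \<open>Moments of normalised sums of level functions\<close>

definition esum :: "(real^'d \<Rightarrow> real) \<Rightarrow> nat \<Rightarrow> 'a \<Rightarrow> real" where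
  "esum g n \<omega> = (\<Sum>i\<in>{1..n}. g (X i \<omega>) - expectation (\<lambda>\<omega>. g (X 0 \<omega>))) / sqrt (real n)"

lemma esum_psum: "esum g n \<omega> = 2 * psum (\<lambda>x. (g x - expectation (\<lambda>\<omega>. g (X 0 \<omega>))) / 2) n \<omega> / sqrt (real n)"
  by (simp add: esum_def psum_def sum_divide_distrib[symmetric])

lemma esum_measurable: "g \<in> borel_measurable borel \<Longrightarrow> esum g n \<in> borel_measurable M"
  unfolding esum_def[abs_def] by (intro borel_measurable_divide borel_measurable_sum borel_measurable_diff measurable_compose[OF X_meas]) auto

text \<open>The regularity and size of an increment between neighbouring grid functions. The factor
  2 stems from taking a difference and is undone by the halving in
  \<open>admissible_center\<close>.\<close>

definition level_fun :: "nat \<Rightarrow> (real^'d \<Rightarrow> real) \<Rightarrow> bool" where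
  "level_fun k g \<longleftrightarrow> (\<forall>x y. \<bar>g x - g y\<bar> \<le> 2 * Lk k * norm (x - y) powr \<alpha>) \<and> (\<forall>x. \<bar>g x\<bar> \<le> 1) \<and> expectation (\<lambda>\<omega>. \<bar>g (X 0 \<omega>)\<bar>) \<le> \<pi>k k"

lemma level_fun_adm: "level_fun k g \<Longrightarrow> admissible (\<lambda>x. (g x - expectation (\<lambda>\<omega>. g (X 0 \<omega>))) / 2) (Lk k) (\<pi>k k)"
  unfolding level_fun_def by (rule admissible_center) (auto simp: \<pi>k_def Lk_ge1)

text \<open>The second moment is bounded at all levels, and this is what passes to the variances of
  the Gaussian limit. The moment of order 2 p is available only up to the cutoff level.\<close>

lemma level_moments:
  "\<exists>C\<ge>0. \<forall>k g n. level_fun k g \<longrightarrow> 1 \<le> n \<longrightarrow>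
     expectation (\<lambda>\<omega>. esum g n \<omega> ^ 2) \<le> C * 2 powr (- \<kappa> * real k) \<and>
     (2 ^ k \<le> 2 * n \<longrightarrow> expectation (\<lambda>\<omega>. esum g n \<omega> ^ (2 * p)) \<le> C * (2 powr (- \<kappa> * real k)) ^ p)"
proof -
  obtain K2 where K2: "0 \<le> K2" "\<And>n h L \<pi>. admissible h L \<pi> \<Longrightarrow> expectation (\<lambda>\<omega>. psum h n \<omega> ^ 2) \<le> K2 * (real n * (L * \<pi> powr (1 / r)))"
    using moment_bound_2 unfolding psum_def by blast
  obtain Kp where Kp: "0 \<le> Kp" "\<And>n h L \<pi>. admissible h L \<pi> \<Longrightarrow> 1 \<le> real n * (L * \<pi> powr (1 / r)) \<Longrightarrow>
      expectation (\<lambda>\<omega>. psum h n \<omega> ^ (2 * p)) \<le> Kp * (real n * (L * \<pi> powr (1 / r))) ^ p"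
    using moment_bound[of p] unfolding psum_def by blast
  define C3 where "C3 = C2 * (7 * dd)"
  have C30: "0 \<le> C3" using dd_ge1 by (simp add: C3_def C2_def)
  define C where "C = 4 * K2 * C3 + 4 ^ p * Kp * C3 ^ p"
  have C0: "0 \<le> C" using K2(1) Kp(1) C30 by (simp add: C_def)
  have main: "expectation (\<lambda>\<omega>. esum g n \<omega> ^ 2) \<le> C * 2 powr (- \<kappa> * real k) \<and>
     (2 ^ k \<le> 2 * n \<longrightarrow> expectation (\<lambda>\<omega>. esum g n \<omega> ^ (2 * p)) \<le> C * (2 powr (- \<kappa> * real k)) ^ p)"
    if g: "level_fun k g" and n: "1 \<le> n" for k g and n :: nat
  proof -
    let ?h = "\<lambda>x. (g x - expectation (\<lambda>\<omega>. g (X 0 \<omega>))) / 2"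
    have h: "admissible ?h (Lk k) (\<pi>k k)" by (rule level_fun_adm[OF g])
    have B: "Bk k \<le> C3 * 2 powr (- \<kappa> * real k)" unfolding C3_def by (rule Bk_upper)
    have B0: "0 \<le> Bk k" using Bk_lower[of k] by (rule order_trans[rotated]) simp
    have n0: "real n \<noteq> 0" "0 \<le> real n" using n by auto
    have pw: "esum g n \<omega> ^ (2 * m) = (4 ^ m / real n ^ m) * psum ?h n \<omega> ^ (2 * m)" for m \<omega>
      unfolding esum_psum power_divide power_mult_distrib by (simp add: power_mult)
    have "expectation (\<lambda>\<omega>. esum g n \<omega> ^ (2 * 1)) = (4 ^ 1 / real n ^ 1) * expectation (\<lambda>\<omega>. psum ?h n \<omega> ^ (2 * 1))"
      unfolding pw by simp
    also have "\<dots> \<le> (4 ^ 1 / real n ^ 1) * (K2 * (real n * Bk k))"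
      using K2(2)[OF h, of n] unfolding Bk_def by (intro mult_left_mono) auto
    also have "\<dots> = 4 * K2 * Bk k" using n0 by simp
    also have "\<dots> \<le> 4 * K2 * (C3 * 2 powr (- \<kappa> * real k))" using K2(1) B by (intro mult_left_mono) auto
    also have "\<dots> \<le> C * 2 powr (- \<kappa> * real k)"
      unfolding mult.assoc[symmetric] C_def using Kp(1) C30 by (intro mult_right_mono) auto
    finally have 1: "expectation (\<lambda>\<omega>. esum g n \<omega> ^ 2) \<le> C * 2 powr (- \<kappa> * real k)" by simp
    have 2: "expectation (\<lambda>\<omega>. esum g n \<omega> ^ (2 * p)) \<le> C * (2 powr (- \<kappa> * real k)) ^ p" if kn: "2 ^ k \<le> 2 * n"
    proof -
      have "real (2 ^ k) \<le> real (2 * n)" using kn by (rule of_nat_mono)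
      then have "1 \<le> real n * (2 / 2 ^ k)" by (simp add: field_simps)
      also have "\<dots> \<le> real n * Bk k" by (intro mult_left_mono Bk_lower) simp
      finally have nB: "1 \<le> real n * (Lk k * \<pi>k k powr (1 / r))" unfolding Bk_def .
      have "expectation (\<lambda>\<omega>. esum g n \<omega> ^ (2 * p)) = (4 ^ p / real n ^ p) * expectation (\<lambda>\<omega>. psum ?h n \<omega> ^ (2 * p))"
        unfolding pw by simp
      also have "\<dots> \<le> (4 ^ p / real n ^ p) * (Kp * (real n * Bk k) ^ p)"
        using Kp(2)[OF h nB] unfolding Bk_def by (intro mult_left_mono) auto
      also have "\<dots> = 4 ^ p * Kp * Bk k ^ p" using n0 by (simp add: power_mult_distrib)
      also have "\<dots> \<le> 4 ^ p * Kp * (C3 * 2 powr (- \<kappa> * real k)) ^ p" using Kp(1) B B0 by (intro mult_left_mono power_mono) auto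
      also have "\<dots> = 4 ^ p * Kp * C3 ^ p * (2 powr (- \<kappa> * real k)) ^ p" unfolding power_mult_distrib by simp
      also have "\<dots> \<le> C * (2 powr (- \<kappa> * real k)) ^ p"
        unfolding C_def using K2(1) C30 by (intro mult_right_mono) auto
      finally show ?thesis .
    qed
    show ?thesis using 1 2 by blast
  qed
  show ?thesis
  proof (intro exI[of _ C] conjI allI impI C0)
    fix k g and n :: nat assume g: "level_fun k g" "1 \<le> n"
    show "expectation (\<lambda>\<omega>. esum g n \<omega> ^ 2) \<le> C * 2 powr (- \<kappa> * real k)" by (rule conjunct1[OF main[OF g]])
    assume k: "2 ^ k \<le> 2 * n"
    show "expectation (\<lambda>\<omega>. esum g n \<omega> ^ (2 * p)) \<le> C * (2 powr (- \<kappa> * real k)) ^ p"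
      by (rule conjunct2[OF main[OF g], rule_format, OF k])
  qed
qed

text \<open>One strip, from 4 grid units below \<open>a j\<close> to 3 above, serves both kinds of
  increments with steps of size at most 2: outside of it the two ramps of coordinate
  \<open>j\<close> are both 1 or both 0.\<close>

lemma strip_expectation:
  assumes "\<And>x. \<bar>g x\<bar> \<le> (\<Sum>j\<in>UNIV. u j x)" "\<And>x j. u j x \<le> indicator {z. real_of_int (a j) - 4 < 2 ^ k * z \<and> 2 ^ k * z < real_of_int (a j) + 3} (Fm j (x $ j))"
    and gm [measurable]: "g \<in> borel_measurable borel" and g1: "\<And>x. \<bar>g x\<bar> \<le> 1"
  shows "expectation (\<lambda>\<omega>. \<bar>g (X 0 \<omega>)\<bar>) \<le> \<pi>k k"
proof -
  define I where "I j = {z. real_of_int (a j) - 4 < 2 ^ k * z \<and> 2 ^ k * z < real_of_int (a j) + 3}" for j :: 'd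
  have I: "I j = {(real_of_int (a j) - 4) / 2 ^ k<..<(real_of_int (a j) + 3) / 2 ^ k}" for j
    unfolding I_def by (auto simp: field_simps)
  have Im [measurable]: "I j \<in> sets borel" for j unfolding I by simp
  have gi: "integrable M (\<lambda>\<omega>. \<bar>g (X 0 \<omega>)\<bar>)" by (rule bounded_integrable[where B=1]) (use g1 in auto)
  have ii: "integrable M (\<lambda>\<omega>. indicator (I j) (Fm j (X 0 \<omega> $ j)) :: real)" for j
    by (rule bounded_integrable[where B=1]) (auto simp: indicator_def)
  have pj: "expectation (\<lambda>\<omega>. indicat_real (I j) (Fm j (X 0 \<omega> $ j))) \<le> 7 / 2 ^ k" for j
  proof -
    have "expectation (\<lambda>\<omega>. indicat_real (I j) (Fm j (X 0 \<omega> $ j))) = expectation (indicat_real {\<omega>\<in>space M. Fm j (X 0 \<omega> $ j) \<in> I j})"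
      by (rule Bochner_Integration.integral_cong) (auto simp: indicator_def)
    also have "\<dots> = prob {\<omega>\<in>space M. Fm j (X 0 \<omega> $ j) \<in> I j}" by simp
    also have "\<dots> = prob {\<omega>\<in>space M. (real_of_int (a j) - 4) / 2 ^ k < Fm j (X 0 \<omega> $ j) \<and> Fm j (X 0 \<omega> $ j) < (real_of_int (a j) + 3) / 2 ^ k}"
      unfolding I by simp
    also have "\<dots> \<le> (real_of_int (a j) + 3) / 2 ^ k - (real_of_int (a j) - 4) / 2 ^ k"
      by (rule Fm_prob_strip) (simp add: divide_strict_right_mono)
    also have "\<dots> = 7 / 2 ^ k" by (simp add: diff_divide_distrib[symmetric])
    finally show ?thesis .
  qed
  have "expectation (\<lambda>\<omega>. \<bar>g (X 0 \<omega>)\<bar>) \<le> expectation (\<lambda>\<omega>. \<Sum>j\<in>UNIV. indicat_real (I j) (Fm j (X 0 \<omega> $ j)))"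
  proof (rule integral_mono[OF gi])
    show "\<bar>g (X 0 \<omega>)\<bar> \<le> (\<Sum>j\<in>UNIV. indicat_real (I j) (Fm j (X 0 \<omega> $ j)))" for \<omega>
      by (rule order_trans[OF assms(1) sum_mono]) (use assms(2) in \<open>simp add: I_def\<close>)
  qed (use ii in simp)
  also have "\<dots> = (\<Sum>j\<in>UNIV. expectation (\<lambda>\<omega>. indicat_real (I j) (Fm j (X 0 \<omega> $ j))))" using ii by simp
  also have "\<dots> \<le> (\<Sum>j\<in>(UNIV :: 'd set). (7::real) / 2 ^ k)" by (rule sum_mono[OF pj])
  also have "\<dots> = 7 * dd / 2 ^ k" by (simp add: dd_def)
  finally have 1: "expectation (\<lambda>\<omega>. \<bar>g (X 0 \<omega>)\<bar>) \<le> 7 * dd / 2 ^ k" .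
  have "expectation (\<lambda>\<omega>. \<bar>g (X 0 \<omega>)\<bar>) \<le> expectation (\<lambda>\<omega>. 1)" by (rule integral_mono[OF gi]) (use g1 in auto)
  then show ?thesis using 1 by (simp add: \<pi>k_def prob_space)
qed

text \<open>The range from -2 to 2 accommodates three moves: refinement of a cell, the shift by 2 to
  the upper bracket, and the passage between cells of nearby points in the continuity proof of the
  limit.\<close>

definition steps :: "('d \<Rightarrow> int) set" where "steps = {b. \<forall>j. -2 \<le> b j \<and> b j \<le> 2}"

lemma level_fun_refine:
  assumes b: "b \<in> steps"
  shows "level_fun k (\<lambda>x. \<psi> (Suc k) (\<lambda>j. 2 * a j + b j) x - \<psi> k a x)"
  unfolding level_fun_def
proof (intro conjI allI)
  let ?g = "\<lambda>x. \<psi> (Suc k) (\<lambda>j. 2 * a j + b j) x - \<psi> k a x"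
  have bj: "-2 \<le> real_of_int (b j)" "real_of_int (b j) \<le> 2" for j
  proof -
    have "- 2 \<le> b j \<and> b j \<le> 2" using b by (simp add: steps_def)
    then show "-2 \<le> real_of_int (b j)" "real_of_int (b j) \<le> 2" by linarith+
  qed
  show g1: "\<bar>?g x\<bar> \<le> 1" for x using \<psi>_range[of "Suc k" "\<lambda>j. 2 * a j + b j" x] \<psi>_range[of k a x] by linarith
  show "\<bar>?g x - ?g y\<bar> \<le> 2 * Lk k * norm (x - y) powr \<alpha>" for x y
  proof -
    have "Lh (Suc k) * norm (x - y) powr \<alpha> \<le> Lk k * norm (x - y) powr \<alpha>" "Lh k * norm (x - y) powr \<alpha> \<le> Lk k * norm (x - y) powr \<alpha>"
      by (auto intro: mult_right_mono Lh_Lk)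
    then show ?thesis using \<psi>_holder[of "Suc k" "\<lambda>j. 2 * a j + b j" x y] \<psi>_holder[of k a x y] by linarith
  qed
  show "expectation (\<lambda>\<omega>. \<bar>?g (X 0 \<omega>)\<bar>) \<le> \<pi>k k"
  proof (rule strip_expectation[where a=a, OF \<psi>_diff _ _ g1])
    fix x :: "real^'d" and j
    define w where "w = 2 ^ k * Fm j (x $ j) - real_of_int (a j)"
    have e: "real_of_int (2 * a j + b j) - 2 ^ Suc k * Fm j (x $ j) = real_of_int (b j) - 2 * w" "real_of_int (a j) - 2 ^ k * Fm j (x $ j) = - w"
      by (simp_all add: w_def algebra_simps)
    show "\<bar>clamp01 (real_of_int (2 * a j + b j) - 2 ^ Suc k * Fm j (x $ j)) - clamp01 (real_of_int (a j) - 2 ^ k * Fm j (x $ j))\<bar>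
       \<le> indicator {z. real_of_int (a j) - 4 < 2 ^ k * z \<and> 2 ^ k * z < real_of_int (a j) + 3} (Fm j (x $ j))"
    proof (cases "-4 < w \<and> w < 3")
      case True
      then show ?thesis using clamp01_lipschitz[of "real_of_int (2 * a j + b j) - 2 ^ Suc k * Fm j (x $ j)" "real_of_int (a j) - 2 ^ k * Fm j (x $ j)"]
        by (simp add: indicator_def w_def)
    next
      case False
      have "clamp01 (real_of_int (b j) - 2 * w) = clamp01 (- w)"
      proof (cases "w \<le> - 4")
        case True
        then show ?thesis using bj[of j] by (simp add: clamp01_1)
      next
        case w: False
        then show ?thesis using False bj[of j] by (simp add: clamp01_0)
      qed
      then show ?thesis unfolding e by simp
    qed
  qed measurable
qed

lemma level_fun_shift:
  assumes b: "b \<in> steps"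
  shows "level_fun k (\<lambda>x. \<psi> k (\<lambda>j. a j + b j) x - \<psi> k a x)"
  unfolding level_fun_def
proof (intro conjI allI)
  let ?g = "\<lambda>x. \<psi> k (\<lambda>j. a j + b j) x - \<psi> k a x"
  have bj: "-2 \<le> real_of_int (b j)" "real_of_int (b j) \<le> 2" for j
  proof -
    have "- 2 \<le> b j \<and> b j \<le> 2" using b by (simp add: steps_def)
    then show "-2 \<le> real_of_int (b j)" "real_of_int (b j) \<le> 2" by linarith+
  qed
  show g1: "\<bar>?g x\<bar> \<le> 1" for x using \<psi>_range[of k "\<lambda>j. a j + b j" x] \<psi>_range[of k a x] by linarith
  show "\<bar>?g x - ?g y\<bar> \<le> 2 * Lk k * norm (x - y) powr \<alpha>" for x y
  proof -
    have "Lh k * norm (x - y) powr \<alpha> \<le> Lk k * norm (x - y) powr \<alpha>"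
      by (auto intro: mult_right_mono Lh_Lk)
    then show ?thesis using \<psi>_holder[of k "\<lambda>j. a j + b j" x y] \<psi>_holder[of k a x y] by linarith
  qed
  show "expectation (\<lambda>\<omega>. \<bar>?g (X 0 \<omega>)\<bar>) \<le> \<pi>k k"
  proof (rule strip_expectation[where a=a, OF \<psi>_diff _ _ g1])
    fix x :: "real^'d" and j
    define w where "w = 2 ^ k * Fm j (x $ j) - real_of_int (a j)"
    have e: "real_of_int (a j + b j) - 2 ^ k * Fm j (x $ j) = real_of_int (b j) - w" "real_of_int (a j) - 2 ^ k * Fm j (x $ j) = - w"
      by (simp_all add: w_def algebra_simps)
    show "\<bar>clamp01 (real_of_int (a j + b j) - 2 ^ k * Fm j (x $ j)) - clamp01 (real_of_int (a j) - 2 ^ k * Fm j (x $ j))\<bar>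
       \<le> indicator {z. real_of_int (a j) - 4 < 2 ^ k * z \<and> 2 ^ k * z < real_of_int (a j) + 3} (Fm j (x $ j))"
    proof (cases "-4 < w \<and> w < 3")
      case True
      then show ?thesis using clamp01_lipschitz[of "real_of_int (a j + b j) - 2 ^ k * Fm j (x $ j)" "real_of_int (a j) - 2 ^ k * Fm j (x $ j)"]
        by (simp add: indicator_def w_def)
    next
      case False
      have "clamp01 (real_of_int (b j) - w) = clamp01 (- w)"
      proof (cases "w \<le> - 4")
        case True
        then show ?thesis using bj[of j] by (simp add: clamp01_1)
      next
        case w: False
        then show ?thesis using False bj[of j] by (simp add: clamp01_0)
      qed
      then show ?thesis unfolding e by simp
    qed
  qed measurable
qed

end

subsection \<open>Causal functions are weakly dependent\<close>

text \<open>Weighted AM-GM for x, y and the number 1, which takes the remaining weight 1 - a - b. It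
  follows from ln z \<le> z - 1 applied to the three ratios with the mean \<open>T\<close>.\<close>

lemma weighted_am_gm:
  fixes x y a b :: real
  assumes "0 \<le> x" "0 \<le> y" "0 < a" "0 < b" "a + b \<le> 1"
  shows "x powr a * y powr b \<le> a * x + b * y + (1 - a - b)"
proof (cases "x = 0 \<or> y = 0")
  case True
  then have "x powr a * y powr b = 0" by auto
  then show ?thesis using assms mult_nonneg_nonneg[of a x] mult_nonneg_nonneg[of b y] by linarith
next
  case False
  then have x: "0 < x" "0 < y" using assms by auto
  define T where "T = a * x + b * y + (1 - a - b)"
  have T: "0 < T" using assms x unfolding T_def by (intro add_pos_nonneg add_pos_pos mult_pos_pos) auto
  have "ln (x / T) \<le> x / T - 1" "ln (y / T) \<le> y / T - 1" "ln (1 / T) \<le> 1 / T - 1" using x T by (auto intro: ln_le_minus_one)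
  then have "ln x - ln T \<le> x / T - 1" "ln y - ln T \<le> y / T - 1" "- ln T \<le> 1 / T - 1" using x T by (auto simp: ln_div)
  then have "a * (ln x - ln T) \<le> a * (x / T - 1)" "b * (ln y - ln T) \<le> b * (y / T - 1)" "(1 - a - b) * (- ln T) \<le> (1 - a - b) * (1 / T - 1)"
    using assms by (blast intro: mult_left_mono less_imp_le, blast intro: mult_left_mono less_imp_le, intro mult_left_mono, simp_all)
  then have "a * ln x + b * ln y - ln T \<le> a * (x / T - 1) + b * (y / T - 1) + (1 - a - b) * (1 / T - 1)"
    by (simp add: algebra_simps)
  also have "\<dots> = (a * x + b * y + (1 - a - b)) / T - 1" using T by (simp add: field_simps)
  also have "\<dots> = T / T - 1" by (simp only: T_def)
  also have "\<dots> = 0" using T by simp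
  finally have "exp (a * ln x + b * ln y) \<le> exp (ln T)" by simp
  then show ?thesis using x T by (simp add: powr_def exp_add T_def)
qed

text \<open>Hoelder's inequality for the exponents r, s / \<alpha> and the constant 1, which takes
  up the weight left over since \<alpha> \<le> 1. Only the law of \<open>D'\<close> enters, so the
  norm may be computed for the identically distributed \<open>D\<close>.\<close>

lemma (in prob_space) holder_coupling:
  fixes D D' :: "'a \<Rightarrow> real"
  assumes D [measurable]: "D \<in> borel_measurable M" and D' [measurable]: "D' \<in> borel_measurable M"
    and pos: "\<And>\<omega>. 0 \<le> D \<omega>" "\<And>\<omega>. 0 \<le> D' \<omega>" and eq: "distr M borel D' = distr M borel D"
    and fin: "Lp_norm_ext M s D < \<infinity>" and rs: "1 \<le> r" "1 < s" "1 / ereal r + 1 / s = 1" and \<alpha>: "0 < \<alpha>" "\<alpha> \<le> 1"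
  shows "integrable M (\<lambda>\<omega>. D' \<omega> powr \<alpha>)"
    and "\<And>Z. Z \<in> borel_measurable M \<Longrightarrow> (\<And>\<omega>. \<bar>Z \<omega>\<bar> \<le> 1) \<Longrightarrow>
      expectation (\<lambda>\<omega>. \<bar>Z \<omega>\<bar> * D' \<omega> powr \<alpha>) \<le> expectation (\<lambda>\<omega>. \<bar>Z \<omega>\<bar>) powr (1 / r) * real_of_ereal (Lp_norm_ext M s D) powr \<alpha>"
proof -
  let ?thesis2 = "\<forall>Z. Z \<in> borel_measurable M \<longrightarrow> (\<forall>\<omega>. \<bar>Z \<omega>\<bar> \<le> 1) \<longrightarrow>
      expectation (\<lambda>\<omega>. \<bar>Z \<omega>\<bar> * D' \<omega> powr \<alpha>) \<le> expectation (\<lambda>\<omega>. \<bar>Z \<omega>\<bar>) powr (1 / r) * real_of_ereal (Lp_norm_ext M s D) powr \<alpha>"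
  have intZ: "integrable M (\<lambda>\<omega>. \<bar>Z \<omega>\<bar>)" if "Z \<in> borel_measurable M" "\<forall>\<omega>. \<bar>Z \<omega>\<bar> \<le> 1" for Z :: "'a \<Rightarrow> real"
    by (rule integrable_const_bound[where B=1]) (use that in auto)
  have "integrable M (\<lambda>\<omega>. D' \<omega> powr \<alpha>) \<and> ?thesis2"
  proof (cases "s = \<infinity>")
    case True
    have r1: "r = 1" using rs(1,3) unfolding True by (simp add: one_ereal_def)
    define d where "d = real_of_ereal (Lp_norm_ext M s D)"
    have e: "Lp_norm_ext M s D = esssup M (\<lambda>\<omega>. ereal \<bar>D \<omega>\<bar>)" by (simp add: Lp_norm_ext_def True)
    have ae: "AE \<omega> in M. ereal \<bar>D \<omega>\<bar> \<le> Lp_norm_ext M s D" unfolding e by (rule esssup_AE)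
    have "\<exists>\<omega>. ereal \<bar>D \<omega>\<bar> \<le> Lp_norm_ext M s D"
      by (rule eventually_happens'[OF ae_filter_bot ae])
    then have nn: "0 \<le> Lp_norm_ext M s D" by (meson abs_ge_zero ereal_less_eq(5) order_trans)
    have d: "Lp_norm_ext M s D = ereal d" unfolding d_def using fin nn by (cases "Lp_norm_ext M s D") auto
    have d0: "0 \<le> d" using nn unfolding d by simp
    have "AE \<omega> in M. D \<omega> \<le> d" using ae unfolding d by eventually_elim (use pos in auto)
    then have "AE x in distr M borel D. x \<le> d" by (subst AE_distr_iff) auto
    then have "AE x in distr M borel D'. x \<le> d" unfolding eq .
    then have ae': "AE \<omega> in M. D' \<omega> \<le> d" by (subst (asm) AE_distr_iff) auto
    have ae2: "AE \<omega> in M. D' \<omega> powr \<alpha> \<le> d powr \<alpha>" using ae' by eventually_elim (use pos \<alpha> in \<open>auto intro: powr_mono2\<close>)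
    have i: "integrable M (\<lambda>\<omega>. D' \<omega> powr \<alpha>)"
      by (rule integrable_const_bound[where B="d powr \<alpha>"]) (use ae2 in auto)
    have "?thesis2"
    proof (intro allI impI)
      fix Z :: "'a \<Rightarrow> real" assume Zm [measurable]: "Z \<in> borel_measurable M" and Z1: "\<forall>\<omega>. \<bar>Z \<omega>\<bar> \<le> 1"
      have iz: "integrable M (\<lambda>\<omega>. \<bar>Z \<omega>\<bar>)" by (rule intZ[OF Zm Z1])
      have hb: "\<bar>Z \<omega>\<bar> * D' \<omega> powr \<alpha> \<le> D' \<omega> powr \<alpha>" for \<omega>
        by (rule mult_left_le_one_le) (use Z1 in auto)
      have "expectation (\<lambda>\<omega>. \<bar>Z \<omega>\<bar> * D' \<omega> powr \<alpha>) \<le> expectation (\<lambda>\<omega>. \<bar>Z \<omega>\<bar> * d powr \<alpha>)"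
      proof (rule integral_mono_AE)
        show "integrable M (\<lambda>\<omega>. \<bar>Z \<omega>\<bar> * D' \<omega> powr \<alpha>)"
          by (rule Bochner_Integration.integrable_bound[OF i]) (auto simp: abs_mult hb)
        show "integrable M (\<lambda>\<omega>. \<bar>Z \<omega>\<bar> * d powr \<alpha>)" using iz by simp
        show "AE \<omega> in M. \<bar>Z \<omega>\<bar> * D' \<omega> powr \<alpha> \<le> \<bar>Z \<omega>\<bar> * d powr \<alpha>"
          using ae2 by eventually_elim (rule mult_left_mono, auto)
      qed
      also have "\<dots> = expectation (\<lambda>\<omega>. \<bar>Z \<omega>\<bar>) powr (1 / r) * d powr \<alpha>" by (simp add: r1)
      finally show "expectation (\<lambda>\<omega>. \<bar>Z \<omega>\<bar> * D' \<omega> powr \<alpha>) \<le> expectation (\<lambda>\<omega>. \<bar>Z \<omega>\<bar>) powr (1 / r) * real_of_ereal (Lp_norm_ext M s D) powr \<alpha>"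
        unfolding d_def .
    qed
    with i show ?thesis by blast
  next
    case False
    then obtain \<sigma> where \<sigma>: "s = ereal \<sigma>" "1 < \<sigma>" using rs(2) by (cases s) auto
    have rs': "1 / r + 1 / \<sigma> = 1" using rs(1,3) \<sigma> by (simp add: one_ereal_def)
    define m where "m = (\<integral>\<^sup>+\<omega>. ennreal (\<bar>D \<omega>\<bar> powr \<sigma>) \<partial>M)"
    have m: "m \<noteq> \<infinity>" using fin by (auto simp: Lp_norm_ext_def False m_def \<sigma>(1) Let_def split: if_splits)
    have Lp: "Lp_norm_ext M s D = ereal (enn2real m powr (1 / \<sigma>))"
      using m by (simp add: Lp_norm_ext_def False m_def[symmetric] \<sigma>(1))
    have "integrable M (\<lambda>\<omega>. \<bar>D \<omega>\<bar> powr \<sigma>)"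
      by (rule integrableI_nonneg) (use m in \<open>auto simp: m_def less_top\<close>)
    then have iD: "integrable M (\<lambda>\<omega>. D \<omega> powr \<sigma>)" using pos by simp
    define B where "B = expectation (\<lambda>\<omega>. D \<omega> powr \<sigma>)"
    have mB: "enn2real m = B"
      unfolding m_def B_def using pos by (subst integral_eq_nn_integral) auto
    have "integrable (distr M borel D) (\<lambda>x. x powr \<sigma>)" using iD by (simp add: integrable_distr_eq)
    then have iD': "integrable M (\<lambda>\<omega>. D' \<omega> powr \<sigma>)" unfolding eq[symmetric] by (simp add: integrable_distr_eq)
    have "B = (\<integral>x. x powr \<sigma> \<partial>distr M borel D)" by (simp add: B_def integral_distr)
    then have B': "expectation (\<lambda>\<omega>. D' \<omega> powr \<sigma>) = B" unfolding eq[symmetric] by (simp add: integral_distr)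
    have B0: "0 \<le> B" unfolding B_def by (rule Bochner_Integration.integral_nonneg) simp
    have RHS: "real_of_ereal (Lp_norm_ext M s D) powr \<alpha> = B powr (\<alpha> / \<sigma>)" by (simp add: Lp mB powr_powr)
    have i: "integrable M (\<lambda>\<omega>. D' \<omega> powr \<alpha>)"
    proof (rule Bochner_Integration.integrable_bound[of _ "\<lambda>\<omega>. 1 + D' \<omega> powr \<sigma>"])
      show "integrable M (\<lambda>\<omega>. 1 + D' \<omega> powr \<sigma>)" using iD' by simp
      show "AE \<omega> in M. norm (D' \<omega> powr \<alpha>) \<le> norm (1 + D' \<omega> powr \<sigma>)"
      proof (rule AE_I2)
        fix \<omega>
        have "D' \<omega> powr \<alpha> \<le> 1 + D' \<omega> powr \<sigma>"
        proof (cases "D' \<omega> \<le> 1")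
          case True
          then have "D' \<omega> powr \<alpha> \<le> 1 powr \<alpha>" using pos \<alpha> by (intro powr_mono2) auto
          then show ?thesis by (simp add: add_increasing2)
        next
          case False
          then have "D' \<omega> powr \<alpha> \<le> D' \<omega> powr \<sigma>" using \<alpha> \<sigma> by (intro powr_mono) auto
          then show ?thesis by simp
        qed
        then show "norm (D' \<omega> powr \<alpha>) \<le> norm (1 + D' \<omega> powr \<sigma>)" by simp
      qed
    qed simp
    have "?thesis2"
    proof (intro allI impI)
      fix Z :: "'a \<Rightarrow> real" assume Zm [measurable]: "Z \<in> borel_measurable M" and Z1: "\<forall>\<omega>. \<bar>Z \<omega>\<bar> \<le> 1"
      have iz: "integrable M (\<lambda>\<omega>. \<bar>Z \<omega>\<bar>)" by (rule intZ[OF Zm Z1])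
      have hb: "\<bar>Z \<omega>\<bar> * D' \<omega> powr \<alpha> \<le> D' \<omega> powr \<alpha>" for \<omega>
        by (rule mult_left_le_one_le) (use Z1 in auto)
      define A where "A = expectation (\<lambda>\<omega>. \<bar>Z \<omega>\<bar>)"
      have A0: "0 \<le> A" by (simp add: A_def)
      have iZD: "integrable M (\<lambda>\<omega>. \<bar>Z \<omega>\<bar> * D' \<omega> powr \<alpha>)"
        by (rule Bochner_Integration.integrable_bound[OF i]) (auto simp: abs_mult hb)
      have "expectation (\<lambda>\<omega>. \<bar>Z \<omega>\<bar> * D' \<omega> powr \<alpha>) \<le> A powr (1 / r) * B powr (\<alpha> / \<sigma>)"
      \<comment> \<open>Normalising by \<open>A\<close> and \<open>B\<close> is impossible here; the
        product vanishes almost surely instead.\<close>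
      proof (cases "A = 0 \<or> B = 0")
        case True
        have "AE \<omega> in M. \<bar>Z \<omega>\<bar> * D' \<omega> powr \<alpha> = 0"
        proof (cases "A = 0")
          case True
          then have "AE \<omega> in M. \<bar>Z \<omega>\<bar> = 0" unfolding A_def by (subst (asm) integral_nonneg_eq_0_iff_AE[OF iz]) auto
          then show ?thesis by eventually_elim simp
        next
          case False
          then have "expectation (\<lambda>\<omega>. D' \<omega> powr \<sigma>) = 0" using True B' by simp
          then have "AE \<omega> in M. D' \<omega> powr \<sigma> = 0" by (subst (asm) integral_nonneg_eq_0_iff_AE[OF iD']) auto
          then show ?thesis by eventually_elim simp
        qed
        then have "expectation (\<lambda>\<omega>. \<bar>Z \<omega>\<bar> * D' \<omega> powr \<alpha>) = 0" by (subst integral_cong_AE[where g="\<lambda>_. 0"]) auto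
        then show ?thesis by simp
      next
        case False
        then have AB: "0 < A" "0 < B" using A0 B0 by auto
        define K where "K = A powr (1 / r) * B powr (\<alpha> / \<sigma>)"
        have pt: "\<bar>Z \<omega>\<bar> * D' \<omega> powr \<alpha> \<le> K * ((1 / r) * (\<bar>Z \<omega>\<bar> / A) + (\<alpha> / \<sigma>) * (D' \<omega> powr \<sigma> / B) + (1 - 1 / r - \<alpha> / \<sigma>))" for \<omega>
        proof -
          \<comment> \<open>Because \<open>Z\<close> is bounded by 1, it may be replaced by its
            power 1 / r, so that its L1 norm suffices instead of an Lr norm.\<close>
          have "\<bar>Z \<omega>\<bar> \<le> \<bar>Z \<omega>\<bar> powr (1 / r)"
            using Z1 rs(1) powr_mono'[of "1/r" 1 "\<bar>Z \<omega>\<bar>"] by (cases "Z \<omega> = 0") auto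
          then have "\<bar>Z \<omega>\<bar> * D' \<omega> powr \<alpha> \<le> \<bar>Z \<omega>\<bar> powr (1 / r) * D' \<omega> powr \<alpha>" by (rule mult_right_mono) simp
          also have "\<dots> = \<bar>Z \<omega>\<bar> powr (1 / r) * (D' \<omega> powr \<sigma>) powr (\<alpha> / \<sigma>)" using \<sigma> by (simp add: powr_powr)
          also have "\<dots> = K * ((\<bar>Z \<omega>\<bar> / A) powr (1 / r) * (D' \<omega> powr \<sigma> / B) powr (\<alpha> / \<sigma>))"
            using AB by (simp add: K_def powr_divide)
          also have "\<dots> \<le> K * ((1 / r) * (\<bar>Z \<omega>\<bar> / A) + (\<alpha> / \<sigma>) * (D' \<omega> powr \<sigma> / B) + (1 - 1 / r - \<alpha> / \<sigma>))"
          proof (rule mult_left_mono)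
            have "\<alpha> / \<sigma> \<le> 1 / \<sigma>" using \<alpha> \<sigma> by (intro divide_right_mono) auto
            then show "(\<bar>Z \<omega>\<bar> / A) powr (1 / r) * (D' \<omega> powr \<sigma> / B) powr (\<alpha> / \<sigma>) \<le> (1 / r) * (\<bar>Z \<omega>\<bar> / A) + (\<alpha> / \<sigma>) * (D' \<omega> powr \<sigma> / B) + (1 - 1 / r - \<alpha> / \<sigma>)"
              using AB rs(1) rs' \<alpha> \<sigma> by (intro weighted_am_gm) auto
          qed (simp add: K_def)
          finally show ?thesis .
        qed
        have "expectation (\<lambda>\<omega>. \<bar>Z \<omega>\<bar> * D' \<omega> powr \<alpha>) \<le> expectation (\<lambda>\<omega>. K * ((1 / r) * (\<bar>Z \<omega>\<bar> / A) + (\<alpha> / \<sigma>) * (D' \<omega> powr \<sigma> / B) + (1 - 1 / r - \<alpha> / \<sigma>)))"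
          by (rule integral_mono[OF iZD _ pt]) (use iz iD' in auto)
        also have "\<dots> = K * ((1 / r) * (A / A) + (\<alpha> / \<sigma>) * (B / B) + (1 - 1 / r - \<alpha> / \<sigma>))"
          using iz iD' by (simp add: A_def[symmetric] B' prob_space)
        also have "\<dots> = K" using AB by simp
        finally show ?thesis unfolding K_def .
      qed
      then show "expectation (\<lambda>\<omega>. \<bar>Z \<omega>\<bar> * D' \<omega> powr \<alpha>) \<le> expectation (\<lambda>\<omega>. \<bar>Z \<omega>\<bar>) powr (1 / r) * real_of_ereal (Lp_norm_ext M s D) powr \<alpha>"
        unfolding RHS A_def .
    qed
    with i show ?thesis by blast
  qed
  then show "integrable M (\<lambda>\<omega>. D' \<omega> powr \<alpha>)"
    "\<And>Z. Z \<in> borel_measurable M \<Longrightarrow> (\<And>\<omega>. \<bar>Z \<omega>\<bar> \<le> 1) \<Longrightarrow>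
      expectation (\<lambda>\<omega>. \<bar>Z \<omega>\<bar> * D' \<omega> powr \<alpha>) \<le> expectation (\<lambda>\<omega>. \<bar>Z \<omega>\<bar>) powr (1 / r) * real_of_ereal (Lp_norm_ext M s D) powr \<alpha>"
    by blast+
qed

text \<open>Used for two relabelings of the innovations: a shift in time, which gives stationarity,
  and the exchange of the past with its copy, which gives resampling.\<close>

lemma (in prob_space) iid_reindex:
  fixes \<eta> :: "'i \<Rightarrow> 'a \<Rightarrow> 'x::topological_space" and \<sigma> :: "'i \<Rightarrow> 'i"
  assumes ind: "indep_vars (\<lambda>_. borel) \<eta> UNIV" and ident: "\<And>i. distr M borel (\<eta> i) = \<mu>" and \<sigma>: "inj \<sigma>"
  shows "distr M (\<Pi>\<^sub>M i\<in>UNIV. borel) (\<lambda>\<omega> i. \<eta> (\<sigma> i) \<omega>) = distr M (\<Pi>\<^sub>M i\<in>UNIV. borel) (\<lambda>\<omega> i. \<eta> i \<omega>)"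
proof -
  have rv [measurable]: "\<eta> i \<in> borel_measurable M" for i using ind by (auto simp: indep_vars_def)
  have \<mu>: "prob_space \<mu>" unfolding ident[of undefined, symmetric] by (rule prob_space_distr) (rule rv)
  have s: "sets (\<Pi>\<^sub>M i\<in>(UNIV::'i set). \<mu>) = sets (\<Pi>\<^sub>M i\<in>(UNIV::'i set). (borel :: 'x measure))"
    by (rule sets_PiM_cong) (auto simp: ident[of undefined, symmetric])
  have 1: "distr M (\<Pi>\<^sub>M i\<in>UNIV. borel) (\<lambda>\<omega> i. \<eta> i \<omega>) = (\<Pi>\<^sub>M i\<in>UNIV. \<mu>)"
    using ind by (subst (asm) indep_vars_iff_distr_eq_PiM') (simp_all only: UNIV_not_empty not_False_eq_True rv ident restrict_UNIV)
  have m1: "(\<lambda>\<omega> i. \<eta> i \<omega>) \<in> M \<rightarrow>\<^sub>M (\<Pi>\<^sub>M i\<in>UNIV. borel)"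
    by (rule measurable_PiM_single') auto
  have m2: "(\<lambda>x i. x (\<sigma> i)) \<in> (\<Pi>\<^sub>M i\<in>UNIV. borel) \<rightarrow>\<^sub>M (\<Pi>\<^sub>M i\<in>UNIV. (borel :: 'x measure))"
    by (rule measurable_PiM_single') auto
  have "distr (\<Pi>\<^sub>M i\<in>UNIV. \<mu>) (\<Pi>\<^sub>M i\<in>UNIV. \<mu>) (\<lambda>\<omega>. \<lambda>n\<in>UNIV. \<omega> (\<sigma> n)) = (\<Pi>\<^sub>M i\<in>UNIV. \<mu>)"
    by (rule distr_PiM_reindex) (use \<mu> \<sigma> in auto)
  then have 2: "distr (\<Pi>\<^sub>M i\<in>UNIV. \<mu>) (\<Pi>\<^sub>M i\<in>UNIV. borel) (\<lambda>x i. x (\<sigma> i)) = (\<Pi>\<^sub>M i\<in>UNIV. \<mu>)"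
    unfolding restrict_UNIV by (subst distr_cong[OF refl s[symmetric] refl])
  have "distr M (\<Pi>\<^sub>M i\<in>UNIV. borel) (\<lambda>\<omega> i. \<eta> (\<sigma> i) \<omega>) = distr (distr M (\<Pi>\<^sub>M i\<in>UNIV. borel) (\<lambda>\<omega> i. \<eta> i \<omega>)) (\<Pi>\<^sub>M i\<in>UNIV. borel) (\<lambda>x i. x (\<sigma> i))"
    by (subst distr_distr[OF m2 m1]) (simp add: comp_def)
  also have "\<dots> = distr M (\<Pi>\<^sub>M i\<in>UNIV. borel) (\<lambda>\<omega> i. \<eta> i \<omega>)" unfolding 1 2 ..
  finally show ?thesis .
qed

lemma (in prob_space) iid_reindex_integral:
  fixes \<eta> :: "'i \<Rightarrow> 'a \<Rightarrow> 'x::topological_space" and \<sigma> :: "'i \<Rightarrow> 'i" and \<phi> :: "('i \<Rightarrow> 'x) \<Rightarrow> 'c::{banach, second_countable_topology}"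
  assumes ind: "indep_vars (\<lambda>_. borel) \<eta> UNIV" and ident: "\<And>i. distr M borel (\<eta> i) = \<mu>" and \<sigma>: "inj \<sigma>"
    and \<phi>: "\<phi> \<in> borel_measurable (\<Pi>\<^sub>M i\<in>UNIV. borel)"
  shows "expectation (\<lambda>\<omega>. \<phi> (\<lambda>i. \<eta> (\<sigma> i) \<omega>)) = expectation (\<lambda>\<omega>. \<phi> (\<lambda>i. \<eta> i \<omega>))"
    "distr M borel (\<lambda>\<omega>. \<phi> (\<lambda>i. \<eta> (\<sigma> i) \<omega>)) = distr M borel (\<lambda>\<omega>. \<phi> (\<lambda>i. \<eta> i \<omega>))"
proof -
  have rv: "\<eta> i \<in> borel_measurable M" for i using ind by (auto simp: indep_vars_def)
  have m: "(\<lambda>\<omega> i. \<eta> (\<tau> i) \<omega>) \<in> M \<rightarrow>\<^sub>M (\<Pi>\<^sub>M i\<in>UNIV. borel)" for \<tau> :: "'i \<Rightarrow> 'i"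
    by (rule measurable_PiM_single') (use rv in auto)
  note e = iid_reindex[OF ind ident \<sigma>]
  show "expectation (\<lambda>\<omega>. \<phi> (\<lambda>i. \<eta> (\<sigma> i) \<omega>)) = expectation (\<lambda>\<omega>. \<phi> (\<lambda>i. \<eta> i \<omega>))"
    using integral_distr[OF m[of \<sigma>] \<phi>] integral_distr[OF m[of "\<lambda>i. i"] \<phi>] unfolding e by metis
  show "distr M borel (\<lambda>\<omega>. \<phi> (\<lambda>i. \<eta> (\<sigma> i) \<omega>)) = distr M borel (\<lambda>\<omega>. \<phi> (\<lambda>i. \<eta> i \<omega>))"
    using distr_distr[OF \<phi> m[of \<sigma>]] distr_distr[OF \<phi> m[of "\<lambda>i. i"]] unfolding e comp_def by metis
qed

lemma causal_weakly_dependent: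
  fixes M :: "'a measure"
    and \<xi> \<xi>' :: "int \<Rightarrow> 'a \<Rightarrow> 'x::banach"
    and G :: "(nat \<Rightarrow> 'x) \<Rightarrow> real^'d::finite"
    and \<alpha> r :: real and s :: ereal and p :: nat
  assumes M: "prob_space M"
    and meas: "\<forall>j. \<xi> j \<in> borel_measurable M \<and> \<xi>' j \<in> borel_measurable M"
    and indep: "prob_space.indep_vars M (\<lambda>_. borel)
                  (\<lambda>(b, j). if b then \<xi>' j else \<xi> j) (UNIV :: (bool \<times> int) set)"
    and ident: "\<forall>j. distr M borel (\<xi> j) = distr M borel (\<xi> 0) \<and>
                    distr M borel (\<xi>' j) = distr M borel (\<xi> 0)"
    and G_meas: "G \<in> (\<Pi>\<^sub>M j\<in>(UNIV :: nat set). (borel :: 'x measure)) \<rightarrow>\<^sub>M borel"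
  defines "\<delta> \<equiv> \<lambda>i. Lp_norm_ext M s (\<lambda>\<omega>. norm (causal_X G \<xi> i \<omega> - coupled_X G \<xi> \<xi>' i \<omega>))"
  assumes rs: "1 \<le> r" "1 < s" "1 / ereal r + 1 / s = 1"
    and p: "2 \<le> p"
    and alpha: "0 < \<alpha>" "\<alpha> \<le> 1"
    and delta_fin: "\<forall>i\<ge>1. \<delta> i < \<infinity>"
    and sum: "summable (\<lambda>i. real (Suc i) ^ (2 * p - 2) * real_of_ereal (\<delta> (Suc i)) powr \<alpha>)"
  shows "weakly_dependent M (causal_X G \<xi>)
    (\<lambda>a i \<omega>. G (\<lambda>j. if int a < int i - int j then \<xi> (int i - int j) \<omega> else \<xi>' (int i - int j) \<omega>))
    (\<lambda>i. real_of_ereal (\<delta> i) powr \<alpha>) r \<alpha> (2 * p)"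
proof -
  interpret prob_space M by (rule M)
  \<comment> \<open>Both innovation sequences are treated as one i.i.d. family, so shifting and
    resampling become injections of its index set.\<close>
  define \<eta> where "\<eta> q = (if fst q then \<xi>' (snd q) else \<xi> (snd q))" for q :: "bool \<times> int"
  have "\<eta> = (\<lambda>(b, j). if b then \<xi>' j else \<xi> j)" by (auto simp: fun_eq_iff \<eta>_def)
  then have ind: "indep_vars (\<lambda>_. borel) \<eta> UNIV" using indep by simp
  have id: "distr M borel (\<eta> q) = distr M borel (\<xi> 0)" for q using ident by (cases q) (auto simp: \<eta>_def)
  have \<eta>m [measurable]: "\<eta> q \<in> borel_measurable M" for q using meas by (cases q) (auto simp: \<eta>_def)
  let ?P = "\<Pi>\<^sub>M q\<in>(UNIV :: (bool \<times> int) set). (borel :: 'x measure)"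
  define x where "x i y = G (\<lambda>j. y (False, int i - int j))" for i :: nat and y :: "bool \<times> int \<Rightarrow> 'x"
  define x' where "x' a i y = G (\<lambda>j. if int a < int i - int j then y (False, int i - int j) else y (True, int i - int j))" for a i :: nat and y :: "bool \<times> int \<Rightarrow> 'x"
  let ?\<eta> = "\<lambda>\<omega> q. \<eta> q \<omega>"
  have \<eta>mm: "?\<eta> \<in> M \<rightarrow>\<^sub>M ?P" by (rule measurable_PiM_single') auto
  have X: "causal_X G \<xi> i \<omega> = x i (?\<eta> \<omega>)" for i \<omega> by (simp add: causal_X_def x_def \<eta>_def)
  have X': "G (\<lambda>j. if int a < int i - int j then \<xi> (int i - int j) \<omega> else \<xi>' (int i - int j) \<omega>) = x' a i (?\<eta> \<omega>)" for a i \<omega>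
    unfolding x'_def by (rule arg_cong[where f=G]) (simp add: \<eta>_def fun_eq_iff)
  have C: "coupled_X G \<xi> \<xi>' i \<omega> = x' 0 i (?\<eta> \<omega>)" for i \<omega>
    unfolding coupled_X_def x'_def by (rule arg_cong[where f=G]) (auto simp: \<eta>_def)
  have xm: "x i \<in> ?P \<rightarrow>\<^sub>M borel" for i
    unfolding x_def by (rule measurable_compose[OF _ G_meas], rule measurable_PiM_single') auto
  have x'm: "x' a i \<in> ?P \<rightarrow>\<^sub>M borel" for a i
    unfolding x'_def by (rule measurable_compose[OF _ G_meas], rule measurable_PiM_single') auto
  have norm_m: "(\<lambda>y. norm (x i y - x' a i y)) \<in> borel_measurable ?P" for a i
  proof -
    note [measurable] = xm x'm
    show ?thesis by measurable
  qed
  define shift where "shift a q = (fst q, snd q + int a)" for a :: nat and q :: "bool \<times> int"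
  \<comment> \<open>Exchanging the two sequences up to time \<open>a\<close> turns
    \<open>x i\<close> into the resampled \<open>x' a i\<close>, so both have the same law.\<close>
  define swap where "swap a q = (if snd q \<le> int a then (\<not> fst q, snd q) else q)" for a :: nat and q :: "bool \<times> int"
  have inj_shift: "inj (shift a)" for a by (auto simp: inj_on_def shift_def prod_eq_iff)
  have inj_swap: "inj (swap a)" for a
    by (rule inj_on_inverseI[where g="swap a"]) (auto simp: swap_def)
  note reindex = iid_reindex_integral[OF ind id]
  have x_shift: "x (i + a) y = x i (\<lambda>q. y (shift a q))" for i a y
    unfolding x_def shift_def by (rule arg_cong[where f=G]) (simp add: algebra_simps)
  have x'_shift: "x' a i y = x' 0 (i - a) (\<lambda>q. y (shift a q))" if "a < i" for i a y
    unfolding x'_def shift_def using that by (intro arg_cong[where f=G] ext) (auto simp: algebra_simps of_nat_diff)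
  have x'_swap: "x' a i y = x i (\<lambda>q. y (swap a q))" for i a y
    unfolding x'_def x_def swap_def by (rule arg_cong[where f=G]) (auto simp: fun_eq_iff)
  show ?thesis
    unfolding X' 
  proof (unfold_locales, unfold X)
    show "(\<lambda>\<omega>. x i (?\<eta> \<omega>)) \<in> borel_measurable M" for i by (rule measurable_compose[OF \<eta>mm xm])
    show "(\<lambda>\<omega>. x' a i (?\<eta> \<omega>)) \<in> borel_measurable M" for a i by (rule measurable_compose[OF \<eta>mm x'm])
  next
    fix A B :: "nat set" and t :: "nat \<Rightarrow> nat" and a :: nat and f :: "nat \<Rightarrow> real^'d \<Rightarrow> complex" and K
    assume fin: "finite A" "finite B" and tA: "\<And>j. j \<in> A \<Longrightarrow> t j \<le> a" and tB: "\<And>i. i \<in> B \<Longrightarrow> a < t i"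
      and fm [measurable]: "\<And>i. f i \<in> borel_measurable borel" and fb: "\<And>i x. norm (f i x) \<le> K"
    \<comment> \<open>\<open>S1\<close> contains the innovations read by the process up to time
      \<open>a\<close>, and \<open>S2\<close> those read by the resampled future. They are disjoint,
      which is the source of independence.\<close>
    define S1 where "S1 = {q :: bool \<times> int. \<not> fst q \<and> snd q \<le> int a}"
    define S2 where "S2 = {q :: bool \<times> int. if fst q then snd q \<le> int a else int a < snd q}"
    define u where "u y = (\<Prod>j\<in>A. f j (x (t j) y))" for y
    define v where "v y = (\<Prod>i\<in>B. f i (x' a (t i) y))" for y
    \<comment> \<open>Families restricted to a part of the index set are filled up with 0, which is
      never read by \<open>u\<close> on \<open>S1\<close> or by \<open>v\<close> on
      \<open>S2\<close>.\<close>
    define ext :: "(bool \<times> int) set \<Rightarrow> (bool \<times> int \<Rightarrow> 'x) \<Rightarrow> bool \<times> int \<Rightarrow> 'x" where "ext S y q = (if q \<in> S then y q else 0)" for S y q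
    have extm: "ext S \<in> (\<Pi>\<^sub>M q\<in>S. borel) \<rightarrow>\<^sub>M ?P" for S
    proof (rule measurable_PiM_single')
      show "(\<lambda>y. ext S y q) \<in> borel_measurable (\<Pi>\<^sub>M q\<in>S. borel)" for q by (cases "q \<in> S") (auto simp: ext_def)
    qed simp
    have um: "u \<in> borel_measurable ?P" unfolding u_def by (intro borel_measurable_prod measurable_compose[OF xm fm])
    have vm: "v \<in> borel_measurable ?P" unfolding v_def by (intro borel_measurable_prod measurable_compose[OF x'm fm])
    have "indep_var (PiM S1 (\<lambda>_. borel)) (\<lambda>\<omega>. restrict (\<lambda>i. \<eta> i \<omega>) S1) (PiM S2 (\<lambda>_. borel)) (\<lambda>\<omega>. restrict (\<lambda>i. \<eta> i \<omega>) S2)"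
      by (rule indep_var_restrict[OF ind]) (auto simp: S1_def S2_def split: if_splits)
    then have "indep_var borel ((\<lambda>y. u (ext S1 y)) \<circ> (\<lambda>\<omega>. restrict (\<lambda>i. \<eta> i \<omega>) S1)) borel ((\<lambda>y. v (ext S2 y)) \<circ> (\<lambda>\<omega>. restrict (\<lambda>i. \<eta> i \<omega>) S2))"
      by (rule indep_var_compose) (rule measurable_compose[OF extm um], rule measurable_compose[OF extm vm])
    moreover have "u (ext S1 (restrict (\<lambda>i. \<eta> i \<omega>) S1)) = u (?\<eta> \<omega>)" for \<omega>
      unfolding u_def x_def ext_def
    proof (intro prod.cong refl arg_cong[where f="f _"] arg_cong[where f=G] ext)
      fix j k assume "j \<in> A"
      from tA[OF this] have "(False, int (t j) - int k) \<in> S1" by (simp add: S1_def)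
      then show "(if (False, int (t j) - int k) \<in> S1 then restrict (\<lambda>i. \<eta> i \<omega>) S1 (False, int (t j) - int k) else 0) = \<eta> (False, int (t j) - int k) \<omega>" by simp
    qed
    moreover have "v (ext S2 (restrict (\<lambda>i. \<eta> i \<omega>) S2)) = v (?\<eta> \<omega>)" for \<omega>
      unfolding v_def x'_def ext_def by (intro prod.cong refl arg_cong[where f="f _"] arg_cong[where f=G] ext) (auto simp: S2_def)
    ultimately have iv: "indep_var borel (\<lambda>\<omega>. u (?\<eta> \<omega>)) borel (\<lambda>\<omega>. v (?\<eta> \<omega>))" by (simp add: comp_def)
    have K0: "0 \<le> K" using fb[of 0 0] norm_ge_zero order_trans by blast
    have nb: "norm (\<Prod>j\<in>C. f j (z j)) \<le> K ^ card C" for C and z :: "nat \<Rightarrow> real^'d"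
      unfolding prod_norm[symmetric] using prod_mono[of C "\<lambda>j. norm (f j (z j))" "\<lambda>_. K"] fb by simp
    have iu: "integrable M (\<lambda>\<omega>. u (?\<eta> \<omega>))"
      by (rule integrable_const_bound[where B="K ^ card A"]) (auto simp: u_def intro!: nb measurable_compose[OF \<eta>mm um, unfolded u_def])
    have ivv: "integrable M (\<lambda>\<omega>. v (?\<eta> \<omega>))"
      by (rule integrable_const_bound[where B="K ^ card B"]) (auto simp: v_def intro!: nb measurable_compose[OF \<eta>mm vm, unfolded v_def])
    have w: "(\<lambda>y. \<Prod>i\<in>B. f i (x (t i) y)) \<in> borel_measurable ?P" by (intro borel_measurable_prod measurable_compose[OF xm fm])
    have "expectation (\<lambda>\<omega>. v (?\<eta> \<omega>)) = expectation (\<lambda>\<omega>. \<Prod>i\<in>B. f i (x (t i) (?\<eta> \<omega>)))"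
      unfolding v_def x'_swap using reindex(1)[OF inj_swap w] .
    then show "expectation (\<lambda>\<omega>. (\<Prod>j\<in>A. f j (x (t j) (?\<eta> \<omega>))) * (\<Prod>i\<in>B. f i (x' a (t i) (?\<eta> \<omega>))))
      = expectation (\<lambda>\<omega>. \<Prod>j\<in>A. f j (x (t j) (?\<eta> \<omega>))) * expectation (\<lambda>\<omega>. \<Prod>i\<in>B. f i (x (t i) (?\<eta> \<omega>)))"
      using indep_var_lebesgue_integral[OF iv iu ivv] unfolding u_def v_def by simp
  next
    fix A :: "nat set" and t :: "nat \<Rightarrow> nat" and a :: nat and f :: "nat \<Rightarrow> real^'d \<Rightarrow> complex" and K
    assume fm: "\<And>i. f i \<in> borel_measurable borel"
    have w: "(\<lambda>y. \<Prod>i\<in>A. f i (x (t i) y)) \<in> borel_measurable ?P" by (intro borel_measurable_prod measurable_compose[OF xm fm])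
    show "expectation (\<lambda>\<omega>. \<Prod>i\<in>A. f i (x (t i + a) (?\<eta> \<omega>))) = expectation (\<lambda>\<omega>. \<Prod>i\<in>A. f i (x (t i) (?\<eta> \<omega>)))"
      unfolding x_shift using reindex(1)[OF inj_shift w] .
  next
    fix a i :: nat assume ai: "a < i"
    have nm: "(\<lambda>\<omega>. norm (x i (?\<eta> \<omega>) - x' a i (?\<eta> \<omega>))) \<in> borel_measurable M" for a i by (rule measurable_compose[OF \<eta>mm norm_m])
    \<comment> \<open>Shifting by \<open>a\<close> moves the resampling time to 0, so the distance
      has the law of the one in the definition of \<open>\<delta> (i - a)\<close>.\<close>
    have eq: "distr M borel (\<lambda>\<omega>. norm (x i (?\<eta> \<omega>) - x' a i (?\<eta> \<omega>))) = distr M borel (\<lambda>\<omega>. norm (x (i - a) (?\<eta> \<omega>) - x' 0 (i - a) (?\<eta> \<omega>)))"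
    proof -
      have "x i y = x (i - a) (\<lambda>q. y (shift a q))" for y using x_shift[of "i - a" a y] ai by simp
      then show ?thesis unfolding x'_shift[OF ai] using reindex(2)[OF inj_shift norm_m[of "i - a" 0], of a] by simp
    qed
    have \<delta>: "\<delta> (i - a) = Lp_norm_ext M s (\<lambda>\<omega>. norm (x (i - a) (?\<eta> \<omega>) - x' 0 (i - a) (?\<eta> \<omega>)))" unfolding \<delta>_def X C ..
    have f: "Lp_norm_ext M s (\<lambda>\<omega>. norm (x (i - a) (?\<eta> \<omega>) - x' 0 (i - a) (?\<eta> \<omega>))) < \<infinity>" unfolding \<delta>[symmetric] using delta_fin ai by simp
    note hc = holder_coupling[OF nm[of "i - a" 0] nm[of i a] norm_ge_zero norm_ge_zero eq f rs alpha]
    show "integrable M (\<lambda>\<omega>. norm (x i (?\<eta> \<omega>) - x' a i (?\<eta> \<omega>)) powr \<alpha>)" by (rule hc(1))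
    fix Z :: "'a \<Rightarrow> real" assume "Z \<in> borel_measurable M" "\<And>\<omega>. \<bar>Z \<omega>\<bar> \<le> 1"
    then show "expectation (\<lambda>\<omega>. \<bar>Z \<omega>\<bar> * norm (x i (?\<eta> \<omega>) - x' a i (?\<eta> \<omega>)) powr \<alpha>) \<le> expectation (\<lambda>\<omega>. \<bar>Z \<omega>\<bar>) powr (1 / r) * real_of_ereal (\<delta> (i - a)) powr \<alpha>"
      unfolding \<delta> by (rule hc(2))
  next
    have "summable (\<lambda>i. real i ^ (2 * p - 2) * real_of_ereal (\<delta> i) powr \<alpha>)"
      using sum by (subst summable_Suc_iff[symmetric])
    then show "summable (\<lambda>i. real i ^ (2 * p - 2) * real_of_ereal (\<delta> i) powr \<alpha>)" .
  qed (use rs p alpha in auto)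
qed

subsection \<open>Chaining\<close>

text \<open>This controls a maximum of many terms without a root: summing the second term over all
  of them bounds the maximum by m plus a sum of 2 p-th powers, which is smallest in order when
  \<open>m\<close> is the 2 p-th root of that sum.\<close>

lemma max_root_bound:
  fixes x m :: real
  assumes "0 < m" "0 < p"
  shows "\<bar>x\<bar> \<le> m + x ^ (2 * p) / m ^ (2 * p - 1)"
proof (cases "\<bar>x\<bar> \<le> m")
  case True
  have "0 \<le> x ^ (2 * p) / m ^ (2 * p - 1)" using assms by (simp add: zero_le_even_power)
  then show ?thesis using True by linarith
next
  case False
  then have "m ^ (2 * p - 1) \<le> \<bar>x\<bar> ^ (2 * p - 1)" using assms by (intro power_mono) auto
  then have "\<bar>x\<bar> * m ^ (2 * p - 1) \<le> \<bar>x\<bar> * \<bar>x\<bar> ^ (2 * p - 1)" by (rule mult_left_mono) simp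
  also have "\<dots> = \<bar>x\<bar> ^ Suc (2 * p - 1)" by simp
  also have "Suc (2 * p - 1) = 2 * p" using assms by simp
  also have "\<bar>x\<bar> ^ (2 * p) = x ^ (2 * p)" by (simp add: power_even_abs)
  finally have "\<bar>x\<bar> \<le> x ^ (2 * p) / m ^ (2 * p - 1)" using assms by (simp add: pos_le_divide_eq)
  then show ?thesis using assms by linarith
qed

context empirical_grid
begin

text \<open>Chosen so that \<open>(\<rho> ^ k) ^ (2 * p)\<close> is the order of the number of grid
  points at level \<open>k\<close> times the moment bound there. It is below 1 exactly when
  \<open>dd / p < \<kappa>\<close>.\<close>

definition \<rho> :: real where "\<rho> = 2 powr (- (\<kappa> * real p - dd) / real (2 * p))"

lemma \<rho>_bounds: "0 < \<rho>" "\<rho> < 1"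
proof -
  show "0 < \<rho>" by (simp add: \<rho>_def)
  have "dd < \<kappa> * real p" using ratio_bounds(3) p_pos by (simp add: pos_divide_less_eq)
  then have "- (\<kappa> * real p - dd) / real (2 * p) < 0" using p_pos by (simp add: divide_neg_pos)
  then have "\<rho> < 2 powr 0" unfolding \<rho>_def by (rule powr_less_mono) simp
  then show "\<rho> < 1" by simp
qed

lemma \<rho>_power: "(\<rho> ^ k) ^ (2 * p) = (2 ^ k) powr dd * (2 powr (- \<kappa> * real k)) ^ p"
proof -
  have e: "real k * real (2 * p) * (- (\<kappa> * real p - dd) / real (2 * p)) = real k * dd + real p * (- \<kappa> * real k)"
    using p_pos by (simp add: field_simps)
  have "(\<rho> ^ k) ^ (2 * p) = \<rho> powr (real k * real (2 * p))"
    using \<rho>_bounds(1) by (simp add: power_mult[symmetric] powr_realpow[symmetric] powr_powr)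
  also have "\<dots> = 2 powr (real k * dd + real p * (- \<kappa> * real k))"
    unfolding \<rho>_def powr_powr e[symmetric] by (simp only: mult.commute powr_powr)
  also have "\<dots> = 2 powr (real k * dd) * 2 powr (real p * (- \<kappa> * real k))" by (rule powr_add)
  also have "2 powr (real k * dd) = (2 ^ k) powr dd" by (simp add: powr_realpow[symmetric] powr_powr)
  also have "2 powr (real p * (- \<kappa> * real k)) = (2 powr (- \<kappa> * real k)) ^ p"
    by (simp add: powr_realpow[symmetric] powr_powr mult.commute)
  finally show ?thesis .
qed

definition Ag :: "nat \<Rightarrow> ('d \<Rightarrow> int) set" where "Ag k = {a. \<forall>j. 0 \<le> a j \<and> a j \<le> 2 ^ k}"

lemma Ag_PiE: "Ag k = PiE UNIV (\<lambda>_. {0..2 ^ k})" by (auto simp: Ag_def PiE_def Pi_def)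

lemma finite_Ag: "finite (Ag k)" unfolding Ag_PiE by (intro finite_PiE) auto

lemma steps_PiE: "steps = PiE UNIV (\<lambda>_. {-2..2})" by (auto simp: steps_def PiE_def Pi_def)

lemma finite_steps: "finite steps" unfolding steps_PiE by (intro finite_PiE) auto

lemma card_Ag: "real (card (Ag k)) \<le> 2 ^ CARD('d) * (2 ^ k) powr dd"
proof -
  have "card (Ag k) = (2 ^ k + 1) ^ CARD('d)" unfolding Ag_PiE by (subst card_PiE) (auto simp: nat_add_distrib nat_power_eq add.commute)
  then have "real (card (Ag k)) = (2 ^ k + 1) ^ CARD('d)" by (simp add: add.commute)
  also have "\<dots> \<le> (2 * 2 ^ k) ^ CARD('d)" by (intro power_mono) auto
  also have "\<dots> = 2 ^ CARD('d) * (2 ^ k) powr dd" by (simp add: power_mult_distrib dd_def powr_realpow)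
  finally show ?thesis .
qed

definition Qk :: "nat \<Rightarrow> (nat \<Rightarrow> ('d \<Rightarrow> int) \<Rightarrow> real) \<Rightarrow> real" where
  "Qk k v = (\<Sum>a\<in>Ag k. \<Sum>b\<in>steps. (v (Suc k) (\<lambda>j. 2 * a j + b j) - v k a) ^ (2 * p) + (v k (\<lambda>j. a j + b j) - v k a) ^ (2 * p))"

text \<open>A measurable majorant of all increments between neighbouring grid points of level \<open>k\<close>.\<close>
definition Mk :: "nat \<Rightarrow> (nat \<Rightarrow> ('d \<Rightarrow> int) \<Rightarrow> real) \<Rightarrow> real" where
  "Mk k v = \<rho> ^ k + Qk k v / (\<rho> ^ k) ^ (2 * p - 1)"

lemma Qk_nonneg: "0 \<le> Qk k v"
  unfolding Qk_def by (intro sum_nonneg add_nonneg_nonneg zero_le_even_power) auto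

lemma Mk_nonneg: "0 \<le> Mk k v"
  unfolding Mk_def using \<rho>_bounds Qk_nonneg[of k v] by simp

lemma Mk_steps:
  assumes a: "a \<in> Ag k" and b: "b \<in> steps"
  shows "\<bar>v (Suc k) (\<lambda>j. 2 * a j + b j) - v k a\<bar> \<le> Mk k v" "\<bar>v k (\<lambda>j. a j + b j) - v k a\<bar> \<le> Mk k v"
proof -
  define x where "x = v (Suc k) (\<lambda>j. 2 * a j + b j) - v k a"
  define y where "y = v k (\<lambda>j. a j + b j) - v k a"
  have ev: "0 \<le> z ^ (2 * p)" for z :: real by (rule zero_le_even_power) simp
  have "x ^ (2 * p) + y ^ (2 * p) \<le> (\<Sum>b\<in>steps. (v (Suc k) (\<lambda>j. 2 * a j + b j) - v k a) ^ (2 * p) + (v k (\<lambda>j. a j + b j) - v k a) ^ (2 * p))"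
    unfolding x_def y_def by (rule member_le_sum[OF b _ finite_steps]) (intro add_nonneg_nonneg ev)
  also have "\<dots> \<le> Qk k v"
    unfolding Qk_def by (rule member_le_sum[OF a _ finite_Ag]) (intro sum_nonneg add_nonneg_nonneg ev)
  finally have le: "x ^ (2 * p) \<le> Qk k v" "y ^ (2 * p) \<le> Qk k v" using ev[of x] ev[of y] by linarith+
  have pos: "0 < \<rho> ^ k" using \<rho>_bounds by simp
  have "\<bar>z\<bar> \<le> Mk k v" if "z ^ (2 * p) \<le> Qk k v" for z
  proof -
    have "z ^ (2 * p) / (\<rho> ^ k) ^ (2 * p - 1) \<le> Qk k v / (\<rho> ^ k) ^ (2 * p - 1)" using that pos by (intro divide_right_mono) auto
    then show ?thesis using max_root_bound[OF pos p_pos, of z] unfolding Mk_def by linarith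
  qed
  then show "\<bar>v (Suc k) (\<lambda>j. 2 * a j + b j) - v k a\<bar> \<le> Mk k v" "\<bar>v k (\<lambda>j. a j + b j) - v k a\<bar> \<le> Mk k v"
    using le unfolding x_def y_def by blast+
qed

definition Kst :: real where "Kst = 2 * 2 ^ CARD('d) * real (card (steps :: ('d \<Rightarrow> int) set))"

text \<open>Stated for an arbitrary field on the grids, since it is applied both to the empirical
  sums and to the Gaussian field. With the choice of \<rho> the two terms of \<open>Mk\<close> have
  the same order.\<close>

lemma Mk_expectation:
  fixes N :: "'n measure" and V :: "'n \<Rightarrow> nat \<Rightarrow> ('d \<Rightarrow> int) \<Rightarrow> real"
  assumes N: "prob_space N" and C: "0 \<le> C"
    and ref: "\<And>a b. b \<in> steps \<Longrightarrow> integrable N (\<lambda>\<omega>. (V \<omega> (Suc k) (\<lambda>j. 2 * a j + b j) - V \<omega> k a) ^ (2 * p))"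
      "\<And>a b. b \<in> steps \<Longrightarrow> (\<integral>\<omega>. (V \<omega> (Suc k) (\<lambda>j. 2 * a j + b j) - V \<omega> k a) ^ (2 * p) \<partial>N) \<le> C * (2 powr (- \<kappa> * real k)) ^ p"
    and shf: "\<And>a b. b \<in> steps \<Longrightarrow> integrable N (\<lambda>\<omega>. (V \<omega> k (\<lambda>j. a j + b j) - V \<omega> k a) ^ (2 * p))"
      "\<And>a b. b \<in> steps \<Longrightarrow> (\<integral>\<omega>. (V \<omega> k (\<lambda>j. a j + b j) - V \<omega> k a) ^ (2 * p) \<partial>N) \<le> C * (2 powr (- \<kappa> * real k)) ^ p"
  shows "integrable N (\<lambda>\<omega>. Mk k (V \<omega>))" "(\<integral>\<omega>. Mk k (V \<omega>) \<partial>N) \<le> (1 + Kst * C) * \<rho> ^ k"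
proof -
  interpret N: prob_space N by (rule N)
  define D where "D = C * (2 powr (- \<kappa> * real k)) ^ p"
  have D0: "0 \<le> D" using C by (simp add: D_def)
  have iQ: "integrable N (\<lambda>\<omega>. Qk k (V \<omega>))"
    unfolding Qk_def by (intro Bochner_Integration.integrable_sum Bochner_Integration.integrable_add ref(1) shf(1))
  show "integrable N (\<lambda>\<omega>. Mk k (V \<omega>))" unfolding Mk_def using iQ by simp
  have "(\<integral>\<omega>. Qk k (V \<omega>) \<partial>N) = (\<Sum>a\<in>Ag k. \<Sum>b\<in>steps. (\<integral>\<omega>. (V \<omega> (Suc k) (\<lambda>j. 2 * a j + b j) - V \<omega> k a) ^ (2 * p) \<partial>N) + (\<integral>\<omega>. (V \<omega> k (\<lambda>j. a j + b j) - V \<omega> k a) ^ (2 * p) \<partial>N))"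
    unfolding Qk_def
    by (simp add: Bochner_Integration.integral_sum Bochner_Integration.integrable_sum Bochner_Integration.integral_add ref(1) shf(1) cong: sum.cong)
  also have "\<dots> \<le> (\<Sum>a\<in>Ag k. \<Sum>b\<in>(steps :: ('d \<Rightarrow> int) set). D + D)"
    unfolding D_def by (intro sum_mono add_mono ref(2) shf(2))
  also have "\<dots> = real (card (Ag k)) * (real (card (steps :: ('d \<Rightarrow> int) set)) * (2 * D))" by simp
  also have "\<dots> \<le> (2 ^ CARD('d) * (2 ^ k) powr dd) * (real (card (steps :: ('d \<Rightarrow> int) set)) * (2 * D))"
    using D0 by (intro mult_right_mono card_Ag) auto
  also have "\<dots> = Kst * C * (\<rho> ^ k) ^ (2 * p)" unfolding \<rho>_power D_def Kst_def by (simp only: mult_ac)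
  finally have Q: "(\<integral>\<omega>. Qk k (V \<omega>) \<partial>N) \<le> Kst * C * (\<rho> ^ k) ^ (2 * p)" .
  have pos: "0 < \<rho> ^ k" using \<rho>_bounds by simp
  have "(\<integral>\<omega>. Mk k (V \<omega>) \<partial>N) = \<rho> ^ k + (\<integral>\<omega>. Qk k (V \<omega>) \<partial>N) / (\<rho> ^ k) ^ (2 * p - 1)"
    unfolding Mk_def using iQ by (simp add: N.prob_space)
  also have "\<dots> \<le> \<rho> ^ k + (Kst * C * (\<rho> ^ k) ^ (2 * p)) / (\<rho> ^ k) ^ (2 * p - 1)"
    using Q pos by (intro add_left_mono divide_right_mono) auto
  also have "(\<rho> ^ k) ^ (2 * p) = \<rho> ^ k * (\<rho> ^ k) ^ (2 * p - 1)"
    using p_pos by (simp add: power_Suc[symmetric] del: power_Suc)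
  also have "\<rho> ^ k + (Kst * C * (\<rho> ^ k * (\<rho> ^ k) ^ (2 * p - 1))) / (\<rho> ^ k) ^ (2 * p - 1) = (1 + Kst * C) * \<rho> ^ k"
  proof -
    have "(\<rho> ^ k) ^ (2 * p - 1) \<noteq> 0" using \<rho>_bounds by simp
    then show ?thesis by (simp add: distrib_right)
  qed
  finally show "(\<integral>\<omega>. Mk k (V \<omega>) \<partial>N) \<le> (1 + Kst * C) * \<rho> ^ k" .
qed

section \<open>Grid cells on the extended space and bracketing of the empirical process\<close>

definition Fb :: "'d \<Rightarrow> ereal \<Rightarrow> real" where
  "Fb j t = prob {\<omega>\<in>space M. ereal (X 0 \<omega> $ j) \<le> t}"

lemma Fb_ereal: "Fb j (ereal y) = Fm j y" by (simp add: Fb_def Fm_def)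

lemma Fb_sets: "{\<omega>\<in>space M. ereal (X 0 \<omega> $ j) \<le> t} \<in> sets M" by measurable

lemma Fb_mono: "s \<le> t \<Longrightarrow> Fb j s \<le> Fb j t"
  unfolding Fb_def by (rule finite_measure_mono[OF _ Fb_sets]) (auto intro: order_trans)

lemma Fb_range: "0 \<le> Fb j t" "Fb j t \<le> 1" unfolding Fb_def by (auto simp: prob_le_1)

lemma Fb_inf: "Fb j \<infinity> = 1" "Fb j (- \<infinity>) = 0"
  unfolding Fb_def by (simp_all add: prob_space)

lemma Fb_continuous: "continuous_on UNIV (Fb j)"
  unfolding continuous_on_def
proof
  fix t :: ereal
  show "(Fb j \<longlongrightarrow> Fb j t) (at t within UNIV)"
  proof (cases t)
    case (real y)
    have "(Fm j \<longlongrightarrow> Fm j y) (at y)" using Fm_continuous[of UNIV j] by (simp add: continuous_on_def)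
    then have "((\<lambda>y. Fb j (ereal y)) \<longlongrightarrow> Fb j t) (at y)" unfolding Fb_ereal real .
    then show ?thesis unfolding real by (simp add: at_ereal filterlim_def filtermap_filtermap)
  next
    case PInf
    have "((\<lambda>y. Fb j (ereal y)) \<longlongrightarrow> 1) at_top" unfolding Fb_ereal by (rule Fm_top)
    then have "(Fb j \<longlongrightarrow> 1) (at_left \<infinity>)" by (simp add: at_left_PInf filterlim_def filtermap_filtermap)
    moreover have "at_left (\<infinity>::ereal) = at \<infinity>" by (rule at_within_nhd[of _ UNIV]) (auto simp: less_top)
    ultimately show ?thesis using PInf Fb_inf by simp
  next
    case MInf
    have "((\<lambda>y. Fb j (ereal y)) \<longlongrightarrow> 0) at_bot" unfolding Fb_ereal by (rule Fm_bot)
    then have "(Fb j \<longlongrightarrow> 0) (at_right (- \<infinity>))" by (simp add: at_right_MInf filterlim_def filtermap_filtermap)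
    moreover have "at_right (- \<infinity>::ereal) = at (- \<infinity>)" by (rule at_within_nhd[of _ UNIV]) auto
    ultimately show ?thesis using MInf Fb_inf by simp
  qed
qed

definition agrid :: "nat \<Rightarrow> ereal^'d \<Rightarrow> 'd \<Rightarrow> int" where
  "agrid k t = (\<lambda>j. \<lfloor>2 ^ k * Fb j (t $ j)\<rfloor>)"

lemma agrid_Ag: "agrid k t \<in> Ag k"
proof -
  have "0 \<le> \<lfloor>2 ^ k * Fb j (t $ j)\<rfloor> \<and> \<lfloor>2 ^ k * Fb j (t $ j)\<rfloor> \<le> 2 ^ k" for j
  proof
    show "0 \<le> \<lfloor>2 ^ k * Fb j (t $ j)\<rfloor>" using Fb_range[of j] by simp
    have "2 ^ k * Fb j (t $ j) \<le> 2 ^ k * 1" using Fb_range[of j] by (intro mult_left_mono) auto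
    then have "\<lfloor>2 ^ k * Fb j (t $ j)\<rfloor> \<le> \<lfloor>(2::real) ^ k\<rfloor>" by (intro floor_mono) simp
    then show "\<lfloor>2 ^ k * Fb j (t $ j)\<rfloor> \<le> 2 ^ k" by (simp add: floor_power[of 2 k, simplified])
  qed
  then show ?thesis by (simp add: Ag_def agrid_def)
qed

lemma agrid_Suc:
  obtains b where "b \<in> steps" "agrid (Suc k) t = (\<lambda>j. 2 * agrid k t j + b j)"
proof
  define b where "b j = agrid (Suc k) t j - 2 * agrid k t j" for j
  have "-2 \<le> b j \<and> b j \<le> 2" for j
  proof -
    define z where "z = 2 ^ k * Fb j (t $ j)"
    have "b j = \<lfloor>2 * z\<rfloor> - 2 * \<lfloor>z\<rfloor>" by (simp add: b_def agrid_def z_def mult.assoc)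
    then show ?thesis by linarith
  qed
  then show "b \<in> steps" by (simp add: steps_def)
  show "agrid (Suc k) t = (\<lambda>j. 2 * agrid k t j + b j)" by (simp add: b_def)
qed

lemma grid_chaining:
  assumes "k \<le> K"
  shows "\<bar>v k (agrid k t) - v K (agrid K t)\<bar> \<le> (\<Sum>i\<in>{k..<K}. Mk i v)"
  using assms
proof (induction K rule: dec_induct)
  case (step n)
  obtain b where b: "b \<in> steps" "agrid (Suc n) t = (\<lambda>j. 2 * agrid n t j + b j)" by (rule agrid_Suc)
  have "\<bar>v (Suc n) (agrid (Suc n) t) - v n (agrid n t)\<bar> \<le> Mk n v"
    unfolding b(2) by (rule Mk_steps(1)[OF agrid_Ag b(1)])
  moreover have "(\<Sum>i\<in>{k..<Suc n}. Mk i v) = (\<Sum>i\<in>{k..<n}. Mk i v) + Mk n v" using step by simp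
  ultimately show ?case using step.IH by linarith
qed simp

lemma \<psi>_lower: "\<psi> k (agrid k t) x \<le> (if ext_le x t then 1 else 0)"
proof (cases "ext_le x t")
  case True
  then show ?thesis by (simp add: \<psi>_range)
next
  case False
  then obtain j where j: "t $ j < ereal (x $ j)" by (auto simp: ext_le_def not_le)
  then have "Fb j (t $ j) \<le> Fm j (x $ j)" unfolding Fb_ereal[symmetric] by (intro Fb_mono) simp
  then have "2 ^ k * Fb j (t $ j) \<le> 2 ^ k * Fm j (x $ j)" by (rule mult_left_mono) simp
  then have "real_of_int (agrid k t j) - 2 ^ k * Fm j (x $ j) \<le> 0" unfolding agrid_def by linarith
  then have "clamp01 (real_of_int (agrid k t j) - 2 ^ k * Fm j (x $ j)) = 0" by (rule clamp01_0)
  then have "\<psi> k (agrid k t) x = 0" unfolding \<psi>_def by (intro prod_zero) auto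
  then show ?thesis using False by simp
qed

text \<open>Of the shift by 2, one unit makes up for rounding down to the grid and one for the width
  of the ramp.\<close>

lemma \<psi>_upper: "(if ext_le x t then 1 else 0) \<le> \<psi> k (\<lambda>j. agrid k t j + 2) x"
proof (cases "ext_le x t")
  case True
  have "clamp01 (real_of_int (agrid k t j + 2) - 2 ^ k * Fm j (x $ j)) = 1" for j
  proof (rule clamp01_1)
    have "Fm j (x $ j) \<le> Fb j (t $ j)" unfolding Fb_ereal[symmetric] using True by (intro Fb_mono) (simp add: ext_le_def)
    then have "2 ^ k * Fm j (x $ j) \<le> 2 ^ k * Fb j (t $ j)" by (rule mult_left_mono) simp
    then show "1 \<le> real_of_int (agrid k t j + 2) - 2 ^ k * Fm j (x $ j)" unfolding agrid_def by linarith
  qed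
  then show ?thesis using True by (simp add: \<psi>_def)
qed (simp add: \<psi>_range)

definition ygrid :: "nat \<Rightarrow> 'a \<Rightarrow> nat \<Rightarrow> ('d \<Rightarrow> int) \<Rightarrow> real" where
  "ygrid n \<omega> k a = esum (\<psi> k a) n \<omega>"

lemma ext_le_measurable [measurable]: "{\<omega>\<in>space M. ext_le (X i \<omega>) t} \<in> sets M"
proof -
  have "{\<omega>\<in>space M. ext_le (X i \<omega>) t} = {\<omega>\<in>space M. \<forall>k\<in>UNIV. ereal (X i \<omega> $ k) \<le> t $ k}" by (simp add: ext_le_def)
  also have "\<dots> \<in> sets M" by measurable
  finally show ?thesis .
qed

lemma integrable_\<psi>: "integrable M (\<lambda>\<omega>. \<psi> k a (X i \<omega>))"
  by (rule bounded_integrable[where B=1], measurable) (simp add: \<psi>_range abs_of_nonneg)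

text \<open>The indicator lies between the grid functions at \<open>agrid k t\<close> and two units
  above. The fluctuation of this bracket is a single increment of level \<open>k\<close>; its mean
  width, multiplied by sqrt n, is the remaining bias.\<close>

lemma emp_proc_end:
  assumes n: "1 \<le> n"
  shows "\<bar>emp_proc M X n \<omega> t - ygrid n \<omega> k (agrid k t)\<bar> \<le> Mk k (ygrid n \<omega>) + sqrt (real n) * (7 * dd / 2 ^ k)"
proof -
  define a where "a = agrid k t"
  define a' where "a' = (\<lambda>j. a j + (\<lambda>_. 2) j)"
  define I where "I x = (if ext_le x t then 1 else 0 :: real)" for x
  define G where "G = measure M {\<omega>\<in>space M. ext_le (X 0 \<omega>) t}"
  define e0 where "e0 = expectation (\<lambda>\<omega>. \<psi> k a (X 0 \<omega>))"
  define e2 where "e2 = expectation (\<lambda>\<omega>. \<psi> k a' (X 0 \<omega>))"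
  have lo: "\<psi> k a x \<le> I x" for x unfolding I_def a_def by (rule \<psi>_lower)
  have up: "I x \<le> \<psi> k a' x" for x unfolding I_def a_def a'_def by (rule \<psi>_upper)
  have two: "(\<lambda>_. 2) \<in> steps" by (simp add: steps_def)
  have "level_fun k (\<lambda>x. \<psi> k a' x - \<psi> k a x)" unfolding a'_def by (rule level_fun_shift[OF two])
  then have L1: "expectation (\<lambda>\<omega>. \<bar>\<psi> k a' (X 0 \<omega>) - \<psi> k a (X 0 \<omega>)\<bar>) \<le> \<pi>k k" by (simp add: level_fun_def)
  have "e2 - e0 = expectation (\<lambda>\<omega>. \<psi> k a' (X 0 \<omega>) - \<psi> k a (X 0 \<omega>))"
    unfolding e0_def e2_def by (rule Bochner_Integration.integral_diff[symmetric]) (rule integrable_\<psi>)+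
  also have "\<dots> \<le> expectation (\<lambda>\<omega>. \<bar>\<psi> k a' (X 0 \<omega>) - \<psi> k a (X 0 \<omega>)\<bar>)"
    by (rule integral_mono) (use integrable_\<psi> in auto)
  also have "\<dots> \<le> 7 * dd / 2 ^ k" using L1 by (simp add: \<pi>k_def)
  finally have e20: "e2 - e0 \<le> 7 * dd / 2 ^ k" .
  have GI: "G = expectation (\<lambda>\<omega>. I (X 0 \<omega>))" and iI: "integrable M (\<lambda>\<omega>. I (X 0 \<omega>))"
  proof -
    have e: "expectation (\<lambda>\<omega>. I (X 0 \<omega>)) = expectation (indicat_real {\<omega>\<in>space M. ext_le (X 0 \<omega>) t})"
      by (rule Bochner_Integration.integral_cong) (auto simp: I_def indicator_def)
    show "G = expectation (\<lambda>\<omega>. I (X 0 \<omega>))" unfolding e G_def by simp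
    have "integrable M (indicat_real {\<omega>\<in>space M. ext_le (X 0 \<omega>) t})" by (rule bounded_integrable[where B=1]) (auto simp: indicator_def)
    then show "integrable M (\<lambda>\<omega>. I (X 0 \<omega>))"
      by (rule Bochner_Integration.integrable_cong[THEN iffD1, rotated 2]) (auto simp: I_def indicator_def)
  qed
  have Gb: "e0 \<le> G" "G \<le> e2" unfolding e0_def e2_def GI
    by (rule integral_mono[OF integrable_\<psi> iI lo], rule integral_mono[OF iI integrable_\<psi> up])
  have sq: "0 < sqrt (real n)" using n by simp
  define T where "T = (\<Sum>i=1..n. I (X i \<omega>) - G)"
  define Ta where "Ta = (\<Sum>i=1..n. \<psi> k a (X i \<omega>) - e0)"
  define Tb where "Tb = (\<Sum>i=1..n. \<psi> k a' (X i \<omega>) - e2)"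
  have "T - Ta = (\<Sum>i=1..n. (I (X i \<omega>) - G) - (\<psi> k a (X i \<omega>) - e0))" unfolding T_def Ta_def by (rule sum_subtractf[symmetric])
  also have "\<dots> \<le> (\<Sum>i=1..n. ((\<psi> k a' (X i \<omega>) - e2) - (\<psi> k a (X i \<omega>) - e0)) + (e2 - e0))"
  proof (rule sum_mono)
    fix i show "(I (X i \<omega>) - G) - (\<psi> k a (X i \<omega>) - e0) \<le> ((\<psi> k a' (X i \<omega>) - e2) - (\<psi> k a (X i \<omega>) - e0)) + (e2 - e0)"
      using up[of "X i \<omega>"] Gb by linarith
  qed
  also have "\<dots> = (Tb - Ta) + real n * (e2 - e0)" unfolding Ta_def Tb_def sum.distrib sum_subtractf[symmetric] by simp
  finally have u: "T - Ta \<le> (Tb - Ta) + real n * (e2 - e0)" .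
  have "- (real n * (e2 - e0)) = (\<Sum>i=1..n. - (e2 - e0))" by (simp add: right_diff_distrib)
  also have "\<dots> \<le> (\<Sum>i=1..n. (I (X i \<omega>) - G) - (\<psi> k a (X i \<omega>) - e0))"
  proof (rule sum_mono)
    fix i show "- (e2 - e0) \<le> (I (X i \<omega>) - G) - (\<psi> k a (X i \<omega>) - e0)" using lo[of "X i \<omega>"] Gb by linarith
  qed
  also have "\<dots> = T - Ta" unfolding T_def Ta_def by (rule sum_subtractf)
  finally have l: "- (real n * (e2 - e0)) \<le> T - Ta" .
  have ne: "0 \<le> real n * (e2 - e0)" using Gb by simp
  have abs: "\<bar>T - Ta\<bar> \<le> \<bar>Tb - Ta\<bar> + real n * (e2 - e0)" using u l ne by linarith
  have U: "emp_proc M X n \<omega> t = T / sqrt (real n)" by (simp add: emp_proc_def T_def I_def G_def)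
  have ya: "ygrid n \<omega> k a = Ta / sqrt (real n)" by (simp add: ygrid_def esum_def Ta_def e0_def)
  have yb: "ygrid n \<omega> k a' = Tb / sqrt (real n)" by (simp add: ygrid_def esum_def Tb_def e2_def)
  have "\<bar>emp_proc M X n \<omega> t - ygrid n \<omega> k a\<bar> = \<bar>T - Ta\<bar> / sqrt (real n)" unfolding U ya diff_divide_distrib[symmetric] abs_divide by simp
  also have "\<dots> \<le> (\<bar>Tb - Ta\<bar> + real n * (e2 - e0)) / sqrt (real n)" using abs sq by (intro divide_right_mono) auto
  also have "\<dots> = \<bar>ygrid n \<omega> k a' - ygrid n \<omega> k a\<bar> + sqrt (real n) * (e2 - e0)"
  proof -
    have "real n / sqrt (real n) = sqrt (real n)" by (rule real_div_sqrt) simp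
    then have "real n * (e2 - e0) / sqrt (real n) = sqrt (real n) * (e2 - e0)" by (metis times_divide_eq_left)
    then show ?thesis unfolding ya yb diff_divide_distrib[symmetric] abs_divide add_divide_distrib by simp
  qed
  also have "\<bar>ygrid n \<omega> k a' - ygrid n \<omega> k a\<bar> \<le> Mk k (ygrid n \<omega>)"
    unfolding a'_def by (rule Mk_steps(2)[OF _ two]) (simp add: a_def agrid_Ag)
  also have "sqrt (real n) * (e2 - e0) \<le> sqrt (real n) * (7 * dd / 2 ^ k)" using e20 sq by (intro mult_left_mono) auto
  finally show ?thesis by (simp add: a_def)
qed

lemma esum_diff: "g \<in> borel_measurable borel \<Longrightarrow> h \<in> borel_measurable borel \<Longrightarrow> (\<And>x. \<bar>g x\<bar> \<le> B) \<Longrightarrow> (\<And>x. \<bar>h x\<bar> \<le> B) \<Longrightarrow>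
  esum (\<lambda>x. g x - h x) n \<omega> = esum g n \<omega> - esum h n \<omega>"
proof -
  assume m: "g \<in> borel_measurable borel" "h \<in> borel_measurable borel" and b: "\<And>x. \<bar>g x\<bar> \<le> B" "\<And>x. \<bar>h x\<bar> \<le> B"
  have i: "integrable M (\<lambda>\<omega>. g (X 0 \<omega>))" "integrable M (\<lambda>\<omega>. h (X 0 \<omega>))"
    by (rule bounded_integrable[where B=B, OF measurable_compose[OF X_meas m(1)]], simp add: b)
      (rule bounded_integrable[where B=B, OF measurable_compose[OF X_meas m(2)]], simp add: b)
  have "expectation (\<lambda>\<omega>. g (X 0 \<omega>) - h (X 0 \<omega>)) = expectation (\<lambda>\<omega>. g (X 0 \<omega>)) - expectation (\<lambda>\<omega>. h (X 0 \<omega>))" using i by simp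
  note ed = this
  show ?thesis unfolding esum_def ed diff_divide_distrib[symmetric] sum_subtractf[symmetric] by (simp add: algebra_simps)
qed

lemma ygrid_diff: "ygrid n \<omega> k a - ygrid n \<omega> l b = esum (\<lambda>x. \<psi> k a x - \<psi> l b x) n \<omega>"
  unfolding ygrid_def by (rule esum_diff[symmetric, where B=1]) (simp_all add: \<psi>_range abs_of_nonneg)

lemma esum_bound: "(\<And>x. \<bar>g x\<bar> \<le> B) \<Longrightarrow> g \<in> borel_measurable borel \<Longrightarrow> integrable M (\<lambda>\<omega>. esum g n \<omega> ^ m)"
proof -
  assume b: "\<And>x. \<bar>g x\<bar> \<le> B" and m: "g \<in> borel_measurable borel"
  define e where "e = expectation (\<lambda>\<omega>. g (X 0 \<omega>))"
  have B: "\<bar>esum g n \<omega>\<bar> \<le> (real n * (B + \<bar>e\<bar>)) / sqrt (real n)" for \<omega>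
  proof -
    have "\<bar>\<Sum>i\<in>{1..n}. g (X i \<omega>) - e\<bar> \<le> (\<Sum>i\<in>{1..n}. \<bar>g (X i \<omega>) - e\<bar>)" by (rule sum_abs)
    also have "\<dots> \<le> (\<Sum>i\<in>{1..n}. B + \<bar>e\<bar>)"
    proof (rule sum_mono)
      fix i show "\<bar>g (X i \<omega>) - e\<bar> \<le> B + \<bar>e\<bar>" using abs_triangle_ineq4[of "g (X i \<omega>)" e] b[of "X i \<omega>"] by linarith
    qed
    finally have "\<bar>\<Sum>i\<in>{1..n}. g (X i \<omega>) - e\<bar> \<le> real n * (B + \<bar>e\<bar>)" by simp
    then show ?thesis unfolding esum_def e_def[symmetric] abs_divide by (simp add: divide_right_mono)
  qed
  show ?thesis
  proof (rule bounded_integrable[where B="((real n * (B + \<bar>e\<bar>)) / sqrt (real n)) ^ m"])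
    show "(\<lambda>\<omega>. esum g n \<omega> ^ m) \<in> borel_measurable M" using esum_measurable[OF m] by (rule borel_measurable_power)
    show "norm (esum g n \<omega> ^ m) \<le> ((real n * (B + \<bar>e\<bar>)) / sqrt (real n)) ^ m" for \<omega>
      unfolding real_norm_def power_abs by (rule power_mono[OF B]) simp
  qed
qed

lemma Mk_ygrid:
  "\<exists>C\<ge>0. \<forall>k n. 1 \<le> n \<longrightarrow> 2 ^ k \<le> 2 * n \<longrightarrow> integrable M (\<lambda>\<omega>. Mk k (ygrid n \<omega>)) \<and> expectation (\<lambda>\<omega>. Mk k (ygrid n \<omega>)) \<le> C * \<rho> ^ k"
proof -
  obtain C where C: "C \<ge> 0" "\<forall>k g n. level_fun k g \<longrightarrow> 1 \<le> n \<longrightarrow>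
     expectation (\<lambda>\<omega>. esum g n \<omega> ^ 2) \<le> C * 2 powr (- \<kappa> * real k) \<and>
     (2 ^ k \<le> 2 * n \<longrightarrow> expectation (\<lambda>\<omega>. esum g n \<omega> ^ (2 * p)) \<le> C * (2 powr (- \<kappa> * real k)) ^ p)"
    using level_moments by (elim exE conjE) (rule that)
  have Kst0: "0 \<le> Kst" by (simp add: Kst_def)
  show ?thesis
  proof (intro exI[of _ "1 + Kst * C"] conjI[of "0 \<le> 1 + Kst * C"] allI impI)
    show "0 \<le> 1 + Kst * C" using C(1) Kst0 by (simp add: add_nonneg_nonneg)
    fix k and n :: nat assume n: "1 \<le> n" and kn: "2 ^ k \<le> 2 * n"
    have b1: "\<bar>\<psi> k a x - \<psi> l b x\<bar> \<le> 1" for k l a b x using \<psi>_range[of k a x] \<psi>_range[of l b x] by linarith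
    have mm: "(\<lambda>x. \<psi> k a x - \<psi> l b x) \<in> borel_measurable borel" for k l a b by measurable
    have int: "integrable M (\<lambda>\<omega>. (ygrid n \<omega> k a - ygrid n \<omega> l b) ^ (2 * p))" for k l a b
      unfolding ygrid_diff by (rule esum_bound[OF b1 mm])
    have e1: "expectation (\<lambda>\<omega>. (ygrid n \<omega> (Suc k) (\<lambda>j. 2 * a j + b j) - ygrid n \<omega> k a) ^ (2 * p)) \<le> C * (2 powr (- \<kappa> * real k)) ^ p" if "b \<in> steps" for a b
      unfolding ygrid_diff using C(2)[rule_format, OF level_fun_refine[OF that] n] kn by blast
    have e2: "expectation (\<lambda>\<omega>. (ygrid n \<omega> k (\<lambda>j. a j + b j) - ygrid n \<omega> k a) ^ (2 * p)) \<le> C * (2 powr (- \<kappa> * real k)) ^ p" if "b \<in> steps" for a b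
      unfolding ygrid_diff using C(2)[rule_format, OF level_fun_shift[OF that] n] kn by blast
    show "integrable M (\<lambda>\<omega>. Mk k (ygrid n \<omega>)) \<and> expectation (\<lambda>\<omega>. Mk k (ygrid n \<omega>)) \<le> (1 + Kst * C) * \<rho> ^ k"
      using Mk_expectation[where V="ygrid n" and N=M and k=k and C=C, OF prob_space_axioms C(1) int e1 int e2] by blast
  qed
qed

text \<open>Chaining from level \<open>k\<close> up to the cutoff, followed by bracketing. The
  majorants form a geometric series, and the bias of order 1 / sqrt n falls below \<rho> ^ k for
  large \<open>n\<close>.\<close>

lemma U_approximation:
  "\<exists>C\<ge>0. \<forall>k. \<forall>\<^sub>F n in sequentially. \<exists>R. integrable M R \<and>
     (\<forall>\<omega>\<in>space M. \<forall>t. \<bar>emp_proc M X n \<omega> t - ygrid n \<omega> k (agrid k t)\<bar> \<le> R \<omega>) \<and> expectation R \<le> C * \<rho> ^ k"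
proof -
  obtain C where C: "C \<ge> 0" "\<And>k n. 1 \<le> n \<Longrightarrow> 2 ^ k \<le> 2 * n \<Longrightarrow> integrable M (\<lambda>\<omega>. Mk k (ygrid n \<omega>)) \<and> expectation (\<lambda>\<omega>. Mk k (ygrid n \<omega>)) \<le> C * \<rho> ^ k"
    using Mk_ygrid by (elim exE conjE) (rule that, auto)
  have main: "\<forall>\<^sub>F n in sequentially. \<exists>R. integrable M R \<and>
     (\<forall>\<omega>\<in>space M. \<forall>t. \<bar>emp_proc M X n \<omega> t - ygrid n \<omega> k (agrid k t)\<bar> \<le> R \<omega>) \<and> expectation R \<le> (C / (1 - \<rho>) + 1) * \<rho> ^ k" for k
  proof -
    have "(\<lambda>n. 7 * dd / sqrt (real n)) \<longlonglongrightarrow> 0" by real_asymp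
    then have ev: "\<forall>\<^sub>F n in sequentially. 7 * dd / sqrt (real n) < \<rho> ^ k"
      by (rule order_tendstoD(2)) (use \<rho>_bounds in simp)
    show ?thesis
      using ev eventually_ge_at_top[of "2 ^ k"]
    proof eventually_elim
      case (elim n)
      have n1: "1 \<le> n" using elim(2) by (rule order_trans[rotated]) simp
      \<comment> \<open>Minimality gives \<open>n \<le> 2 ^ K\<close> and
        \<open>2 ^ K \<le> 2 * n\<close>: fine enough for a vanishing bias, coarse enough for the
        moment bound at all levels up to \<open>K\<close>.\<close>
      define K where "K = (LEAST K. n \<le> 2 ^ K)"
      have ex: "n \<le> 2 ^ n" by (rule less_imp_le[OF less_exp])
      have K1: "n \<le> 2 ^ K" unfolding K_def by (rule LeastI[of "\<lambda>K. n \<le> 2 ^ K"]) (rule ex)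
      have K2: "2 ^ K \<le> 2 * n"
      proof (cases K)
        case 0
        then show ?thesis using n1 by simp
      next
        case (Suc K')
        then have "\<not> n \<le> 2 ^ K'" using not_less_Least[of K' "\<lambda>K. n \<le> 2 ^ K"] unfolding K_def[symmetric] by simp
        then show ?thesis using Suc by simp
      qed
      have kK: "k \<le> K"
      proof (rule ccontr)
        assume "\<not> k \<le> K"
        then have "(2::nat) ^ K < 2 ^ k" by (intro power_strict_increasing) auto
        then show False using K1 elim(2) by linarith
      qed
      have iK: "(2::nat) ^ i \<le> 2 * n" if "i \<le> K" for i
        using power_increasing[OF that, of "2::nat"] K2 by linarith
      define R where "R \<omega> = (\<Sum>i\<in>{k..K}. Mk i (ygrid n \<omega>)) + 7 * dd / sqrt (real n)" for \<omega>
      have Ri: "integrable M (\<lambda>\<omega>. \<Sum>i\<in>{k..K}. Mk i (ygrid n \<omega>))"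
        by (intro Bochner_Integration.integrable_sum) (use C(2)[OF n1 iK] in auto)
      have "expectation R = (\<Sum>i\<in>{k..K}. expectation (\<lambda>\<omega>. Mk i (ygrid n \<omega>))) + 7 * dd / sqrt (real n)"
      proof -
        have "expectation (\<lambda>\<omega>. \<Sum>i\<in>{k..K}. Mk i (ygrid n \<omega>)) = (\<Sum>i\<in>{k..K}. expectation (\<lambda>\<omega>. Mk i (ygrid n \<omega>)))"
          by (rule Bochner_Integration.integral_sum) (use C(2)[OF n1 iK] in auto)
        then show ?thesis unfolding R_def using Ri by (simp add: prob_space)
      qed
      also have "(\<Sum>i\<in>{k..K}. expectation (\<lambda>\<omega>. Mk i (ygrid n \<omega>))) \<le> (\<Sum>i\<in>{k..K}. C * \<rho> ^ i)"
        by (rule sum_mono) (use C(2)[OF n1 iK] in auto)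
      also have "\<dots> \<le> C / (1 - \<rho>) * \<rho> ^ k"
      proof -
        have "(\<Sum>i\<in>{k..K}. \<rho> ^ i) = (\<rho> ^ k - \<rho> ^ Suc K) / (1 - \<rho>)"
          using kK \<rho>_bounds by (subst sum_gp) auto
        also have "\<dots> \<le> \<rho> ^ k / (1 - \<rho>)" using \<rho>_bounds by (intro divide_right_mono) auto
        finally have "C * (\<Sum>i\<in>{k..K}. \<rho> ^ i) \<le> C * (\<rho> ^ k / (1 - \<rho>))" using C(1) by (rule mult_left_mono)
        then show ?thesis by (simp add: sum_distrib_left)
      qed
      finally have ER: "expectation R \<le> (C / (1 - \<rho>) + 1) * \<rho> ^ k" using elim(1) by (simp add: distrib_right)
      have "\<bar>emp_proc M X n \<omega> t - ygrid n \<omega> k (agrid k t)\<bar> \<le> R \<omega>" for \<omega> t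
      proof -
        have 1: "\<bar>ygrid n \<omega> k (agrid k t) - ygrid n \<omega> K (agrid K t)\<bar> \<le> (\<Sum>i\<in>{k..<K}. Mk i (ygrid n \<omega>))"
          by (rule grid_chaining[OF kK, where v="ygrid n \<omega>"])
        have 2: "\<bar>emp_proc M X n \<omega> t - ygrid n \<omega> K (agrid K t)\<bar> \<le> Mk K (ygrid n \<omega>) + sqrt (real n) * (7 * dd / 2 ^ K)"
          by (rule emp_proc_end[OF n1])
        have 3: "sqrt (real n) * (7 * dd / 2 ^ K) \<le> 7 * dd / sqrt (real n)"
        proof -
          have "real n \<le> 2 ^ K" using K1 by (metis of_nat_le_iff of_nat_numeral of_nat_power)
          then have "7 * dd / 2 ^ K \<le> 7 * dd / real n" using n1 dd_ge1 by (intro divide_left_mono) auto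
          then have "sqrt (real n) * (7 * dd / 2 ^ K) \<le> sqrt (real n) * (7 * dd / real n)" by (rule mult_left_mono) simp
          also have "\<dots> = 7 * dd * (sqrt (real n) / real n)" by simp
          also have "sqrt (real n) / real n = 1 / sqrt (real n)" using n1 by (simp add: real_sqrt_divide[symmetric] field_simps)
          finally show ?thesis by simp
        qed
        have 4: "(\<Sum>i\<in>{k..K}. Mk i (ygrid n \<omega>)) = (\<Sum>i\<in>{k..<K}. Mk i (ygrid n \<omega>)) + Mk K (ygrid n \<omega>)"
          using kK by (simp add: sum.last_plus atLeastLessThanSuc_atLeastAtMost[symmetric])
        show ?thesis using 1 2 3 unfolding R_def 4 by linarith
      qed
      moreover have "integrable M R" unfolding R_def using Ri by simp
      ultimately show ?case using ER by blast
    qed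
  qed
  have "0 \<le> C / (1 - \<rho>) + 1" using C(1) \<rho>_bounds by simp
  with main show ?thesis by blast
qed

subsection \<open>Limiting covariances and the Gaussian field\<close>

definition qfun :: "nat \<times> ('d \<Rightarrow> int) \<Rightarrow> real^'d \<Rightarrow> real" where "qfun q = \<psi> (fst q) (snd q)"

lemma qfun_range: "\<bar>qfun q x\<bar> \<le> 1" by (simp add: qfun_def \<psi>_range abs_of_nonneg)

lemma qfun_measurable [measurable]: "qfun q \<in> borel_measurable borel" unfolding qfun_def by (rule \<psi>_measurable)

lemma esum_lincomb:
  assumes I: "finite I"
  shows "esum (\<lambda>x. \<Sum>i\<in>I. w i * qfun (q i) x) n \<omega> = (\<Sum>i\<in>I. w i * esum (qfun (q i)) n \<omega>)"
proof -
  have e: "expectation (\<lambda>\<omega>. \<Sum>i\<in>I. w i * qfun (q i) (X 0 \<omega>)) = (\<Sum>i\<in>I. w i * expectation (\<lambda>\<omega>. qfun (q i) (X 0 \<omega>)))"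
    unfolding qfun_def by (subst Bochner_Integration.integral_sum) (auto intro!: integrable_\<psi>)
  have "(\<Sum>m\<in>{1..n}. (\<Sum>i\<in>I. w i * qfun (q i) (X m \<omega>)) - (\<Sum>i\<in>I. w i * expectation (\<lambda>\<omega>. qfun (q i) (X 0 \<omega>))))
    = (\<Sum>m\<in>{1..n}. \<Sum>i\<in>I. w i * (qfun (q i) (X m \<omega>) - expectation (\<lambda>\<omega>. qfun (q i) (X 0 \<omega>))))"
    by (simp only: sum_subtractf[symmetric] right_diff_distrib)
  also have "\<dots> = (\<Sum>i\<in>I. \<Sum>m\<in>{1..n}. w i * (qfun (q i) (X m \<omega>) - expectation (\<lambda>\<omega>. qfun (q i) (X 0 \<omega>))))"
    by (rule sum.swap)
  finally show ?thesis unfolding esum_def e by (simp only: sum_divide_distrib[symmetric] sum_distrib_left[symmetric] times_divide_eq_right)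
qed

text \<open>The combination is divided by \<open>s\<close>, which exceeds the sum of the absolute
  weights and is never 0, to make it admissible with \<pi> = 1. The central limit theorem is then
  scaled back by \<open>2 * s\<close>, the 2 coming from the halving in the centering.\<close>

lemma lincomb_clt:
  assumes I: "finite I"
  shows "\<exists>v\<ge>0. (\<lambda>n. expectation (\<lambda>\<omega>. (\<Sum>i\<in>I. w i * esum (qfun (q i)) n \<omega>) ^ 2)) \<longlonglongrightarrow> v \<and>
    (\<forall>u. (\<lambda>n. expectation (\<lambda>\<omega>. iexp (u * (\<Sum>i\<in>I. w i * esum (qfun (q i)) n \<omega>)))) \<longlonglongrightarrow> complex_of_real (exp (- (v * u\<^sup>2) / 2)))"
proof -
  define s where "s = (\<Sum>i\<in>I. \<bar>w i\<bar>) + 1"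
  define \<Lambda> where "\<Lambda> = (\<Sum>i\<in>I. \<bar>w i\<bar> * Lh (fst (q i)))"
  define h where "h x = (\<Sum>i\<in>I. w i * qfun (q i) x)" for x
  define g where "g x = h x / s" for x
  have s1: "1 \<le> s" unfolding s_def by (simp add: sum_nonneg)
  have \<Lambda>0: "0 \<le> \<Lambda>" unfolding \<Lambda>_def by (intro sum_nonneg mult_nonneg_nonneg) (auto simp: Lh_def dd_def)
  have hb: "\<bar>h x\<bar> \<le> s" for x
  proof -
    have "\<bar>h x\<bar> \<le> (\<Sum>i\<in>I. \<bar>w i * qfun (q i) x\<bar>)" unfolding h_def by (rule sum_abs)
    also have "\<dots> \<le> (\<Sum>i\<in>I. \<bar>w i\<bar>)" unfolding abs_mult by (intro sum_mono mult_right_le_one_le) (auto simp: qfun_range)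
    finally show ?thesis by (simp add: s_def)
  qed
  have gb: "\<bar>g x\<bar> \<le> 1" for x using hb[of x] s1 by (simp add: g_def abs_divide)
  have hl: "\<bar>h x - h y\<bar> \<le> \<Lambda> * norm (x - y) powr \<alpha>" for x y
  proof -
    have "h x - h y = (\<Sum>i\<in>I. w i * (qfun (q i) x - qfun (q i) y))" unfolding h_def by (simp only: sum_subtractf[symmetric] right_diff_distrib)
    then have "\<bar>h x - h y\<bar> \<le> (\<Sum>i\<in>I. \<bar>w i * (qfun (q i) x - qfun (q i) y)\<bar>)" by (simp only: sum_abs)
    also have "\<dots> \<le> (\<Sum>i\<in>I. \<bar>w i\<bar> * (Lh (fst (q i)) * norm (x - y) powr \<alpha>))"
      unfolding abs_mult qfun_def by (intro sum_mono mult_left_mono \<psi>_holder) auto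
    also have "\<dots> = \<Lambda> * norm (x - y) powr \<alpha>" unfolding \<Lambda>_def sum_distrib_right by (simp only: mult.assoc)
    finally show ?thesis .
  qed
  define L where "L = max 1 \<Lambda>"
  have gl: "\<bar>g x - g y\<bar> \<le> 2 * L * norm (x - y) powr \<alpha>" for x y
  proof -
    have "\<bar>g x - g y\<bar> = \<bar>h x - h y\<bar> / s" using s1 unfolding g_def diff_divide_distrib[symmetric] abs_divide by simp
    also have "\<dots> \<le> \<bar>h x - h y\<bar> / 1" using s1 by (intro divide_left_mono) auto
    also have "\<dots> \<le> \<Lambda> * norm (x - y) powr \<alpha>" using hl by simp
    also have "\<dots> \<le> (2 * L) * norm (x - y) powr \<alpha>" using \<Lambda>0 by (intro mult_right_mono) (auto simp: L_def)
    finally show ?thesis .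
  qed
  have gm: "g \<in> borel_measurable borel" unfolding g_def h_def by measurable
  have e1: "expectation (\<lambda>\<omega>. \<bar>g (X 0 \<omega>)\<bar>) \<le> 1"
  proof -
    have "expectation (\<lambda>\<omega>. \<bar>g (X 0 \<omega>)\<bar>) \<le> expectation (\<lambda>\<omega>. 1)"
      by (rule integral_mono[OF bounded_integrable[where B=1]]) (auto simp: gb intro!: borel_measurable_abs measurable_compose[OF X_meas gm])
    then show ?thesis by (simp add: prob_space)
  qed
  define f where "f = (\<lambda>x. (g x - expectation (\<lambda>\<omega>. g (X 0 \<omega>))) / 2)"
  have admissible: "admissible f L 1" unfolding f_def
    by (rule admissible_center[OF gl gb e1 order_refl]) (simp add: L_def)
  have eg: "esum h n \<omega> = 2 * s * (psum f n \<omega> / sqrt (real n))" for n \<omega>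
  proof -
    have hg: "h x = s * g x" for x using s1 by (simp add: g_def)
    have "esum h n \<omega> = s * esum g n \<omega>"
      unfolding esum_def hg by (simp add: right_diff_distrib[symmetric] sum_distrib_left[symmetric])
    also have "esum g n \<omega> = 2 * psum f n \<omega> / sqrt (real n)" unfolding f_def by (rule esum_psum)
    finally show ?thesis by simp
  qed
  have lin: "(\<Sum>i\<in>I. w i * esum (qfun (q i)) n \<omega>) = 2 * s * (psum f n \<omega> / sqrt (real n))" for n \<omega>
    unfolding esum_lincomb[OF I, symmetric] eg[symmetric] h_def[abs_def] ..
  obtain v where v: "0 \<le> v" "(\<lambda>n. expectation (\<lambda>\<omega>. psum f n \<omega> ^ 2) / real n) \<longlonglongrightarrow> v"
    using variance_limit[OF admissible] by blast
  show ?thesis unfolding lin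
  proof (intro exI[of _ "(2 * s)\<^sup>2 * v"] conjI allI)
    show "0 \<le> (2 * s)\<^sup>2 * v" using v by simp
    have "expectation (\<lambda>\<omega>. (2 * s * (psum f n \<omega> / sqrt (real n)))\<^sup>2) = (2 * s)\<^sup>2 * (expectation (\<lambda>\<omega>. psum f n \<omega> ^ 2) / real n)" for n
      unfolding power_mult_distrib power_divide by simp
    then show "(\<lambda>n. expectation (\<lambda>\<omega>. (2 * s * (psum f n \<omega> / sqrt (real n)))\<^sup>2)) \<longlonglongrightarrow> (2 * s)\<^sup>2 * v"
      using tendsto_mult_left[OF v(2), of "(2 * s)\<^sup>2"] by (simp only:)
    fix u :: real
    have "u * (2 * s * y) = (u * (2 * s)) * y" for y by simp
    moreover have "v * (u * (2 * s))\<^sup>2 = (2 * s)\<^sup>2 * v * u\<^sup>2" by (simp add: power_mult_distrib)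
    ultimately show "(\<lambda>n. expectation (\<lambda>\<omega>. iexp (u * (2 * s * (psum f n \<omega> / sqrt (real n)))))) \<longlonglongrightarrow> complex_of_real (exp (- ((2 * s)\<^sup>2 * v * u\<^sup>2) / 2))"
      using clt[OF admissible v(2), of "u * (2 * s)"] by (simp only:)
  qed
qed

definition limit_cov :: "nat \<times> ('d \<Rightarrow> int) \<Rightarrow> nat \<times> ('d \<Rightarrow> int) \<Rightarrow> real" where
  "limit_cov q q' = lim (\<lambda>n. expectation (\<lambda>\<omega>. esum (qfun q) n \<omega> * esum (qfun q') n \<omega>))"

lemma esum_mult_integrable: "integrable M (\<lambda>\<omega>. esum (qfun q) n \<omega> * esum (qfun q') n \<omega>)"
proof -
  have i: "integrable M (\<lambda>\<omega>. (esum (qfun q) n \<omega>)\<^sup>2)" for q by (rule esum_bound[OF qfun_range qfun_measurable])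
  have m: "esum (qfun q) n \<in> borel_measurable M" for q by (rule esum_measurable[OF qfun_measurable])
  show ?thesis
  proof (rule Bochner_Integration.integrable_bound[OF Bochner_Integration.integrable_add[OF i[of q] i[of q']]])
    show "(\<lambda>\<omega>. esum (qfun q) n \<omega> * esum (qfun q') n \<omega>) \<in> borel_measurable M" by (intro borel_measurable_times m)
    have "\<bar>x * y\<bar> \<le> \<bar>x\<^sup>2 + y\<^sup>2\<bar>" for x y :: real
    proof -
      have "2 * (\<bar>x\<bar> * \<bar>y\<bar>) \<le> \<bar>x\<bar>\<^sup>2 + \<bar>y\<bar>\<^sup>2" using sum_squares_bound[of "\<bar>x\<bar>" "\<bar>y\<bar>"] by simp
      moreover have "0 \<le> \<bar>x\<bar> * \<bar>y\<bar>" by simp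
      ultimately show ?thesis unfolding abs_mult power2_abs by linarith
    qed
    then show "AE \<omega> in M. norm (esum (qfun q) n \<omega> * esum (qfun q') n \<omega>) \<le> norm ((esum (qfun q) n \<omega>)\<^sup>2 + (esum (qfun q') n \<omega>)\<^sup>2)"
      by simp
  qed
qed

text \<open>Polarisation: the variances of sum and difference converge, hence so do the
  covariances.\<close>

lemma limit_cov_lim: "(\<lambda>n. expectation (\<lambda>\<omega>. esum (qfun q) n \<omega> * esum (qfun q') n \<omega>)) \<longlonglongrightarrow> limit_cov q q'"
proof -
  \<comment> \<open>Indexing by \<open>bool\<close> instead of by the set \<open>{q, q'}\<close>
    keeps the two weights apart when \<open>q = q'\<close>.\<close>
  define qq where "qq b = (if b then q else q')" for b
  have s: "(\<Sum>b\<in>UNIV. (if b then 1 else e) * esum (qfun (qq b)) n \<omega>) = esum (qfun q) n \<omega> + e * esum (qfun q') n \<omega>" for e :: real and n \<omega>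
    by (simp add: UNIV_bool qq_def)
  have "\<exists>v. (\<lambda>n. expectation (\<lambda>\<omega>. (esum (qfun q) n \<omega> + e * esum (qfun q') n \<omega>)\<^sup>2)) \<longlonglongrightarrow> v" for e :: real
    using lincomb_clt[where I="UNIV :: bool set" and w="\<lambda>b. if b then 1 else e" and q=qq, OF finite] unfolding s by blast
  then obtain v where v: "(\<lambda>n. expectation (\<lambda>\<omega>. (esum (qfun q) n \<omega> + e * esum (qfun q') n \<omega>)\<^sup>2)) \<longlonglongrightarrow> v e" for e :: real
    using choice[of "\<lambda>e v. (\<lambda>n. expectation (\<lambda>\<omega>. (esum (qfun q) n \<omega> + e * esum (qfun q') n \<omega>)\<^sup>2)) \<longlonglongrightarrow> v"] by auto
  have ex: "expectation (\<lambda>\<omega>. (esum (qfun q) n \<omega> + e * esum (qfun q') n \<omega>)\<^sup>2) =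
    expectation (\<lambda>\<omega>. esum (qfun q) n \<omega> * esum (qfun q) n \<omega>) + (2 * e) * expectation (\<lambda>\<omega>. esum (qfun q) n \<omega> * esum (qfun q') n \<omega>) + e\<^sup>2 * expectation (\<lambda>\<omega>. esum (qfun q') n \<omega> * esum (qfun q') n \<omega>)" for e n
  proof -
    have "(x + e * y)\<^sup>2 = x * x + (2 * e) * (x * y) + e\<^sup>2 * (y * y)" for x y :: real by (simp add: power2_eq_square algebra_simps)
    then show ?thesis by (simp add: esum_mult_integrable)
  qed
  have "(\<lambda>n. (expectation (\<lambda>\<omega>. (esum (qfun q) n \<omega> + 1 * esum (qfun q') n \<omega>)\<^sup>2) - expectation (\<lambda>\<omega>. (esum (qfun q) n \<omega> + (-1) * esum (qfun q') n \<omega>)\<^sup>2)) / 4) \<longlonglongrightarrow> (v 1 - v (-1)) / 4"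
    by (intro tendsto_intros v) simp
  then have "(\<lambda>n. expectation (\<lambda>\<omega>. esum (qfun q) n \<omega> * esum (qfun q') n \<omega>)) \<longlonglongrightarrow> (v 1 - v (-1)) / 4" unfolding ex by simp
  then show ?thesis unfolding limit_cov_def by (simp add: limI)
qed

lemma lincomb_variance:
  assumes I: "finite I"
  shows "(\<lambda>n. expectation (\<lambda>\<omega>. (\<Sum>i\<in>I. w i * esum (qfun (q i)) n \<omega>)\<^sup>2)) \<longlonglongrightarrow> (\<Sum>i\<in>I. \<Sum>j\<in>I. w i * w j * limit_cov (q i) (q j))"
proof -
  have "expectation (\<lambda>\<omega>. (\<Sum>i\<in>I. w i * esum (qfun (q i)) n \<omega>)\<^sup>2) = (\<Sum>i\<in>I. \<Sum>j\<in>I. w i * w j * expectation (\<lambda>\<omega>. esum (qfun (q i)) n \<omega> * esum (qfun (q j)) n \<omega>))" for n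
  proof -
    have "(\<Sum>i\<in>I. w i * esum (qfun (q i)) n \<omega>)\<^sup>2 = (\<Sum>i\<in>I. \<Sum>j\<in>I. (w i * w j) * (esum (qfun (q i)) n \<omega> * esum (qfun (q j)) n \<omega>))" for \<omega>
      unfolding power2_eq_square sum_product by (intro sum.cong refl) (simp only: mult_ac)
    then show ?thesis by (simp add: Bochner_Integration.integral_sum Bochner_Integration.integrable_sum esum_mult_integrable)
  qed
  then show ?thesis by (simp only:) (intro tendsto_intros limit_cov_lim)
qed

lemma lincomb_gaussian:
  assumes I: "finite I"
  shows "0 \<le> (\<Sum>i\<in>I. \<Sum>j\<in>I. w i * w j * limit_cov (q i) (q j))"
    "(\<lambda>n. expectation (\<lambda>\<omega>. iexp (u * (\<Sum>i\<in>I. w i * esum (qfun (q i)) n \<omega>)))) \<longlonglongrightarrow> complex_of_real (exp (- ((\<Sum>i\<in>I. \<Sum>j\<in>I. w i * w j * limit_cov (q i) (q j)) * u\<^sup>2) / 2))"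
proof -
  obtain v where v: "v \<ge> 0" "(\<lambda>n. expectation (\<lambda>\<omega>. (\<Sum>i\<in>I. w i * esum (qfun (q i)) n \<omega>) ^ 2)) \<longlonglongrightarrow> v"
    "\<And>u. (\<lambda>n. expectation (\<lambda>\<omega>. iexp (u * (\<Sum>i\<in>I. w i * esum (qfun (q i)) n \<omega>)))) \<longlonglongrightarrow> complex_of_real (exp (- (v * u\<^sup>2) / 2))"
    using lincomb_clt[OF I, of w q] by blast
  have e: "(\<Sum>i\<in>I. \<Sum>j\<in>I. w i * w j * limit_cov (q i) (q j)) = v" by (rule LIMSEQ_unique[OF lincomb_variance[OF I] v(2)])
  show "0 \<le> (\<Sum>i\<in>I. \<Sum>j\<in>I. w i * w j * limit_cov (q i) (q j))" unfolding e by (rule v(1))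
  show "(\<lambda>n. expectation (\<lambda>\<omega>. iexp (u * (\<Sum>i\<in>I. w i * esum (qfun (q i)) n \<omega>)))) \<longlonglongrightarrow> complex_of_real (exp (- ((\<Sum>i\<in>I. \<Sum>j\<in>I. w i * w j * limit_cov (q i) (q j)) * u\<^sup>2) / 2))"
    unfolding e by (rule v(3))
qed

lemma limit_cov_sym: "limit_cov q q' = limit_cov q' q" unfolding limit_cov_def by (simp only: mult.commute)

lemma gaussian_field_exists:
  fixes em :: "nat \<Rightarrow> 'k"
  assumes em: "inj em"
  defines "N \<equiv> PiM (UNIV :: 'k set) (\<lambda>_. std_normal_distribution)"
  shows "\<exists>Z. (\<forall>q. (\<lambda>\<omega>. Z \<omega> q) \<in> borel_measurable N) \<and>
    (\<forall>I w u. finite I \<longrightarrow> char (distr N borel (\<lambda>\<omega>. \<Sum>q\<in>I. w q * Z \<omega> q)) u = complex_of_real (exp (- ((\<Sum>q\<in>I. \<Sum>q'\<in>I. w q * w q' * limit_cov q q') * u\<^sup>2) / 2)))"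
proof -
  interpret N: prob_space N unfolding N_def by (rule iid_std_normal_exists(1)[OF em])
  have ind: "N.indep_vars (\<lambda>_. borel) (\<lambda>k \<omega>. \<omega> (em k)) UNIV" unfolding N_def by (rule iid_std_normal_exists(2)[OF em])
  have std: "distr N borel (\<lambda>\<omega>. \<omega> (em k)) = std_normal_distribution" for k unfolding N_def by (rule iid_std_normal_exists(3)[OF em])
  define Kn where "Kn i j = limit_cov (from_nat i) (from_nat j)" for i j :: nat
  \<comment> \<open>Nonnegativity was proved for arbitrary, possibly repeating families, so repeated
    values of \<open>from_nat\<close> do no harm.\<close>
  have psd: "psd Kn" unfolding psd_def Kn_def using limit_cov_sym lincomb_gaussian(1)[where q=from_nat] by blast
  note g = N.gaussian_array[OF ind std psd]
  define Z where "Z \<omega> q = (\<Sum>k\<le>to_nat q. chol Kn (to_nat q) k * \<omega> (em k))" for \<omega> and q :: "nat \<times> ('d \<Rightarrow> int)"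
  show ?thesis
  proof (intro exI[of _ Z] conjI allI impI)
    show "(\<lambda>\<omega>. Z \<omega> q) \<in> borel_measurable N" for q unfolding Z_def by (rule g(1))
    fix I :: "(nat \<times> ('d \<Rightarrow> int)) set" and w :: "nat \<times> ('d \<Rightarrow> int) \<Rightarrow> real" and u :: real
    assume I: "finite I"
    have inj: "inj_on to_nat I" by (rule inj_on_subset[OF inj_to_nat]) simp
    have "(\<Sum>q\<in>I. w q * Z \<omega> q) = (\<Sum>i\<in>to_nat ` I. w (from_nat i) * (\<Sum>k\<le>i. chol Kn i k * \<omega> (em k)))" for \<omega>
      unfolding sum.reindex[OF inj] Z_def by simp
    moreover have "(\<Sum>q\<in>I. \<Sum>q'\<in>I. w q * w q' * limit_cov q q') = (\<Sum>i\<in>to_nat ` I. \<Sum>j\<in>to_nat ` I. w (from_nat i) * w (from_nat j) * Kn i j)"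
      unfolding sum.reindex[OF inj] Kn_def by simp
    ultimately show "char (distr N borel (\<lambda>\<omega>. \<Sum>q\<in>I. w q * Z \<omega> q)) u = complex_of_real (exp (- ((\<Sum>q\<in>I. \<Sum>q'\<in>I. w q * w q' * limit_cov q q') * u\<^sup>2) / 2))"
      using g(2)[of "to_nat ` I" "\<lambda>i. w (from_nat i)" u] I by simp
  qed
qed

end

subsection \<open>The limit process\<close>

text \<open>Convergence of the variances is not assumed but recovered: near 0 the limit has positive
  real part, and taking logarithms at one such nonzero point identifies the limit variance.\<close>

lemma gaussian_char_limit:
  fixes v :: "nat \<Rightarrow> real"
  assumes Q: "real_distribution Q" and v: "\<And>k. 0 \<le> v k"
    and lim: "\<And>u. (\<lambda>k. complex_of_real (exp (- (v k * u\<^sup>2) / 2))) \<longlonglongrightarrow> char Q u"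
  shows "\<exists>w\<ge>0. \<forall>u. char Q u = complex_of_real (exp (- (w * u\<^sup>2) / 2))"
proof -
  interpret Q: real_distribution Q by (rule Q)
  have "(char Q \<longlongrightarrow> 1) (at 0)" using Q.isCont_char[of 0] by (simp add: isCont_def Q.char_zero)
  then have "((\<lambda>u. Re (char Q u)) \<longlongrightarrow> 1) (at 0)" using tendsto_Re by fastforce
  then have "\<forall>\<^sub>F u in at 0. Re (char Q u) > 0" by (rule order_tendstoD(1)) simp
  moreover have "\<forall>\<^sub>F u in at (0::real). u \<noteq> 0" by (simp add: eventually_at_filter)
  ultimately have "\<forall>\<^sub>F u in at 0. Re (char Q u) > 0 \<and> u \<noteq> 0" by (rule eventually_conj)
  then obtain u0 where u0: "Re (char Q u0) > 0" "u0 \<noteq> 0"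
    using eventually_happens'[of "at (0::real)"] trivial_limit_at[of "0::real"] by blast
  define m where "m = Re (char Q u0)"
  have "(\<lambda>k. Re (complex_of_real (exp (- (v k * u0\<^sup>2) / 2)))) \<longlonglongrightarrow> m" unfolding m_def by (rule tendsto_Re[OF lim])
  then have "(\<lambda>k. exp (- (v k * u0\<^sup>2) / 2)) \<longlonglongrightarrow> m" by (simp only: Re_complex_of_real)
  then have "(\<lambda>k. ln (exp (- (v k * u0\<^sup>2) / 2))) \<longlonglongrightarrow> ln m" using u0(1) by (intro tendsto_ln) (auto simp: m_def)
  then have "(\<lambda>k. - (v k * u0\<^sup>2) / 2) \<longlonglongrightarrow> ln m" by (simp only: ln_exp)
  then have "(\<lambda>k. (- 2 / u0\<^sup>2) * (- (v k * u0\<^sup>2) / 2)) \<longlonglongrightarrow> (- 2 / u0\<^sup>2) * ln m" by (rule tendsto_mult_left)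
  moreover have "(- 2 / u0\<^sup>2) * (- (v k * u0\<^sup>2) / 2) = v k" for k using u0(2) by simp
  ultimately have vl: "v \<longlonglongrightarrow> (- 2 / u0\<^sup>2) * ln m" by (simp only:)
  define w where "w = (- 2 / u0\<^sup>2) * ln m"
  have w0: "0 \<le> w" unfolding w_def by (rule LIMSEQ_le_const[OF vl]) (use v in auto)
  have "char Q u = complex_of_real (exp (- (w * u\<^sup>2) / 2))" for u
  proof (rule LIMSEQ_unique[OF lim])
    show "(\<lambda>k. complex_of_real (exp (- (v k * u\<^sup>2) / 2))) \<longlonglongrightarrow> complex_of_real (exp (- (w * u\<^sup>2) / 2))"
      by (intro tendsto_of_real tendsto_exp tendsto_divide tendsto_minus tendsto_mult tendsto_const vl[folded w_def]) simp
  qed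
  then show ?thesis using w0 by blast
qed

lemma char_distr_iexp:
  assumes "Y \<in> borel_measurable N"
  shows "char (distr N borel Y) u = (\<integral>\<omega>. iexp (u * Y \<omega>) \<partial>N)"
  unfolding char_def using assms by (simp add: integral_distr)

locale gaussian_limit = empirical_grid M X X' \<delta> r \<alpha> p c \<theta> + N: prob_space N
  for M :: "'a measure" and X :: "nat \<Rightarrow> 'a \<Rightarrow> real^'d::finite" and X' \<delta> r \<alpha> p c \<theta> and N :: "'n measure" +
  fixes Z :: "'n \<Rightarrow> nat \<times> ('d \<Rightarrow> int) \<Rightarrow> real"
  assumes Z_measurable [measurable]: "\<And>q. (\<lambda>\<omega>. Z \<omega> q) \<in> borel_measurable N"
    and Z_char: "\<And>I w u. finite I \<Longrightarrow> char (distr N borel (\<lambda>\<omega>. \<Sum>q\<in>I. w q * Z \<omega> q)) u = complex_of_real (exp (- ((\<Sum>q\<in>I. \<Sum>q'\<in>I. w q * w q' * limit_cov q q') * u\<^sup>2) / 2))"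
begin

lemma Z_square: "integrable N (\<lambda>\<omega>. (Z \<omega> q)\<^sup>2)"
proof -
  have "integrable N (\<lambda>\<omega>. (\<Sum>q\<in>{q}. 1 * Z \<omega> q) ^ (2 * 1))"
    by (rule N.gaussian_moment(1)[OF _ _ Z_char]) (use lincomb_gaussian(1)[where q="\<lambda>q. q" and I="{q}" and w="\<lambda>_. 1"] in auto)
  then show ?thesis by simp
qed

text \<open>The variance of a Gaussian increment is the limit of the empirical second moments and
  inherits their bound, which is available at every level. The higher moments then follow from
  Gaussianity, without any cutoff.\<close>

lemma Z_diff_moment:
  "\<exists>C\<ge>0. \<forall>k q q'. level_fun k (\<lambda>x. qfun q x - qfun q' x) \<longrightarrow> integrable N (\<lambda>\<omega>. (Z \<omega> q - Z \<omega> q') ^ (2 * p)) \<and>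
     N.expectation (\<lambda>\<omega>. (Z \<omega> q - Z \<omega> q') ^ (2 * p)) \<le> C * (2 powr (- \<kappa> * real k)) ^ p"
proof -
  obtain C where C: "C \<ge> 0" "\<forall>k g n. level_fun k g \<longrightarrow> 1 \<le> n \<longrightarrow>
     expectation (\<lambda>\<omega>. esum g n \<omega> ^ 2) \<le> C * 2 powr (- \<kappa> * real k) \<and>
     (2 ^ k \<le> 2 * n \<longrightarrow> expectation (\<lambda>\<omega>. esum g n \<omega> ^ (2 * p)) \<le> C * (2 powr (- \<kappa> * real k)) ^ p)"
    using level_moments by (elim exE conjE) (rule that)
  define D where "D = C ^ p * (fact (2 * p) / (2 ^ p * fact p))"
  have D0: "0 \<le> D" using C(1) by (simp add: D_def)
  show ?thesis
  proof (intro exI[of _ D] conjI[OF D0] allI impI)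
    fix k q q' assume lev: "level_fun k (\<lambda>x. qfun q x - qfun q' x)"
    show "integrable N (\<lambda>\<omega>. (Z \<omega> q - Z \<omega> q') ^ (2 * p)) \<and> N.expectation (\<lambda>\<omega>. (Z \<omega> q - Z \<omega> q') ^ (2 * p)) \<le> D * (2 powr (- \<kappa> * real k)) ^ p"
    \<comment> \<open>The signed weights on \<open>{q, q'}\<close> used in the second case require
      two different elements.\<close>
    proof (cases "q = q'")
      case True
      then show ?thesis using D0 p_pos by (simp add: zero_power)
    next
      case False
      define w where "w x = (if x = q then 1 else - 1 :: real)" for x
      define v where "v = (\<Sum>i\<in>{q, q'}. \<Sum>j\<in>{q, q'}. w i * w j * limit_cov i j)"
      have v0: "0 \<le> v" unfolding v_def by (rule lincomb_gaussian(1)[where q="\<lambda>q. q"]) simp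
      have s: "(\<Sum>x\<in>{q, q'}. w x * f x) = f q - f q'" for f :: "nat \<times> ('d \<Rightarrow> int) \<Rightarrow> real" using False by (simp add: w_def)
      have ch: "char (distr N borel (\<lambda>\<omega>. Z \<omega> q - Z \<omega> q')) u = complex_of_real (exp (- (v * u\<^sup>2) / 2))" for u
        using Z_char[of "{q, q'}" w u] unfolding s v_def by simp
      have m: "(\<lambda>\<omega>. Z \<omega> q - Z \<omega> q') \<in> borel_measurable N" by measurable
      have ed: "esum (qfun q) n \<omega> - esum (qfun q') n \<omega> = esum (\<lambda>x. qfun q x - qfun q' x) n \<omega>" for n \<omega>
        by (rule esum_diff[symmetric, OF qfun_measurable qfun_measurable qfun_range qfun_range])
      have "(\<lambda>n. expectation (\<lambda>\<omega>. (\<Sum>i\<in>{q, q'}. w i * esum (qfun i) n \<omega>)\<^sup>2)) \<longlonglongrightarrow> v"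
        unfolding v_def by (rule lincomb_variance[where q="\<lambda>q. q"]) simp
      then have "(\<lambda>n. expectation (\<lambda>\<omega>. (esum (\<lambda>x. qfun q x - qfun q' x) n \<omega>)\<^sup>2)) \<longlonglongrightarrow> v" unfolding s ed .
      then have vle: "v \<le> C * 2 powr (- \<kappa> * real k)"
        by (rule LIMSEQ_le_const2) (use C(2)[rule_format, OF lev] in blast)
      have "N.expectation (\<lambda>\<omega>. (Z \<omega> q - Z \<omega> q') ^ (2 * p)) = v ^ p * (fact (2 * p) / (2 ^ p * fact p))"
        by (rule N.gaussian_moment(2)[OF m v0 ch])
      also have "\<dots> \<le> (C * 2 powr (- \<kappa> * real k)) ^ p * (fact (2 * p) / (2 ^ p * fact p))"
        by (intro mult_right_mono power_mono vle v0) simp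
      also have "\<dots> = D * (2 powr (- \<kappa> * real k)) ^ p" by (simp add: D_def power_mult_distrib)
      finally show ?thesis using N.gaussian_moment(1)[OF m v0 ch] by blast
    qed
  qed
qed

definition zgrid :: "'n \<Rightarrow> nat \<Rightarrow> ('d \<Rightarrow> int) \<Rightarrow> real" where "zgrid \<omega> k a = Z \<omega> (k, a)"

lemma zgrid_measurable [measurable]: "(\<lambda>\<omega>. zgrid \<omega> k a) \<in> borel_measurable N"
  unfolding zgrid_def by measurable

lemma Mk_zgrid: "\<exists>C\<ge>0. \<forall>k. integrable N (\<lambda>\<omega>. Mk k (zgrid \<omega>)) \<and> N.expectation (\<lambda>\<omega>. Mk k (zgrid \<omega>)) \<le> C * \<rho> ^ k"
proof -
  obtain C where C: "C \<ge> 0" "\<forall>k q q'. level_fun k (\<lambda>x. qfun q x - qfun q' x) \<longrightarrow> integrable N (\<lambda>\<omega>. (Z \<omega> q - Z \<omega> q') ^ (2 * p)) \<and>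
     N.expectation (\<lambda>\<omega>. (Z \<omega> q - Z \<omega> q') ^ (2 * p)) \<le> C * (2 powr (- \<kappa> * real k)) ^ p"
    using Z_diff_moment by (elim exE conjE) (rule that)
  have Kst0: "0 \<le> Kst" by (simp add: Kst_def)
  show ?thesis
  proof (intro exI[of _ "1 + Kst * C"] conjI[of "0 \<le> 1 + Kst * C"] allI)
    show "0 \<le> 1 + Kst * C" using C(1) Kst0 by (simp add: add_nonneg_nonneg)
    fix k
    have r: "integrable N (\<lambda>\<omega>. (zgrid \<omega> (Suc k) (\<lambda>j. 2 * a j + b j) - zgrid \<omega> k a) ^ (2 * p)) \<and>
        N.expectation (\<lambda>\<omega>. (zgrid \<omega> (Suc k) (\<lambda>j. 2 * a j + b j) - zgrid \<omega> k a) ^ (2 * p)) \<le> C * (2 powr (- \<kappa> * real k)) ^ p" if "b \<in> steps" for a b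
      unfolding zgrid_def by (rule C(2)[rule_format]) (simp add: qfun_def level_fun_refine[OF that])
    have s: "integrable N (\<lambda>\<omega>. (zgrid \<omega> k (\<lambda>j. a j + b j) - zgrid \<omega> k a) ^ (2 * p)) \<and>
        N.expectation (\<lambda>\<omega>. (zgrid \<omega> k (\<lambda>j. a j + b j) - zgrid \<omega> k a) ^ (2 * p)) \<le> C * (2 powr (- \<kappa> * real k)) ^ p" if "b \<in> steps" for a b
      unfolding zgrid_def by (rule C(2)[rule_format]) (simp add: qfun_def level_fun_shift[OF that])
    note m = Mk_expectation[where V=zgrid and N=N and k=k and C=C, OF N.prob_space_axioms C(1) conjunct1[OF r] conjunct2[OF r] conjunct1[OF s] conjunct2[OF s]]
    show "integrable N (\<lambda>\<omega>. Mk k (zgrid \<omega>)) \<and> N.expectation (\<lambda>\<omega>. Mk k (zgrid \<omega>)) \<le> (1 + Kst * C) * \<rho> ^ k"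
      by (intro conjI m)
  qed
qed

definition tail :: "'n \<Rightarrow> nat \<Rightarrow> real" where "tail \<omega> k = (\<Sum>i. Mk (i + k) (zgrid \<omega>))"

text \<open>The series is formed in \<open>ennreal\<close>, where it always has a value, so
  measurability of the set is immediate.\<close>

definition S :: "'n set" where "S = {\<omega>\<in>space N. (\<Sum>k. ennreal (Mk k (zgrid \<omega>))) < \<infinity>}"

text \<open>The value 0 off \<open>S\<close> makes every path continuous, not only almost every
  path.\<close>

definition W :: "'n \<Rightarrow> ereal^'d \<Rightarrow> real" where
  "W \<omega> t = (if \<omega> \<in> S then lim (\<lambda>k. zgrid \<omega> k (agrid k t)) else 0)"

lemma Mk_measurable [measurable]: "(\<lambda>\<omega>. Mk k (zgrid \<omega>)) \<in> borel_measurable N"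
  unfolding Mk_def Qk_def by measurable

lemma S_sets [measurable]: "S \<in> sets N" unfolding S_def by measurable

lemma S_summable: "\<omega> \<in> S \<Longrightarrow> summable (\<lambda>k. Mk k (zgrid \<omega>))"
  unfolding S_def by (intro summable_suminf_not_top) (auto simp: Mk_nonneg)

lemma S_summable_shift: "\<omega> \<in> S \<Longrightarrow> summable (\<lambda>i. Mk (i + k) (zgrid \<omega>))"
  by (subst summable_iff_shift[of "\<lambda>i. Mk i (zgrid \<omega>)" k]) (rule S_summable)

lemma tail_bounds: "\<exists>C\<ge>0. \<forall>k. integrable N (\<lambda>\<omega>. tail \<omega> k) \<and> N.expectation (\<lambda>\<omega>. tail \<omega> k) \<le> C * \<rho> ^ k"
  and S_AE: "AE \<omega> in N. \<omega> \<in> S"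
proof -
  obtain C where C: "C \<ge> 0" "\<And>k. integrable N (\<lambda>\<omega>. Mk k (zgrid \<omega>))" "\<And>k. N.expectation (\<lambda>\<omega>. Mk k (zgrid \<omega>)) \<le> C * \<rho> ^ k"
    using Mk_zgrid by (elim exE conjE) (rule that, auto)
  have sC: "summable (\<lambda>k. C * \<rho> ^ k)" using \<rho>_bounds by (intro summable_mult summable_geometric) auto
  have E0: "0 \<le> N.expectation (\<lambda>\<omega>. Mk k (zgrid \<omega>))" for k by (rule integral_nonneg_AE) (simp add: Mk_nonneg)
  have sE: "summable (\<lambda>k. N.expectation (\<lambda>\<omega>. Mk k (zgrid \<omega>)))"
    by (rule summable_comparison_test'[OF sC]) (use E0 C(3) in auto)
  have "(\<integral>\<^sup>+\<omega>. (\<Sum>k. ennreal (Mk k (zgrid \<omega>))) \<partial>N) = (\<Sum>k. \<integral>\<^sup>+\<omega>. ennreal (Mk k (zgrid \<omega>)) \<partial>N)"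
    by (rule nn_integral_suminf) measurable
  also have "\<dots> = (\<Sum>k. ennreal (N.expectation (\<lambda>\<omega>. Mk k (zgrid \<omega>))))"
    by (intro suminf_cong nn_integral_eq_integral C(2)) (simp add: Mk_nonneg)
  also have "\<dots> = ennreal (\<Sum>k. N.expectation (\<lambda>\<omega>. Mk k (zgrid \<omega>)))"
    by (rule suminf_ennreal2[OF E0 sE])
  finally have "(\<integral>\<^sup>+\<omega>. (\<Sum>k. ennreal (Mk k (zgrid \<omega>))) \<partial>N) \<noteq> \<infinity>" by simp
  then have "AE \<omega> in N. (\<Sum>k. ennreal (Mk k (zgrid \<omega>))) \<noteq> \<infinity>" by (intro nn_integral_PInf_AE) measurable
  then show AE: "AE \<omega> in N. \<omega> \<in> S" by (rule AE_mp) (auto simp: S_def less_top[symmetric])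
  show "\<exists>C\<ge>0. \<forall>k. integrable N (\<lambda>\<omega>. tail \<omega> k) \<and> N.expectation (\<lambda>\<omega>. tail \<omega> k) \<le> C * \<rho> ^ k"
  proof (intro exI[of _ "C / (1 - \<rho>)"] conjI[of "0 \<le> C / (1 - \<rho>)"] allI)
    show "0 \<le> C / (1 - \<rho>)" using C(1) \<rho>_bounds by simp
    fix k
    have a: "AE \<omega> in N. summable (\<lambda>i. norm (Mk (i + k) (zgrid \<omega>)))"
      using AE by (rule AE_mp) (auto simp: Mk_nonneg S_summable_shift)
    have n: "norm (Mk i (zgrid \<omega>)) = Mk i (zgrid \<omega>)" for i \<omega> by (simp add: Mk_nonneg)
    have b: "summable (\<lambda>i. N.expectation (\<lambda>\<omega>. norm (Mk (i + k) (zgrid \<omega>))))"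
      unfolding n summable_iff_shift[of "\<lambda>i. N.expectation (\<lambda>\<omega>. Mk i (zgrid \<omega>))" k] by (rule sE)
    have "N.expectation (\<lambda>\<omega>. tail \<omega> k) = (\<Sum>i. N.expectation (\<lambda>\<omega>. Mk (i + k) (zgrid \<omega>)))"
      unfolding tail_def by (rule integral_suminf[OF C(2) a b])
    also have "\<dots> \<le> (\<Sum>i. C * \<rho> ^ (i + k))"
    proof (rule suminf_le)
      show "summable (\<lambda>i. N.expectation (\<lambda>\<omega>. Mk (i + k) (zgrid \<omega>)))" using b unfolding n .
      show "summable (\<lambda>i. C * \<rho> ^ (i + k))" unfolding summable_iff_shift[of "\<lambda>i. C * \<rho> ^ i" k] by (rule sC)
    qed (rule C(3))
    also have "\<dots> = (\<Sum>i. (C * \<rho> ^ k) * \<rho> ^ i)" by (simp add: power_add mult_ac)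
    also have "\<dots> = (C * \<rho> ^ k) * (1 / (1 - \<rho>))"
      using \<rho>_bounds by (subst suminf_mult) (auto simp: suminf_geometric summable_geometric)
    finally have "N.expectation (\<lambda>\<omega>. tail \<omega> k) \<le> C / (1 - \<rho>) * \<rho> ^ k" by simp
    moreover have "integrable N (\<lambda>\<omega>. tail \<omega> k)" unfolding tail_def by (rule integrable_suminf[OF C(2) a b])
    ultimately show "integrable N (\<lambda>\<omega>. tail \<omega> k) \<and> N.expectation (\<lambda>\<omega>. tail \<omega> k) \<le> C / (1 - \<rho>) * \<rho> ^ k" by blast
  qed
qed

lemma partial_tail:
  assumes "\<omega> \<in> S" "k \<le> K"
  shows "(\<Sum>i\<in>{k..<K}. Mk i (zgrid \<omega>)) \<le> tail \<omega> k"
proof -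
  have "(\<Sum>i\<in>{k..<K}. Mk i (zgrid \<omega>)) = (\<Sum>i\<in>{0..<K - k}. Mk (i + k) (zgrid \<omega>))"
    using assms(2) sum.shift_bounds_nat_ivl[of "\<lambda>i. Mk i (zgrid \<omega>)" 0 k "K - k"] by simp
  also have "\<dots> \<le> tail \<omega> k" unfolding tail_def
    by (rule sum_le_suminf) (auto simp: Mk_nonneg S_summable_shift[OF assms(1)])
  finally show ?thesis .
qed

lemma Mk_le_tail: "\<omega> \<in> S \<Longrightarrow> Mk k (zgrid \<omega>) \<le> tail \<omega> k"
  using partial_tail[of \<omega> k "Suc k"] by simp

lemma tail_tendsto:
  assumes "\<omega> \<in> S"
  shows "tail \<omega> \<longlonglongrightarrow> 0"
proof -
  let ?f = "\<lambda>i. Mk i (zgrid \<omega>)"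
  have "(\<lambda>k. suminf ?f - (\<Sum>i<k. ?f i)) \<longlonglongrightarrow> suminf ?f - suminf ?f"
    by (intro tendsto_diff tendsto_const summable_LIMSEQ S_summable assms)
  moreover have "tail \<omega> = (\<lambda>k. suminf ?f - (\<Sum>i<k. ?f i))"
    unfolding tail_def[abs_def] by (intro ext suminf_minus_initial_segment[OF S_summable[OF assms]])
  ultimately show ?thesis by simp
qed

lemma W_limit:
  assumes S: "\<omega> \<in> S"
  shows "(\<lambda>k. zgrid \<omega> k (agrid k t)) \<longlonglongrightarrow> W \<omega> t"
proof -
  have "Cauchy (\<lambda>k. zgrid \<omega> k (agrid k t))"
  proof (rule metric_CauchyI)
    fix e :: real assume "0 < e"
    then obtain n where n: "\<And>k. k \<ge> n \<Longrightarrow> tail \<omega> k < e / 2"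
      using order_tendstoD(2)[OF tail_tendsto[OF S], of "e / 2"] unfolding eventually_sequentially by auto
    have d: "\<bar>zgrid \<omega> n (agrid n t) - zgrid \<omega> m (agrid m t)\<bar> < e / 2" if "n \<le> m" for m
      using grid_chaining[OF that, of "zgrid \<omega>" t] partial_tail[OF S that] n[OF order_refl] by linarith
    show "\<exists>n. \<forall>m\<ge>n. \<forall>m'\<ge>n. dist (zgrid \<omega> m (agrid m t)) (zgrid \<omega> m' (agrid m' t)) < e"
    proof (intro exI[of _ n] allI impI)
      fix m m' assume "n \<le> m" "n \<le> m'"
      then show "dist (zgrid \<omega> m (agrid m t)) (zgrid \<omega> m' (agrid m' t)) < e"
        using d[of m] d[of m'] unfolding dist_real_def by linarith
    qed
  qed
  then have "convergent (\<lambda>k. zgrid \<omega> k (agrid k t))" by (rule Cauchy_convergent)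
  then show ?thesis using S by (simp add: W_def convergent_LIMSEQ_iff)
qed

lemma W_zgrid:
  assumes S: "\<omega> \<in> S"
  shows "\<bar>W \<omega> t - zgrid \<omega> k (agrid k t)\<bar> \<le> tail \<omega> k"
proof (rule LIMSEQ_le_const2)
  show "(\<lambda>K. \<bar>zgrid \<omega> K (agrid K t) - zgrid \<omega> k (agrid k t)\<bar>) \<longlonglongrightarrow> \<bar>W \<omega> t - zgrid \<omega> k (agrid k t)\<bar>"
    by (intro tendsto_intros W_limit S)
  have "\<bar>zgrid \<omega> K (agrid K t) - zgrid \<omega> k (agrid k t)\<bar> \<le> tail \<omega> k" if "k \<le> K" for K
    using grid_chaining[OF that, of "zgrid \<omega>" t] partial_tail[OF S that] by linarith
  then show "\<exists>n. \<forall>K\<ge>n. \<bar>zgrid \<omega> K (agrid K t) - zgrid \<omega> k (agrid k t)\<bar> \<le> tail \<omega> k" by blast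
qed

text \<open>If the quantiles of \<open>s\<close> and \<open>t\<close> differ by less than one grid
  unit of level \<open>k\<close> in each coordinate, their cells differ by at most one step. The
  path difference is then bounded by three times the tail at level \<open>k\<close>: twice for the
  approximation and once for the step.\<close>

lemma W_continuous: "continuous_on UNIV (W \<omega>)"
proof (cases "\<omega> \<in> S")
  case True
  show ?thesis unfolding continuous_on_def
  proof (intro ballI tendstoI)
    fix t :: "ereal^'d" and e :: real assume "0 < e"
    then have "\<forall>\<^sub>F k in sequentially. tail \<omega> k < e / 3" by (intro order_tendstoD(2)[OF tail_tendsto[OF True]]) simp
    then obtain k where k: "tail \<omega> k < e / 3" using eventually_happens'[OF sequentially_bot] by blast
    have lim: "((\<lambda>s. 2 ^ k * Fb j (s $ j)) \<longlongrightarrow> 2 ^ k * Fb j (t $ j)) (at t)" for j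
    proof -
      have "isCont (Fb j) (t $ j)" using Fb_continuous[of j] by (simp add: continuous_on_eq_continuous_at)
      then show ?thesis by (intro tendsto_mult_left isCont_tendsto_compose[of _ "Fb j"] tendsto_vec_nth tendsto_ident_at)
    qed
    have "\<forall>\<^sub>F s in at t. \<bar>2 ^ k * Fb j (s $ j) - 2 ^ k * Fb j (t $ j)\<bar> < 1" for j
      using tendstoD[OF lim[of j], of 1] by (simp add: dist_real_def)
    then have "\<forall>\<^sub>F s in at t. \<forall>j. \<bar>2 ^ k * Fb j (s $ j) - 2 ^ k * Fb j (t $ j)\<bar> < 1" by (rule eventually_all_finite)
    then show "\<forall>\<^sub>F s in at t within UNIV. dist (W \<omega> s) (W \<omega> t) < e"
    proof eventually_elim
      case (elim s)
      define b where "b j = agrid k s j - agrid k t j" for j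
      have "-2 \<le> b j \<and> b j \<le> 2" for j using elim[rule_format, of j] unfolding b_def agrid_def by linarith
      then have bs: "b \<in> steps" by (simp add: steps_def)
      have "agrid k s = (\<lambda>j. agrid k t j + b j)" by (simp add: b_def)
      then have "\<bar>zgrid \<omega> k (agrid k s) - zgrid \<omega> k (agrid k t)\<bar> \<le> Mk k (zgrid \<omega>)"
        using Mk_steps(2)[where v="zgrid \<omega>" and k=k, OF agrid_Ag bs, of t] by simp
      then show ?case
        using W_zgrid[OF True, of s k] W_zgrid[OF True, of t k] Mk_le_tail[OF True, of k] k
        unfolding dist_real_def by linarith
    qed
  qed
next
  case False
  then show ?thesis by (simp add: W_def[abs_def])
qed

lemma W_measurable [measurable]: "(\<lambda>\<omega>. W \<omega> t) \<in> borel_measurable N"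
proof -
  have m: "(\<lambda>\<omega>. zgrid \<omega> k (agrid k t)) \<in> borel_measurable N" for k by measurable
  have "(\<lambda>\<omega>. if \<omega> \<in> S then lim (\<lambda>k. zgrid \<omega> k (agrid k t)) else 0) \<in> borel_measurable N"
    by (rule measurable_If_set[OF borel_measurable_lim_metric[OF m]]) (auto intro: sets.Int)
  then show ?thesis unfolding W_def .
qed

text \<open>Different points may fall into the same grid cell, so \<open>f\<close> need not be
  injective and weights of equal images are merged first.\<close>

lemma Z_family_char:
  assumes T: "finite T"
  shows "\<exists>v\<ge>0. \<forall>u. N.expectation (\<lambda>\<omega>. iexp (u * (\<Sum>t\<in>T. w t * Z \<omega> (f t)))) = complex_of_real (exp (- (v * u\<^sup>2) / 2))"
proof -
  define w' where "w' q = (\<Sum>t\<in>{t\<in>T. f t = q}. w t)" for q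
  have "(\<Sum>t\<in>T. w t * Z \<omega> (f t)) = (\<Sum>q\<in>f ` T. w' q * Z \<omega> q)" for \<omega>
  proof -
    have "(\<Sum>t\<in>T. w t * Z \<omega> (f t)) = (\<Sum>q\<in>f ` T. \<Sum>t\<in>{t\<in>T. f t = q}. w t * Z \<omega> (f t))" using T by (rule sum.image_gen)
    also have "\<dots> = (\<Sum>q\<in>f ` T. w' q * Z \<omega> q)" unfolding w'_def sum_distrib_right by (intro sum.cong) auto
    finally show ?thesis .
  qed
  note e = this
  have "N.expectation (\<lambda>\<omega>. iexp (u * (\<Sum>q\<in>f ` T. w' q * Z \<omega> q))) = complex_of_real (exp (- ((\<Sum>q\<in>f ` T. \<Sum>q'\<in>f ` T. w' q * w' q' * limit_cov q q') * u\<^sup>2) / 2))" for u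
    by (subst Z_char[symmetric]) (use T in \<open>auto simp: char_distr_iexp\<close>)
  moreover have "0 \<le> (\<Sum>q\<in>f ` T. \<Sum>q'\<in>f ` T. w' q * w' q' * limit_cov q q')"
    by (rule lincomb_gaussian(1)[where q="\<lambda>q. q"]) (use T in simp)
  ultimately show ?thesis unfolding e by blast
qed

text \<open>At each level the grid values are jointly Gaussian, and they converge to the path almost
  surely; bounded convergence of the characteristic functions preserves the Gaussian form.\<close>

lemma W_gaussian: "centered_gaussian_process N W"
  unfolding centered_gaussian_process_def
proof (intro conjI allI impI)
  show "prob_space N" by (rule N.prob_space_axioms)
  fix T :: "(ereal^'d) set" and w :: "ereal^'d \<Rightarrow> real" assume T: "finite T"
  show m: "(\<lambda>\<omega>. \<Sum>t\<in>T. w t * W \<omega> t) \<in> borel_measurable N" by measurable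
  have "\<forall>k. \<exists>v\<ge>0. \<forall>u. N.expectation (\<lambda>\<omega>. iexp (u * (\<Sum>t\<in>T. w t * Z \<omega> (k, agrid k t)))) = complex_of_real (exp (- (v * u\<^sup>2) / 2))"
    by (intro allI Z_family_char T)
  then obtain v where v: "\<And>k. 0 \<le> v k" "\<And>k u. N.expectation (\<lambda>\<omega>. iexp (u * (\<Sum>t\<in>T. w t * zgrid \<omega> k (agrid k t)))) = complex_of_real (exp (- (v k * u\<^sup>2) / 2))"
    unfolding zgrid_def using choice[of "\<lambda>k v. v \<ge> 0 \<and> (\<forall>u. N.expectation (\<lambda>\<omega>. iexp (u * (\<Sum>t\<in>T. w t * Z \<omega> (k, agrid k t)))) = complex_of_real (exp (- (v * u\<^sup>2) / 2)))"] by blast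
  show "\<exists>v\<ge>0. \<forall>u. char (distr N borel (\<lambda>\<omega>. \<Sum>t\<in>T. w t * W \<omega> t)) u = complex_of_real (exp (- (v * u\<^sup>2) / 2))"
  proof (rule gaussian_char_limit[OF _ v(1)])
    show "real_distribution (distr N borel (\<lambda>\<omega>. \<Sum>t\<in>T. w t * W \<omega> t))" by (rule N.real_distribution_distr[OF m])
    fix u
    have "(\<lambda>k. N.expectation (\<lambda>\<omega>. iexp (u * (\<Sum>t\<in>T. w t * zgrid \<omega> k (agrid k t))))) \<longlonglongrightarrow> N.expectation (\<lambda>\<omega>. iexp (u * (\<Sum>t\<in>T. w t * W \<omega> t)))"
    proof (rule integral_dominated_convergence[where w="\<lambda>_. 1"])
      show "AE \<omega> in N. (\<lambda>k. iexp (u * (\<Sum>t\<in>T. w t * zgrid \<omega> k (agrid k t)))) \<longlonglongrightarrow> iexp (u * (\<Sum>t\<in>T. w t * W \<omega> t))"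
        using S_AE by (rule AE_mp) (auto intro!: AE_I2 tendsto_intros W_limit)
    qed (auto intro!: AE_I2)
    then show "(\<lambda>k. complex_of_real (exp (- (v k * u\<^sup>2) / 2))) \<longlonglongrightarrow> char (distr N borel (\<lambda>\<omega>. \<Sum>t\<in>T. w t * W \<omega> t)) u"
      unfolding v(2) char_distr_iexp[OF m] .
  qed
qed

end

section \<open>Measurability of the empirical process and the final convergence\<close>

context empirical_grid
begin

text \<open>A point below \<open>s\<close> but not below \<open>t\<close> must fall between them in
  some coordinate. This extends the marginal continuity to the joint distribution function on the
  extended space.\<close>

lemma ext_cdf_diff:
  "\<bar>prob {\<omega>\<in>space M. ext_le (X 0 \<omega>) s} - prob {\<omega>\<in>space M. ext_le (X 0 \<omega>) t}\<bar> \<le> (\<Sum>j\<in>UNIV. \<bar>Fb j (s $ j) - Fb j (t $ j)\<bar>)"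
proof -
  have one: "prob {\<omega>\<in>space M. ext_le (X 0 \<omega>) s} - prob {\<omega>\<in>space M. ext_le (X 0 \<omega>) t} \<le> (\<Sum>j\<in>UNIV. \<bar>Fb j (s $ j) - Fb j (t $ j)\<bar>)" for s t
  proof -
    define B where "B j = {\<omega>\<in>space M. ereal (X 0 \<omega> $ j) \<le> s $ j} - {\<omega>\<in>space M. ereal (X 0 \<omega> $ j) \<le> t $ j}" for j
    have Bm: "B j \<in> sets M" for j unfolding B_def by (intro sets.Diff Fb_sets)
    have Bp: "prob (B j) \<le> \<bar>Fb j (s $ j) - Fb j (t $ j)\<bar>" for j
    proof (cases "s $ j \<le> t $ j")
      case True
      then have "B j = {}" by (auto simp: B_def intro: order_trans)
      then show ?thesis by simp
    next
      case False
      have "prob (B j) = Fb j (s $ j) - Fb j (t $ j)"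
        unfolding B_def Fb_def by (rule finite_measure_Diff[OF Fb_sets Fb_sets]) (use False in auto)
      then show ?thesis by simp
    qed
    have "prob {\<omega>\<in>space M. ext_le (X 0 \<omega>) s} \<le> prob ({\<omega>\<in>space M. ext_le (X 0 \<omega>) t} \<union> (\<Union>j. B j))"
      by (rule finite_measure_mono) (auto simp: B_def ext_le_def intro!: sets.Un sets.finite_UN Bm[unfolded B_def] ext_le_measurable[unfolded ext_le_def])
    also have "\<dots> \<le> prob {\<omega>\<in>space M. ext_le (X 0 \<omega>) t} + prob (\<Union>j. B j)"
      by (rule measure_Un_le) (auto intro!: Bm)
    also have "prob (\<Union>j. B j) \<le> (\<Sum>j\<in>UNIV. prob (B j))" by (rule finite_measure_subadditive_finite) (auto intro: Bm)
    also have "\<dots> \<le> (\<Sum>j\<in>UNIV. \<bar>Fb j (s $ j) - Fb j (t $ j)\<bar>)" by (intro sum_mono Bp)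
    finally show ?thesis by simp
  qed
  have "(\<Sum>j\<in>UNIV. \<bar>Fb j (t $ j) - Fb j (s $ j)\<bar>) = (\<Sum>j\<in>UNIV. \<bar>Fb j (s $ j) - Fb j (t $ j)\<bar>)"
    by (intro sum.cong refl abs_minus_commute)
  then show ?thesis using one[of s t] one[of t s] by linarith
qed

lemma emp_proc_measurable: "emp_proc M X n \<in> M \<rightarrow>\<^sub>M D_borel"
proof -
  define G where "G t = prob {\<omega>\<in>space M. ext_le (X 0 \<omega>) t}" for t
  have "emp_proc M X n \<omega> = emp_path (1 / sqrt (real n)) n G (\<lambda>i. X i \<omega>)" for \<omega>
    by (rule ext) (simp add: emp_proc_def emp_path_def G_def)
  then have e: "emp_proc M X n = (\<lambda>\<omega>. emp_path (1 / sqrt (real n)) n G (\<lambda>i. X i \<omega>))" by (rule ext)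
  have Gd: "\<bar>G t - G s\<bar> \<le> (\<Sum>j\<in>UNIV. \<bar>Fb j (t $ j) - Fb j (s $ j)\<bar>)" for s t unfolding G_def by (rule ext_cdf_diff)
  show ?thesis unfolding e
  proof (rule emp_path_measurable[OF X_meas])
    show "continuous_on UNIV G"
      unfolding continuous_on_def
    proof
      fix t :: "ereal^'d"
      have "((\<lambda>s. Fb j (s $ j)) \<longlongrightarrow> Fb j (t $ j)) (at t)" for j
      proof -
        have "isCont (Fb j) (t $ j)" using Fb_continuous[of j] by (simp add: continuous_on_eq_continuous_at)
        then show ?thesis by (intro isCont_tendsto_compose[of _ "Fb j"] tendsto_vec_nth tendsto_ident_at)
      qed
      then have "((\<lambda>s. \<Sum>j\<in>UNIV. \<bar>Fb j (s $ j) - Fb j (t $ j)\<bar>) \<longlongrightarrow> (\<Sum>j\<in>UNIV. \<bar>Fb j (t $ j) - Fb j (t $ j)\<bar>)) (at t)"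
        by (intro tendsto_intros)
      then have "((\<lambda>s. \<Sum>j\<in>UNIV. \<bar>Fb j (s $ j) - Fb j (t $ j)\<bar>) \<longlongrightarrow> 0) (at t)" by simp
      then have "((\<lambda>s. G s - G t) \<longlongrightarrow> 0) (at t)" by (rule Lim_null_comparison[rotated]) (use Gd in simp)
      then show "(G \<longlongrightarrow> G t) (at t within UNIV)" by (rule LIM_zero_cancel)
    qed
    fix e :: real assume e: "0 < e"
    \<comment> \<open>The solution of dd C1 d powr \<theta> = e, by Hoelder continuity of the
      marginals.\<close>
    define d where "d = (e / (dd * C1)) powr (1 / \<theta>)"
    have dC: "0 < dd * C1" using dd_ge1 C1_ge1 by simp
    have d0: "0 < d" using e dC by (auto simp: d_def)
    have de: "C1 * d powr \<theta> = e / dd" using e dC \<theta>_pos dd_ge1 C1_ge1 by (simp add: d_def powr_powr)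
    show "\<exists>d>0. \<forall>s t. (\<forall>k. s $ k = t $ k \<or> (\<exists>x y. t $ k = ereal x \<and> s $ k = ereal y \<and> \<bar>x - y\<bar> \<le> d)) \<longrightarrow> \<bar>G t - G s\<bar> \<le> e"
    proof (intro exI[of _ d] conjI d0 allI impI)
      fix s t :: "ereal^'d" assume st: "\<forall>k. s $ k = t $ k \<or> (\<exists>x y. t $ k = ereal x \<and> s $ k = ereal y \<and> \<bar>x - y\<bar> \<le> d)"
      have "\<bar>Fb j (t $ j) - Fb j (s $ j)\<bar> \<le> e / dd" for j
        using st[rule_format, of j]
      proof (elim disjE exE conjE)
        assume "s $ j = t $ j"
        then show ?thesis using e dd_ge1 by simp
      next
        fix x y assume xy: "t $ j = ereal x" "s $ j = ereal y" "\<bar>x - y\<bar> \<le> d"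
        have "\<bar>Fm j x - Fm j y\<bar> \<le> C1 * \<bar>x - y\<bar> powr \<theta>" by (rule Fm_holder)
        also have "\<dots> \<le> C1 * d powr \<theta>" using xy(3) \<theta>_pos C1_ge1 by (intro mult_left_mono powr_mono2) auto
        finally show ?thesis unfolding xy Fb_ereal de .
      qed
      then have "(\<Sum>j\<in>UNIV. \<bar>Fb j (t $ j) - Fb j (s $ j)\<bar>) \<le> (\<Sum>j\<in>(UNIV :: 'd set). e / dd)" by (intro sum_mono)
      also have "\<dots> = e" using dd_ge1 by (simp add: dd_def)
      finally show "\<bar>G t - G s\<bar> \<le> e" using Gd[of t s] by linarith
    qed
  qed
qed

end

context gaussian_limit
begin

text \<open>For fixed \<open>k\<close> this is convergence of finitely many linear statistics. Their
  second moments are bounded in \<open>n\<close> because they converge to the limiting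
  variances.\<close>

lemma finite_dim_convergence:
  fixes \<Phi> :: "(('d \<Rightarrow> int) \<Rightarrow> real) \<Rightarrow> real"
  assumes lip: "\<And>x y. \<bar>\<Phi> x - \<Phi> y\<bar> \<le> L * (\<Sum>i\<in>Ag k. \<bar>x i - y i\<bar>)" and bd: "\<And>x. \<bar>\<Phi> x\<bar> \<le> K"
  shows "(\<lambda>\<omega>. \<Phi> (ygrid n \<omega> k)) \<in> borel_measurable M" "(\<lambda>\<omega>. \<Phi> (zgrid \<omega> k)) \<in> borel_measurable N"
    "(\<lambda>n. expectation (\<lambda>\<omega>. \<Phi> (ygrid n \<omega> k))) \<longlonglongrightarrow> N.expectation (\<lambda>\<omega>. \<Phi> (zgrid \<omega> k))"
proof -
  have y: "ygrid n \<omega> k a = esum (qfun (k, a)) n \<omega>" for n \<omega> a by (simp add: ygrid_def qfun_def)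
  have "\<exists>B\<ge>0. \<forall>n. expectation (\<lambda>\<omega>. (ygrid n \<omega> k a)\<^sup>2) \<le> B" for a
  proof -
    have "(\<lambda>n. expectation (\<lambda>\<omega>. (esum (qfun (k, a)) n \<omega>)\<^sup>2)) \<longlonglongrightarrow> limit_cov (k, a) (k, a)"
      using limit_cov_lim[of "(k, a)" "(k, a)"] by (simp only: power2_eq_square)
    then have "Bseq (\<lambda>n. expectation (\<lambda>\<omega>. (esum (qfun (k, a)) n \<omega>)\<^sup>2))" by (intro convergent_imp_Bseq) (rule convergentI)
    then obtain B where "0 < B" "\<And>n. norm (expectation (\<lambda>\<omega>. (esum (qfun (k, a)) n \<omega>)\<^sup>2)) \<le> B" by (rule BseqE) blast
    then show ?thesis unfolding y real_norm_def by (intro exI[of _ B] conjI allI) (auto intro: order_trans[OF abs_ge_self])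
  qed
  then obtain B where B: "\<And>a. 0 \<le> B a" "\<And>a n. expectation (\<lambda>\<omega>. (ygrid n \<omega> k a)\<^sup>2) \<le> B a"
    using choice[of "\<lambda>a B. 0 \<le> B \<and> (\<forall>n. expectation (\<lambda>\<omega>. (ygrid n \<omega> k a)\<^sup>2) \<le> B)"] by blast
  \<comment> \<open>One constant has to bound the second moments of both processes at all grid
    points, hence the sum.\<close>
  define B' where "B' a = B a + N.expectation (\<lambda>\<omega>. (zgrid \<omega> k a)\<^sup>2)" for a
  have z0: "0 \<le> N.expectation (\<lambda>\<omega>. (zgrid \<omega> k a)\<^sup>2)" for a by (rule integral_nonneg_AE) simp
  have B'0: "0 \<le> B' a" for a unfolding B'_def using B(1) z0 by (rule add_nonneg_nonneg)
  have B's: "B' a \<le> sum B' (Ag k)" if "a \<in> Ag k" for a by (rule member_le_sum[OF that B'0 finite_Ag])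
  have y2: "expectation (\<lambda>\<omega>. (ygrid n \<omega> k a)\<^sup>2) \<le> sum B' (Ag k)" if "a \<in> Ag k" for n a
    by (rule order_trans[OF _ B's[OF that]]) (unfold B'_def, use B(2)[of n a] z0[of a] in linarith)
  have z2: "N.expectation (\<lambda>\<omega>. (zgrid \<omega> k a)\<^sup>2) \<le> sum B' (Ag k)" if "a \<in> Ag k" for a
    by (rule order_trans[OF _ B's[OF that]]) (unfold B'_def, use B(1)[of a] in linarith)
  have ym: "(\<lambda>\<omega>. ygrid n \<omega> k a) \<in> borel_measurable M" for n a unfolding y by (rule esum_measurable[OF qfun_measurable])
  have yi: "integrable M (\<lambda>\<omega>. (ygrid n \<omega> k a)\<^sup>2)" for n a unfolding y by (rule esum_bound[OF qfun_range qfun_measurable])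
  have zi: "integrable N (\<lambda>\<omega>. (zgrid \<omega> k a)\<^sup>2)" for a unfolding zgrid_def by (rule Z_square)
  have ch: "(\<lambda>n. expectation (\<lambda>\<omega>. iexp (\<Sum>a\<in>Ag k. w a * ygrid n \<omega> k a))) \<longlonglongrightarrow> N.expectation (\<lambda>\<omega>. iexp (\<Sum>a\<in>Ag k. w a * zgrid \<omega> k a))" for w
  proof -
    have inj: "inj_on (Pair k) (Ag k)" by (auto intro: inj_onI)
    have "N.expectation (\<lambda>\<omega>. iexp (1 * (\<Sum>q\<in>Pair k ` Ag k. w (snd q) * Z \<omega> q))) =
      complex_of_real (exp (- ((\<Sum>q\<in>Pair k ` Ag k. \<Sum>q'\<in>Pair k ` Ag k. w (snd q) * w (snd q') * limit_cov q q') * 1\<^sup>2) / 2))"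
      by (subst Z_char[symmetric]) (auto simp: char_distr_iexp finite_Ag)
    then have "N.expectation (\<lambda>\<omega>. iexp (1 * (\<Sum>a\<in>Ag k. w a * zgrid \<omega> k a))) =
      complex_of_real (exp (- ((\<Sum>a\<in>Ag k. \<Sum>b\<in>Ag k. w a * w b * limit_cov (k, a) (k, b)) * 1\<^sup>2) / 2))"
      unfolding sum.reindex[OF inj] comp_def snd_conv zgrid_def .
    then show ?thesis using lincomb_gaussian(2)[OF finite_Ag[of k], of 1 w "\<lambda>a. (k, a)"] unfolding y by simp
  qed
  note l = multivariate_levy[where Y="\<lambda>n \<omega>. ygrid n \<omega> k" and Z="\<lambda>\<omega>. zgrid \<omega> k", OF prob_space_axioms N.prob_space_axioms finite_Ag[of k] ym zgrid_measurable yi y2 zi z2 ch lip bd]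
  show "(\<lambda>\<omega>. \<Phi> (ygrid n \<omega> k)) \<in> borel_measurable M" by (rule l(1))
  show "(\<lambda>\<omega>. \<Phi> (zgrid \<omega> k)) \<in> borel_measurable N" by (rule l(2))
  show "(\<lambda>n. expectation (\<lambda>\<omega>. \<Phi> (ygrid n \<omega> k))) \<longlonglongrightarrow> N.expectation (\<lambda>\<omega>. \<Phi> (zgrid \<omega> k))" by (rule l(3))
qed

lemma W_conv: "conv_distr_D M (emp_proc M X) N W"
proof -
  obtain CU where CU: "CU \<ge> 0" "\<And>k. \<forall>\<^sub>F n in sequentially. \<exists>R. integrable M R \<and>
     (\<forall>\<omega>\<in>space M. \<forall>t. \<bar>emp_proc M X n \<omega> t - ygrid n \<omega> k (agrid k t)\<bar> \<le> R \<omega>) \<and> expectation R \<le> CU * \<rho> ^ k"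
    using U_approximation by blast
  obtain CW where CW: "CW \<ge> 0" "\<And>k. integrable N (\<lambda>\<omega>. tail \<omega> k)" "\<And>k. N.expectation (\<lambda>\<omega>. tail \<omega> k) \<le> CW * \<rho> ^ k"
    using tail_bounds by blast
  define \<rho>' where "\<rho>' k = (CU + CW) * \<rho> ^ k" for k
  have r: "CU * \<rho> ^ k \<le> \<rho>' k" "CW * \<rho> ^ k \<le> \<rho>' k" for k
    unfolding \<rho>'_def using CU(1) CW(1) \<rho>_bounds by (auto intro!: mult_right_mono)
  interpret G: grid_approximation M N "emp_proc M X" W agrid Ag "\<lambda>k n \<omega>. ygrid n \<omega> k" "\<lambda>k \<omega>. zgrid \<omega> k" S \<rho>'
  proof unfold_locales
    show "emp_proc M X n \<in> M \<rightarrow>\<^sub>M D_borel" for n by (rule emp_proc_measurable)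
    show "continuous_on UNIV (W \<omega>)" for \<omega> by (rule W_continuous)
    show "finite (Ag k)" for k by (rule finite_Ag)
    show "agrid k t \<in> Ag k" for k t by (rule agrid_Ag)
    show "\<forall>\<^sub>F n in sequentially. \<exists>R. integrable M R \<and> (\<forall>\<omega>\<in>space M. \<forall>t. \<bar>emp_proc M X n \<omega> t - ygrid n \<omega> k (agrid k t)\<bar> \<le> R \<omega>) \<and> expectation R \<le> \<rho>' k" for k
      using CU(2)[of k] by (rule eventually_mono) (use r(1)[of k] in \<open>blast intro: order_trans\<close>)
    show "\<exists>R. integrable N R \<and> (AE \<omega> in N. \<forall>t. \<bar>W \<omega> t - zgrid \<omega> k (agrid k t)\<bar> \<le> R \<omega>) \<and> N.expectation R \<le> \<rho>' k" for k
    proof (intro exI[of _ "\<lambda>\<omega>. tail \<omega> k"] conjI CW(2) order_trans[OF CW(3) r(2)])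
      show "AE \<omega> in N. \<forall>t. \<bar>W \<omega> t - zgrid \<omega> k (agrid k t)\<bar> \<le> tail \<omega> k"
        using S_AE by (rule AE_mp) (auto intro!: AE_I2 W_zgrid)
    qed
    have "(\<lambda>k. (CU + CW) * \<rho> ^ k) \<longlonglongrightarrow> (CU + CW) * 0"
      using \<rho>_bounds by (intro tendsto_mult_left LIMSEQ_realpow_zero) auto
    then show "\<rho>' \<longlonglongrightarrow> 0" by (simp add: \<rho>'_def[abs_def])
    show "S \<in> sets N" by (rule S_sets)
    show "W \<omega> = (\<lambda>_. 0)" if "\<omega> \<notin> S" for \<omega> using that by (simp add: W_def[abs_def])
    show "\<exists>c. c \<longlonglongrightarrow> 0 \<and> (\<forall>k t. \<bar>W \<omega> t - zgrid \<omega> k (agrid k t)\<bar> \<le> c k)" if "\<omega> \<in> S" for \<omega>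
      using tail_tendsto[OF that] W_zgrid[OF that] by blast
  qed (rule finite_dim_convergence; assumption)+
  show ?thesis
    unfolding conv_distr_D_def using emp_proc_measurable G.W_meas G.D_bcont_tendsto by blast
qed

end

theorem theorem4:
  fixes M :: "'a measure"
    and \<xi> \<xi>' :: "int \<Rightarrow> 'a \<Rightarrow> 'x::banach"
    and G :: "(nat \<Rightarrow> 'x) \<Rightarrow> real^'d::finite"
    and \<theta> \<alpha> r :: real and s :: ereal and p :: nat
  assumes M: "prob_space M"
    and meas: "\<forall>j. \<xi> j \<in> borel_measurable M \<and> \<xi>' j \<in> borel_measurable M"
    and indep: "prob_space.indep_vars M (\<lambda>_. borel)
                  (\<lambda>(b, j). if b then \<xi>' j else \<xi> j) (UNIV :: (bool \<times> int) set)"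
    and ident: "\<forall>j. distr M borel (\<xi> j) = distr M borel (\<xi> 0) \<and>
                    distr M borel (\<xi>' j) = distr M borel (\<xi> 0)"
    and G_meas: "G \<in> (\<Pi>\<^sub>M j\<in>(UNIV :: nat set). (borel :: 'x measure)) \<rightarrow>\<^sub>M borel"
  defines "F \<equiv> \<lambda>x. measure M {\<omega> \<in> space M. causal_X G \<xi> 0 \<omega> \<le> x}"
    and "\<delta> \<equiv> \<lambda>i. Lp_norm_ext M s (\<lambda>\<omega>. norm (causal_X G \<xi> i \<omega> - coupled_X G \<xi> \<xi>' i \<omega>))"
  assumes theta: "0 < \<theta>" "\<theta> \<le> 1"
    and holder: "\<exists>c. \<forall>x y. \<bar>F x - F y\<bar> \<le> c * norm (x - y) powr \<theta>"
    and rs: "1 \<le> r" "1 < s" "1 / ereal r + 1 / s = 1"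
    and p: "r * real CARD('d) < real p"
    and alpha: "0 < \<alpha>" "\<alpha> \<le> 1"
    and ratio: "\<theta> / \<alpha> > r * real p / (real p - r * real CARD('d))"
    and delta_fin: "\<forall>i\<ge>1. \<delta> i < \<infinity>"
    and sum: "summable (\<lambda>i. real (Suc i) ^ (2 * p - 2) * real_of_ereal (\<delta> (Suc i)) powr \<alpha>)"
  shows "\<exists>(N :: (ereal^'d \<Rightarrow> real) measure) W.
           centered_gaussian_process N W \<and>
           (AE \<omega> in N. continuous_on UNIV (W \<omega>)) \<and>
           conv_distr_D M (emp_proc M (causal_X G \<xi>)) N W"
proof -
  have card1: "1 \<le> real CARD('d)" using one_le_card_finite[where 'a='d] by simp
  have "1 * 1 \<le> r * real CARD('d)" using rs(1) card1 by (intro mult_mono) auto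
  then have "1 < real p" using p by linarith
  then have p2: "2 \<le> p" by simp
  obtain C where C: "\<And>x y. \<bar>F x - F y\<bar> \<le> C * norm (x - y) powr \<theta>" using holder by blast
  \<comment> \<open>The condition on \<theta> / \<alpha> says \<alpha> / \<theta> < (p - r d) / (r
    p), and the right-hand side equals 1 / r - d / p.\<close>
  have exponent: "real CARD('d) / real p < 1 / r - \<alpha> / \<theta>"
  proof -
    define u where "u = real p - r * real CARD('d)"
    have u: "0 < u" using p by (simp add: u_def)
    have rp: "0 < r * real p" using rs(1) p2 by simp
    have "r * real p * \<alpha> < \<theta> * u" using ratio u alpha(1) unfolding u_def[symmetric] by (simp add: divide_less_eq less_divide_eq mult_ac)
    then have "\<alpha> / \<theta> < u / (r * real p)" using theta(1) rp by (simp add: divide_less_eq less_divide_eq mult_ac)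
    also have "u / (r * real p) = 1 / r - real CARD('d) / real p"
      using rs(1) p2 by (simp add: u_def diff_divide_distrib)
    finally show ?thesis by linarith
  qed
  define X' where "X' = (\<lambda>a i \<omega>. G (\<lambda>j. if int a < int i - int j then \<xi> (int i - int j) \<omega> else \<xi>' (int i - int j) \<omega>))"
  have wd: "weakly_dependent M (causal_X G \<xi>) X' (\<lambda>i. real_of_ereal (\<delta> i) powr \<alpha>) r \<alpha> (2 * p)"
    unfolding X'_def \<delta>_def
    by (rule causal_weakly_dependent[OF M meas indep ident G_meas rs p2 alpha delta_fin[unfolded \<delta>_def] sum[unfolded \<delta>_def]])
  interpret E: empirical_grid M "causal_X G \<xi>" X' "\<lambda>i. real_of_ereal (\<delta> i) powr \<alpha>" r \<alpha> p C \<theta>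
    by (intro empirical_grid.intro empirical_grid_axioms.intro wd theta(1) exponent C[unfolded F_def])
  \<comment> \<open>Points of the required sample space are functions on \<open>ereal^'d\<close>;
    the constant vectors provide countably many coordinates to carry the independent
    normals.\<close>
  define em :: "nat \<Rightarrow> ereal^'d" where "em i = (\<chi> k. ereal (real i))" for i
  have em: "inj em" by (auto intro!: injI simp: em_def vec_eq_iff)
  define N where "N = PiM (UNIV :: (ereal^'d) set) (\<lambda>_. std_normal_distribution)"
  have N: "prob_space N" unfolding N_def by (rule iid_std_normal_exists(1)[OF em])
  obtain Z where Z: "\<And>q. (\<lambda>\<omega>. Z \<omega> q) \<in> borel_measurable N"
    "\<And>I w u. finite I \<Longrightarrow> char (distr N borel (\<lambda>\<omega>. \<Sum>q\<in>I. w q * Z \<omega> q)) u = complex_of_real (exp (- ((\<Sum>q\<in>I. \<Sum>q'\<in>I. w q * w q' * E.limit_cov q q') * u\<^sup>2) / 2))"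
    using E.gaussian_field_exists[OF em] unfolding N_def[symmetric] by blast
  interpret L: gaussian_limit M "causal_X G \<xi>" X' "\<lambda>i. real_of_ereal (\<delta> i) powr \<alpha>" r \<alpha> p C \<theta> N Z
    by (intro gaussian_limit.intro gaussian_limit_axioms.intro E.empirical_grid_axioms N Z)
  show ?thesis
    using L.W_gaussian L.W_continuous L.W_conv by blast
qed

end
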